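(* Assume $\alpha\le 1$. Let $u_n(x)=a_nx+b_n$ be such that $n\,\mathbb{P}(\xi>u_n(x))\to\nu(x,\infty)$ as $n\to\infty$ for every real $x\in E$, and assume that the conditions $\mathbf{D}(u_n)$ and $\mathbf{D}'(u_n)$, with $u_n=u_n(x)$, hold for the sequence $\{\xi(k),k\in\mathbb{Z}\}$ for every real $x\in E$. Let $\tau_k=\inf\{m\in\mathbb{N}_+:\#\{S_1,\ldots,S_m\}\ge k\}$ for $k\ge1$, and let $$m(n)=\begin{cases}[qn], & \text{if }\alpha<1,\\ \left[\dfrac{n}{h(n)}\right], & \text{if }\alpha=1.\end{cases}$$ Then the point process $$N^{(n)}:=\sum_{k\ge1}\delta_{\left(\frac{\tau_k}{n},\ \frac{\xi(S_{\tau_k})-b_{m(n)}}{a_{m(n)}}\right)}$$ on $[0,\infty)\times E$ converges weakly, as $n\to\infty$, to the Poisson point process $N$ on $[0,\infty)\times E$ with intensity measure $\mathrm{Leb}\times\nu$, where $\mathrm{Leb}$ is Lebesgue measure.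
   Context: Random walk: $\{X_k,k\in\mathbb{N}_+\}$ are i.i.d. integer-valued centered random variables (i.e. $\mathbb{E}X_1=0$ whenever the mean exists), $S_n=X_1+\cdots+X_n$, and $\mathbb{P}(S_n/n^{1/\alpha}\le x)\to F_\alpha(x)$ for every $x\in\mathbb{R}$, where $F_\alpha$ is the distribution function of the stable law with characteristic function $\phi(\theta)=\exp(-|\theta|^\alpha(C_1+iC_2\,\mathrm{sgn}\,\theta))$, $\alpha\in(0,2]$. Put $q:=\mathbb{P}(S_k\neq0\ \forall k\in\mathbb{N}_+)$ and $h(n):=1+\sum_{k=1}^n\mathbb{P}(S_k=0)$. $[\cdot]$ is the integer part. Scenery: $\{\xi(k),k\in\mathbb{Z}\}$ is a (strictly) stationary sequence of real random variables, independent of $\{X_k\}$; $\xi$ denotes a random variable with the law of $\xi(k)$. Measure $\nu$: $a_n>0$, $b_n\in\mathbb{R}$, and $\xi$ is in the domain of attraction of an extreme value distribution $G$. $\nu$ is the measure on $E$ given by: $\nu(x,\infty)=x^{-\beta}$, $E=(0,\infty]$ if $G$ is Fréchet ($\beta>0$); $\nu(x,\infty)=(-x)^{\delta}$, $E=(-\infty,0]$ if $G$ is Weibull ($\delta>0$); $\nu(x,\infty)=e^{-x}$, $E=(-\infty,\infty]$ if $G$ is Gumbel. Here $\nu(x,\infty)$ is the mass of the part of $E$ above $x$. Point processes on $[0,\infty)\times E$ are random elements of the space of point measures with the vague topology (only points falling in $[0,\infty)\times E$ are counted), and weak convergence is with respect to this topology. Conditions. For integers $i_1<\cdots<i_p$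 and $u\in\mathbb{R}$ let $F_{i_1,\ldots,i_p}(u)=\mathbb{P}(\xi(i_1)\le u,\ldots,\xi(i_p)\le u)$. $\mathbf{D}(u_n)$: there exist a family $(\alpha_{n,l})_{(n,l)\in\mathbb{N}^2}$ and a sequence $(l_n)$ of positive integers such that $\alpha_{n,l_n}\to0$, $l_n=o(n)$, and $|F_{i_1,\ldots,i_p,j_1,\ldots,j_{p'}}(u_n)-F_{i_1,\ldots,i_p}(u_n)F_{j_1,\ldots,j_{p'}}(u_n)|\le\alpha_{n,l}$ for all integers $i_1<\cdots<i_p<j_1<\cdots<j_{p'}$ with $j_1-i_p\ge l$ (uniformly in $p,p'$). $\mathbf{D}'(u_n)$: there is a sequence of integers $(k_n)$ with $k_n\to\infty$, $\frac{n^2}{k_n}\alpha_{n,l_n}\to0$ and $k_nl_n=o(n)$, where $(l_n)$ and $(\alpha_{n,l})$ are those of $\mathbf{D}(u_n)$, such that $\lim_{n\to\infty}n\sum_{j=1}^{[n/k_n]}\mathbb{P}(\xi(0)>u_n,\xi(j)>u_n)=0$. *)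

theory Defs
  imports "HOL-Probability.Probability"
begin

section \<open>Point measures and the vague topology\<close>

text \<open>
  The point measure \<open>\<Sum>i\<in>I. \<delta>\<^bsub>x i\<^esub>\<close> on \<open>E\<close>, as a measure on the Borel sets of \<open>E\<close>;
  points outside \<open>E\<close> are not counted, and points are counted with multiplicity.
\<close>

definition point_sum :: "'a::topological_space set \<Rightarrow> 'i set \<Rightarrow> ('i \<Rightarrow> 'a) \<Rightarrow> 'a measure" where
  "point_sum E I x = distr (count_space {i \<in> I. x i \<in> E}) (restrict_space borel E) x"

lemma space_point_sum: "space (point_sum E I x) = E"
  by (simp add: point_sum_def space_restrict_space)

lemma sets_point_sum: "sets (point_sum E I x) = sets (restrict_space borel E)"
  by (simp add: point_sum_def)

lemma emeasure_point_sum: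
  assumes "A \<in> sets (restrict_space borel E)"
  shows "emeasure (point_sum E I x) A = emeasure (count_space UNIV) {i \<in> I. x i \<in> A}"
proof -
  have A: "A \<subseteq> E"
    using sets.sets_into_space[OF assms] by (simp add: space_restrict_space)
  have "x \<in> measurable (count_space {i \<in> I. x i \<in> E}) (restrict_space borel E)"
    by (simp add: space_restrict_space)
  then have "emeasure (point_sum E I x) A
      = emeasure (count_space {i \<in> I. x i \<in> E}) (x -` A \<inter> {i \<in> I. x i \<in> E})"
    unfolding point_sum_def using assms by (simp add: emeasure_distr)
  also have "x -` A \<inter> {i \<in> I. x i \<in> E} = {i \<in> I. x i \<in> A}"
    using A by auto
  also have "emeasure (count_space {i \<in> I. x i \<in> E}) {i \<in> I. x i \<in> A}
      = emeasure (count_space UNIV) {i \<in> I. x i \<in> A}"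
  proof -
    have "{i \<in> I. x i \<in> A} \<subseteq> {i \<in> I. x i \<in> E}" using A by auto
    then show ?thesis by (simp add: emeasure_count_space)
  qed
  finally show ?thesis .
qed

text \<open>
  Radon point measures on \<open>E\<close>.  The index set is a set of naturals: for a \<open>\<sigma>\<close>-compact \<open>E\<close>,
  local finiteness allows at most countably many points.
\<close>

definition point_measures :: "'a::t2_space set \<Rightarrow> 'a measure set" where
  "point_measures E = {point_sum E I x | (I :: nat set) x.
     \<forall>K. compact K \<and> K \<subseteq> E \<longrightarrow> finite {i \<in> I. x i \<in> K}}"

definition cc_fun :: "'a::topological_space set \<Rightarrow> ('a \<Rightarrow> real) set" where
  "cc_fun E = {f. continuous_on E f \<and> (\<exists>K. compact K \<and> K \<subseteq> E \<and> (\<forall>x\<in>E - K. f x = 0))}"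

text \<open>The coarsest topology making \<open>\<mu> \<mapsto> \<integral>f d\<mu>\<close> continuous for all \<open>f\<close> in \<open>cc_fun E\<close>.\<close>

definition vague_topology :: "'a::t2_space set \<Rightarrow> 'a measure topology" where
  "vague_topology E = topology_generated_by
     {{\<mu> \<in> point_measures E. integral\<^sup>L \<mu> f \<in> U} | f U. f \<in> cc_fun E \<and> open U}"

lemma topspace_vague_topology: "topspace (vague_topology E) = point_measures E"
proof -
  have "(\<lambda>_. 0) \<in> cc_fun E"
    by (auto simp: cc_fun_def intro!: exI[of _ "{}"])
  then have "point_measures E \<in>
      {{\<mu> \<in> point_measures E. integral\<^sup>L \<mu> f \<in> U} | f U. f \<in> cc_fun E \<and> open U}"
    by (auto intro!: exI[of _ "\<lambda>_. 0"] exI[of _ UNIV])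
  then show ?thesis
    unfolding vague_topology_def topology_generated_by_topspace by blast
qed

definition borel_of :: "'a topology \<Rightarrow> 'a measure" where
  "borel_of T = sigma (topspace T) {U. openin T U}"

definition converges_weakly ::
  "'a topology \<Rightarrow> 'w measure \<Rightarrow> (nat \<Rightarrow> 'w \<Rightarrow> 'a) \<Rightarrow> 'v measure \<Rightarrow> ('v \<Rightarrow> 'a) \<Rightarrow> bool" where
  "converges_weakly T M Y M' Z \<longleftrightarrow>
     (\<forall>n. Y n \<in> measurable M (borel_of T)) \<and>
     Z \<in> measurable M' (borel_of T) \<and>
     (\<forall>f. continuous_map T euclideanreal f \<and> bounded (f ` topspace T) \<longrightarrow>
        (\<lambda>n. integral\<^sup>L M (\<lambda>\<omega>. f (Y n \<omega>))) \<longlonglongrightarrow> integral\<^sup>L M' (\<lambda>\<omega>. f (Z \<omega>)))"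

definition poisson_point_process ::
  "'a::t2_space set \<Rightarrow> 'a measure \<Rightarrow> 'v measure \<Rightarrow> ('v \<Rightarrow> 'a measure) \<Rightarrow> bool" where
  "poisson_point_process E \<mu> M N \<longleftrightarrow>
     prob_space M \<and>
     N \<in> measurable M (borel_of (vague_topology E)) \<and>
     (\<forall>B\<in>sets (restrict_space borel E). emeasure \<mu> B < \<infinity> \<longrightarrow>
        (\<forall>k::nat. measure M {\<omega> \<in> space M. emeasure (N \<omega>) B = of_nat k}
           = exp (- measure \<mu> B) * measure \<mu> B ^ k / fact k)) \<and>
     (\<forall>B\<in>sets (restrict_space borel E). emeasure \<mu> B = \<infinity> \<longrightarrow>
        (AE \<omega> in M. emeasure (N \<omega>) B = \<infinity>)) \<and>
     (\<forall>\<B>. finite \<B> \<and> \<B> \<subseteq> sets (restrict_space borel E) \<and> disjoint \<B> \<longrightarrow>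
        prob_space.indep_vars M (\<lambda>_. borel) (\<lambda>B \<omega>. emeasure (N \<omega>) B) \<B>)"


section \<open>Extreme value distributions\<close>

datatype extreme_value = Frechet real | Weibull real | Gumbel

fun ev_valid :: "extreme_value \<Rightarrow> bool" where
  "ev_valid (Frechet \<beta>) \<longleftrightarrow> 0 < \<beta>"
| "ev_valid (Weibull \<delta>) \<longleftrightarrow> 0 < \<delta>"
| "ev_valid Gumbel \<longleftrightarrow> True"

fun ev_cdf :: "extreme_value \<Rightarrow> real \<Rightarrow> real" where
  "ev_cdf (Frechet \<beta>) x = (if 0 < x then exp (- (x powr (- \<beta>))) else 0)"
| "ev_cdf (Weibull \<delta>) x = (if x < 0 then exp (- ((- x) powr \<delta>)) else 1)"
| "ev_cdf Gumbel x = exp (- exp (- x))"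

fun ev_space :: "extreme_value \<Rightarrow> ereal set" where
  "ev_space (Frechet \<beta>) = {0<..}"
| "ev_space (Weibull \<delta>) = {-\<infinity><..0}"
| "ev_space Gumbel = {-\<infinity><..}"

fun ev_tail :: "extreme_value \<Rightarrow> real \<Rightarrow> real" where
  "ev_tail (Frechet \<beta>) x = x powr (- \<beta>)"
| "ev_tail (Weibull \<delta>) x = (- x) powr \<delta>"
| "ev_tail Gumbel x = exp (- x)"

text \<open>
  The tail values determine \<open>\<nu>\<close>: the sets below are a \<open>\<pi>\<close>-system generating the Borel sets
  of \<open>ev_space G\<close>, with finite masses, and countably many of them cover \<open>ev_space G\<close>.
\<close>

definition ev_measure :: "extreme_value \<Rightarrow> ereal measure \<Rightarrow> bool" where
  "ev_measure G \<nu> \<longleftrightarrow>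
     sets \<nu> = sets (restrict_space borel (ev_space G)) \<and>
     (\<forall>x::real. ereal x \<in> ev_space G \<longrightarrow>
        emeasure \<nu> {y \<in> ev_space G. ereal x < y} = ennreal (ev_tail G x))"

definition in_domain_of_attraction :: "'w measure \<Rightarrow> ('w \<Rightarrow> real) \<Rightarrow> extreme_value \<Rightarrow> bool" where
  "in_domain_of_attraction M Y G \<longleftrightarrow>
     (\<exists>c d :: nat \<Rightarrow> real. (\<forall>n. 0 < c n) \<and>
        (\<forall>x. (\<lambda>n. measure M {\<omega> \<in> space M. Y \<omega> \<le> c n * x + d n} ^ n) \<longlonglongrightarrow> ev_cdf G x))"


section \<open>The scenery\<close>

definition stationary :: "'w measure \<Rightarrow> (int \<Rightarrow> 'w \<Rightarrow> real) \<Rightarrow> bool" where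
  "stationary M \<xi> \<longleftrightarrow>
     (\<forall>k. \<xi> k \<in> borel_measurable M) \<and>
     (\<forall>s. distr M (\<Pi>\<^sub>M k\<in>UNIV. borel) (\<lambda>\<omega> k. \<xi> (k + s) \<omega>)
        = distr M (\<Pi>\<^sub>M k\<in>UNIV. borel) (\<lambda>\<omega> k. \<xi> k \<omega>))"

text \<open>An index tuple \<open>i\<^sub>1 < \<dots> < i\<^sub>p\<close> is represented by the finite set \<open>I\<close> of its entries.\<close>

definition joint_cdf :: "'w measure \<Rightarrow> (int \<Rightarrow> 'w \<Rightarrow> real) \<Rightarrow> int set \<Rightarrow> real \<Rightarrow> real" where
  "joint_cdf M \<xi> I u = measure M {\<omega> \<in> space M. \<forall>i\<in>I. \<xi> i \<omega> \<le> u}"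

text \<open>
  The mixing coefficients \<open>A\<close> and the gaps \<open>l\<close> are explicit parameters because the second
  condition has to refer to the witnesses of the first one.
\<close>

definition cond_D ::
  "'w measure \<Rightarrow> (int \<Rightarrow> 'w \<Rightarrow> real) \<Rightarrow> (nat \<Rightarrow> real) \<Rightarrow> (nat \<Rightarrow> nat \<Rightarrow> real) \<Rightarrow> (nat \<Rightarrow> nat) \<Rightarrow> bool" where
  "cond_D M \<xi> u A l \<longleftrightarrow>
     (\<forall>n. 0 < l n) \<and>
     (\<lambda>n. A n (l n)) \<longlonglongrightarrow> 0 \<and>
     (\<lambda>n. real (l n) / real n) \<longlonglongrightarrow> 0 \<and>
     (\<forall>n m. \<forall>I J. finite I \<and> I \<noteq> {} \<and> finite J \<and> J \<noteq> {} \<and> Max I < Min J \<and> int m \<le> Min J - Max I \<longrightarrow>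
        \<bar>joint_cdf M \<xi> (I \<union> J) (u n) - joint_cdf M \<xi> I (u n) * joint_cdf M \<xi> J (u n)\<bar> \<le> A n m)"

definition cond_D' ::
  "'w measure \<Rightarrow> (int \<Rightarrow> 'w \<Rightarrow> real) \<Rightarrow> (nat \<Rightarrow> real) \<Rightarrow> (nat \<Rightarrow> nat \<Rightarrow> real) \<Rightarrow> (nat \<Rightarrow> nat) \<Rightarrow> bool" where
  "cond_D' M \<xi> u A l \<longleftrightarrow>
     (\<exists>k :: nat \<Rightarrow> nat.
        filterlim k at_top sequentially \<and>
        (\<lambda>n. (real n)\<^sup>2 / real (k n) * A n (l n)) \<longlonglongrightarrow> 0 \<and>
        (\<lambda>n. real (k n * l n) / real n) \<longlonglongrightarrow> 0 \<and>
        (\<lambda>n. real n * (\<Sum>j=1..n div k n.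
            measure M {\<omega> \<in> space M. \<xi> 0 \<omega> > u n \<and> \<xi> (int j) \<omega> > u n})) \<longlonglongrightarrow> 0)"


section \<open>The random walk and the point process of first visits\<close>

definition walk :: "(nat \<Rightarrow> 'w \<Rightarrow> int) \<Rightarrow> nat \<Rightarrow> 'w \<Rightarrow> int" where
  "walk X n \<omega> = (\<Sum>k=1..n. X k \<omega>)"

definition escape_prob :: "'w measure \<Rightarrow> (nat \<Rightarrow> 'w \<Rightarrow> int) \<Rightarrow> real" where
  "escape_prob M X = measure M {\<omega> \<in> space M. \<forall>k\<ge>1. walk X k \<omega> \<noteq> 0}"

definition truncated_green :: "'w measure \<Rightarrow> (nat \<Rightarrow> 'w \<Rightarrow> int) \<Rightarrow> nat \<Rightarrow> real" where
  "truncated_green M X n = 1 + (\<Sum>k=1..n. measure M {\<omega> \<in> space M. walk X k \<omega> = 0})"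

text \<open>Only meant for \<open>\<alpha> \<le> 1\<close>; the second branch is the case \<open>\<alpha> = 1\<close>.\<close>

definition range_scale :: "'w measure \<Rightarrow> (nat \<Rightarrow> 'w \<Rightarrow> int) \<Rightarrow> real \<Rightarrow> nat \<Rightarrow> nat" where
  "range_scale M X \<alpha> n =
     (if \<alpha> < 1 then nat \<lfloor>escape_prob M X * real n\<rfloor> else nat \<lfloor>real n / truncated_green M X n\<rfloor>)"

text \<open>The value is \<open>\<infinity>\<close> if the path \<open>s\<close> never visits \<open>k\<close> different sites.\<close>

definition visit_time :: "(nat \<Rightarrow> int) \<Rightarrow> nat \<Rightarrow> enat" where
  "visit_time s k = Inf {enat m | m. 1 \<le> m \<and> k \<le> card (s ` {1..m})}"

text \<open>
  Indices \<open>k\<close> with infinite visit time contribute no point in \<open>[0,\<infinity>) \<times> E\<close>.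
  The arguments \<open>a\<close> and \<open>b\<close> are the norming constants already taken at index \<open>m(n)\<close>.
\<close>

definition first_visit_process ::
  "ereal set \<Rightarrow> (nat \<Rightarrow> 'w \<Rightarrow> int) \<Rightarrow> (int \<Rightarrow> 'w \<Rightarrow> real) \<Rightarrow> real \<Rightarrow> real \<Rightarrow> nat \<Rightarrow> 'w \<Rightarrow> (real \<times> ereal) measure"
where
  "first_visit_process E X \<xi> a b n \<omega> =
     (let \<tau> = visit_time (\<lambda>j. walk X j \<omega>);
          t = (\<lambda>k. the_enat (\<tau> k))
      in point_sum ({0..} \<times> E) {k. 1 \<le> k \<and> \<tau> k \<noteq> \<infinity>}
           (\<lambda>k. (real (t k) / real n, ereal ((\<xi> (walk X (t k) \<omega>) \<omega> - b) / a))))"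

end

theory Submission
  imports Defs "HOL-Real_Asymp.Real_Asymp"
begin

text \<open>
  A point of the process sits at every time of a first visit and carries the scenery value of the new
  site.  For \<open>\<alpha> \<le> 1\<close> the number of sites visited up to time \<open>n\<close>, divided by \<open>m(n)\<close>, tends to \<open>1\<close>: if \<open>\<alpha> < 1\<close>
  the walk is transient and a fraction \<open>q\<close> of the times is new; if \<open>\<alpha> = 1\<close> the Green function \<open>h\<close> tends to
  infinity and the range is of order \<open>n / h(n)\<close>.  In a time interval of length
  \<open>\<kappa> n\<close> the walk thus inspects about \<open>\<kappa> m(n)\<close> new values of the scenery, each of which exceeds \<open>u\<^bsub>m(n)\<^esub>(x)\<close> with
  probability about \<open>\<nu>(x, \<infinity>) / m(n)\<close>.  Poisson limits follow if rare values at different sites are nearly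
  independent, for sites inspected in one time interval as well as for different time intervals and
  levels.

  Within one interval the independence comes from mixing.  A blocking argument shows that a
  deterministic set \<open>A\<close> of at most \<open>\<Lambda> n\<close> sites avoids the level \<open>u\<^sub>n\<close> with probability
  \<open>exp (- card A \<cdot> P(\<xi> > u\<^sub>n)) + o(1)\<close>, uniformly in \<open>A\<close> (\<open>uniform_avoidance_of_mixing\<close>).

  Mixing is assumed for one level at a time and for sets of sites of which one lies to the left of the
  other, whereas the sites visited in different time intervals are interlaced and are compared with
  different levels.  The independence of the intervals comes from the walk.
  Let \<open>V\<close> be the range of a piece of the walk, \<open>V'\<close> an independent copy, and let \<open>H\<close> be the conditional
  probability, given the scenery, that \<open>V\<close> avoids the level.  Then \<open>E H\<^sup>2\<close> is the probability that
  \<open>V \<union> V'\<close> avoids it.  Since two independent ranges have a negligible intersection, this is asymptotically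
  \<open>(E H)\<^sup>2\<close>, so that \<open>H\<close> is nearly a constant and the avoidance by the next piece is nearly independent of
  every event of the scenery, in particular of what the earlier pieces have met
  (\<open>avoid_decoupling\<close>, \<open>blocks_avoid_tendsto\<close>).

  The facts about the walk are derived from the characteristic function and a renewal equation.  Its decay
  near the origin gives the local bound \<open>P(S\<^sub>n = z) \<le> C n\<^sup>-\<^sup>1\<^sup>/\<^sup>\<alpha>\<close>, and for \<open>\<alpha> = 1\<close> a Chung--Fuchs argument shows
  that \<open>h\<close> is unbounded.  Hence \<open>h\<close> varies slowly, \<open>P(no return up to n) \<sim> 1 / h(n)\<close>, the range
  concentrates about its mean \<open>\<sim> n / h(n)\<close>, and the intersection of two independent ranges is \<open>o(n / h(n))\<close>.

  To pass to point processes, time is cut into dyadic intervals of length \<open>2\<^sup>-\<^sup>r\<close> and the mark space at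
  finitely many levels.  The numbers of points in these cells determine the vague topology as
  \<open>r\<close> grows, so their convergence in law is enough (\<open>converges_weakly_of_counts\<close>).  On a much finer time
  grid no interval carries two points, up to a small probability, and the counts are determined by the set
  of empty cells.  By inclusion and exclusion the law of that set is given by the probabilities that
  several cells are empty at once, which are the avoidance probabilities above
  (\<open>asymptotically_poisson_counts\<close>).
\<close>

section \<open>Expectations under discrete laws\<close>

lemma expectation_bind_pmf:
  fixes h :: "'b \<Rightarrow> real"
  assumes B: "\<And>x y. x \<in> set_pmf p \<Longrightarrow> y \<in> set_pmf (f x) \<Longrightarrow> abs (h y) \<le> B"
  shows "measure_pmf.expectation (bind_pmf p f) h = measure_pmf.expectation p (\<lambda>x. measure_pmf.expectation (f x) h)"
proof -
  define h' where "h' y = (if y \<in> set_pmf (bind_pmf p f) then h y else 0)" for y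
  have B0: "0 \<le> B"
    using B set_pmf_not_empty[of p] set_pmf_not_empty
    by (metis all_not_in_conv abs_ge_zero order_trans)
  have "measure_pmf.expectation (bind_pmf p f) h = measure_pmf.expectation (bind_pmf p f) h'"
    by (intro integral_cong_AE) (auto simp: AE_measure_pmf_iff h'_def)
  also have "\<dots> = measure_pmf.expectation p (\<lambda>x. measure_pmf.expectation (f x) h')"
    unfolding measure_pmf_bind
  proof (rule integral_bind[where B=B and B'=1 and K="count_space UNIV"])
    show "\<And>x. abs (h' x) \<le> B"
      using B B0 by (auto simp: h'_def)
    show "(\<lambda>x. measure_pmf (f x)) \<in> measurable (measure_pmf p) (subprob_algebra (count_space UNIV))"
      by (subst measurable_cong_sets[OF sets_measure_pmf_count_space refl]) (rule measurable_measure_pmf)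
  qed (auto simp: measure_pmf.emeasure_space_1 measure_pmf.finite_measure_axioms AE_measure_pmf_iff)
  also have "\<dots> = measure_pmf.expectation p (\<lambda>x. measure_pmf.expectation (f x) h)"
    by (intro integral_cong_AE) (auto simp: AE_measure_pmf_iff h'_def intro!: integral_cong_AE)
  finally show ?thesis .
qed

lemma integrable_bounded_pmf:
  fixes h :: "'b \<Rightarrow> 'c::{banach, second_countable_topology}"
  assumes "\<And>x. x \<in> set_pmf p \<Longrightarrow> norm (h x) \<le> B"
  shows "integrable (measure_pmf p) h"
  using assms by (intro measure_pmf.integrable_const_bound[where B=B]) (auto simp: AE_measure_pmf_iff)

lemma integral_pmf_cong:
  assumes "\<And>x. x \<in> set_pmf p \<Longrightarrow> f x = g x"
  shows "measure_pmf.expectation p f = measure_pmf.expectation p g"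
  using assms by (intro integral_cong_AE) (auto simp: AE_measure_pmf_iff)

lemma integral_pmf_mono:
  fixes f g :: "'b \<Rightarrow> real"
  assumes "\<And>x. x \<in> set_pmf p \<Longrightarrow> \<bar>f x\<bar> \<le> B" "\<And>x. x \<in> set_pmf p \<Longrightarrow> \<bar>g x\<bar> \<le> C"
    and "\<And>x. x \<in> set_pmf p \<Longrightarrow> f x \<le> g x"
  shows "measure_pmf.expectation p f \<le> measure_pmf.expectation p g"
  using assms
  by (intro integral_mono_AE integrable_bounded_pmf[where B=B] integrable_bounded_pmf[where B=C])
     (auto simp: AE_measure_pmf_iff)

lemma expectation_pmf_le:
  fixes f :: "'b \<Rightarrow> real"
  assumes "\<And>x. x \<in> set_pmf p \<Longrightarrow> \<bar>f x\<bar> \<le> C"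
  shows "measure_pmf.expectation p f \<le> C"
proof -
  have "measure_pmf.expectation p f \<le> measure_pmf.expectation p (\<lambda>_. C)"
    using assms by (intro integral_pmf_mono[where B=C and C="\<bar>C\<bar>"]) (auto simp: abs_le_iff)
  then show ?thesis by simp
qed

section \<open>Range and returns of an integer walk\<close>

text \<open>
  The starting point \<open>z\<close> belongs to the visited sites only if the path returns to it.
\<close>

fun visited :: "int \<Rightarrow> int list \<Rightarrow> int set" where
  "visited z [] = {}"
| "visited z (x # w) = insert (z + x) (visited (z + x) w)"

abbreviation steps_expectation :: "int pmf \<Rightarrow> nat \<Rightarrow> (int list \<Rightarrow> real) \<Rightarrow> real" where
  "steps_expectation \<rho> n \<equiv> measure_pmf.expectation (replicate_pmf n \<rho>)"

definition no_return_prob :: "int pmf \<Rightarrow> nat \<Rightarrow> real" where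
  "no_return_prob \<rho> n = steps_expectation \<rho> n (\<lambda>w. of_bool (0 \<notin> visited 0 w))"

definition position_pmf :: "int pmf \<Rightarrow> nat \<Rightarrow> int pmf" where
  "position_pmf \<rho> n = map_pmf sum_list (replicate_pmf n \<rho>)"

definition green :: "int pmf \<Rightarrow> nat \<Rightarrow> real" where
  "green \<rho> n = (\<Sum>k\<le>n. pmf (position_pmf \<rho> k) 0)"

definition mean_range :: "int pmf \<Rightarrow> nat \<Rightarrow> real" where
  "mean_range \<rho> n = (\<Sum>j<n. no_return_prob \<rho> j)"

lemma visited_translate: "visited z w = (+) z ` visited 0 w"
proof (induction w arbitrary: z)
  case (Cons x w)
  have "visited z (x # w) = insert (z + x) ((+) (z + x) ` visited 0 w)"
    using Cons[of "z + x"] by simp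
  moreover have "visited 0 (x # w) = insert x ((+) x ` visited 0 w)"
    using Cons[of x] by simp
  ultimately show ?case
    by (simp add: image_image add.assoc)
qed simp

lemma mem_visited_iff: "y \<in> visited z w \<longleftrightarrow> y - z \<in> visited 0 w"
  by (subst visited_translate) (auto simp: image_iff algebra_simps intro!: bexI[of _ "y - z"])

lemma visited_append: "visited z (u @ v) = visited z u \<union> visited (z + sum_list u) v"
  by (induction u arbitrary: z) (auto simp: add.assoc)

lemma finite_visited [simp]: "finite (visited z w)"
  by (induction w arbitrary: z) auto

lemma card_visited_translate: "card (visited z w) = card (visited 0 w)"
  by (subst visited_translate) (simp add: card_image)

lemma card_visited_le: "card (visited z w) \<le> length w"
  by (induction w arbitrary: z) (auto intro: le_trans[OF card_insert_le_m1] simp: card_insert_if le_SucI)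

lemma range_bound: "length w \<le> n \<Longrightarrow> real (card (visited 0 w)) \<le> real n"
  using card_visited_le[of 0 w] by simp

lemma range_bound2: "length w \<le> n \<Longrightarrow> (real (card (visited 0 w)))\<^sup>2 \<le> (real n)\<^sup>2"
  using range_bound[of w n] by (intro power_mono) auto

lemma range_bound2_abs: "length w \<le> n \<Longrightarrow> \<bar>(real (card (visited 0 w)))\<^sup>2\<bar> \<le> (real n)\<^sup>2"
  using range_bound2[of w n] by simp

lemma card_visited_Cons:
  "card (visited 0 (x # w)) = card (visited 0 w) + of_bool (0 \<notin> visited 0 w)"
  using mem_visited_iff[of x x w] card_visited_translate[of x w] by (simp add: card_insert_if)

text \<open>
  Every site is counted at the time of its last visit.
\<close>

lemma card_visited_eq_sum:
  "card (visited 0 w) = (\<Sum>k=1..length w. of_bool (0 \<notin> visited 0 (drop k w)))"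
proof (induction w)
  case (Cons x w)
  have "(\<Sum>k=1..length (x # w). of_bool (0 \<notin> visited 0 (drop k (x # w))) :: nat)
      = (\<Sum>k=0..length w. of_bool (0 \<notin> visited 0 (drop k w)))"
    using sum.shift_bounds_cl_Suc_ivl[of "\<lambda>k. of_bool (0 \<notin> visited 0 (drop k (x # w))) :: nat" 0 "length w"]
    by simp
  also have "\<dots> = of_bool (0 \<notin> visited 0 w) + card (visited 0 w)"
    unfolding Cons by (subst sum.atLeast_Suc_atMost) (simp_all del: sum_of_bool_eq)
  finally show ?case
    using card_visited_Cons[of x w] by simp
qed simp

text \<open>
  At most one summand is nonzero, the one that belongs to the last visit to the origin.
\<close>

lemma last_visit_decomposition:
  "(\<Sum>k\<le>length w. of_bool (z + sum_list (take k w) = 0) * of_bool (0 \<notin> visited 0 (drop k w)) :: real)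
     = of_bool (z = 0 \<or> 0 \<in> visited z w)"
proof (induction w arbitrary: z)
  case (Cons x w)
  have "(\<Sum>k\<le>length (x # w). of_bool (z + sum_list (take k (x # w)) = 0)
          * of_bool (0 \<notin> visited 0 (drop k (x # w))) :: real)
      = of_bool (z = 0) * of_bool (0 \<notin> visited 0 (x # w))
        + (\<Sum>k\<le>length w. of_bool (z + x + sum_list (take k w) = 0) * of_bool (0 \<notin> visited 0 (drop k w)))"
    by (simp add: sum.atMost_Suc_shift add.assoc del: sum.atMost_Suc)
  also have "(\<Sum>k\<le>length w. of_bool (z + x + sum_list (take k w) = 0) * of_bool (0 \<notin> visited 0 (drop k w)) :: real)
      = of_bool (0 \<in> visited z (x # w))"
    unfolding Cons visited.simps insert_iff eq_commute[of 0 "z + x"] ..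
  finally show ?case
    by (cases "z = 0") auto
qed auto

subsection \<open>Splitting the walk\<close>

lemma length_replicate_pmf: "w \<in> set_pmf (replicate_pmf n \<rho>) \<Longrightarrow> length w = n"
  by (simp add: set_replicate_pmf)

text \<open>
  The Markov property: the first \<open>k\<close> steps are independent of the remaining ones.
\<close>

lemma expectation_steps_split:
  assumes k: "k \<le> n" and B: "\<And>u v. length u = k \<Longrightarrow> length v = n - k \<Longrightarrow> \<bar>f u v\<bar> \<le> B"
  shows "steps_expectation \<rho> n (\<lambda>w. f (take k w) (drop k w))
       = steps_expectation \<rho> k (\<lambda>u. steps_expectation \<rho> (n - k) (\<lambda>v. f u v))"
proof -
  have "replicate_pmf n \<rho> = replicate_pmf (k + (n - k)) \<rho>"
    using k by simp
  also have "\<dots> = bind_pmf (replicate_pmf k \<rho>) (\<lambda>u. map_pmf (\<lambda>v. u @ v) (replicate_pmf (n - k) \<rho>))"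
    by (subst replicate_pmf_distrib) (simp add: map_pmf_def)
  finally have eq: "replicate_pmf n \<rho>
      = bind_pmf (replicate_pmf k \<rho>) (\<lambda>u. map_pmf (\<lambda>v. u @ v) (replicate_pmf (n - k) \<rho>))" .
  have "steps_expectation \<rho> n (\<lambda>w. f (take k w) (drop k w))
      = steps_expectation \<rho> k (\<lambda>u. steps_expectation \<rho> (n - k) (\<lambda>v. f (take k (u @ v)) (drop k (u @ v))))"
    unfolding eq
    by (subst expectation_bind_pmf[where B=B]) (auto dest!: length_replicate_pmf intro!: B)
  also have "\<dots> = steps_expectation \<rho> k (\<lambda>u. steps_expectation \<rho> (n - k) (\<lambda>v. f u v))"
    by (intro integral_pmf_cong) (auto dest!: length_replicate_pmf)
  finally show ?thesis .
qed

lemma expectation_steps_Suc: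
  assumes "\<And>w. length w = Suc n \<Longrightarrow> \<bar>f w\<bar> \<le> B"
  shows "steps_expectation \<rho> (Suc n) f = measure_pmf.expectation \<rho> (\<lambda>x. steps_expectation \<rho> n (\<lambda>w. f (x # w)))"
proof -
  have "replicate_pmf (Suc n) \<rho> = bind_pmf \<rho> (\<lambda>x. map_pmf (\<lambda>w. x # w) (replicate_pmf n \<rho>))"
    by (simp add: map_pmf_def)
  then show ?thesis
    using assms by (simp only:) (subst expectation_bind_pmf[where B=B], auto dest!: length_replicate_pmf)
qed

lemma expectation_steps_product:
  assumes k: "k \<le> n" and B: "\<And>u. length u = k \<Longrightarrow> \<bar>f u\<bar> \<le> B" "\<And>v. length v = n - k \<Longrightarrow> \<bar>g v\<bar> \<le> C"
  shows "steps_expectation \<rho> n (\<lambda>w. f (take k w) * g (drop k w))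
       = steps_expectation \<rho> k f * steps_expectation \<rho> (n - k) g"
proof -
  have "\<bar>f u * g v\<bar> \<le> \<bar>B\<bar> * \<bar>C\<bar>" if "length u = k" "length v = n - k" for u v
    unfolding abs_mult using B(1)[OF that(1)] B(2)[OF that(2)] by (intro mult_mono) auto
  then show ?thesis
    by (subst expectation_steps_split[OF k, where f="\<lambda>u v. f u * g v"]) auto
qed

lemma expectation_steps_sum:
  assumes "finite I" "\<And>i w. i \<in> I \<Longrightarrow> length w = n \<Longrightarrow> \<bar>f i w\<bar> \<le> B i"
  shows "steps_expectation \<rho> n (\<lambda>w. \<Sum>i\<in>I. f i w) = (\<Sum>i\<in>I. steps_expectation \<rho> n (f i))"
  using assms
  by (intro Bochner_Integration.integral_sum integrable_bounded_pmf) (auto dest!: length_replicate_pmf)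

lemma expectation_steps_take:
  assumes k: "k \<le> n" and B: "\<And>u. length u = k \<Longrightarrow> \<bar>f u\<bar> \<le> B"
  shows "steps_expectation \<rho> n (\<lambda>w. f (take k w)) = steps_expectation \<rho> k f"
  using expectation_steps_product[OF k, of f B "\<lambda>_. 1" 1] B by simp

lemma expectation_steps_drop:
  assumes k: "k \<le> n" and B: "\<And>u. length u = n - k \<Longrightarrow> \<bar>f u\<bar> \<le> B"
  shows "steps_expectation \<rho> n (\<lambda>w. f (drop k w)) = steps_expectation \<rho> (n - k) f"
  using expectation_steps_product[OF k, of "\<lambda>_. 1" 1 f B] B by simp

subsection \<open>Return probabilities\<close>

lemma no_return_prob_nonneg: "0 \<le> no_return_prob \<rho> n"
  unfolding no_return_prob_def by (intro integral_nonneg_AE) auto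

lemma no_return_prob_0 [simp]: "no_return_prob \<rho> 0 = 1"
  by (simp add: no_return_prob_def)

lemma no_return_prob_le_1: "no_return_prob \<rho> n \<le> 1"
  unfolding no_return_prob_def by (intro expectation_pmf_le) auto

lemma no_return_prob_antimono: "m \<le> n \<Longrightarrow> no_return_prob \<rho> n \<le> no_return_prob \<rho> m"
proof -
  assume mn: "m \<le> n"
  have sub: "visited 0 (take m w) \<subseteq> visited 0 w" for w
    using visited_append[of 0 "take m w" "drop m w"] by auto
  have "no_return_prob \<rho> n \<le> steps_expectation \<rho> n (\<lambda>w. of_bool (0 \<notin> visited 0 (take m w)))"
    unfolding no_return_prob_def using sub by (intro integral_pmf_mono[where B=1 and C=1]) auto
  also have "\<dots> = no_return_prob \<rho> m"
    unfolding no_return_prob_def using mn by (intro expectation_steps_take[where B=1]) auto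
  finally show ?thesis .
qed

lemma expectation_sum_list_eq: "steps_expectation \<rho> n (\<lambda>w. of_bool (sum_list w = z)) = pmf (position_pmf \<rho> n) z"
proof -
  have "(\<lambda>w. of_bool (sum_list w = z) :: real) = indicator (sum_list -` {z})"
    by (auto simp: indicator_def fun_eq_iff)
  then show ?thesis by (simp add: position_pmf_def pmf_map)
qed

lemma position_pmf_0: "position_pmf \<rho> 0 = return_pmf 0"
  by (simp add: position_pmf_def)

lemma green_ge_1: "1 \<le> green \<rho> n"
proof -
  have "pmf (position_pmf \<rho> 0) 0 \<le> green \<rho> n"
    unfolding green_def by (intro member_le_sum) auto
  then show ?thesis by (simp add: position_pmf_0)
qed

lemma green_mono: "m \<le> n \<Longrightarrow> green \<rho> m \<le> green \<rho> n"
  unfolding green_def by (intro sum_mono2) auto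

text \<open>The renewal equation: a path of length \<open>n\<close> that starts at the origin has a last visit there.\<close>

lemma renewal_equation: "(\<Sum>k\<le>n. pmf (position_pmf \<rho> k) 0 * no_return_prob \<rho> (n - k)) = 1"
proof -
  have "(\<Sum>k\<le>n. pmf (position_pmf \<rho> k) 0 * no_return_prob \<rho> (n - k))
     = (\<Sum>k\<le>n. steps_expectation \<rho> n (\<lambda>w. of_bool (sum_list (take k w) = 0) * of_bool (0 \<notin> visited 0 (drop k w))))"
    unfolding expectation_sum_list_eq[symmetric] no_return_prob_def
    by (intro sum.cong refl expectation_steps_product[where B=1 and C=1, symmetric]) auto
  also have "\<dots> = steps_expectation \<rho> n (\<lambda>w. \<Sum>k\<le>n. of_bool (sum_list (take k w) = 0) * of_bool (0 \<notin> visited 0 (drop k w)))"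
    by (intro expectation_steps_sum[where B="\<lambda>_. 1", symmetric]) (auto simp: abs_mult)
  also have "\<dots> = steps_expectation \<rho> n (\<lambda>w. 1)"
  proof (intro integral_pmf_cong)
    fix w assume "w \<in> set_pmf (replicate_pmf n \<rho>)"
    then show "(\<Sum>k\<le>n. of_bool (sum_list (take k w) = 0) * of_bool (0 \<notin> visited 0 (drop k w)) :: real) = 1"
      using last_visit_decomposition[of 0 w] length_replicate_pmf[of w n \<rho>] by (simp del: sum_of_bool_mult_eq)
  qed
  finally show ?thesis by simp
qed

subsection \<open>Moments of the range\<close>

lemma mean_range_0 [simp]: "mean_range \<rho> 0 = 0"
  by (simp add: mean_range_def)

lemma mean_range_Suc: "mean_range \<rho> (Suc n) = mean_range \<rho> n + no_return_prob \<rho> n"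
  by (simp add: mean_range_def)

lemma mean_range_nonneg: "0 \<le> mean_range \<rho> n"
  unfolding mean_range_def by (intro sum_nonneg no_return_prob_nonneg)

lemma mean_range_mono: "m \<le> n \<Longrightarrow> mean_range \<rho> m \<le> mean_range \<rho> n"
  unfolding mean_range_def by (intro sum_mono2) (auto intro: no_return_prob_nonneg)

lemma mean_range_ge: "real n * no_return_prob \<rho> n \<le> mean_range \<rho> n"
  unfolding mean_range_def
  using sum_bounded_below[of "{..<n}" "no_return_prob \<rho> n" "no_return_prob \<rho>"]
  by (simp add: no_return_prob_antimono)

text \<open>
  The \<open>k\<close>th step makes the last visit to its site if the walk does not return there within the remaining
  \<open>n - k\<close> steps; the sum over \<open>k\<close> counts the range by last visits.
\<close>

lemma expectation_card_visited:
  "steps_expectation \<rho> n (\<lambda>w. real (card (visited 0 w))) = mean_range \<rho> n"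
proof -
  have "steps_expectation \<rho> n (\<lambda>w. real (card (visited 0 w)))
      = steps_expectation \<rho> n (\<lambda>w. \<Sum>k=1..n. of_bool (0 \<notin> visited 0 (drop k w)))"
    by (intro integral_pmf_cong)
      (auto simp: card_visited_eq_sum dest!: length_replicate_pmf simp del: sum_of_bool_eq)
  also have "\<dots> = (\<Sum>k=1..n. steps_expectation \<rho> n (\<lambda>w. of_bool (0 \<notin> visited 0 (drop k w))))"
    by (intro expectation_steps_sum[where B="\<lambda>_. 1"]) auto
  also have "\<dots> = (\<Sum>k=1..n. no_return_prob \<rho> (n - k))"
    unfolding no_return_prob_def by (intro sum.cong refl expectation_steps_drop[where B=1]) auto
  also have "\<dots> = mean_range \<rho> n"
    unfolding mean_range_def
    by (intro sum.reindex_bij_witness[of _ "\<lambda>j. n - j" "\<lambda>k. n - k"]) auto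
  finally show ?thesis .
qed

text \<open>
  Summing the renewal equation over all lengths up to \<open>n\<close> gives
  \<open>\<Sum>k. g k * Q (n - k) = n\<close>; keeping only the terms \<open>k \<le> m\<close> bounds the mean range.
\<close>

lemma green_times_mean_range_le: "green \<rho> m * mean_range \<rho> n \<le> real (m + n)"
proof -
  define g q where "g k = pmf (position_pmf \<rho> k) 0" and "q = no_return_prob \<rho>" for k
  have "green \<rho> m * mean_range \<rho> n = (\<Sum>k\<le>m. \<Sum>j<n. g k * q j)"
    by (simp add: green_def mean_range_def sum_product g_def q_def)
  also have "\<dots> = (\<Sum>(k, j)\<in>{..m} \<times> {..<n}. g k * q j)"
    by (simp add: sum.cartesian_product)
  also have "\<dots> \<le> (\<Sum>(k, j)\<in>{(i, j). i + j < m + n}. g k * q j)"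
  proof (intro sum_mono2)
    have "{(i, j). i + j < m + n} \<subseteq> {..<m + n} \<times> {..<m + n}" by auto
    then show "finite {(i, j). i + j < m + n}" by (rule finite_subset) auto
  qed (auto simp: g_def q_def no_return_prob_nonneg)
  also have "\<dots> = (\<Sum>k<m + n. \<Sum>i\<le>k. g i * q (k - i))"
    by (rule sum.triangle_reindex)
  also have "\<dots> = real (m + n)"
    by (simp add: g_def q_def renewal_equation)
  finally show ?thesis .
qed

text \<open>
  The range is counted by last visits again.  If the walk does not return to the origin and makes its
  last visit to some site at time \<open>k\<close>, then neither the path before \<open>k\<close> returns to the origin nor the path
  after \<open>k\<close> to its own starting point, and these two events are independent.
\<close>

lemma expectation_range_no_return_le:
  "steps_expectation \<rho> n (\<lambda>w. real (card (visited 0 w)) * of_bool (0 \<notin> visited 0 w))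
   \<le> (\<Sum>k\<le>n. no_return_prob \<rho> k * no_return_prob \<rho> (n - k))"
proof -
  have sub: "visited 0 (take k w) \<subseteq> visited 0 w" for w k
    using visited_append[of 0 "take k w" "drop k w"] by auto
  have "steps_expectation \<rho> n (\<lambda>w. real (card (visited 0 w)) * of_bool (0 \<notin> visited 0 w))
     \<le> steps_expectation \<rho> n (\<lambda>w. \<Sum>k\<le>n. of_bool (0 \<notin> visited 0 (take k w)) * of_bool (0 \<notin> visited 0 (drop k w)))"
  proof (intro integral_pmf_mono[where B="real n" and C="real (Suc n)"])
    fix w assume "w \<in> set_pmf (replicate_pmf n \<rho>)"
    then have len: "length w = n" by (rule length_replicate_pmf)
    show "\<bar>real (card (visited 0 w)) * of_bool (0 \<notin> visited 0 w)\<bar> \<le> real n"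
      using card_visited_le[of 0 w] len by auto
    have "(\<Sum>k\<le>n. of_bool (0 \<notin> visited 0 (take k w)) * of_bool (0 \<notin> visited 0 (drop k w)) :: real) \<le> (\<Sum>k\<le>n. 1)"
      by (intro sum_mono) auto
    moreover have "(\<Sum>k\<le>n. of_bool (0 \<notin> visited 0 (take k w)) * of_bool (0 \<notin> visited 0 (drop k w)) :: real) \<ge> 0"
      by (intro sum_nonneg) auto
    ultimately show "\<bar>\<Sum>k\<le>n. of_bool (0 \<notin> visited 0 (take k w)) * of_bool (0 \<notin> visited 0 (drop k w)) :: real\<bar> \<le> real (Suc n)"
      by simp
    show "real (card (visited 0 w)) * of_bool (0 \<notin> visited 0 w)
        \<le> (\<Sum>k\<le>n. of_bool (0 \<notin> visited 0 (take k w)) * of_bool (0 \<notin> visited 0 (drop k w)))"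
    proof (cases "0 \<in> visited 0 w")
      case True
      then show ?thesis by (auto intro!: sum_nonneg simp del: sum_of_bool_mult_eq)
    next
      case False
      then have no: "0 \<notin> visited 0 (take k w)" for k using sub by blast
      have "real (card (visited 0 w)) = (\<Sum>k=1..n. of_bool (0 \<notin> visited 0 (drop k w)))"
        using len by (simp add: card_visited_eq_sum del: sum_of_bool_eq)
      also have "\<dots> \<le> (\<Sum>k\<le>n. of_bool (0 \<notin> visited 0 (drop k w)))"
        by (intro sum_mono2) auto
      finally show ?thesis using False no by (simp del: sum_of_bool_mult_eq sum_of_bool_eq)
    qed
  qed
  also have "\<dots> = (\<Sum>k\<le>n. steps_expectation \<rho> n (\<lambda>w. of_bool (0 \<notin> visited 0 (take k w)) * of_bool (0 \<notin> visited 0 (drop k w))))"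
    by (intro expectation_steps_sum[where B="\<lambda>_. 1"]) (auto simp: abs_mult)
  also have "\<dots> = (\<Sum>k\<le>n. no_return_prob \<rho> k * no_return_prob \<rho> (n - k))"
    unfolding no_return_prob_def
    by (intro sum.cong refl expectation_steps_product[where B=1 and C=1]) auto
  finally show ?thesis .
qed

lemma card_visited_le_of_length: "length w = n \<Longrightarrow> card (visited z w) \<le> n"
  using card_visited_le[of z w] by simp

definition range_second_moment :: "int pmf \<Rightarrow> nat \<Rightarrow> real" where
  "range_second_moment \<rho> n = steps_expectation \<rho> n (\<lambda>w. (real (card (visited 0 w)))\<^sup>2)"

text \<open>
  Putting one step in front of a path adds a new site exactly if the path does not return, so that the
  increments of the second moment are controlled by \<open>expectation_range_no_return_le\<close>.
\<close>

lemma range_second_moment_crude: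
  "range_second_moment \<rho> n \<le> mean_range \<rho> n + 2 * (mean_range \<rho> n)\<^sup>2"
proof -
  define q where "q = no_return_prob \<rho>"
  have "range_second_moment \<rho> n \<le> mean_range \<rho> n + 2 * (\<Sum>j<n. \<Sum>k\<le>j. q k * q (j - k))"
  proof (induction n)
    case (Suc n)
    let ?R = "\<lambda>w. real (card (visited 0 w))" and ?Z = "\<lambda>w. of_bool (0 \<notin> visited 0 w) :: real"
    have int: "integrable (measure_pmf (replicate_pmf n \<rho>)) (\<lambda>w. (?R w)\<^sup>2)"
       "integrable (measure_pmf (replicate_pmf n \<rho>)) (\<lambda>w. ?R w * ?Z w)"
       "integrable (measure_pmf (replicate_pmf n \<rho>)) ?Z"
      subgoal by (rule integrable_bounded_pmf[where B="(real n)\<^sup>2"]) (auto dest!: length_replicate_pmf simp: card_visited_le)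
      subgoal by (rule integrable_bounded_pmf[where B="real n"]) (auto dest!: length_replicate_pmf simp: card_visited_le)
      subgoal by (rule integrable_bounded_pmf[where B=1]) auto
      done
    have "range_second_moment \<rho> (Suc n) = measure_pmf.expectation \<rho> (\<lambda>x. steps_expectation \<rho> n (\<lambda>w. (?R (x # w))\<^sup>2))"
      unfolding range_second_moment_def
      by (intro expectation_steps_Suc[where B="(real (Suc n))\<^sup>2"]) (rule range_bound2_abs, simp)
    also have "\<dots> = steps_expectation \<rho> n (\<lambda>w. (?R w)\<^sup>2 + 2 * (?R w * ?Z w) + ?Z w)"
    proof -
      have "(?R (x # w))\<^sup>2 = (?R w)\<^sup>2 + 2 * (?R w * ?Z w) + ?Z w" for x w
        by (cases "0 \<in> visited 0 w")
          (simp_all add: card_visited_Cons power2_eq_square algebra_simps del: visited.simps)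
      then show ?thesis by (simp del: visited.simps)
    qed
    also have "\<dots> = range_second_moment \<rho> n + 2 * steps_expectation \<rho> n (\<lambda>w. ?R w * ?Z w) + q n"
      using int by (simp add: range_second_moment_def q_def no_return_prob_def)
    also have "\<dots> \<le> range_second_moment \<rho> n + 2 * (\<Sum>k\<le>n. q k * q (n - k)) + q n"
      using expectation_range_no_return_le[of n \<rho>] by (simp add: q_def)
    finally show ?case
      using Suc by (simp add: mean_range_Suc q_def)
  qed (simp add: range_second_moment_def)
  moreover have "(\<Sum>j<n. \<Sum>k\<le>j. q k * q (j - k)) = (\<Sum>(k, j)\<in>{(i, j). i + j < n}. q k * q j)"
    by (rule sum.triangle_reindex[symmetric])
  moreover have "\<dots> \<le> (\<Sum>(k, j)\<in>{..<n} \<times> {..<n}. q k * q j)"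
    by (intro sum_mono2) (auto simp: q_def no_return_prob_nonneg)
  moreover have "\<dots> = (mean_range \<rho> n)\<^sup>2"
    by (simp add: power2_eq_square mean_range_def sum_product q_def sum.cartesian_product)
  ultimately show ?thesis by linarith
qed

lemma card_visited_append_le:
  "card (visited 0 w) \<le> card (visited 0 (take k w)) + card (visited 0 (drop k w))"
  using visited_append[of 0 "take k w" "drop k w"]
    card_Un_le[of "visited 0 (take k w)" "visited (sum_list (take k w)) (drop k w)"]
  by (simp add: card_visited_translate[of "sum_list (take k w)"])

lemma mean_range_subadditive: "mean_range \<rho> (m + n) \<le> mean_range \<rho> m + mean_range \<rho> n"
proof (induction m)
  case (Suc m)
  then show ?case
    using no_return_prob_antimono[of m "m + n" \<rho>] by (simp add: mean_range_Suc)
qed simp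

lemma mean_range_mult_le: "mean_range \<rho> (J * k) \<le> real J * mean_range \<rho> k"
proof (induction J)
  case (Suc J)
  then show ?case
    using mean_range_subadditive[of \<rho> k "J * k"] by (simp add: algebra_simps)
qed simp

text \<open>
  The range is subadditive, and the ranges of the two pieces are independent.
\<close>

lemma range_second_moment_add_le:
  "range_second_moment \<rho> (m + n) \<le> range_second_moment \<rho> m + 2 * mean_range \<rho> m * mean_range \<rho> n + range_second_moment \<rho> n"
proof -
  let ?R = "\<lambda>w. real (card (visited 0 w))"
  have b: "?R w \<le> real l" if "length w = l" for w l
    using card_visited_le[of 0 w] that by simp
  have b2: "(?R w)\<^sup>2 \<le> (real l)\<^sup>2" if "length w = l" for w l
    using b[OF that] by (intro power_mono) auto
  have R2: "(?R w)\<^sup>2 \<le> (?R (take m w))\<^sup>2 + 2 * (?R (take m w) * ?R (drop m w)) + (?R (drop m w))\<^sup>2" for w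
  proof -
    have "(?R w)\<^sup>2 \<le> (?R (take m w) + ?R (drop m w))\<^sup>2"
      using card_visited_append_le[of w m] by (intro power_mono) (auto simp flip: of_nat_add)
    then show ?thesis by (simp add: power2_eq_square algebra_simps)
  qed
  have int: "integrable (measure_pmf (replicate_pmf (m + n) \<rho>)) (\<lambda>w. (?R (take m w))\<^sup>2)"
    "integrable (measure_pmf (replicate_pmf (m + n) \<rho>)) (\<lambda>w. (?R (drop m w))\<^sup>2)"
    "integrable (measure_pmf (replicate_pmf (m + n) \<rho>)) (\<lambda>w. ?R (take m w) * ?R (drop m w))"
    "integrable (measure_pmf (replicate_pmf (m + n) \<rho>)) (\<lambda>w. (?R w)\<^sup>2)"
    subgoal by (rule integrable_bounded_pmf[where B="(real m)\<^sup>2"]) (unfold real_norm_def, rule range_bound2_abs, auto dest!: length_replicate_pmf)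
    subgoal by (rule integrable_bounded_pmf[where B="(real n)\<^sup>2"]) (unfold real_norm_def, rule range_bound2_abs, auto dest!: length_replicate_pmf)
    subgoal by (rule integrable_bounded_pmf[where B="real m * real n"]) (auto dest!: length_replicate_pmf simp: abs_mult intro!: mult_mono b)
    subgoal by (rule integrable_bounded_pmf[where B="(real (m + n))\<^sup>2"]) (unfold real_norm_def, rule range_bound2_abs, auto dest!: length_replicate_pmf)
    done
  have "range_second_moment \<rho> (m + n) \<le> steps_expectation \<rho> (m + n)
     (\<lambda>w. (?R (take m w))\<^sup>2 + 2 * (?R (take m w) * ?R (drop m w)) + (?R (drop m w))\<^sup>2)"
    unfolding range_second_moment_def using int R2 by (intro integral_mono) auto
  also have "\<dots> = steps_expectation \<rho> (m + n) (\<lambda>w. (?R (take m w))\<^sup>2)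
      + 2 * steps_expectation \<rho> (m + n) (\<lambda>w. ?R (take m w) * ?R (drop m w))
      + steps_expectation \<rho> (m + n) (\<lambda>w. (?R (drop m w))\<^sup>2)"
    using int by simp
  also have "steps_expectation \<rho> (m + n) (\<lambda>w. (?R (take m w))\<^sup>2) = range_second_moment \<rho> m"
    unfolding range_second_moment_def by (rule expectation_steps_take[where B="(real m)\<^sup>2"]) (simp, rule range_bound2_abs, simp)
  also have "steps_expectation \<rho> (m + n) (\<lambda>w. (?R (drop m w))\<^sup>2) = range_second_moment \<rho> n"
    unfolding range_second_moment_def using expectation_steps_drop[where B="(real n)\<^sup>2" and k=m and n="m+n" and f="\<lambda>w. (?R w)\<^sup>2"] range_bound2_abs by (simp del: abs_power2)
  also have "steps_expectation \<rho> (m + n) (\<lambda>w. ?R (take m w) * ?R (drop m w)) = mean_range \<rho> m * mean_range \<rho> n"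
    unfolding expectation_card_visited[symmetric]
    using expectation_steps_product[where B="real m" and C="real n" and k=m and n="m+n" and f="?R" and g="?R"]
    by (simp add: card_visited_le_of_length)
  finally show ?thesis by simp
qed

text \<open>
  For \<open>J\<close> pieces the second moment exceeds the square of \<open>J\<close> mean ranges only by \<open>J\<close> single second
  moments; this is what makes the variance of the range small.
\<close>

lemma range_second_moment_mult_le:
  "range_second_moment \<rho> (J * k) \<le> real J * range_second_moment \<rho> k + (real J * mean_range \<rho> k)\<^sup>2"
proof (induction J)
  case 0
  then show ?case by (simp add: range_second_moment_def)
next
  case (Suc J)
  have "range_second_moment \<rho> (Suc J * k)
     \<le> range_second_moment \<rho> k + 2 * mean_range \<rho> k * mean_range \<rho> (J * k) + range_second_moment \<rho> (J * k)"
    using range_second_moment_add_le[of \<rho> k "J * k"] by simp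
  also have "\<dots> \<le> range_second_moment \<rho> k + 2 * mean_range \<rho> k * (real J * mean_range \<rho> k)
      + (real J * range_second_moment \<rho> k + (real J * mean_range \<rho> k)\<^sup>2)"
    using Suc mean_range_mult_le[of \<rho> J k] mean_range_nonneg[of \<rho> k]
    by (intro add_mono mult_left_mono) auto
  also have "\<dots> \<le> real (Suc J) * range_second_moment \<rho> k + (real (Suc J) * mean_range \<rho> k)\<^sup>2"
    by (simp add: power2_eq_square algebra_simps)
  finally show ?case .
qed

lemma range_second_moment_mono: "m \<le> n \<Longrightarrow> range_second_moment \<rho> m \<le> range_second_moment \<rho> n"
proof -
  assume mn: "m \<le> n"
  let ?R = "\<lambda>w. real (card (visited 0 w))"
  have b2: "(?R w)\<^sup>2 \<le> (real l)\<^sup>2" if "length w \<le> l" for w l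
    using card_visited_le[of 0 w] that by (intro power_mono) auto
  have "range_second_moment \<rho> m = steps_expectation \<rho> n (\<lambda>w. (?R (take m w))\<^sup>2)"
    unfolding range_second_moment_def
    by (rule expectation_steps_take[where B="(real m)\<^sup>2", symmetric]) (rule mn, rule range_bound2_abs, simp)
  also have "\<dots> \<le> range_second_moment \<rho> n"
    unfolding range_second_moment_def
  proof (intro integral_pmf_mono[where B="(real n)\<^sup>2" and C="(real n)\<^sup>2"])
    fix w
    have "visited 0 (take m w) \<subseteq> visited 0 w"
      using visited_append[of 0 "take m w" "drop m w"] by auto
    then show "(?R (take m w))\<^sup>2 \<le> (?R w)\<^sup>2"
      by (intro power_mono) (auto intro: card_mono)
    fix w assume "w \<in> set_pmf (replicate_pmf n \<rho>)"
    then have "length w = n" by (rule length_replicate_pmf)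
    then show "\<bar>(?R (take m w))\<^sup>2\<bar> \<le> (real n)\<^sup>2" "\<bar>(?R w)\<^sup>2\<bar> \<le> (real n)\<^sup>2"
      by - (rule range_bound2_abs, simp)+
  qed
  finally show ?thesis .
qed

subsection \<open>Intersection of two independent ranges\<close>

definition hit_prob :: "int pmf \<Rightarrow> nat \<Rightarrow> int \<Rightarrow> real" where
  "hit_prob \<rho> n z = steps_expectation \<rho> n (\<lambda>w. of_bool (z \<in> visited 0 w))"

lemma hit_prob_nonneg: "0 \<le> hit_prob \<rho> n z"
  unfolding hit_prob_def by (intro integral_nonneg_AE) auto

lemma position_pmf_Suc:
  "pmf (position_pmf \<rho> (Suc n)) z = measure_pmf.expectation \<rho> (\<lambda>x. pmf (position_pmf \<rho> n) (z - x))"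
  unfolding expectation_sum_list_eq[symmetric]
  by (subst expectation_steps_Suc[where B=1]) (auto simp: eq_diff_eq algebra_simps intro!: integral_pmf_cong)

text \<open>
  After the first visit to \<open>z\<close>, which happens within \<open>n\<close> steps with probability
  \<open>hit_prob \<rho> n z\<close>, the walk spends in the mean another \<open>green \<rho> N - 1\<close> visits there
  during the following \<open>N\<close> steps.
\<close>

lemma hit_prob_times_green_le:
  "hit_prob \<rho> n z * green \<rho> N \<le> (\<Sum>j=1..n + N. pmf (position_pmf \<rho> j) z)"
proof (induction n arbitrary: z)
  case 0
  then show ?case by (simp add: hit_prob_def sum_nonneg)
next
  case (Suc n)
  let ?p = "\<lambda>j. pmf (position_pmf \<rho> j)"
  have "hit_prob \<rho> (Suc n) z = measure_pmf.expectation \<rho> (\<lambda>x. steps_expectation \<rho> n (\<lambda>w. of_bool (z \<in> visited 0 (x # w))))"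
    unfolding hit_prob_def by (intro expectation_steps_Suc[where B=1]) auto
  also have "\<dots> = measure_pmf.expectation \<rho> (\<lambda>x. if x = z then 1 else hit_prob \<rho> n (z - x))"
    unfolding hit_prob_def
    by (intro integral_pmf_cong) (auto simp: mem_visited_iff[of z])
  finally have "hit_prob \<rho> (Suc n) z * green \<rho> N
     = measure_pmf.expectation \<rho> (\<lambda>x. (if x = z then 1 else hit_prob \<rho> n (z - x)) * green \<rho> N)"
    by simp
  also have "\<dots> \<le> measure_pmf.expectation \<rho> (\<lambda>x. \<Sum>j\<le>n + N. ?p j (z - x))"
  proof (intro integral_pmf_mono)
    fix x
    have le1: "hit_prob \<rho> n y \<le> 1" for y
      unfolding hit_prob_def by (intro expectation_pmf_le) auto
    show "\<bar>(if x = z then 1 else hit_prob \<rho> n (z - x)) * green \<rho> N\<bar> \<le> green \<rho> N"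
      using green_ge_1[of \<rho> N] le1 hit_prob_nonneg[of \<rho> n] by (auto simp: abs_mult intro: mult_left_le_one_le)
    have "(\<Sum>j\<le>n + N. ?p j (z - x)) \<le> (\<Sum>j\<le>n + N. 1)"
      by (intro sum_mono pmf_le_1)
    then show "\<bar>\<Sum>j\<le>n + N. ?p j (z - x)\<bar> \<le> real (Suc (n + N))"
      by (subst abs_of_nonneg) (auto intro: sum_nonneg)
    show "(if x = z then 1 else hit_prob \<rho> n (z - x)) * green \<rho> N \<le> (\<Sum>j\<le>n + N. ?p j (z - x))"
    proof (cases "x = z")
      case True
      then show ?thesis using green_mono[of N "n + N" \<rho>] by (simp add: green_def)
    next
      case False
      have "hit_prob \<rho> n (z - x) * green \<rho> N \<le> (\<Sum>j=1..n + N. ?p j (z - x))"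
        by (rule Suc)
      also have "\<dots> \<le> (\<Sum>j\<le>n + N. ?p j (z - x))"
        by (intro sum_mono2) auto
      finally show ?thesis using False by simp
    qed
  qed
  also have "\<dots> = (\<Sum>j\<le>n + N. measure_pmf.expectation \<rho> (\<lambda>x. ?p j (z - x)))"
    by (intro Bochner_Integration.integral_sum integrable_bounded_pmf[where B=1]) (auto simp: pmf_le_1)
  also have "\<dots> = (\<Sum>j\<le>n + N. ?p (Suc j) z)"
    by (simp add: position_pmf_Suc)
  also have "\<dots> = (\<Sum>j=1..Suc n + N. ?p j z)"
    by (intro sum.reindex_bij_witness[of _ "\<lambda>j. j - 1" Suc]) auto
  finally show ?case .
qed

text \<open>
  The two paths are independent and both start at the origin.
\<close>

definition mean_intersection :: "int pmf \<Rightarrow> nat \<Rightarrow> real" where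
  "mean_intersection \<rho> n = steps_expectation \<rho> n (\<lambda>u. steps_expectation \<rho> n (\<lambda>v. real (card (visited 0 u \<inter> visited 0 v))))"

lemma ennreal_hit_prob: "ennreal (hit_prob \<rho> n z) = emeasure (replicate_pmf n \<rho>) {w. z \<in> visited 0 w}"
proof -
  have "(\<lambda>w. of_bool (z \<in> visited 0 w) :: real) = indicator {w. z \<in> visited 0 w}"
    by (auto simp: indicator_def fun_eq_iff)
  then show ?thesis by (simp add: hit_prob_def measure_pmf.emeasure_eq_measure)
qed

lemma nn_integral_swap_pmf_count_space:
  fixes f :: "'a \<Rightarrow> 'b \<Rightarrow> ennreal"
  shows "(\<integral>\<^sup>+w. (\<integral>\<^sup>+z. f w z \<partial>count_space UNIV) \<partial>measure_pmf p) = (\<integral>\<^sup>+z. (\<integral>\<^sup>+w. f w z \<partial>measure_pmf p) \<partial>count_space UNIV)"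
  using nn_integral_fst_count_space[of "\<lambda>(w, z). ennreal (pmf p w) * f w z"]
    nn_integral_snd_count_space[of "\<lambda>(w, z). ennreal (pmf p w) * f w z"]
  by (simp add: nn_integral_measure_pmf nn_integral_cmult)

lemma ennreal_expectation_pmf:
  assumes "\<And>x. x \<in> set_pmf p \<Longrightarrow> 0 \<le> f x" "\<And>x. x \<in> set_pmf p \<Longrightarrow> f x \<le> B"
  shows "ennreal (measure_pmf.expectation p f) = (\<integral>\<^sup>+x. ennreal (f x) \<partial>measure_pmf p)"
  using assms
  by (intro nn_integral_eq_integral[symmetric] integrable_bounded_pmf[where B=B]) (auto simp: AE_measure_pmf_iff)

lemma mean_intersection_nonneg: "0 \<le> mean_intersection \<rho> n"
  unfolding mean_intersection_def by (intro integral_nonneg_AE AE_pmfI) auto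

text \<open>
  A site belongs to both ranges with the square of its hitting probability.
\<close>

lemma ennreal_mean_intersection:
  "ennreal (mean_intersection \<rho> n) = (\<integral>\<^sup>+z. ennreal ((hit_prob \<rho> n z)\<^sup>2) \<partial>count_space UNIV)"
proof -
  let ?P = "measure_pmf (replicate_pmf n \<rho>)"
  have card: "real (card (visited 0 u \<inter> visited 0 v)) \<le> real n" if "u \<in> set_pmf (replicate_pmf n \<rho>)" for u v
  proof -
    have "card (visited 0 u \<inter> visited 0 v) \<le> card (visited 0 u)"
      by (intro card_mono) auto
    then show ?thesis using card_visited_le[of 0 u] length_replicate_pmf[OF that] by simp
  qed
  have "ennreal (mean_intersection \<rho> n)
     = (\<integral>\<^sup>+u. ennreal (steps_expectation \<rho> n (\<lambda>v. real (card (visited 0 u \<inter> visited 0 v)))) \<partial>?P)"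
    unfolding mean_intersection_def
    by (intro ennreal_expectation_pmf[where B="real n"]) (use card in \<open>auto intro!: expectation_pmf_le integral_nonneg_AE\<close>)
  also have "\<dots> = (\<integral>\<^sup>+u. (\<integral>\<^sup>+v. ennreal (real (card (visited 0 u \<inter> visited 0 v))) \<partial>?P) \<partial>?P)"
    by (intro nn_integral_cong_AE AE_pmfI ennreal_expectation_pmf[where B="real n"]) (use card in auto)
  also have "\<dots> = (\<integral>\<^sup>+u. (\<integral>\<^sup>+v. (\<integral>\<^sup>+z. indicator (visited 0 u) z * indicator (visited 0 v) z \<partial>count_space UNIV) \<partial>?P) \<partial>?P)"
  proof (intro nn_integral_cong)
    fix u v :: "int list"
    have "(\<integral>\<^sup>+z. indicator (visited 0 u) z * indicator (visited 0 v) z \<partial>count_space UNIV)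
        = (\<integral>\<^sup>+z. indicator (visited 0 u \<inter> visited 0 v) z \<partial>count_space UNIV)"
      by (simp add: indicator_inter_arith)
    then show "ennreal (real (card (visited 0 u \<inter> visited 0 v)))
        = (\<integral>\<^sup>+z. indicator (visited 0 u) z * indicator (visited 0 v) z \<partial>count_space UNIV)"
      by (simp add: ennreal_of_nat_eq_real_of_nat)
  qed
  also have "\<dots> = (\<integral>\<^sup>+u. (\<integral>\<^sup>+z. indicator (visited 0 u) z * emeasure ?P {v. z \<in> visited 0 v} \<partial>count_space UNIV) \<partial>?P)"
  proof (intro nn_integral_cong)
    fix u
    have "(\<integral>\<^sup>+v. indicator (visited 0 u) z * indicator (visited 0 v) z \<partial>?P)
        = indicator (visited 0 u) z * emeasure ?P {v. z \<in> visited 0 v}" for z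
    proof -
      have "(\<integral>\<^sup>+v. indicator (visited 0 v) z \<partial>?P) = (\<integral>\<^sup>+v. indicator {v. z \<in> visited 0 v} v \<partial>?P)"
        by (intro nn_integral_cong) (auto simp: indicator_def)
      then show ?thesis by (simp add: nn_integral_cmult)
    qed
    then show "(\<integral>\<^sup>+v. (\<integral>\<^sup>+z. indicator (visited 0 u) z * indicator (visited 0 v) z \<partial>count_space UNIV) \<partial>?P)
       = (\<integral>\<^sup>+z. indicator (visited 0 u) z * emeasure ?P {v. z \<in> visited 0 v} \<partial>count_space UNIV)"
      by (simp add: nn_integral_swap_pmf_count_space)
  qed
  also have "\<dots> = (\<integral>\<^sup>+z. emeasure ?P {v. z \<in> visited 0 v} * emeasure ?P {v. z \<in> visited 0 v} \<partial>count_space UNIV)"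
  proof -
    have "(\<integral>\<^sup>+u. indicator (visited 0 u) z * c \<partial>?P) = emeasure ?P {v. z \<in> visited 0 v} * c" for z c
    proof -
      have "(\<integral>\<^sup>+v. indicator (visited 0 v) z \<partial>?P) = (\<integral>\<^sup>+v. indicator {v. z \<in> visited 0 v} v \<partial>?P)"
        by (intro nn_integral_cong) (auto simp: indicator_def)
      then show ?thesis by (simp add: nn_integral_multc)
    qed
    then show ?thesis by (simp add: nn_integral_swap_pmf_count_space)
  qed
  also have "\<dots> = (\<integral>\<^sup>+z. ennreal ((hit_prob \<rho> n z)\<^sup>2) \<partial>count_space UNIV)"
    by (simp add: ennreal_hit_prob[symmetric] ennreal_mult' power2_eq_square hit_prob_nonneg)
  finally show ?thesis .
qed

text \<open>
  By \<open>hit_prob_times_green_le\<close> the squared hitting probabilities are dominated by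
  \<open>\<Sum>j. \<Sum>k. p\<^sub>j(z) p\<^sub>k(z)\<close>; after summation over \<open>z\<close> each term is at most the larger index's bound
  \<open>s (max j k)\<close>, which occurs about \<open>2 max j k\<close> times.
\<close>

lemma mean_intersection_le:
  assumes s: "\<And>j z. 1 \<le> j \<Longrightarrow> pmf (position_pmf \<rho> j) z \<le> s j"
  shows "(green \<rho> n)\<^sup>2 * mean_intersection \<rho> n \<le> 2 * (\<Sum>r=1..2 * n. real r * s r)"
proof -
  let ?p = "\<lambda>j. pmf (position_pmf \<rho> j)" and ?N = "2 * n"
  have s0: "0 \<le> s j" if "1 \<le> j" for j
    using s[OF that, of 0] pmf_nonneg[of "position_pmf \<rho> j" 0] by linarith
  have pjk: "(\<integral>\<^sup>+z. ennreal (?p j z * ?p k z) \<partial>count_space UNIV) \<le> ennreal (s j)" if "1 \<le> j" for j k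
  proof -
    have "(\<integral>\<^sup>+z. ennreal (?p j z * ?p k z) \<partial>count_space UNIV) \<le> (\<integral>\<^sup>+z. ennreal (s j) * ennreal (?p k z) \<partial>count_space UNIV)"
      using s[OF that] s0[OF that]
      by (intro nn_integral_mono) (auto simp flip: ennreal_mult intro!: ennreal_leI mult_right_mono)
    also have "\<dots> = ennreal (s j)"
      by (simp add: nn_integral_cmult nn_integral_pmf measure_pmf.emeasure_eq_measure)
    finally show ?thesis .
  qed
  have pmax: "(\<integral>\<^sup>+z. ennreal (?p j z * ?p k z) \<partial>count_space UNIV)
      \<le> ennreal ((if k \<le> j then s j else 0) + (if j \<le> k then s k else 0))" if "1 \<le> j" "1 \<le> k" for j k
  proof (cases "k \<le> j")
    case True
    show ?thesis
      by (rule order_trans[OF pjk[OF that(1)] ennreal_leI]) (use True s0[OF that(2)] in auto)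
  next
    case False
    show ?thesis
      using pjk[OF that(2), of j] False by (simp add: mult.commute)
  qed
  have sq: "(green \<rho> n * hit_prob \<rho> n z)\<^sup>2 \<le> (\<Sum>j=1..?N. \<Sum>k=1..?N. ?p j z * ?p k z)" for z
  proof -
    have "(green \<rho> n * hit_prob \<rho> n z)\<^sup>2 \<le> (\<Sum>j=1..?N. ?p j z)\<^sup>2"
      using hit_prob_times_green_le[of \<rho> n z n] hit_prob_nonneg[of \<rho> n z] green_ge_1[of \<rho> n]
      by (intro power_mono) (auto simp: mult.commute mult_2_right)
    then show ?thesis by (simp add: power2_eq_square sum_product)
  qed
  have "ennreal ((green \<rho> n)\<^sup>2 * mean_intersection \<rho> n)
      = (\<integral>\<^sup>+z. ennreal ((green \<rho> n * hit_prob \<rho> n z)\<^sup>2) \<partial>count_space UNIV)"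
    by (simp add: ennreal_mult mean_intersection_nonneg ennreal_mean_intersection
        nn_integral_cmult[symmetric] power_mult_distrib)
  also have "\<dots> \<le> (\<integral>\<^sup>+z. ennreal (\<Sum>j=1..?N. \<Sum>k=1..?N. ?p j z * ?p k z) \<partial>count_space UNIV)"
    by (intro nn_integral_mono ennreal_leI sq)
  also have "\<dots> = (\<Sum>j=1..?N. \<Sum>k=1..?N. \<integral>\<^sup>+z. ennreal (?p j z * ?p k z) \<partial>count_space UNIV)"
  proof -
    have "ennreal (\<Sum>j=1..?N. \<Sum>k=1..?N. ?p j z * ?p k z) = (\<Sum>j=1..?N. \<Sum>k=1..?N. ennreal (?p j z * ?p k z))" for z
      by (simp add: sum_ennreal sum_nonneg)
    then show ?thesis by (simp add: nn_integral_sum del: sum_ennreal)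
  qed
  also have "\<dots> \<le> (\<Sum>j=1..?N. \<Sum>k=1..?N. ennreal ((if k \<le> j then s j else 0) + (if j \<le> k then s k else 0)))"
    by (intro sum_mono pmax) auto
  also have "\<dots> = (\<Sum>j=1..?N. ennreal (\<Sum>k=1..?N. (if k \<le> j then s j else 0) + (if j \<le> k then s k else 0)))"
    by (intro sum.cong refl sum_ennreal) (use s0 in auto)
  also have "\<dots> = ennreal (\<Sum>j=1..?N. \<Sum>k=1..?N. (if k \<le> j then s j else 0) + (if j \<le> k then s k else 0))"
    by (intro sum_ennreal sum_nonneg) (use s0 in auto)
  also have "(\<Sum>j=1..?N. \<Sum>k=1..?N. (if k \<le> j then s j else 0) + (if j \<le> k then s k else 0)) = 2 * (\<Sum>r=1..?N. real r * s r)"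
  proof -
    have 1: "(\<Sum>k=1..?N. if k \<le> j then s j else 0) = real j * s j" if "j \<in> {1..?N}" for j
    proof -
      have "{1..?N} \<inter> {k. k \<le> j} = {1..j}" using that by auto
      then show ?thesis by (simp add: sum.If_cases)
    qed
    have "(\<Sum>j=1..?N. \<Sum>k=1..?N. if j \<le> k then s k else 0) = (\<Sum>k=1..?N. \<Sum>j=1..?N. if j \<le> k then s k else 0)"
      by (rule sum.swap)
    also have "\<dots> = (\<Sum>k=1..?N. real k * s k)"
      by (intro sum.cong refl 1)
    finally show ?thesis
      using sum.cong[OF refl 1, of "{1..?N}"] by (simp only: sum.distrib)
  qed
  finally have "ennreal ((green \<rho> n)\<^sup>2 * mean_intersection \<rho> n) \<le> ennreal (2 * (\<Sum>r=1..?N. real r * s r))" .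
  moreover have "0 \<le> 2 * (\<Sum>r=1..?N. real r * s r)"
    by (auto intro!: sum_nonneg mult_nonneg_nonneg s0)
  ultimately show ?thesis by (subst (asm) ennreal_le_iff) auto
qed

section \<open>Local estimates from the characteristic function\<close>

definition step_char :: "int pmf \<Rightarrow> real \<Rightarrow> complex" where
  "step_char \<rho> t = measure_pmf.expectation \<rho> (\<lambda>x. iexp (t * of_int x))"

lemma expectation_bind_pmf_complex:
  fixes h :: "'b \<Rightarrow> complex"
  assumes B: "\<And>y. norm (h y) \<le> B"
  shows "measure_pmf.expectation (bind_pmf p f) h = measure_pmf.expectation p (\<lambda>x. measure_pmf.expectation (f x) h)"
proof -
  have int: "integrable (measure_pmf q) h" for q :: "'b pmf"
    by (rule integrable_bounded_pmf[where B=B]) (rule B)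
  have nE: "norm (measure_pmf.expectation q h) \<le> B" for q :: "'b pmf"
  proof -
    have "norm (measure_pmf.expectation q h) \<le> measure_pmf.expectation q (\<lambda>y. norm (h y))"
      by (rule integral_norm_bound)
    also have "\<dots> \<le> B"
      by (rule expectation_pmf_le) (simp add: B)
    finally show ?thesis .
  qed
  have int2: "integrable (measure_pmf p) (\<lambda>x. measure_pmf.expectation (f x) h)"
    by (rule integrable_bounded_pmf[where B=B]) (rule nE)
  have Re_B: "\<bar>Re (h y)\<bar> \<le> B" and Im_B: "\<bar>Im (h y)\<bar> \<le> B" for y
    using abs_Re_le_cmod[of "h y"] abs_Im_le_cmod[of "h y"] B[of y] by linarith+
  show ?thesis
  proof (rule complex_eqI)
    show "Re (measure_pmf.expectation (bind_pmf p f) h) = Re (measure_pmf.expectation p (\<lambda>x. measure_pmf.expectation (f x) h))"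
      using int int2
      by (simp flip: integral_Re) (rule expectation_bind_pmf[where B=B], rule Re_B)
    show "Im (measure_pmf.expectation (bind_pmf p f) h) = Im (measure_pmf.expectation p (\<lambda>x. measure_pmf.expectation (f x) h))"
      using int int2
      by (simp flip: integral_Im) (rule expectation_bind_pmf[where B=B], rule Im_B)
  qed
qed

lemma position_pmf_Suc_bind: "position_pmf \<rho> (Suc n) = bind_pmf \<rho> (\<lambda>x. map_pmf ((+) x) (position_pmf \<rho> n))"
  by (simp add: position_pmf_def map_bind_pmf pmf.map_comp o_def map_pmf_def bind_assoc_pmf bind_return_pmf)

lemma position_char: "measure_pmf.expectation (position_pmf \<rho> n) (\<lambda>z. iexp (t * of_int z)) = step_char \<rho> t ^ n"
proof (induction n)
  case (Suc n)
  have "measure_pmf.expectation (position_pmf \<rho> (Suc n)) (\<lambda>z. iexp (t * of_int z))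
     = measure_pmf.expectation \<rho> (\<lambda>x. iexp (t * of_int x) * measure_pmf.expectation (position_pmf \<rho> n) (\<lambda>z. iexp (t * of_int z)))"
    unfolding position_pmf_Suc_bind
    by (subst expectation_bind_pmf_complex[where B=1]) (simp_all add: distrib_left exp_add)
  then show ?case using Suc by (simp add: step_char_def)
qed (simp add: position_pmf_0)

lemma step_char_eq_char: "step_char \<rho> t = char (distr (measure_pmf \<rho>) borel of_int) t"
  by (simp add: step_char_def char_def integral_distr)

lemma real_distribution_distr_pmf: "real_distribution (distr (measure_pmf p) borel (f :: _ \<Rightarrow> real))"
  by (intro real_distribution.intro measure_pmf.prob_space_distr) (auto simp: real_distribution_axioms_def)

lemma norm_step_char_le_1: "norm (step_char \<rho> t) \<le> 1"
  unfolding step_char_eq_char by (rule real_distribution.cmod_char_le_1[OF real_distribution_distr_pmf])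

lemma step_char_0 [simp]: "step_char \<rho> 0 = 1"
  by (simp add: step_char_def)

lemma isCont_step_char: "isCont (step_char \<rho>) t"
  using real_distribution.isCont_char[OF real_distribution_distr_pmf, where t=t]
  by (simp add: step_char_eq_char[abs_def])

lemma step_char_minus: "step_char \<rho> (- t) = cnj (step_char \<rho> t)"
proof -
  have "cnj (step_char \<rho> t) = measure_pmf.expectation \<rho> (\<lambda>x. cnj (iexp (t * of_int x)))"
    unfolding step_char_def by simp
  also have "\<dots> = step_char \<rho> (- t)"
    unfolding step_char_def by (simp add: exp_cnj)
  finally show ?thesis ..
qed

lemma norm_step_char_abs: "norm (step_char \<rho> \<bar>t\<bar>) = norm (step_char \<rho> t)"
  by (cases "t \<ge> 0") (simp_all add: step_char_minus abs_if)

text \<open>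
  A concentration inequality: \<open>\<bar>\<Sum>j<N. iexp (\<eta> * j * (S - z))\<bar>\<^sup>2\<close> is nonnegative and equals
  \<open>N\<^sup>2\<close> when \<open>S = z\<close>.  Only values of the characteristic function near the origin enter, also for
  a periodic walk.
\<close>

lemma concentration_inequality:
  "(real N)\<^sup>2 * pmf (position_pmf \<rho> n) z
     \<le> (\<Sum>j<N. \<Sum>k<N. norm (step_char \<rho> (\<eta> * (real j - real k))) ^ n)"
proof -
  let ?P = "position_pmf \<rho> n"
  define F :: "int \<Rightarrow> complex" where "F x = (\<Sum>j<N. iexp (\<eta> * real j * of_int (x - z)))" for x
  define e where "e j k x = iexp (\<eta> * (real j - real k) * of_int (x - z))" for j k and x :: int
  have F2: "complex_of_real ((norm (F x))\<^sup>2) = (\<Sum>j<N. \<Sum>k<N. e j k x)" for x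
  proof -
    have "complex_of_real ((norm (F x))\<^sup>2) = F x * cnj (F x)"
      by (rule complex_norm_square)
    also have "\<dots> = (\<Sum>j<N. \<Sum>k<N. iexp (\<eta> * real j * of_int (x - z)) * cnj (iexp (\<eta> * real k * of_int (x - z))))"
      by (simp add: F_def sum_product)
    also have "\<dots> = (\<Sum>j<N. \<Sum>k<N. e j k x)"
      by (intro sum.cong refl) (simp add: e_def exp_cnj algebra_simps flip: exp_add)
    finally show ?thesis .
  qed
  have inte: "integrable (measure_pmf ?P) (e j k)" for j k
    by (rule integrable_bounded_pmf[where B=1]) (simp add: e_def)
  have intF: "integrable (measure_pmf ?P) (\<lambda>x. (norm (F x))\<^sup>2)"
  proof (rule integrable_bounded_pmf[where B="(real N)\<^sup>2"])
    fix x
    have "norm (F x) \<le> (\<Sum>j<N. norm (iexp (\<eta> * real j * of_int (x - z))))"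
      unfolding F_def by (rule norm_sum)
    then have "norm (F x) \<le> real N" by simp
    then show "norm ((norm (F x))\<^sup>2) \<le> (real N)\<^sup>2"
      by (simp add: power_mono)
  qed
  have Ee: "norm (measure_pmf.expectation ?P (e j k)) \<le> norm (step_char \<rho> (\<eta> * (real j - real k))) ^ n" for j k
  proof -
    let ?t = "\<eta> * (real j - real k)"
    have eq: "e j k = (\<lambda>x. iexp (- ?t * of_int z) * iexp (?t * of_int x))"
      by (rule ext) (simp add: e_def algebra_simps flip: exp_add)
    have "measure_pmf.expectation ?P (e j k) = iexp (- ?t * of_int z) * step_char \<rho> ?t ^ n"
      unfolding eq position_char[symmetric] by (rule integral_mult_right_zero)
    then show ?thesis by (simp add: norm_mult norm_power)
  qed
  have "(real N)\<^sup>2 * pmf ?P z = measure_pmf.expectation ?P (\<lambda>x. (real N)\<^sup>2 * indicator {z} x)"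
    by (simp add: measure_pmf_single)
  also have "\<dots> \<le> measure_pmf.expectation ?P (\<lambda>x. (norm (F x))\<^sup>2)"
  proof (intro integral_mono intF)
    show "(real N)\<^sup>2 * indicator {z} x \<le> (norm (F x))\<^sup>2" for x
      by (auto simp: indicator_def F_def)
  qed (auto intro!: integrable_bounded_pmf[where B="(real N)\<^sup>2"] simp: indicator_def)
  also have "\<dots> = norm (measure_pmf.expectation ?P (\<lambda>x. complex_of_real ((norm (F x))\<^sup>2)))"
    by (subst integral_complex_of_real) simp
  also have "measure_pmf.expectation ?P (\<lambda>x. complex_of_real ((norm (F x))\<^sup>2))
      = (\<Sum>j<N. \<Sum>k<N. measure_pmf.expectation ?P (e j k))"
    unfolding F2 by (simp add: inte)
  also have "norm \<dots> \<le> (\<Sum>j<N. \<Sum>k<N. norm (step_char \<rho> (\<eta> * (real j - real k))) ^ n)"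
    by (intro order_trans[OF norm_sum] sum_mono Ee)
  finally show ?thesis .
qed

subsection \<open>Walks attracted to a stable law\<close>

text \<open>
  The law of \<open>S\<^sub>n / n\<^sup>1\<^sup>/\<^sup>\<alpha>\<close>.
\<close>

definition scaled_law :: "int pmf \<Rightarrow> real \<Rightarrow> nat \<Rightarrow> real measure" where
  "scaled_law \<rho> \<alpha> n = distr (measure_pmf (position_pmf \<rho> n)) borel (\<lambda>z. of_int z / real n powr (1 / \<alpha>))"

locale stable_walk =
  fixes \<rho> :: "int pmf" and \<alpha> C\<^sub>1 C\<^sub>2 :: real and \<mu> :: "real measure"
  assumes index: "0 < \<alpha>" "\<alpha> \<le> 1"
    and stable_law: "real_distribution \<mu>" "0 < C\<^sub>1"
      "\<And>\<theta>. char \<mu> \<theta> =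
        exp (- complex_of_real (\<bar>\<theta>\<bar> powr \<alpha>) * (complex_of_real C\<^sub>1 + \<i> * complex_of_real (C\<^sub>2 * sgn \<theta>)))"
    and attraction: "weak_conv_m (scaled_law \<rho> \<alpha>) \<mu>"
begin

lemma real_distribution_scaled_law: "real_distribution (scaled_law \<rho> \<alpha> n)"
  unfolding scaled_law_def by (rule real_distribution_distr_pmf)

lemma char_scaled_law: "char (scaled_law \<rho> \<alpha> n) \<theta> = step_char \<rho> (\<theta> / real n powr (1 / \<alpha>)) ^ n"
  by (simp add: scaled_law_def char_def integral_distr flip: position_char)

text \<open>
  Weak convergence gives convergence of the characteristic functions that is locally uniform, hence
  also along moving arguments.
\<close>

lemma char_scaled_law_tendsto:
  assumes n: "filterlim n at_top sequentially" and \<theta>: "\<theta> \<longlonglongrightarrow> \<theta>0"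
  shows "(\<lambda>j. char (scaled_law \<rho> \<alpha> (n j)) (\<theta> j)) \<longlonglongrightarrow> char \<mu> \<theta>0"
proof -
  have "weak_conv_m (\<lambda>j. scaled_law \<rho> \<alpha> (n j)) \<mu>"
    using attraction n unfolding weak_conv_m_def weak_conv_def by (auto intro: filterlim_compose)
  then obtain \<Omega> :: "real measure" and Y :: "nat \<Rightarrow> real \<Rightarrow> real" and Y0 :: "real \<Rightarrow> real" where
    \<Omega>: "prob_space \<Omega>" and Ym: "\<And>j. Y j \<in> measurable \<Omega> borel"
    and Yd: "\<And>j. distr \<Omega> borel (Y j) = scaled_law \<rho> \<alpha> (n j)"
    and Y0m: "Y0 \<in> measurable \<Omega> lborel" and Y0d: "distr \<Omega> borel Y0 = \<mu>"
    and Yc: "\<And>x. x \<in> space \<Omega> \<Longrightarrow> (\<lambda>j. Y j x) \<longlonglongrightarrow> Y0 x"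
    using Skorohod[of "\<lambda>j. scaled_law \<rho> \<alpha> (n j)" \<mu>] real_distribution_scaled_law stable_law(1) by blast
  interpret \<Omega>: prob_space \<Omega> by fact
  note [measurable] = Ym
  have [measurable]: "Y0 \<in> borel_measurable \<Omega>" using Y0m by simp
  have "(\<lambda>j. (CLINT x|\<Omega>. iexp (\<theta> j * Y j x))) \<longlonglongrightarrow> (CLINT x|\<Omega>. iexp (\<theta>0 * Y0 x))"
  proof (rule integral_dominated_convergence[where w="\<lambda>_. 1"])
    show "AE x in \<Omega>. (\<lambda>j. iexp (\<theta> j * Y j x)) \<longlonglongrightarrow> iexp (\<theta>0 * Y0 x)"
      by (intro AE_I2 tendsto_intros \<theta> Yc)
  qed auto
  moreover have "char (scaled_law \<rho> \<alpha> (n j)) (\<theta> j) = (CLINT x|\<Omega>. iexp (\<theta> j * Y j x))" for j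
    by (simp add: char_def integral_distr flip: Yd)
  moreover have "char \<mu> \<theta>0 = (CLINT x|\<Omega>. iexp (\<theta>0 * Y0 x))"
    by (simp add: char_def integral_distr flip: Y0d)
  ultimately show ?thesis by simp
qed

lemma norm_char_1: "norm (char \<mu> 1) = exp (- C\<^sub>1)"
  by (simp add: stable_law(3) norm_exp_eq_Re)

text \<open>
  If the bound failed along some \<open>t\<^sub>j \<rightarrow> 0\<close>, choose \<open>n\<^sub>j \<approx> t\<^sub>j\<^sup>-\<^sup>\<alpha>\<close>.  Then \<open>\<phi>(t\<^sub>j)\<close> to the power \<open>n\<^sub>j\<close> is the characteristic
  function of the rescaled walk at an argument close to \<open>1\<close>, where its limit has modulus \<open>exp (- C\<^sub>1)\<close>.
\<close>

lemma step_char_decay: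
  obtains c \<epsilon> where "0 < c" "0 < \<epsilon>" "\<And>t. \<bar>t\<bar> < \<epsilon> \<Longrightarrow> norm (step_char \<rho> t) \<le> exp (- c * \<bar>t\<bar> powr \<alpha>)"
proof -
  \<comment> \<open>any constant below \<open>C\<^sub>1\<close> would do\<close>
  define c where "c = C\<^sub>1 / 2"
  have c: "0 < c" "c < C\<^sub>1" using stable_law(2) by (auto simp: c_def)
  have "\<exists>\<epsilon>>0. \<forall>t. 0 < t \<and> t < \<epsilon> \<longrightarrow> norm (step_char \<rho> t) \<le> exp (- c * t powr \<alpha>)"
  proof (rule ccontr)
    assume "\<not> ?thesis"
    then have "\<forall>j. \<exists>t. 0 < t \<and> t < 1 / real (Suc j) \<and> exp (- c * t powr \<alpha>) < norm (step_char \<rho> t)"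
      by (auto simp: not_le dest!: spec[of _ "1 / real (Suc _)"])
    then obtain t where t: "\<And>j. 0 < t j" "\<And>j. t j < 1 / real (Suc j)"
        and big: "\<And>j. exp (- c * t j powr \<alpha>) < norm (step_char \<rho> (t j))"
      by metis
    have t0: "t \<longlonglongrightarrow> 0"
      by (rule tendsto_sandwich[OF _ _ tendsto_const lim_1_over_n[THEN LIMSEQ_Suc]])
        (use t in \<open>auto simp: less_imp_le intro!: always_eventually\<close>)
    define n where "n j = nat \<lceil>t j powr (- \<alpha>)\<rceil>" for j
    have n_ge: "t j powr (- \<alpha>) \<le> real (n j)" and n_le: "real (n j) \<le> t j powr (- \<alpha>) + 1" for j
      unfolding n_def by (auto simp: of_nat_nat intro: less_imp_le of_int_ceiling_le_add_one)
    have t0': "filterlim t (at_right 0) sequentially"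
      using t0 by (simp add: filterlim_at t(1) less_imp_neq[OF t(1), symmetric])
    have "filterlim (\<lambda>j. t j powr (- \<alpha>)) at_top sequentially"
      by (rule filterlim_compose[OF _ t0']) (use index in real_asymp)
    then have "filterlim (\<lambda>j. real (n j)) at_top sequentially"
      by (rule filterlim_at_top_mono) (simp add: n_ge)
    then have n_inf: "filterlim n at_top sequentially"
      by (simp add: filterlim_sequentially_iff_filterlim_real)
    have prod: "(\<lambda>j. real (n j) * t j powr \<alpha>) \<longlonglongrightarrow> 1"
    proof (rule tendsto_sandwich[of "\<lambda>_. 1" _ _ "\<lambda>j. 1 + t j powr \<alpha>"])
      have "t j powr (- \<alpha>) * t j powr \<alpha> = 1" for j
        using t(1)[of j] by (simp flip: powr_add)
      then have "1 \<le> real (n j) * t j powr \<alpha>" "real (n j) * t j powr \<alpha> \<le> 1 + t j powr \<alpha>" for j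
        using mult_right_mono[OF n_ge, of "t j powr \<alpha>" j] mult_right_mono[OF n_le, of "t j powr \<alpha>" j]
        by (simp_all add: distrib_right)
      then show "\<forall>\<^sub>F j in sequentially. 1 \<le> real (n j) * t j powr \<alpha>"
        "\<forall>\<^sub>F j in sequentially. real (n j) * t j powr \<alpha> \<le> 1 + t j powr \<alpha>"
        by simp_all
      have "((\<lambda>x. 1 + x powr \<alpha>) \<longlongrightarrow> 1) (at_right 0)"
        using index by real_asymp
      then show "(\<lambda>j. 1 + t j powr \<alpha>) \<longlonglongrightarrow> 1"
        using t0' by (rule filterlim_compose)
    qed simp
    define \<theta> where "\<theta> j = t j * real (n j) powr (1 / \<alpha>)" for j
    have npos: "0 < real (n j)" for j
      using n_ge[of j] t(1)[of j] by (smt (verit) powr_gt_zero)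
    have \<theta>_eq: "\<theta> j = (real (n j) * t j powr \<alpha>) powr (1 / \<alpha>)" for j
      using index t(1)[of j] npos[of j] by (simp add: \<theta>_def powr_mult powr_powr)
    have "\<theta> \<longlonglongrightarrow> 1 powr (1 / \<alpha>)"
      unfolding \<theta>_eq[abs_def] by (intro tendsto_powr prod tendsto_const) simp
    then have \<theta>1: "\<theta> \<longlonglongrightarrow> 1" by simp
    have "(\<lambda>j. norm (char (scaled_law \<rho> \<alpha> (n j)) (\<theta> j))) \<longlonglongrightarrow> exp (- C\<^sub>1)"
      using tendsto_norm[OF char_scaled_law_tendsto[OF n_inf \<theta>1]] by (simp add: norm_char_1)
    moreover have "exp (- c * (real (n j) * t j powr \<alpha>)) \<le> norm (char (scaled_law \<rho> \<alpha> (n j)) (\<theta> j))" for j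
    proof -
      have "\<theta> j / real (n j) powr (1 / \<alpha>) = t j"
        using npos[of j] by (simp add: \<theta>_def)
      then have "norm (char (scaled_law \<rho> \<alpha> (n j)) (\<theta> j)) = norm (step_char \<rho> (t j)) ^ n j"
        by (simp add: char_scaled_law norm_power)
      moreover have "exp (- c * (real (n j) * t j powr \<alpha>)) = exp (- c * t j powr \<alpha>) ^ n j"
        by (simp add: algebra_simps flip: exp_of_nat_mult)
      ultimately show ?thesis using big[of j] by (simp add: power_mono)
    qed
    moreover have "(\<lambda>j. exp (- c * (real (n j) * t j powr \<alpha>))) \<longlonglongrightarrow> exp (- c * 1)"
      by (intro tendsto_intros prod)
    ultimately have "exp (- c * 1) \<le> exp (- C\<^sub>1)"
      by (intro LIMSEQ_le) auto
    with c show False by simp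
  qed
  then obtain \<epsilon> where \<epsilon>: "\<epsilon> > 0" "\<And>t. 0 < t \<Longrightarrow> t < \<epsilon> \<Longrightarrow> norm (step_char \<rho> t) \<le> exp (- c * t powr \<alpha>)"
    by blast
  show ?thesis
  proof (rule that[OF c(1) \<epsilon>(1)])
    fix t :: real assume "\<bar>t\<bar> < \<epsilon>"
    then show "norm (step_char \<rho> t) \<le> exp (- c * \<bar>t\<bar> powr \<alpha>)"
      using \<epsilon>(2)[of "\<bar>t\<bar>"] norm_step_char_le_1[where \<rho>=\<rho> and t=t] by (cases "t = 0") (auto simp: norm_step_char_abs)
  qed
qed

lemma summable_exp_powr: "0 < c \<Longrightarrow> summable (\<lambda>d. exp (- c * real d powr \<alpha>))"
proof -
  assume c: "0 < c"
  show ?thesis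
  proof (rule summable_comparison_test_bigo)
    show "summable (\<lambda>d. norm (1 / (real d)\<^sup>2))"
      using inverse_power_summable[of 2, where 'a=real] by (simp add: field_simps)
    show "(\<lambda>d. exp (- c * real d powr \<alpha>)) \<in> O(\<lambda>d. 1 / (real d)\<^sup>2)"
      using c index by real_asymp
  qed
qed

text \<open>
  The concentration inequality at frequencies \<open>\<eta> j\<close> with spacing \<open>\<eta> = n\<^sup>-\<^sup>1\<^sup>/\<^sup>\<alpha>\<close> and \<open>N \<approx> \<epsilon> n\<^sup>1\<^sup>/\<^sup>\<alpha>\<close> of them: all differences
  stay in the range where \<open>step_char_decay\<close> applies, and every row of the double sum is bounded.
\<close>

lemma local_bound:
  obtains C where "0 < C" "\<And>n z. 1 \<le> n \<Longrightarrow> pmf (position_pmf \<rho> n) z \<le> C * real n powr (- (1 / \<alpha>))"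
proof -
  obtain c \<epsilon> where c: "0 < c" and \<epsilon>: "0 < \<epsilon>"
    and decay: "\<And>t. \<bar>t\<bar> < \<epsilon> \<Longrightarrow> norm (step_char \<rho> t) \<le> exp (- c * \<bar>t\<bar> powr \<alpha>)"
    using step_char_decay by blast
  define B where "B = (\<Sum>d. exp (- c * real d powr \<alpha>))"
  have B: "(\<Sum>d\<in>D. exp (- c * real d powr \<alpha>)) \<le> B" if "finite D" for D
    unfolding B_def by (rule sum_le_suminf[OF summable_exp_powr[OF c] that]) simp
  have B0: "0 < B"
    using B[of "{0}"] index by (simp add: powr_def)
  show ?thesis
  proof (rule that[of "2 * B / \<epsilon>"])
    show "0 < 2 * B / \<epsilon>" using B0 \<epsilon> by simp
    fix n :: nat and z :: int assume n: "1 \<le> n"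
    define r where "r = real n powr (1 / \<alpha>)"
    have r: "0 < r" using n by (simp add: r_def)
    define \<eta> where "\<eta> = 1 / r"
    define N where "N = nat \<lceil>\<epsilon> * r\<rceil>"
    have N: "\<epsilon> * r \<le> real N" "real N < \<epsilon> * r + 1" and N1: "0 < N"
      unfolding N_def using \<epsilon> r by (auto simp: of_nat_nat) linarith
    have rn: "r powr \<alpha> = real n"
      using index n by (simp add: r_def powr_powr)
    have entry: "norm (step_char \<rho> (\<eta> * (real j - real k))) ^ n \<le> exp (- c * \<bar>real j - real k\<bar> powr \<alpha>)"
      if "j < N" "k < N" for j k
    proof -
      have "\<bar>real j - real k\<bar> \<le> real N - 1" using that by linarith
      also have "\<dots> < \<epsilon> * r" using N by simp
      finally have "\<bar>\<eta> * (real j - real k)\<bar> < \<epsilon>"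
        using r by (simp add: \<eta>_def abs_mult field_simps)
      then have "norm (step_char \<rho> (\<eta> * (real j - real k))) ^ n \<le> exp (- c * \<bar>\<eta> * (real j - real k)\<bar> powr \<alpha>) ^ n"
        by (intro power_mono decay) auto
      also have "\<dots> = exp (real n * (- c * \<bar>\<eta> * (real j - real k)\<bar> powr \<alpha>))"
        by (rule exp_of_nat_mult[symmetric])
      also have "\<bar>\<eta> * (real j - real k)\<bar> powr \<alpha> = \<bar>real j - real k\<bar> powr \<alpha> / real n"
        using r by (simp add: \<eta>_def abs_mult powr_divide rn)
      finally show ?thesis using n by simp
    qed
    have row: "(\<Sum>k<N. exp (- c * \<bar>real j - real k\<bar> powr \<alpha>)) \<le> 2 * B" for j
    proof -
      have "(\<Sum>k<N. exp (- c * \<bar>real j - real k\<bar> powr \<alpha>))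
         \<le> (\<Sum>k<N. (if k \<le> j then exp (- c * real (j - k) powr \<alpha>) else 0) + (if j \<le> k then exp (- c * real (k - j) powr \<alpha>) else 0))"
        by (intro sum_mono) (auto simp: of_nat_diff abs_if)
      also have "\<dots> = (\<Sum>k\<in>{k. k < N \<and> k \<le> j}. exp (- c * real (j - k) powr \<alpha>)) + (\<Sum>k\<in>{k. k < N \<and> j \<le> k}. exp (- c * real (k - j) powr \<alpha>))"
        by (simp add: sum.distrib sum.If_cases Int_def)
      also have "(\<Sum>k\<in>{k. k < N \<and> k \<le> j}. exp (- c * real (j - k) powr \<alpha>)) = (\<Sum>d\<in>(\<lambda>k. j - k) ` {k. k < N \<and> k \<le> j}. exp (- c * real d powr \<alpha>))"
        by (subst sum.reindex) (auto simp: inj_on_def)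
      also have "(\<Sum>k\<in>{k. k < N \<and> j \<le> k}. exp (- c * real (k - j) powr \<alpha>)) = (\<Sum>d\<in>(\<lambda>k. k - j) ` {k. k < N \<and> j \<le> k}. exp (- c * real d powr \<alpha>))"
        by (subst sum.reindex) (auto simp: inj_on_def)
      also have "(\<Sum>d\<in>(\<lambda>k. j - k) ` {k. k < N \<and> k \<le> j}. exp (- c * real d powr \<alpha>)) + (\<Sum>d\<in>(\<lambda>k. k - j) ` {k. k < N \<and> j \<le> k}. exp (- c * real d powr \<alpha>)) \<le> B + B"
        by (intro add_mono B) auto
      finally show ?thesis by simp
    qed
    have "(real N)\<^sup>2 * pmf (position_pmf \<rho> n) z \<le> (\<Sum>j<N. \<Sum>k<N. norm (step_char \<rho> (\<eta> * (real j - real k))) ^ n)"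
      by (rule concentration_inequality)
    also have "\<dots> \<le> (\<Sum>j<N. \<Sum>k<N. exp (- c * \<bar>real j - real k\<bar> powr \<alpha>))"
      by (intro sum_mono entry) auto
    also have "\<dots> \<le> (\<Sum>j<N. 2 * B)"
      by (intro sum_mono row)
    finally have "real N * (real N * pmf (position_pmf \<rho> n) z) \<le> real N * (2 * B)"
      by (simp add: power2_eq_square mult.assoc)
    then have "real N * pmf (position_pmf \<rho> n) z \<le> 2 * B"
      using N1 by simp
    moreover have "\<epsilon> * r * pmf (position_pmf \<rho> n) z \<le> real N * pmf (position_pmf \<rho> n) z"
      using N by (intro mult_right_mono) auto
    ultimately have "\<epsilon> * r * pmf (position_pmf \<rho> n) z \<le> 2 * B" by linarith
    then show "pmf (position_pmf \<rho> n) z \<le> 2 * B / \<epsilon> * real n powr (- (1 / \<alpha>))"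
      using \<epsilon> r by (simp add: powr_minus r_def field_simps)
  qed
qed

text \<open>
  For \<open>\<alpha> = 1\<close> the powers \<open>\<phi>(t)\<^sup>k\<close> with \<open>k t \<le> \<delta>\<close> are close to \<open>1\<close>.  Hence the geometric sum
  \<open>\<Sum>k<K. \<phi>(t)\<^sup>k\<close> with \<open>K \<approx> \<delta> / t\<close> is of order \<open>K\<close>, while \<open>1 - \<phi>(t)\<close> times it is at most \<open>2\<close>.
\<close>

lemma step_char_lipschitz:
  assumes "\<alpha> = 1"
  obtains C \<epsilon> where "0 < C" "0 < \<epsilon>" "\<And>t. 0 < t \<Longrightarrow> t < \<epsilon> \<Longrightarrow> norm (1 - step_char \<rho> t) \<le> C * t"
proof -
  have "\<exists>\<delta>>0. \<exists>n0. \<forall>n\<ge>n0. \<forall>\<theta>. \<bar>\<theta>\<bar> \<le> \<delta> \<longrightarrow> norm (char (scaled_law \<rho> \<alpha> n) \<theta> - 1) \<le> 1 / 2"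
  proof (rule ccontr)
    assume neg: "\<not> ?thesis"
    have "\<exists>n \<theta>. j \<le> n \<and> \<bar>\<theta>\<bar> \<le> 1 / real (Suc j) \<and> 1 / 2 < norm (char (scaled_law \<rho> \<alpha> n) \<theta> - 1)" for j
      using neg[unfolded not_ex, rule_format, of "1 / real (Suc j)"] by (auto simp: not_le)
    then obtain n \<theta> where n: "\<And>j. j \<le> n j" and \<theta>: "\<And>j. \<bar>\<theta> j\<bar> \<le> 1 / real (Suc j)"
      and far: "\<And>j. 1 / 2 < norm (char (scaled_law \<rho> \<alpha> (n j)) (\<theta> j) - 1)"
      by metis
    have "\<theta> \<longlonglongrightarrow> 0"
      by (rule Lim_null_comparison[OF _ lim_1_over_n[THEN LIMSEQ_Suc]]) (simp add: \<theta>[simplified])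
    moreover have "filterlim n at_top sequentially"
      using n by (intro filterlim_at_top_mono[OF filterlim_ident]) auto
    ultimately have "(\<lambda>j. norm (char (scaled_law \<rho> \<alpha> (n j)) (\<theta> j) - 1)) \<longlonglongrightarrow> norm (char \<mu> 0 - 1)"
      by (intro tendsto_intros char_scaled_law_tendsto)
    then have "1 / 2 \<le> norm (char \<mu> 0 - 1)"
      using far by (intro LIMSEQ_le_const) (auto intro!: exI[of _ 0] less_imp_le)
    then show False
      using real_distribution.char_zero[OF stable_law(1)] by simp
  qed
  then obtain \<delta> n0 where \<delta>: "0 < \<delta>"
    and large: "\<And>n \<theta>. n0 \<le> n \<Longrightarrow> \<bar>\<theta>\<bar> \<le> \<delta> \<Longrightarrow> norm (char (scaled_law \<rho> \<alpha> n) \<theta> - 1) \<le> 1 / 2"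
    by blast
  have "\<forall>\<^sub>F t in at 0. \<forall>k\<in>{..n0}. norm (step_char \<rho> t ^ k - 1) < 1 / 2"
  proof (intro eventually_ball_finite ballI)
    fix k
    have "((\<lambda>t. norm (step_char \<rho> t ^ k - 1)) \<longlongrightarrow> norm (step_char \<rho> 0 ^ k - 1)) (at 0)"
      using isCont_step_char[where t=0] by (intro tendsto_intros) (simp add: isCont_def)
    then show "\<forall>\<^sub>F t in at 0. norm (step_char \<rho> t ^ k - 1) < 1 / 2"
      by (rule order_tendstoD) simp
  qed simp
  then obtain e where e: "0 < e" "\<And>t k. t \<noteq> 0 \<Longrightarrow> \<bar>t\<bar> < e \<Longrightarrow> k \<le> n0 \<Longrightarrow> norm (step_char \<rho> t ^ k - 1) < 1 / 2"
    unfolding eventually_at by (auto simp: dist_real_def)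
  have close: "norm (step_char \<rho> t ^ k - 1) \<le> 1 / 2" if "0 < t" "t < e" "t * real k \<le> \<delta>" for t k
  proof (cases "k \<le> n0")
    case True
    then show ?thesis using e(2)[of t k] that by simp
  next
    case False
    then have "char (scaled_law \<rho> \<alpha> k) (t * real k) = step_char \<rho> t ^ k"
      unfolding char_scaled_law using assms by simp
    then show ?thesis using large[of k "t * real k"] False that by simp
  qed
  show ?thesis
  proof (rule that[of "8 / \<delta>" "min e (\<delta> / 2)"])
    fix t assume t: "0 < t" "t < min e (\<delta> / 2)"
    let ?\<phi> = "step_char \<rho> t"
    define K where "K = nat \<lfloor>\<delta> / t\<rfloor>"
    have K: "real K \<le> \<delta> / t" "\<delta> / t < real K + 1"
      unfolding K_def using t \<delta> by auto
    have "2 < \<delta> / t" using t \<delta> by (simp add: field_simps)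
    then have K2: "\<delta> / (2 * t) \<le> real K" using K by (simp add: field_simps)
    have K0: "0 < real K" using K2 t \<delta> by (smt (verit) divide_pos_pos)
    have "real K / 2 \<le> (\<Sum>k<K. Re (?\<phi> ^ k))"
    proof -
      have "1 / 2 \<le> Re (?\<phi> ^ k)" if "k < K" for k
      proof -
        have "t * real k \<le> t * real K" using that t by (intro mult_left_mono) auto
        also have "\<dots> \<le> \<delta>" using K t by (simp add: field_simps)
        finally have "norm (?\<phi> ^ k - 1) \<le> 1 / 2" using t by (intro close) auto
        then show ?thesis using abs_Re_le_cmod[of "?\<phi> ^ k - 1"] by simp
      qed
      then show ?thesis using sum_bounded_below[of "{..<K}" "1 / 2" "\<lambda>k. Re (?\<phi> ^ k)"] by simp
    qed
    also have "\<dots> \<le> norm (\<Sum>k<K. ?\<phi> ^ k)"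
      using complex_Re_le_cmod[of "\<Sum>k<K. ?\<phi> ^ k"] by simp
    finally have "norm (1 - ?\<phi>) * (real K / 2) \<le> norm (1 - ?\<phi>) * norm (\<Sum>k<K. ?\<phi> ^ k)"
      by (intro mult_left_mono) auto
    also have "\<dots> = norm (1 - ?\<phi> ^ K)"
      by (simp add: one_diff_power_eq norm_mult)
    also have "\<dots> \<le> 1 + norm ?\<phi> ^ K"
      using norm_triangle_ineq4[of 1 "?\<phi> ^ K"] by (simp add: norm_power)
    also have "\<dots> \<le> 2"
      using power_le_one[OF norm_ge_zero norm_step_char_le_1[where \<rho>=\<rho> and t=t], of K] by simp
    finally have "norm (1 - ?\<phi>) * real K \<le> 4" by simp
    moreover have "norm (1 - ?\<phi>) * (\<delta> / (2 * t)) \<le> norm (1 - ?\<phi>) * real K"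
      using K2 by (intro mult_left_mono) auto
    ultimately have "norm (1 - ?\<phi>) * (\<delta> / (2 * t)) \<le> 4" by linarith
    then show "norm (1 - ?\<phi>) \<le> 8 / \<delta> * t"
      using t \<delta> by (simp add: field_simps)
  qed (use \<delta> e in auto)
qed

end

lemma sum_roots_of_unity:
  assumes "0 < N"
  shows "(\<Sum>j<N. iexp (2 * pi * real j / real N * of_int z)) = of_nat N * of_bool (int N dvd z)"
proof -
  define w where "w = iexp (2 * pi * of_int z / real N)"
  have pow: "iexp (2 * pi * real j / real N * of_int z) = w ^ j" for j
    unfolding w_def by (subst exp_of_nat_mult[symmetric]) (simp add: algebra_simps)
  have w1: "w = 1 \<longleftrightarrow> int N dvd z"
  proof
    assume "w = 1"
    then have "\<exists>n::int. 2 * pi * of_int z / real N = of_int (2 * n) * pi"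
      unfolding w_def exp_eq_1 by simp
    then obtain n :: int where "2 * pi * of_int z / real N = of_int (2 * n) * pi" by blast
    then have "real_of_int z = real_of_int (int N * n)"
      using assms by (simp add: field_simps)
    then have "z = int N * n" by (simp only: of_int_eq_iff)
    then show "int N dvd z" by simp
  next
    assume "int N dvd z"
    then obtain n where "z = int N * n" by (auto elim: dvdE)
    then have "2 * pi * of_int z / real N = of_int (2 * n) * pi"
      using assms by (simp add: field_simps)
    then show "w = 1" unfolding w_def exp_eq_1 by auto
  qed
  show ?thesis
  proof (cases "int N dvd z")
    case True
    then show ?thesis using w1 by (simp only: pow) simp
  next
    case False
    have "w ^ N = 1"
    proof -
      have "w ^ N = iexp (real N * (2 * pi * of_int z / real N))"
        unfolding w_def by (subst exp_of_nat_mult[symmetric]) (simp add: algebra_simps)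
      also have "real N * (2 * pi * of_int z / real N) = of_int (2 * z) * pi"
        using assms by simp
      also have "iexp (of_int (2 * z) * pi) = 1"
        unfolding exp_eq_1 by auto
      finally show ?thesis .
    qed
    moreover have "1 - w ^ N = (1 - w) * (\<Sum>j<N. w ^ j)" by (rule one_diff_power_eq)
    ultimately show ?thesis using False w1 by (simp only: pow) simp
  qed
qed

text \<open>
  Each doubling of the range contributes at least \<open>1/2\<close>.
\<close>

lemma harmonic_block: "0 < J \<Longrightarrow> real m / 2 \<le> (\<Sum>j=J..2 ^ m * J. 1 / real j)"
proof (induction m)
  case (Suc m)
  let ?a = "2 ^ m * J"
  have "{J..2 * a} = {J..a} \<union> {a<..2 * a}" if "J \<le> a" for a
    using that by auto
  from this[of ?a] have "{J..2 ^ Suc m * J} = {J..?a} \<union> {?a<..2 * ?a}"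
    by (simp add: mult.assoc)
  then have "(\<Sum>j=J..2 ^ Suc m * J. 1 / real j) = (\<Sum>j=J..?a. 1 / real j) + (\<Sum>j\<in>{?a<..2 * ?a}. 1 / real j)"
    by (simp only:) (rule sum.union_disjoint, auto)
  moreover have "(\<Sum>j\<in>{?a<..2 * ?a}. 1 / (2 * real ?a)) \<le> (\<Sum>j\<in>{?a<..2 * ?a}. 1 / real j)"
    using Suc.prems by (intro sum_mono divide_left_mono) (auto simp flip: of_nat_mult of_nat_power)
  ultimately show ?case using Suc by (simp add: field_simps)
qed simp

lemma divisibility_prob:
  assumes "0 < N"
  shows "measure (position_pmf \<rho> n) {z. int N dvd z} = Re (\<Sum>j<N. step_char \<rho> (2 * pi * real j / real N) ^ n) / real N"
proof -
  let ?P = "position_pmf \<rho> n"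
  have "complex_of_real (measure ?P {z. int N dvd z}) = measure_pmf.expectation ?P (\<lambda>z. of_bool (int N dvd z))"
  proof -
    have "(\<lambda>z. of_bool (int N dvd z)) = (\<lambda>z. complex_of_real (indicator {z. int N dvd z} z))"
      by (auto simp: indicator_def)
    then show ?thesis by simp
  qed
  then have "of_nat N * complex_of_real (measure ?P {z. int N dvd z})
      = measure_pmf.expectation ?P (\<lambda>z. of_nat N * of_bool (int N dvd z))"
    by simp
  also have "\<dots> = measure_pmf.expectation ?P (\<lambda>z. \<Sum>j<N. iexp (2 * pi * real j / real N * of_int z))"
    by (simp only: sum_roots_of_unity[OF assms])
  also have "\<dots> = (\<Sum>j<N. measure_pmf.expectation ?P (\<lambda>z. iexp (2 * pi * real j / real N * of_int z)))"
    by (rule Bochner_Integration.integral_sum) (rule integrable_bounded_pmf[where B=1], simp)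
  also have "\<dots> = (\<Sum>j<N. step_char \<rho> (2 * pi * real j / real N) ^ n)"
    by (simp only: position_char)
  finally have "Re (of_nat N * complex_of_real (measure ?P {z. int N dvd z})) = Re (\<Sum>j<N. step_char \<rho> (2 * pi * real j / real N) ^ n)"
    by simp
  then show ?thesis using assms by (simp add: field_simps)
qed

text \<open>
  Multiples of a large modulus, other than \<open>0\<close>, are far away.
\<close>

lemma divisibility_prob_tendsto:
  assumes K: "0 < K"
  shows "(\<lambda>J. measure (position_pmf \<rho> n) {z. int (Suc J * K) dvd z}) \<longlonglongrightarrow> pmf (position_pmf \<rho> n) 0"
proof -
  let ?P = "position_pmf \<rho> n"
  have "(\<lambda>J. measure_pmf.expectation ?P (indicator {z. int (Suc J * K) dvd z} :: int \<Rightarrow> real))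
      \<longlonglongrightarrow> measure_pmf.expectation ?P (indicator {0})"
  proof (rule integral_dominated_convergence[where w="\<lambda>_. 1"])
    show "AE z in measure_pmf ?P. (\<lambda>J. indicator {z. int (Suc J * K) dvd z} z :: real) \<longlonglongrightarrow> indicator {0} z"
    proof (rule AE_I2)
      fix z :: int
      have "indicator {z. int (Suc J * K) dvd z} z = (indicator {0} z :: real)" if "nat \<bar>z\<bar> \<le> J" for J
      proof (cases "z = 0")
        case False
        have "\<bar>z\<bar> < int (Suc J)" using that by linarith
        also have "\<dots> \<le> int (Suc J * K)"
          unfolding of_nat_le_iff using mult_le_mono2[of 1 K "Suc J"] K by (metis One_nat_def Suc_leI mult_1_right)
        finally have "\<not> int (Suc J * K) dvd z" using False zdvd_not_zless[of "\<bar>z\<bar>" "int (Suc J * K)"] by simp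
        then show ?thesis using False by simp
      qed simp
      then show "(\<lambda>J. indicator {z. int (Suc J * K) dvd z} z :: real) \<longlonglongrightarrow> indicator {0} z"
        by (intro tendsto_eventually eventually_sequentiallyI[of "nat \<bar>z\<bar>"]) auto
    qed
  qed auto
  then show ?thesis by (simp add: measure_pmf_single)
qed

text \<open>
  The Chung--Fuchs criterion for \<open>\<alpha> = 1\<close>: near the origin \<open>Re (1 / (1 - r \<phi>(\<theta>)))\<close> is at least
  of order \<open>1 / \<theta>\<close> for \<open>\<theta> \<ge> 1 - r\<close>, and \<open>1 / \<theta>\<close> is not integrable at \<open>0\<close>.  The integral over
  the circle is replaced by averages over roots of unity.
\<close>

theorem (in stable_walk) green_unbounded:
  assumes "\<alpha> = 1"
  shows "filterlim (green \<rho>) at_top sequentially"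
proof -
  obtain c \<epsilon>1 where c: "0 < c" and \<epsilon>1: "0 < \<epsilon>1"
    and decay: "\<And>t. \<bar>t\<bar> < \<epsilon>1 \<Longrightarrow> norm (step_char \<rho> t) \<le> exp (- c * \<bar>t\<bar> powr \<alpha>)"
    using step_char_decay by blast
  obtain C \<epsilon>2 where C: "0 < C" and \<epsilon>2: "0 < \<epsilon>2"
    and lip: "\<And>t. 0 < t \<Longrightarrow> t < \<epsilon>2 \<Longrightarrow> norm (1 - step_char \<rho> t) \<le> C * t"
    using step_char_lipschitz[OF assms] by blast
  define \<epsilon> where "\<epsilon> = min (min \<epsilon>1 \<epsilon>2) (min (1 / c) 1)"
  have \<epsilon>: "0 < \<epsilon>" "\<epsilon> \<le> \<epsilon>1" "\<epsilon> \<le> \<epsilon>2" "\<epsilon> \<le> 1 / c" "\<epsilon> \<le> 1" using \<epsilon>1 \<epsilon>2 c by (auto simp: \<epsilon>_def)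
  define A where "A = c / (2 * (1 + C)\<^sup>2)"
  have A: "0 < A" using c C by (simp add: A_def)
  have Re_pos: "0 \<le> Re (1 / (1 - of_real r * step_char \<rho> t))" if "0 < r" "r < 1" for r t
  proof -
    have "Re (of_real r * step_char \<rho> t) \<le> norm (of_real r * step_char \<rho> t)" by (rule complex_Re_le_cmod)
    also have "\<dots> \<le> 1"
      using that norm_step_char_le_1[where \<rho>=\<rho> and t=t] by (simp add: norm_mult mult_le_one)
    finally show ?thesis by (simp add: Re_divide del: times_complex.simps)
  qed
  have Re_big: "A / t \<le> Re (1 / (1 - of_real r * step_char \<rho> t))"
    if t: "0 < t" "t < \<epsilon>" "1 - r \<le> t" and r: "0 < r" "r < 1" for r t
  proof -
    let ?z = "1 - of_real r * step_char \<rho> t"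
    have "norm (step_char \<rho> t) \<le> exp (- (c * t))"
      using decay[of t] t \<epsilon> assms by simp
    also have "\<dots> \<le> 1 - c * t / 2"
    proof -
      have ct: "0 \<le> c * t" "c * t \<le> 1" using t \<epsilon> c mult_left_mono[of t "1 / c" c] by auto
      have "exp (- (c * t)) = inverse (exp (c * t))" by (rule exp_minus)
      also have "\<dots> \<le> inverse (1 + c * t)"
        using ct exp_ge_add_one_self[of "c * t"] by (intro le_imp_inverse_le) auto
      also have "\<dots> \<le> 1 - c * t / 2"
      proof -
        have "c * t * (c * t) \<le> c * t * 1" using ct by (intro mult_left_mono) auto
        then have "1 \<le> (1 - c * t / 2) * (1 + c * t)" by (simp add: algebra_simps)
        then show ?thesis using ct by (simp add: field_simps)
      qed
      finally show ?thesis .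
    qed
    finally have \<phi>: "norm (step_char \<rho> t) \<le> 1 - c * t / 2" .
    have "r * norm (step_char \<rho> t) \<le> norm (step_char \<rho> t)"
      using r by (simp add: mult_left_le_one_le)
    moreover have "Re (of_real r * step_char \<rho> t) \<le> r * norm (step_char \<rho> t)"
      using complex_Re_le_cmod[of "of_real r * step_char \<rho> t"] r by (simp add: norm_mult)
    ultimately have Re: "c * t / 2 \<le> Re ?z" using \<phi> by simp
    have "?z = of_real (1 - r) + of_real r * (1 - step_char \<rho> t)" by (simp add: algebra_simps)
    then have "norm ?z \<le> norm (of_real (1 - r) :: complex) + norm (of_real r * (1 - step_char \<rho> t))"
      by (metis norm_triangle_ineq)
    also have "\<dots> = (1 - r) + r * norm (1 - step_char \<rho> t)"
      using r by (simp add: norm_mult del: of_real_diff)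
    also have "\<dots> \<le> t + 1 * norm (1 - step_char \<rho> t)"
      using r t by (intro add_mono mult_right_mono) auto
    also have "\<dots> \<le> (1 + C) * t"
      using lip[of t] t \<epsilon> by (simp add: algebra_simps)
    finally have z: "norm ?z \<le> (1 + C) * t" .
    have z0: "0 < norm ?z" using Re t c abs_Re_le_cmod[of ?z] by (smt (verit) divide_pos_pos mult_pos_pos)
    have "A / t = (c * t / 2) / ((1 + C) * t)\<^sup>2"
      using t C by (simp add: A_def power2_eq_square)
    also have "\<dots> \<le> Re ?z / (norm ?z)\<^sup>2"
    proof (intro frac_le power_mono Re z)
      have "0 \<le> c * t / 2" using t c by simp
      then show "0 \<le> Re ?z" using Re by (rule order_trans)
      show "0 < (norm ?z)\<^sup>2" using z0 by (rule zero_less_power)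
    qed simp
    also have "\<dots> = Re (1 / ?z)"
      by (simp add: Re_divide cmod_power2)
    finally show ?thesis .
  qed
  have bound: "A * real m / (4 * pi) \<le> H" if H: "\<And>n. green \<rho> n \<le> H" for m H
  proof -
    \<comment> \<open>\<open>K\<close> fixes the resolution \<open>1 - r = 2 \<pi> / K\<close>; the modulus \<open>N = J K\<close> below tends to infinity with \<open>J\<close>,
      which turns divisibility by \<open>N\<close> into a return to the origin.  The frequencies \<open>2 \<pi> j / N\<close> with
      \<open>J \<le> j \<le> 2\<^sup>m J\<close> then lie between \<open>1 - r\<close> and \<open>\<epsilon>\<close> and contribute about \<open>m\<close>.\<close>
    obtain K :: nat where K: "2 ^ m * (2 * pi) / \<epsilon> < real K"
      using reals_Archimedean2 by blast
    have K1: "2 ^ m * (2 * pi) < \<epsilon> * real K" using K \<epsilon> by (simp add: field_simps)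
    have m1: "(1::real) \<le> 2 ^ m" by simp
    have "2 * pi \<le> 2 ^ m * (2 * pi)" using mult_right_mono[OF m1, of "2 * pi"] by simp
    moreover have leK: "\<epsilon> * real K \<le> 1 * real K" using \<epsilon> by (intro mult_right_mono) auto
    ultimately have K2: "2 * pi < real K" using K1 by linarith
    then have K0: "0 < real K" "0 < K" using pi_gt_zero by (auto intro: less_trans gr0I)
    define r where "r = 1 - 2 * pi / real K"
    have r: "0 < r" "r < 1" using K2 K0 by (auto simp: r_def)
    have Kpow: "2 ^ m < K"
    proof -
      have "(2::real) ^ m * 1 \<le> 2 ^ m * (2 * pi)" using pi_gt3 by (intro mult_left_mono) auto
      also have "\<dots> < real K" using K1 leK by linarith
      finally have "real (2 ^ m) < real K" by simp
      then show ?thesis by (simp only: of_nat_less_iff)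
    qed
    have fin: "A * real m / (4 * pi) - r ^ n1 / (1 - r) \<le> H" for n1
    proof -
      have J: "A * real m / (4 * pi) - r ^ n1 / (1 - r)
          \<le> (\<Sum>n<n1. r ^ n * measure (position_pmf \<rho> n) {z. int (Suc J0 * K) dvd z})" for J0
      proof -
        define J where "J = Suc J0"
        define N where "N = J * K"
        have N0: "0 < N" using K0 by (simp add: N_def J_def)
        define \<theta> where "\<theta> j = 2 * pi * real j / real N" for j
        define w where "w j = of_real r * step_char \<rho> (\<theta> j)" for j
        have nw: "norm (w j) \<le> r" for j
          using norm_step_char_le_1[where \<rho>=\<rho> and t="\<theta> j"] r by (simp add: w_def norm_mult mult_left_le)
        have w1: "w j \<noteq> 1" for j using nw[of j] r by auto
        have geo: "(\<Sum>n<n1. w j ^ n) = (1 - w j ^ n1) * (1 / (1 - w j))" for j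
          using one_diff_power_eq[of "w j" n1] w1[of j] by simp
        have tail: "norm (w j ^ n1 * (1 / (1 - w j))) \<le> r ^ n1 / (1 - r)" for j
        proof -
          have "1 - r \<le> norm (1 - w j)"
            using norm_triangle_ineq2[of 1 "w j"] nw[of j] by simp
          moreover have "norm (w j) ^ n1 \<le> r ^ n1" using nw by (intro power_mono) auto
          ultimately show ?thesis using r by (simp add: norm_mult norm_power norm_divide) (intro frac_le, auto)
        qed
        have "(\<Sum>n<n1. r ^ n * measure (position_pmf \<rho> n) {z. int N dvd z})
           = (\<Sum>n<n1. Re (\<Sum>j<N. w j ^ n)) / real N"
          unfolding divisibility_prob[OF N0] w_def \<theta>_def
          by (simp add: sum_divide_distrib power_mult_distrib sum_distrib_left flip: of_real_power)
        also have "(\<Sum>n<n1. Re (\<Sum>j<N. w j ^ n)) = (\<Sum>j<N. Re (\<Sum>n<n1. w j ^ n))"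
          by (simp add: sum.swap[of _ "{..<N}"])
        finally have eq: "(\<Sum>n<n1. r ^ n * measure (position_pmf \<rho> n) {z. int N dvd z})
           = (\<Sum>j<N. Re (\<Sum>n<n1. w j ^ n)) / real N" .
        have low: "Re (1 / (1 - w j)) - r ^ n1 / (1 - r) \<le> Re (\<Sum>n<n1. w j ^ n)" for j
          using tail[of j] complex_Re_le_cmod[of "w j ^ n1 * (1 / (1 - w j))"]
          unfolding geo left_diff_distrib by simp
        have "real N * (A * real m / (4 * pi)) \<le> (\<Sum>j=J..2 ^ m * J. A * real N / (2 * pi) * (1 / real j))"
          using mult_left_mono[OF harmonic_block[of J m], of "A * real N / (2 * pi)"] A
          by (simp add: J_def sum_distrib_left field_simps)
        also have "\<dots> \<le> (\<Sum>j=J..2 ^ m * J. Re (1 / (1 - w j)))"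
        proof (intro sum_mono)
          fix j assume j: "j \<in> {J..2 ^ m * J}"
          have J0: "0 < real J" by (simp add: J_def)
          have jr: "real J \<le> real j" "real j \<le> 2 ^ m * real J"
          proof -
            have "real j \<le> real (2 ^ m * J)" using j by (simp only: of_nat_le_iff atLeastAtMost_iff)
            then show "real j \<le> 2 ^ m * real J" by simp
          qed (use j in simp)
          have "1 - r \<le> \<theta> j"
            using jr(1) J0 K0 by (simp add: r_def \<theta>_def N_def field_simps)
          moreover have "\<theta> j < \<epsilon>"
          proof -
            have "2 * pi * real j \<le> (2 ^ m * (2 * pi)) * real J"
              using mult_left_mono[OF jr(2), of "2 * pi"] by (simp add: mult_ac)
            also have "\<dots> < \<epsilon> * real K * real J" using K1 J0 by (intro mult_strict_right_mono) auto
            finally show ?thesis using J0 K0 by (simp add: \<theta>_def N_def field_simps)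
          qed
          ultimately have "A / \<theta> j \<le> Re (1 / (1 - w j))"
            unfolding w_def using r by (intro Re_big) (auto simp: r_def)
          then show "A * real N / (2 * pi) * (1 / real j) \<le> Re (1 / (1 - w j))"
            by (simp add: \<theta>_def mult_ac)
        qed
        also have "\<dots> \<le> (\<Sum>j<N. Re (1 / (1 - w j)))"
        proof (intro sum_mono2)
          have "2 ^ m * J < K * J" using Kpow by (intro mult_strict_right_mono) (auto simp: J_def)
          then have "2 ^ m * J < N" by (simp only: N_def mult.commute)
          then show "{J..2 ^ m * J} \<subseteq> {..<N}" using le_less_trans by auto
          show "0 \<le> Re (1 / (1 - w b))" for b
            unfolding w_def using r by (rule Re_pos)
        qed simp
        finally have "real N * (A * real m / (4 * pi)) - real N * (r ^ n1 / (1 - r)) \<le> (\<Sum>j<N. Re (1 / (1 - w j)) - r ^ n1 / (1 - r))"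
          by (simp add: sum_subtractf)
        also have "\<dots> \<le> (\<Sum>j<N. Re (\<Sum>n<n1. w j ^ n))"
          by (intro sum_mono low)
        finally have "real N * (A * real m / (4 * pi) - r ^ n1 / (1 - r)) \<le> (\<Sum>j<N. Re (\<Sum>n<n1. w j ^ n))"
          by (simp only: right_diff_distrib)
        then have "A * real m / (4 * pi) - r ^ n1 / (1 - r) \<le> (\<Sum>j<N. Re (\<Sum>n<n1. w j ^ n)) / real N"
          using N0 by (subst pos_le_divide_eq) (simp_all only: mult.commute of_nat_0_less_iff)
        then show ?thesis unfolding eq[symmetric] by (simp add: N_def J_def)
      qed
      have "(\<lambda>J0. \<Sum>n<n1. r ^ n * measure (position_pmf \<rho> n) {z. int (Suc J0 * K) dvd z})
          \<longlonglongrightarrow> (\<Sum>n<n1. r ^ n * pmf (position_pmf \<rho> n) 0)"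
        by (intro tendsto_intros divisibility_prob_tendsto K0)
      then have "A * real m / (4 * pi) - r ^ n1 / (1 - r) \<le> (\<Sum>n<n1. r ^ n * pmf (position_pmf \<rho> n) 0)"
        using J by (intro LIMSEQ_le_const) auto
      also have "\<dots> \<le> (\<Sum>n<n1. 1 * pmf (position_pmf \<rho> n) 0)"
        using r by (intro sum_mono mult_right_mono power_le_one) auto
      also have "\<dots> \<le> green \<rho> n1"
        unfolding green_def by (simp, intro sum_mono2) auto
      finally show ?thesis using H[of n1] by simp
    qed
    have "(\<lambda>n1. A * real m / (4 * pi) - r ^ n1 / (1 - r)) \<longlonglongrightarrow> A * real m / (4 * pi) - 0 / (1 - r)"
      using r by (intro tendsto_intros LIMSEQ_realpow_zero) auto
    then show ?thesis using fin by (intro LIMSEQ_le_const2) auto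
  qed
  have "\<exists>n. Z < green \<rho> n" for Z
  proof (rule ccontr)
    assume "\<not> ?thesis"
    then have H: "\<And>n. green \<rho> n \<le> Z" by (simp add: not_less)
    obtain m :: nat where "Z * (4 * pi) / A < real m" using reals_Archimedean2 by blast
    then have "Z < A * real m / (4 * pi)" using A by (simp add: field_simps)
    with bound[OF H, of m] show False by simp
  qed
  then show ?thesis
    unfolding filterlim_at_top_dense eventually_sequentially
    by (meson green_mono less_le_trans)
qed

section \<open>Asymptotics of the range\<close>

lemma cesaro_null:
  fixes a :: "nat \<Rightarrow> real"
  assumes a: "a \<longlonglongrightarrow> 0"
  shows "(\<lambda>N. (\<Sum>r=1..N. a r) / real N) \<longlonglongrightarrow> 0"
proof (rule LIMSEQ_I)
  fix e :: real assume e: "0 < e"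
  from LIMSEQ_D[OF a, of "e / 2"] e obtain r0 where r0: "\<And>r. r0 \<le> r \<Longrightarrow> \<bar>a r\<bar> < e / 2" by auto
  define S where "S = (\<Sum>r=1..r0. \<bar>a r\<bar>)"
  obtain N0 :: nat where N0: "2 * S / e < real N0" using reals_Archimedean2 by blast
  have "\<bar>(\<Sum>r=1..N. a r) / real N\<bar> < e" if N: "max (Suc r0) (Suc N0) \<le> N" for N
  proof -
    have "\<bar>\<Sum>r=1..N. a r\<bar> \<le> (\<Sum>r=1..N. \<bar>a r\<bar>)" by (rule sum_abs)
    also have "\<dots> \<le> (\<Sum>r=1..N. (if r \<le> r0 then \<bar>a r\<bar> else 0) + e / 2)"
      using r0 e by (intro sum_mono) (auto simp: less_imp_le)
    also have "\<dots> = (\<Sum>r\<in>{1..N} \<inter> {r. r \<le> r0}. \<bar>a r\<bar>) + real N * (e / 2)"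
      by (simp add: sum.distrib sum.If_cases)
    also have "{1..N} \<inter> {r. r \<le> r0} = {1..r0}" using N by auto
    finally have "\<bar>\<Sum>r=1..N. a r\<bar> \<le> S + real N * (e / 2)" by (simp add: S_def)
    moreover have "S < real N * (e / 2)"
    proof -
      have "2 * S / e < real N" using N0 N by linarith
      then show ?thesis using e by (simp add: field_simps)
    qed
    ultimately have "\<bar>\<Sum>r=1..N. a r\<bar> < real N * e" by (simp add: field_simps)
    then show ?thesis using N by (simp add: field_simps)
  qed
  then show "\<exists>no. \<forall>n\<ge>no. norm ((\<Sum>r=1..n. a r) / real n - 0) < e" by auto
qed

text \<open>
  The bounds have an error \<open>c / J\<close> with a parameter \<open>J\<close> that is sent to infinity after \<open>n\<close>.
\<close>

lemma tendsto_sandwich_parametric: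
  fixes f :: "nat \<Rightarrow> real"
  assumes lo: "\<And>J::nat. 1 \<le> J \<Longrightarrow> \<exists>l. (l \<longlonglongrightarrow> L - c / real J) \<and> (\<forall>\<^sub>F n in sequentially. l n \<le> f n)"
    and up: "\<And>J::nat. 1 \<le> J \<Longrightarrow> \<exists>u. (u \<longlonglongrightarrow> L + c / real J) \<and> (\<forall>\<^sub>F n in sequentially. f n \<le> u n)"
  shows "f \<longlonglongrightarrow> L"
proof (rule order_tendstoI)
  fix b assume b: "b < L"
  obtain J0 :: nat where J0: "c / (L - b) < real J0" using reals_Archimedean2 by blast
  define J where "J = Suc J0"
  have "c / (L - b) < real J" using J0 by (simp add: J_def)
  then have "c / real J < L - b" using b by (simp add: J_def field_simps)
  then have "b < L - c / real J" by simp
  moreover obtain l where "l \<longlonglongrightarrow> L - c / real J" "\<forall>\<^sub>F n in sequentially. l n \<le> f n"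
    using lo[of J] by (auto simp: J_def)
  ultimately have "\<forall>\<^sub>F n in sequentially. b < l n" "\<forall>\<^sub>F n in sequentially. l n \<le> f n"
    by (auto dest: order_tendstoD)
  then show "\<forall>\<^sub>F n in sequentially. b < f n" by eventually_elim simp
next
  fix b assume b: "L < b"
  obtain J0 :: nat where J0: "c / (b - L) < real J0" using reals_Archimedean2 by blast
  define J where "J = Suc J0"
  have "c / (b - L) < real J" using J0 by (simp add: J_def)
  then have "c / real J < b - L" using b by (simp add: J_def field_simps)
  then have "L + c / real J < b" by simp
  moreover obtain u where "u \<longlonglongrightarrow> L + c / real J" "\<forall>\<^sub>F n in sequentially. f n \<le> u n"
    using up[of J] by (auto simp: J_def)
  ultimately have "\<forall>\<^sub>F n in sequentially. u n < b" "\<forall>\<^sub>F n in sequentially. f n \<le> u n"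
    by (auto dest: order_tendstoD)
  then show "\<forall>\<^sub>F n in sequentially. f n < b" by eventually_elim simp
qed

lemma linear_growth_at_top:
  assumes l: "(\<lambda>n. real (l n) / real n) \<longlonglongrightarrow> \<kappa>" "0 < \<kappa>"
  shows "filterlim l at_top sequentially"
proof -
  have "filterlim (\<lambda>n. (real (l n) / real n) * real n) at_top sequentially"
    by (rule filterlim_tendsto_pos_mult_at_top[OF l filterlim_real_sequentially])
  moreover have "\<forall>\<^sub>F n in sequentially. real (l n) / real n * real n = real (l n)"
    using eventually_gt_at_top[of 0] by eventually_elim simp
  ultimately have "filterlim (\<lambda>n. real (l n)) at_top sequentially"
    by (simp cong: filterlim_cong)
  then show ?thesis by (simp add: filterlim_sequentially_iff_filterlim_real)
qed

lemma floor_ratio_tendsto_1: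
  assumes "filterlim x at_top sequentially"
  shows "(\<lambda>n. real (nat \<lfloor>x n\<rfloor>) / x n) \<longlonglongrightarrow> 1"
proof (rule tendsto_sandwich[of "\<lambda>n. 1 - 1 / x n" _ _ "\<lambda>_. 1"])
  have pos: "\<forall>\<^sub>F n in sequentially. 0 < x n"
    using assms by (simp add: filterlim_at_top_dense)
  have fl: "real (nat \<lfloor>y\<rfloor>) \<le> y" "y - 1 \<le> real (nat \<lfloor>y\<rfloor>)" if "0 < y" for y
    using that by (auto simp: of_nat_nat)
  show "\<forall>\<^sub>F n in sequentially. 1 - 1 / x n \<le> real (nat \<lfloor>x n\<rfloor>) / x n"
    using pos
  proof eventually_elim
    case (elim n)
    then have "1 - 1 / x n = (x n - 1) / x n" by (simp add: field_simps)
    also have "\<dots> \<le> real (nat \<lfloor>x n\<rfloor>) / x n" using fl(2)[OF elim] elim by (intro divide_right_mono) auto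
    finally show ?case .
  qed
  show "\<forall>\<^sub>F n in sequentially. real (nat \<lfloor>x n\<rfloor>) / x n \<le> 1"
    using pos
  proof eventually_elim
    case (elim n)
    have "real (nat \<lfloor>x n\<rfloor>) / x n \<le> x n / x n" using fl(1)[OF elim] elim by (intro divide_right_mono) auto
    then show ?case using elim by simp
  qed
  have "(\<lambda>n. 1 / x n) \<longlonglongrightarrow> 0"
    using tendsto_inverse_0_at_top[OF assms] by (simp add: inverse_eq_divide)
  from tendsto_diff[OF tendsto_const[of 1] this] show "(\<lambda>n. 1 - 1 / x n) \<longlonglongrightarrow> 1" by simp
qed simp

lemma range_second_moment_le:
  assumes "1 \<le> k" "n \<le> J * k"
  shows "range_second_moment \<rho> n \<le> (3 * real J + (real J)\<^sup>2) * (mean_range \<rho> k)\<^sup>2"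
proof -
  have "mean_range \<rho> 1 \<le> mean_range \<rho> k" using assms by (intro mean_range_mono)
  then have Q1: "1 \<le> mean_range \<rho> k" by (simp add: mean_range_def)
  then have "mean_range \<rho> k * 1 \<le> mean_range \<rho> k * mean_range \<rho> k" by (intro mult_left_mono) auto
  then have M: "range_second_moment \<rho> k \<le> 3 * (mean_range \<rho> k)\<^sup>2"
    using range_second_moment_crude[of \<rho> k] by (simp add: power2_eq_square)
  have "range_second_moment \<rho> n \<le> real J * range_second_moment \<rho> k + (real J * mean_range \<rho> k)\<^sup>2"
    using range_second_moment_mono[OF assms(2)] range_second_moment_mult_le by (rule order_trans)
  also have "\<dots> \<le> real J * (3 * (mean_range \<rho> k)\<^sup>2) + (real J * mean_range \<rho> k)\<^sup>2"
    using M by (intro add_right_mono mult_left_mono) auto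
  finally show ?thesis by (simp add: power_mult_distrib algebra_simps)
qed

context stable_walk
begin

abbreviation "h \<equiv> green \<rho>"
abbreviation "q \<equiv> no_return_prob \<rho>"
abbreviation "Q \<equiv> mean_range \<rho>"

lemma h_pos: "0 < h n" using green_ge_1[of \<rho> n] by simp

lemma return_bound:
  obtains C where "0 < C" "\<And>k. 1 \<le> k \<Longrightarrow> pmf (position_pmf \<rho> k) 0 \<le> C / real k"
proof -
  obtain C where C: "0 < C" "\<And>n z. 1 \<le> n \<Longrightarrow> pmf (position_pmf \<rho> n) z \<le> C * real n powr (- (1 / \<alpha>))"
    using local_bound by blast
  show ?thesis
  proof (rule that[OF C(1)])
    fix k :: nat assume k: "1 \<le> k"
    have "real k powr (- (1 / \<alpha>)) \<le> real k powr (- 1)"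
      using k index by (intro powr_mono) auto
    then have "C * real k powr (- (1 / \<alpha>)) \<le> C * (1 / real k)"
      using C k by (intro mult_left_mono) (auto simp: powr_minus_divide)
    then show "pmf (position_pmf \<rho> k) 0 \<le> C / real k"
      using C(2)[OF k, of 0] by simp
  qed
qed

text \<open>
  The local bound is summable for \<open>\<alpha> < 1\<close>.
\<close>

lemma green_bounded_or_unbounded:
  "(\<alpha> < 1 \<and> (\<exists>H\<ge>1. h \<longlonglongrightarrow> H)) \<or> (\<alpha> = 1 \<and> filterlim h at_top sequentially)"
proof (cases "\<alpha> = 1")
  case True
  then show ?thesis using green_unbounded by simp
next
  case False
  then have \<alpha>: "\<alpha> < 1" using index by simp
  obtain C where C: "0 < C" "\<And>n z. 1 \<le> n \<Longrightarrow> pmf (position_pmf \<rho> n) z \<le> C * real n powr (- (1 / \<alpha>))"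
    using local_bound by blast
  have "summable (\<lambda>k. pmf (position_pmf \<rho> k) 0)"
  proof (rule summable_comparison_test)
    show "summable (\<lambda>k. C * real k powr (- (1 / \<alpha>)))"
      using \<alpha> index by (intro summable_mult) (simp add: summable_real_powr_iff)
    show "\<exists>N. \<forall>n\<ge>N. norm (pmf (position_pmf \<rho> n) 0) \<le> C * real n powr (- (1 / \<alpha>))"
      using C(2) by (intro exI[of _ 1]) auto
  qed
  then have "h \<longlonglongrightarrow> (\<Sum>k. pmf (position_pmf \<rho> k) 0)"
    unfolding green_def by (rule summable_LIMSEQ')
  moreover from this have "1 \<le> (\<Sum>k. pmf (position_pmf \<rho> k) 0)"
    by (rule LIMSEQ_le_const) (auto intro: green_ge_1)
  ultimately show ?thesis using \<alpha> by blast
qed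

lemma green_diff_le:
  assumes C: "0 < C" "\<And>k. 1 \<le> k \<Longrightarrow> pmf (position_pmf \<rho> k) 0 \<le> C / real k" and a: "1 \<le> a" "a \<le> b"
  shows "h b - h a \<le> real (b - a) * (C / real a)"
proof -
  have "{..b} = {..a} \<union> {a<..b}" using a by auto
  then have "h b - h a = (\<Sum>k\<in>{a<..b}. pmf (position_pmf \<rho> k) 0)"
    unfolding green_def by (simp only:) (subst sum.union_disjoint, auto)
  also have "\<dots> \<le> (\<Sum>k\<in>{a<..b}. C / real a)"
  proof (rule sum_mono)
    fix k assume k: "k \<in> {a<..b}"
    then have "pmf (position_pmf \<rho> k) 0 \<le> C / real k" using a by (intro C) auto
    also have "\<dots> \<le> C / real a" using k a C by (intro divide_left_mono) auto
    finally show "pmf (position_pmf \<rho> k) 0 \<le> C / real a" .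
  qed
  finally show ?thesis by simp
qed

text \<open>The truncated Green function varies slowly, because \<open>h (J n) - h n\<close> stays bounded.\<close>

lemma green_slowly_varying: assumes J: "1 \<le> J" shows "(\<lambda>n. h (J * n) / h n) \<longlonglongrightarrow> 1"
  using green_bounded_or_unbounded
proof (elim disjE conjE exE)
  fix H assume H: "1 \<le> H" "h \<longlonglongrightarrow> H"
  have "filterlim (\<lambda>n. J * n) at_top sequentially"
    using J by (intro filterlim_at_top_mono[OF filterlim_ident]) auto
  then have "(\<lambda>n. h (J * n)) \<longlonglongrightarrow> H" using H(2) by (rule filterlim_compose[rotated])
  then have "(\<lambda>n. h (J * n) / h n) \<longlonglongrightarrow> H / H" using H by (intro tendsto_intros) auto
  then show ?thesis using H by simp
next
  assume inf: "filterlim h at_top sequentially"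
  obtain C where C: "0 < C" "\<And>k. 1 \<le> k \<Longrightarrow> pmf (position_pmf \<rho> k) 0 \<le> C / real k"
    using return_bound by blast
  show ?thesis
  proof (rule tendsto_sandwich[of "\<lambda>_. 1" _ _ "\<lambda>n. 1 + real J * C / h n"])
    show "\<forall>\<^sub>F n in sequentially. 1 \<le> h (J * n) / h n"
      using J h_pos by (intro always_eventually allI) (simp add: green_mono)
    show "\<forall>\<^sub>F n in sequentially. h (J * n) / h n \<le> 1 + real J * C / h n"
      using eventually_ge_at_top[of 1]
    proof eventually_elim
      case (elim n)
      have "h (J * n) - h n \<le> real (J * n - n) * (C / real n)"
        using J elim by (intro green_diff_le C) auto
      also have "\<dots> \<le> real (J * n) * (C / real n)"
        using C by (intro mult_right_mono of_nat_mono) auto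
      also have "\<dots> = real J * C" using elim by simp
      finally show ?case using h_pos[of n] by (simp add: field_simps)
    qed
    have "(\<lambda>n. real J * C / h n) \<longlonglongrightarrow> 0"
      using tendsto_mult[OF tendsto_const tendsto_inverse_0_at_top[OF inf], of "real J * C"] by (simp add: divide_inverse)
    from tendsto_add[OF tendsto_const[of 1] this] show "(\<lambda>n. 1 + real J * C / h n) \<longlonglongrightarrow> 1" by simp
  qed simp
qed

text \<open>
  Slow variation along integer multiples extends to all linear rescalings by monotonicity.
\<close>

lemma green_ratio:
  assumes l: "(\<lambda>n. real (l n) / real n) \<longlonglongrightarrow> \<kappa>" "0 < \<kappa>"
  shows "(\<lambda>n. h (l n) / h n) \<longlonglongrightarrow> 1"
proof -
  obtain J :: nat where J: "max \<kappa> (1 / \<kappa>) < real J" using reals_Archimedean2 by blast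
  have J0: "0 < real J" using J l by auto
  then have J1: "1 \<le> J" by linarith
  have "1 / real J < \<kappa>" using J l J0 by (simp add: field_simps)
  then have ev1: "\<forall>\<^sub>F n in sequentially. 1 / real J < real (l n) / real n"
    using l by (auto dest: order_tendstoD)
  have ev2: "\<forall>\<^sub>F n in sequentially. real (l n) / real n < real J"
    using l J by (auto dest: order_tendstoD)
  have l_inf: "filterlim l at_top sequentially" by (rule linear_growth_at_top[OF l])
  show ?thesis
  proof (rule tendsto_sandwich[of "\<lambda>n. h (l n) / h (J * l n)" _ _ "\<lambda>n. h (J * n) / h n"])
    show "(\<lambda>n. h (J * n) / h n) \<longlonglongrightarrow> 1" by (rule green_slowly_varying[OF J1])
    have "(\<lambda>n. inverse (h (J * l n) / h (l n))) \<longlonglongrightarrow> inverse 1"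
      by (intro tendsto_inverse filterlim_compose[OF green_slowly_varying[OF J1] l_inf]) simp
    then show "(\<lambda>n. h (l n) / h (J * l n)) \<longlonglongrightarrow> 1" by simp
    show "\<forall>\<^sub>F n in sequentially. h (l n) / h n \<le> h (J * n) / h n"
      using ev2 eventually_gt_at_top[of 0]
    proof eventually_elim
      case (elim n)
      then have "real (l n) \<le> real (J * n)" by (simp add: field_simps)
      then have "l n \<le> J * n" by (simp only: of_nat_le_iff)
      then show ?case using h_pos[of n] by (intro divide_right_mono green_mono) auto
    qed
    show "\<forall>\<^sub>F n in sequentially. h (l n) / h (J * l n) \<le> h (l n) / h n"
      using ev1 eventually_gt_at_top[of 0]
    proof eventually_elim
      case (elim n)
      then have "real n \<le> real (J * l n)" using J0 by (simp add: field_simps)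
      then have "n \<le> J * l n" by (simp only: of_nat_le_iff)
      then show ?case using h_pos by (intro divide_left_mono green_mono) (auto simp: less_imp_le)
    qed
  qed
qed

text \<open>
  In the renewal equation for length \<open>n\<close> all no-return probabilities are at least \<open>q n\<close>, which gives
  \<open>q n \<cdot> h n \<le> 1\<close>.  In the one for length \<open>(J + 1) n\<close> the terms with \<open>k \<le> J n\<close> are at most \<open>q n\<close> times the Green
  function, and the others contribute at most \<open>C / J\<close>.
\<close>

lemma no_return_times_green: "(\<lambda>n. q n * h n) \<longlonglongrightarrow> 1"
proof -
  obtain C where C: "0 < C" "\<And>k. 1 \<le> k \<Longrightarrow> pmf (position_pmf \<rho> k) 0 \<le> C / real k"
    using return_bound by blast
  show ?thesis
  proof (rule tendsto_sandwich_parametric[where c=C])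
    fix J :: nat assume J: "1 \<le> J"
    have "(\<lambda>n. inverse (h (Suc J * n) / h n) * (1 - C / real J)) \<longlonglongrightarrow> inverse 1 * (1 - C / real J)"
      using J by (intro tendsto_intros green_slowly_varying) auto
    moreover have "\<forall>\<^sub>F n in sequentially. inverse (h (Suc J * n) / h n) * (1 - C / real J) \<le> q n * h n"
      using eventually_ge_at_top[of 1]
    proof eventually_elim
      case (elim n)
      define N where "N = Suc J * n"
      let ?g = "\<lambda>k. pmf (position_pmf \<rho> k) 0"
      have split: "{..N} = {..J * n} \<union> {J * n<..N}" by (auto simp: N_def)
      have "1 = (\<Sum>k\<le>N. ?g k * q (N - k))" by (rule renewal_equation[symmetric])
      also have "\<dots> = (\<Sum>k\<le>J * n. ?g k * q (N - k)) + (\<Sum>k\<in>{J * n<..N}. ?g k * q (N - k))"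
        unfolding split by (rule sum.union_disjoint) auto
      also have "\<dots> \<le> (\<Sum>k\<le>J * n. ?g k * q n) + (\<Sum>k\<in>{J * n<..N}. ?g k * 1)"
        by (intro add_mono sum_mono mult_left_mono no_return_prob_antimono no_return_prob_le_1) (auto simp: N_def)
      also have "(\<Sum>k\<in>{J * n<..N}. ?g k * 1) = h N - h (J * n)"
        unfolding green_def split by (subst sum.union_disjoint) auto
      also have "(\<Sum>k\<le>J * n. ?g k * q n) = h (J * n) * q n"
        by (simp add: green_def sum_distrib_right)
      also have "h (J * n) * q n \<le> h N * q n"
        by (intro mult_right_mono green_mono no_return_prob_nonneg) (simp add: N_def)
      also have "h N - h (J * n) \<le> real (N - J * n) * (C / real (J * n))"
        using J elim by (intro green_diff_le C) (auto simp: N_def Suc_le_eq)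
      also have "\<dots> = C / real J" using elim J by (simp add: N_def)
      finally have "1 - C / real J \<le> h N * q n" by simp
      then have "(1 - C / real J) * (h n / h N) \<le> (h N * q n) * (h n / h N)"
        using h_pos[of n] h_pos[of N] by (intro mult_right_mono) auto
      then show ?case
        unfolding N_def[symmetric] using h_pos[of N] by (simp add: mult_ac)
    qed
    ultimately show "\<exists>l. (l \<longlonglongrightarrow> 1 - C / real J) \<and> (\<forall>\<^sub>F n in sequentially. l n \<le> q n * h n)"
      by auto
    have "q n * h n \<le> 1" for n
    proof -
      have "h n * q n = (\<Sum>k\<le>n. pmf (position_pmf \<rho> k) 0 * q n)" by (simp add: green_def sum_distrib_right)
      also have "\<dots> \<le> (\<Sum>k\<le>n. pmf (position_pmf \<rho> k) 0 * q (n - k))"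
        by (intro sum_mono mult_left_mono no_return_prob_antimono) auto
      finally show ?thesis by (simp add: renewal_equation mult.commute)
    qed
    then have "\<forall>\<^sub>F n in sequentially. q n * h n \<le> 1 + C / real J"
      using C by (intro always_eventually allI) (smt (verit) divide_nonneg_nonneg of_nat_0_le_iff)
    then show "\<exists>u. (u \<longlonglongrightarrow> 1 + C / real J) \<and> (\<forall>\<^sub>F n in sequentially. q n * h n \<le> u n)"
      by (intro exI[of _ "\<lambda>_. 1 + C / real J"]) auto
  qed
qed

lemma div_ratio: "1 \<le> J \<Longrightarrow> (\<lambda>n. real (n div J) / real n) \<longlonglongrightarrow> 1 / real J"
proof (rule tendsto_sandwich[of "\<lambda>n. 1 / real J - 1 / real n" _ _ "\<lambda>_. 1 / real J"])
  assume J: "1 \<le> J"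
  have lo: "real n \<le> real J * (real (n div J) + 1)" for n
  proof -
    have "n \<le> J * (n div J + 1)"
      using J dividend_less_times_div[of J n] by simp
    then have "real n \<le> real (J * (n div J + 1))" by (simp only: of_nat_le_iff)
    then show ?thesis by (simp add: distrib_left)
  qed
  show "\<forall>\<^sub>F n in sequentially. 1 / real J - 1 / real n \<le> real (n div J) / real n"
    using eventually_gt_at_top[of 0]
  proof eventually_elim
    case (elim n)
    have "1 / real J - 1 / real n = (real n - real J) / (real J * real n)" using J elim by (simp add: field_simps)
    also have "\<dots> \<le> (real J * real (n div J)) / (real J * real n)"
      using lo[of n] by (intro divide_right_mono) (auto simp: distrib_left)
    finally show ?case using J by simp
  qed
  show "\<forall>\<^sub>F n in sequentially. real (n div J) / real n \<le> 1 / real J"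
    using eventually_gt_at_top[of 0]
  proof eventually_elim
    case (elim n)
    have "real (n div J * J) \<le> real n" by (simp only: of_nat_le_iff) simp
    then show ?case using J elim by (simp add: field_simps)
  qed
  show "(\<lambda>n. 1 / real J - 1 / real n) \<longlonglongrightarrow> 1 / real J"
    using tendsto_diff[OF tendsto_const lim_1_over_n, of "1 / real J"] by simp
qed simp

text \<open>
  The lower bound is \<open>mean_range_ge\<close>, the upper one \<open>green_times_mean_range_le\<close> with \<open>m = n div J\<close>.
\<close>

lemma mean_range_asymptotic: "(\<lambda>n. Q n * h n / real n) \<longlonglongrightarrow> 1"
proof (rule tendsto_sandwich_parametric[where c=1])
  fix J :: nat assume J: "1 \<le> J"
  have "(\<lambda>n. q n * h n - 1 / real J) \<longlonglongrightarrow> 1 - 1 / real J"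
    by (intro tendsto_intros no_return_times_green)
  moreover have "\<forall>\<^sub>F n in sequentially. q n * h n - 1 / real J \<le> Q n * h n / real n"
    using eventually_gt_at_top[of 0]
  proof eventually_elim
    case (elim n)
    have "real n * q n * h n \<le> Q n * h n"
      using h_pos[of n] by (intro mult_right_mono mean_range_ge) auto
    then have "q n * h n \<le> Q n * h n / real n" using elim by (simp add: field_simps)
    moreover have "0 \<le> 1 / real J" by simp
    ultimately show ?case by linarith
  qed
  ultimately show "\<exists>l. (l \<longlonglongrightarrow> 1 - 1 / real J) \<and> (\<forall>\<^sub>F n in sequentially. l n \<le> Q n * h n / real n)"
    by blast
  let ?m = "\<lambda>n. n div J"
  have "(\<lambda>n. (1 + real (?m n) / real n) * inverse (h (?m n) / h n)) \<longlonglongrightarrow> (1 + 1 / real J) * inverse 1"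
    using J by (intro tendsto_intros div_ratio green_ratio[where \<kappa>="1 / real J"]) auto
  moreover have "\<forall>\<^sub>F n in sequentially. Q n * h n / real n \<le> (1 + real (?m n) / real n) * inverse (h (?m n) / h n)"
    using eventually_gt_at_top[of 0]
  proof eventually_elim
    case (elim n)
    have "h (?m n) * Q n \<le> real (?m n + n)" by (rule green_times_mean_range_le)
    then have "Q n \<le> real (?m n + n) / h (?m n)" using h_pos[of "?m n"] by (simp add: field_simps)
    then have "Q n * (h n / real n) \<le> real (?m n + n) / h (?m n) * (h n / real n)"
      using h_pos[of n] by (intro mult_right_mono) auto
    also have "\<dots> = (1 + real (?m n) / real n) * inverse (h (?m n) / h n)"
      using elim h_pos[of n] h_pos[of "?m n"] by (simp add: field_simps)
    finally show ?case by simp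
  qed
  ultimately show "\<exists>u. (u \<longlonglongrightarrow> 1 + 1 / real J) \<and> (\<forall>\<^sub>F n in sequentially. Q n * h n / real n \<le> u n)"
    by auto
qed

lemma mean_range_linear:
  assumes l: "(\<lambda>n. real (l n) / real n) \<longlonglongrightarrow> \<kappa>" "0 < \<kappa>"
  shows "(\<lambda>n. Q (l n) * h n / real n) \<longlonglongrightarrow> \<kappa>"
proof -
  have l_inf: "filterlim l at_top sequentially" by (rule linear_growth_at_top[OF l])
  have "(\<lambda>n. (Q (l n) * h (l n) / real (l n)) * (real (l n) / real n) * inverse (h (l n) / h n)) \<longlonglongrightarrow> 1 * \<kappa> * inverse 1"
    by (intro tendsto_intros filterlim_compose[OF mean_range_asymptotic l_inf] l green_ratio[OF l]) simp
  moreover have "\<forall>\<^sub>F n in sequentially. (Q (l n) * h (l n) / real (l n)) * (real (l n) / real n) * inverse (h (l n) / h n) = Q (l n) * h n / real n"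
    using filterlim_at_top[THEN iffD1, rule_format, OF l_inf, of 1]
  proof eventually_elim
    case (elim n)
    then show ?case using h_pos[of n] h_pos[of "l n"] by (simp add: field_simps)
  qed
  ultimately show ?thesis by (simp cong: filterlim_cong)
qed

lemma expectation_square_deviation:
  "steps_expectation \<rho> N (\<lambda>w. (a * real (card (visited 0 w)) - \<kappa>)\<^sup>2)
     = a\<^sup>2 * range_second_moment \<rho> N - 2 * \<kappa> * (a * Q N) + \<kappa>\<^sup>2"
proof -
  let ?R = "\<lambda>w. real (card (visited 0 w))"
  have int: "integrable (measure_pmf (replicate_pmf N \<rho>)) (\<lambda>w. (?R w)\<^sup>2)"
    "integrable (measure_pmf (replicate_pmf N \<rho>)) ?R"
    subgoal by (rule integrable_bounded_pmf[where B="(real N)\<^sup>2"])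
      (unfold real_norm_def, rule range_bound2_abs, auto dest!: length_replicate_pmf)
    subgoal by (rule integrable_bounded_pmf[where B="real N"])
      (auto dest!: length_replicate_pmf intro: card_visited_le_of_length)
    done
  have "(a * ?R w - \<kappa>)\<^sup>2 = a\<^sup>2 * (?R w)\<^sup>2 - 2 * \<kappa> * a * ?R w + \<kappa>\<^sup>2" for w
    by (simp add: power2_eq_square algebra_simps)
  then show ?thesis
    using int by (simp add: range_second_moment_def expectation_card_visited)
qed

text \<open>
  The path is cut into \<open>J\<close> pieces of length at most \<open>k\<close>.  By \<open>range_second_moment_le\<close> the second moment
  exceeds the square of the mean by a relative error of order \<open>1 / J\<close> only.
\<close>

lemma range_mean_square:
  assumes l: "(\<lambda>n. real (l n) / real n) \<longlonglongrightarrow> \<kappa>" "0 < \<kappa>"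
  shows "(\<lambda>n. steps_expectation \<rho> (l n) (\<lambda>w. (h n / real n * real (card (visited 0 w)) - \<kappa>)\<^sup>2)) \<longlonglongrightarrow> 0"
proof (rule tendsto_sandwich_parametric[where c="3 * \<kappa>\<^sup>2"])
  fix J :: nat assume J: "1 \<le> J"
  have l_inf: "filterlim l at_top sequentially" by (rule linear_growth_at_top[OF l])
  let ?a = "\<lambda>n. h n / real n" and ?k = "\<lambda>n. l n div J + 1"
  let ?E = "\<lambda>n. steps_expectation \<rho> (l n) (\<lambda>w. (?a n * real (card (visited 0 w)) - \<kappa>)\<^sup>2)"
  have nn: "0 \<le> ?E n" for n by (intro integral_nonneg_AE) auto
  have "0 - 3 * \<kappa>\<^sup>2 / real J \<le> ?E n" for n
    using nn[of n] by (rule order_trans[rotated]) simp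
  then show "\<exists>f. (f \<longlonglongrightarrow> 0 - 3 * \<kappa>\<^sup>2 / real J) \<and> (\<forall>\<^sub>F n in sequentially. f n \<le> ?E n)"
    by (intro exI[of _ "\<lambda>_. 0 - 3 * \<kappa>\<^sup>2 / real J"] conjI tendsto_const always_eventually allI)
  have "(\<lambda>n. real (l n div J) / real (l n) * (real (l n) / real n) + 1 / real n) \<longlonglongrightarrow> 1 / real J * \<kappa> + 0"
    by (intro tendsto_intros filterlim_compose[OF div_ratio[OF J] l_inf] l lim_1_over_n)
  moreover have "\<forall>\<^sub>F n in sequentially. real (l n div J) / real (l n) * (real (l n) / real n) + 1 / real n = real (?k n) / real n"
    using filterlim_at_top[THEN iffD1, rule_format, OF l_inf, of 1]
  proof eventually_elim
    case (elim n) then show ?case by (simp add: add_divide_distrib)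
  qed
  ultimately have "(\<lambda>n. real (?k n) / real n) \<longlonglongrightarrow> 1 / real J * \<kappa> + 0"
    by (rule Lim_transform_eventually)
  then have k: "(\<lambda>n. real (?k n) / real n) \<longlonglongrightarrow> \<kappa> / real J" by simp
  have "(\<lambda>n. (3 * real J + (real J)\<^sup>2) * (Q (?k n) * h n / real n)\<^sup>2 - 2 * \<kappa> * (Q (l n) * h n / real n) + \<kappa>\<^sup>2)
      \<longlonglongrightarrow> (3 * real J + (real J)\<^sup>2) * (\<kappa> / real J)\<^sup>2 - 2 * \<kappa> * \<kappa> + \<kappa>\<^sup>2"
    using J l(2) by (intro tendsto_intros mean_range_linear k l) auto
  also have "(3 * real J + (real J)\<^sup>2) * (\<kappa> / real J)\<^sup>2 - 2 * \<kappa> * \<kappa> + \<kappa>\<^sup>2 = 0 + 3 * \<kappa>\<^sup>2 / real J"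
    using J by (simp add: power2_eq_square field_simps)
  finally have lim: "(\<lambda>n. (3 * real J + (real J)\<^sup>2) * (Q (?k n) * h n / real n)\<^sup>2 - 2 * \<kappa> * (Q (l n) * h n / real n) + \<kappa>\<^sup>2)
      \<longlonglongrightarrow> 0 + 3 * \<kappa>\<^sup>2 / real J" .
  have "?E n \<le> (3 * real J + (real J)\<^sup>2) * (Q (?k n) * h n / real n)\<^sup>2 - 2 * \<kappa> * (Q (l n) * h n / real n) + \<kappa>\<^sup>2" for n
  proof -
    have "l n \<le> J * ?k n"
      using J dividend_less_times_div[of J "l n"] by simp
    then have "range_second_moment \<rho> (l n) \<le> (3 * real J + (real J)\<^sup>2) * (Q (?k n))\<^sup>2"
      by (intro range_second_moment_le) auto
    then have "(?a n)\<^sup>2 * range_second_moment \<rho> (l n) \<le> (?a n)\<^sup>2 * ((3 * real J + (real J)\<^sup>2) * (Q (?k n))\<^sup>2)"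
      by (intro mult_left_mono) auto
    also have "\<dots> = (3 * real J + (real J)\<^sup>2) * (Q (?k n) * h n / real n)\<^sup>2"
      by (simp add: power_mult_distrib power_divide)
    finally show ?thesis
      unfolding expectation_square_deviation by (simp add: mult_ac)
  qed
  then show "\<exists>u. (u \<longlonglongrightarrow> 0 + 3 * \<kappa>\<^sup>2 / real J) \<and> (\<forall>\<^sub>F n in sequentially. ?E n \<le> u n)"
    using lim by (intro exI conjI always_eventually) auto
qed

lemma range_mean_deviation:
  assumes l: "(\<lambda>n. real (l n) / real n) \<longlonglongrightarrow> \<kappa>" "0 < \<kappa>"
  shows "(\<lambda>n. steps_expectation \<rho> (l n) (\<lambda>w. \<bar>h n / real n * real (card (visited 0 w)) - \<kappa>\<bar>)) \<longlonglongrightarrow> 0"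
proof (rule tendsto_sandwich_parametric[where c=1])
  fix J :: nat assume J: "1 \<le> J"
  let ?X = "\<lambda>n w. h n / real n * real (card (visited 0 w)) - \<kappa>"
  let ?E = "\<lambda>n. steps_expectation \<rho> (l n) (\<lambda>w. \<bar>?X n w\<bar>)"
  have nn: "0 \<le> ?E n" for n by (intro integral_nonneg_AE) auto
  have "0 - 1 / real J \<le> ?E n" for n
    using nn[of n] by (rule order_trans[rotated]) simp
  then show "\<exists>f. (f \<longlonglongrightarrow> 0 - 1 / real J) \<and> (\<forall>\<^sub>F n in sequentially. f n \<le> ?E n)"
    by (intro exI[of _ "\<lambda>_. 0 - 1 / real J"] conjI tendsto_const always_eventually allI)
  have "(\<lambda>n. 1 / real J + real J * steps_expectation \<rho> (l n) (\<lambda>w. (?X n w)\<^sup>2)) \<longlonglongrightarrow> 1 / real J + real J * 0"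
    by (intro tendsto_intros range_mean_square l)
  moreover have "?E n \<le> 1 / real J + real J * steps_expectation \<rho> (l n) (\<lambda>w. (?X n w)\<^sup>2)" for n
  proof -
    \<comment> \<open>a substitute for the Cauchy--Schwarz inequality\<close>
    have ineq: "\<bar>x\<bar> \<le> 1 / real J + real J * x\<^sup>2" for x :: real
    proof -
      have "0 \<le> (1 - real J * \<bar>x\<bar>)\<^sup>2" by simp
      then have "2 * (real J * \<bar>x\<bar>) \<le> 1 + real J * (real J * x\<^sup>2)"
        by (simp add: power2_eq_square algebra_simps flip: abs_mult)
      moreover have "0 \<le> real J * \<bar>x\<bar>" by simp
      ultimately have "real J * \<bar>x\<bar> \<le> 1 + real J * (real J * x\<^sup>2)" by linarith
      then show ?thesis using J by (simp add: field_simps)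
    qed
    have X: "\<bar>?X n w\<bar> \<le> h n / real n * real (l n) + \<kappa>" if "w \<in> set_pmf (replicate_pmf (l n) \<rho>)" for w
    proof -
      have "\<bar>?X n w\<bar> \<le> \<bar>h n / real n * real (card (visited 0 w))\<bar> + \<bar>\<kappa>\<bar>" by (rule abs_triangle_ineq4)
      also have "\<dots> = h n / real n * real (card (visited 0 w)) + \<kappa>"
        using h_pos[of n] l(2) by (simp add: abs_mult)
      also have "\<dots> \<le> h n / real n * real (l n) + \<kappa>"
        using h_pos[of n] card_visited_le_of_length[OF length_replicate_pmf[OF that], of 0]
        by (intro add_right_mono mult_left_mono) auto
      finally show ?thesis .
    qed
    have int: "integrable (measure_pmf (replicate_pmf (l n) \<rho>)) (\<lambda>w. \<bar>?X n w\<bar>)"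
      "integrable (measure_pmf (replicate_pmf (l n) \<rho>)) (\<lambda>w. (?X n w)\<^sup>2)"
      subgoal by (rule integrable_bounded_pmf) (use X in auto)
      subgoal
      proof (rule integrable_bounded_pmf)
        fix w assume "w \<in> set_pmf (replicate_pmf (l n) \<rho>)"
        from power_mono[OF X[OF this], of 2]
        show "norm ((?X n w)\<^sup>2) \<le> (h n / real n * real (l n) + \<kappa>)\<^sup>2" by simp
      qed
      done
    have "?E n \<le> steps_expectation \<rho> (l n) (\<lambda>w. 1 / real J + real J * (?X n w)\<^sup>2)"
      using int ineq by (intro integral_mono) auto
    also have "\<dots> = 1 / real J + real J * steps_expectation \<rho> (l n) (\<lambda>w. (?X n w)\<^sup>2)"
      using int by simp
    finally show ?thesis .
  qed
  ultimately show "\<exists>u. (u \<longlonglongrightarrow> 0 + 1 / real J) \<and> (\<forall>\<^sub>F n in sequentially. ?E n \<le> u n)"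
    by (intro exI conjI always_eventually allI) auto
qed

lemma green_div_n: "(\<lambda>n. h n / real n) \<longlonglongrightarrow> 0"
proof -
  obtain C where C: "0 < C" "\<And>k. 1 \<le> k \<Longrightarrow> pmf (position_pmf \<rho> k) 0 \<le> C / real k"
    using return_bound by blast
  have lim: "(\<lambda>k. C / real k) \<longlonglongrightarrow> 0"
    using tendsto_mult[OF tendsto_const[of C] lim_1_over_n] by simp
  have "(\<lambda>k. pmf (position_pmf \<rho> k) 0) \<longlonglongrightarrow> 0"
    by (rule tendsto_sandwich[OF _ _ tendsto_const lim]) (use C in \<open>auto intro!: eventually_sequentiallyI[of 1]\<close>)
  from tendsto_add[OF lim_1_over_n cesaro_null[OF this]]
  have "(\<lambda>n. 1 / real n + (\<Sum>k=1..n. pmf (position_pmf \<rho> k) 0) / real n) \<longlonglongrightarrow> 0" by simp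
  moreover have "h n = 1 + (\<Sum>k=1..n. pmf (position_pmf \<rho> k) 0)" for n
  proof -
    have "{..n} = insert 0 {1..n}" by auto
    then show ?thesis unfolding green_def by (simp add: position_pmf_0)
  qed
  ultimately show ?thesis by (simp add: add_divide_distrib)
qed

lemma n_div_green: "filterlim (\<lambda>n. real n / h n) at_top sequentially"
proof -
  have "filterlim (\<lambda>n. inverse (h n / real n)) at_top sequentially"
    by (rule filterlim_inverse_at_top[OF green_div_n])
      (use h_pos in \<open>auto intro!: eventually_sequentiallyI[of 1] divide_pos_pos\<close>)
  then show ?thesis by simp
qed

text \<open>
  The summand \<open>r\<^sup>1\<^sup>-\<^sup>1\<^sup>/\<^sup>\<alpha>\<close> tends to \<open>0\<close> if \<open>\<alpha> < 1\<close>; it equals \<open>1\<close> if \<open>\<alpha> = 1\<close>, and then \<open>h\<close> tends to infinity.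
\<close>

lemma sum_local_bound_null:
  "(\<lambda>n. (\<Sum>r=1..2 * n. real r * (real r powr (- (1 / \<alpha>)))) / (real n * h n)) \<longlonglongrightarrow> 0"
  using green_bounded_or_unbounded
proof (elim disjE conjE exE)
  assume \<alpha>: "\<alpha> < 1"
  have null: "(\<lambda>r. real r * real r powr (- (1 / \<alpha>))) \<longlonglongrightarrow> 0"
  proof -
    have "0 < 1 / \<alpha> - 1" using \<alpha> index by simp
    then have "(\<lambda>r. real r powr (- (1 / \<alpha> - 1))) \<longlonglongrightarrow> 0" by real_asymp
    moreover have "\<forall>\<^sub>F r in sequentially. real r powr (- (1 / \<alpha> - 1)) = real r * real r powr (- (1 / \<alpha>))"
      using eventually_gt_at_top[of 0]
    proof eventually_elim
      case (elim r)
      have "real r powr (- (1 / \<alpha> - 1)) = real r powr (1 + - (1 / \<alpha>))" by simp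
      also have "\<dots> = real r powr 1 * real r powr (- (1 / \<alpha>))" by (rule powr_add)
      finally show ?case using elim by simp
    qed
    ultimately show ?thesis by (simp cong: filterlim_cong)
  qed
  have "filterlim (\<lambda>n::nat. 2 * n) at_top sequentially"
    by (intro filterlim_at_top_mono[OF filterlim_ident]) auto
  from tendsto_mult[OF tendsto_const[of 2] filterlim_compose[OF cesaro_null[OF null] this]]
  have lim: "(\<lambda>n. 2 * ((\<Sum>r=1..2 * n. real r * real r powr (- (1 / \<alpha>))) / real (2 * n))) \<longlonglongrightarrow> 0" by simp
  show ?thesis
  proof (rule tendsto_sandwich[OF _ _ tendsto_const lim])
    show "\<forall>\<^sub>F n in sequentially. 0 \<le> (\<Sum>r=1..2 * n. real r * (real r powr (- (1 / \<alpha>)))) / (real n * h n)"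
      using h_pos by (intro always_eventually allI divide_nonneg_nonneg sum_nonneg) (auto simp: less_imp_le)
    show "\<forall>\<^sub>F n in sequentially. (\<Sum>r=1..2 * n. real r * (real r powr (- (1 / \<alpha>)))) / (real n * h n)
        \<le> 2 * ((\<Sum>r=1..2 * n. real r * real r powr (- (1 / \<alpha>))) / real (2 * n))"
      using eventually_gt_at_top[of 0]
    proof eventually_elim
      case (elim n)
      have "(\<Sum>r=1..2 * n. real r * (real r powr (- (1 / \<alpha>)))) / (real n * h n)
         \<le> (\<Sum>r=1..2 * n. real r * (real r powr (- (1 / \<alpha>)))) / (real n * 1)"
        using elim green_ge_1[of \<rho> n] by (intro divide_left_mono mult_left_mono sum_nonneg mult_pos_pos) auto
      then show ?case by simp
    qed
  qed
next
  assume \<alpha>: "\<alpha> = 1" and inf: "filterlim h at_top sequentially"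
  have "(\<lambda>n. 2 * inverse (h n)) \<longlonglongrightarrow> 2 * 0"
    by (intro tendsto_intros tendsto_inverse_0_at_top inf)
  moreover have "\<forall>\<^sub>F n in sequentially. 2 * inverse (h n) = (\<Sum>r=1..2 * n. real r * (real r powr (- (1 / \<alpha>)))) / (real n * h n)"
    using eventually_gt_at_top[of 0]
  proof eventually_elim
    case (elim n)
    have "(\<Sum>r=1..2 * n. real r * (real r powr (- (1 / \<alpha>)))) = (\<Sum>r=1..2 * n. 1)"
      by (intro sum.cong refl) (auto simp: \<alpha> powr_minus)
    then show ?case using elim by (simp add: field_simps)
  qed
  ultimately show ?thesis by (simp cong: filterlim_cong)
qed

text \<open>
  The order of magnitude of the range: \<open>m n\<close> is any sequence equivalent to \<open>n / h n\<close>.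
\<close>

context
  fixes m :: "nat \<Rightarrow> nat"
  assumes m: "(\<lambda>n. real (m n) * h n / real n) \<longlonglongrightarrow> 1"
begin

lemma inverse_scale: "(\<lambda>n. real n / (h n * real (m n))) \<longlonglongrightarrow> 1"
  using tendsto_inverse[OF m] by (simp add: mult.commute)

lemma scale_at_top: "filterlim m at_top sequentially"
proof -
  have "filterlim (\<lambda>n. (real (m n) * h n / real n) * (real n / h n)) at_top sequentially"
    by (rule filterlim_tendsto_pos_mult_at_top[OF m _ n_div_green]) simp
  moreover have "\<forall>\<^sub>F n in sequentially. (real (m n) * h n / real n) * (real n / h n) = real (m n)"
    using eventually_gt_at_top[of 0]
  proof eventually_elim
    case (elim n) then show ?case using h_pos[of n] by simp
  qed
  ultimately have "filterlim (\<lambda>n. real (m n)) at_top sequentially" by (simp cong: filterlim_cong)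
  then show ?thesis by (simp add: filterlim_sequentially_iff_filterlim_real)
qed

lemma mean_range_scale:
  assumes l: "(\<lambda>n. real (l n) / real n) \<longlonglongrightarrow> \<kappa>" "0 < \<kappa>"
  shows "(\<lambda>n. Q (l n) / real (m n)) \<longlonglongrightarrow> \<kappa>"
proof -
  have "(\<lambda>n. (Q (l n) * h n / real n) * (real n / (h n * real (m n)))) \<longlonglongrightarrow> \<kappa> * 1"
    by (intro tendsto_intros mean_range_linear l inverse_scale)
  moreover have "\<forall>\<^sub>F n in sequentially. (Q (l n) * h n / real n) * (real n / (h n * real (m n))) = Q (l n) / real (m n)"
    using eventually_gt_at_top[of 0]
  proof eventually_elim
    case (elim n) then show ?case using h_pos[of n] by simp
  qed
  ultimately show ?thesis by (simp cong: filterlim_cong)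
qed

lemma range_concentration:
  assumes l: "(\<lambda>n. real (l n) / real n) \<longlonglongrightarrow> \<kappa>" "0 < \<kappa>"
  shows "(\<lambda>n. steps_expectation \<rho> (l n) (\<lambda>w. \<bar>real (card (visited 0 w)) / real (m n) - \<kappa>\<bar>)) \<longlonglongrightarrow> 0"
proof (rule tendsto_sandwich)
  let ?b = "\<lambda>n. real n / (h n * real (m n))"
  let ?D = "\<lambda>n. steps_expectation \<rho> (l n) (\<lambda>w. \<bar>h n / real n * real (card (visited 0 w)) - \<kappa>\<bar>)"
  show "\<forall>\<^sub>F n in sequentially. 0 \<le> steps_expectation \<rho> (l n) (\<lambda>w. \<bar>real (card (visited 0 w)) / real (m n) - \<kappa>\<bar>)"
    by (intro always_eventually allI integral_nonneg_AE) auto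
  have "(\<lambda>n. ?b n * ?D n + \<kappa> * \<bar>?b n - 1\<bar>) \<longlonglongrightarrow> 1 * 0 + \<kappa> * \<bar>1 - 1\<bar>"
    by (intro tendsto_intros inverse_scale range_mean_deviation l)
  then show "(\<lambda>n. ?b n * ?D n + \<kappa> * \<bar>?b n - 1\<bar>) \<longlonglongrightarrow> 0" by simp
  show "\<forall>\<^sub>F n in sequentially. steps_expectation \<rho> (l n) (\<lambda>w. \<bar>real (card (visited 0 w)) / real (m n) - \<kappa>\<bar>) \<le> ?b n * ?D n + \<kappa> * \<bar>?b n - 1\<bar>"
    using eventually_gt_at_top[of 0]
  proof eventually_elim
    case (elim n)
    have b0: "0 \<le> ?b n" using h_pos[of n] by simp
    have int: "integrable (measure_pmf (replicate_pmf (l n) \<rho>)) (\<lambda>w. real (card (visited 0 w)))"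
      by (rule integrable_bounded_pmf[where B="real (l n)"])
        (auto dest!: length_replicate_pmf intro: card_visited_le_of_length)
    have "steps_expectation \<rho> (l n) (\<lambda>w. \<bar>real (card (visited 0 w)) / real (m n) - \<kappa>\<bar>)
      \<le> steps_expectation \<rho> (l n) (\<lambda>w. ?b n * \<bar>h n / real n * real (card (visited 0 w)) - \<kappa>\<bar> + \<kappa> * \<bar>?b n - 1\<bar>)"
    proof (intro integral_mono)
      fix w
      have "real (card (visited 0 w)) / real (m n) - \<kappa> = ?b n * (h n / real n * real (card (visited 0 w)) - \<kappa>) + \<kappa> * (?b n - 1)"
        using elim h_pos[of n] by (cases "m n = 0") (simp_all add: field_simps)
      also have "\<bar>\<dots>\<bar> \<le> \<bar>?b n * (h n / real n * real (card (visited 0 w)) - \<kappa>)\<bar> + \<bar>\<kappa> * (?b n - 1)\<bar>"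
        by (rule abs_triangle_ineq)
      also have "\<dots> = ?b n * \<bar>h n / real n * real (card (visited 0 w)) - \<kappa>\<bar> + \<kappa> * \<bar>?b n - 1\<bar>"
        using b0 l(2) by (simp only: abs_mult abs_of_nonneg less_imp_le)
      finally show "\<bar>real (card (visited 0 w)) / real (m n) - \<kappa>\<bar> \<le> ?b n * \<bar>h n / real n * real (card (visited 0 w)) - \<kappa>\<bar> + \<kappa> * \<bar>?b n - 1\<bar>" .
    qed (use int in simp_all)
    also have "\<dots> = ?b n * ?D n + \<kappa> * \<bar>?b n - 1\<bar>"
      using int by simp
    finally show ?case .
  qed
qed simp

text \<open>
  By \<open>mean_intersection_le\<close> and the local bound the mean intersection is at most
  \<open>h\<^sup>-\<^sup>2 \<Sum>r\<le>2l. C r\<^sup>1\<^sup>-\<^sup>1\<^sup>/\<^sup>\<alpha>\<close>, which is \<open>o(n / h n)\<close>.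
\<close>

lemma intersection_negligible:
  assumes l: "(\<lambda>n. real (l n) / real n) \<longlonglongrightarrow> \<kappa>" "0 < \<kappa>"
  shows "(\<lambda>n. mean_intersection \<rho> (l n) / real (m n)) \<longlonglongrightarrow> 0"
proof -
  obtain C where C: "0 < C" "\<And>n z. 1 \<le> n \<Longrightarrow> pmf (position_pmf \<rho> n) z \<le> C * real n powr (- (1 / \<alpha>))"
    using local_bound by blast
  have l_inf: "filterlim l at_top sequentially" by (rule linear_growth_at_top[OF l])
  let ?S = "\<lambda>n. \<Sum>r=1..2 * n. real r * (real r powr (- (1 / \<alpha>)))"
  let ?u = "\<lambda>n. 2 * C * (?S (l n) / (real (l n) * h (l n))) * (real (l n) / real n) * inverse (h (l n) / h n) * (real n / (h n * real (m n)))"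
  have "?u \<longlonglongrightarrow> 2 * C * 0 * \<kappa> * inverse 1 * 1"
    by (intro tendsto_intros filterlim_compose[OF sum_local_bound_null l_inf] l green_ratio[OF l] inverse_scale) simp
  then have u: "?u \<longlonglongrightarrow> 0" by simp
  show ?thesis
  proof (rule tendsto_sandwich[OF _ _ tendsto_const u])
    show "\<forall>\<^sub>F n in sequentially. 0 \<le> mean_intersection \<rho> (l n) / real (m n)"
      by (simp add: mean_intersection_nonneg)
    show "\<forall>\<^sub>F n in sequentially. mean_intersection \<rho> (l n) / real (m n) \<le> ?u n"
      using filterlim_at_top[THEN iffD1, rule_format, OF l_inf, of 1] eventually_gt_at_top[of 0]
    proof eventually_elim
      case (elim n)
      have "(h (l n))\<^sup>2 * mean_intersection \<rho> (l n) \<le> 2 * (\<Sum>r=1..2 * l n. real r * (C * real r powr (- (1 / \<alpha>))))"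
        by (rule mean_intersection_le) (rule C(2))
      also have "\<dots> = 2 * C * ?S (l n)" by (simp add: sum_distrib_left mult_ac)
      finally have "mean_intersection \<rho> (l n) \<le> 2 * C * ?S (l n) / (h (l n))\<^sup>2"
        using h_pos[of "l n"] by (simp add: field_simps)
      then have "mean_intersection \<rho> (l n) / real (m n) \<le> 2 * C * ?S (l n) / (h (l n))\<^sup>2 / real (m n)"
        by (rule divide_right_mono) simp
      also have "\<dots> = ?u n"
        using elim h_pos[of n] h_pos[of "l n"] by (simp add: power2_eq_square)
      finally show ?case .
    qed
  qed
qed

end

text \<open>
  If \<open>\<alpha> < 1\<close>, then \<open>h\<close> converges, and \<open>no_return_times_green\<close> identifies its limit as the reciprocal of the
  escape probability.
\<close>

lemma scale_asymptotic:
  assumes qinf: "\<alpha> < 1 \<Longrightarrow> q \<longlonglongrightarrow> qinf"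
    and m: "\<And>n. m n = (if \<alpha> < 1 then nat \<lfloor>qinf * real n\<rfloor> else nat \<lfloor>real n / h n\<rfloor>)"
  shows "(\<lambda>n. real (m n) * h n / real n) \<longlonglongrightarrow> 1"
  using green_bounded_or_unbounded
proof (elim disjE conjE exE)
  fix H assume \<alpha>: "\<alpha> < 1" and H: "1 \<le> H" "h \<longlonglongrightarrow> H"
  have "(\<lambda>n. q n * h n * inverse (h n)) \<longlonglongrightarrow> 1 * inverse H"
    using H by (intro tendsto_intros no_return_times_green) auto
  moreover have "(\<lambda>n. q n * h n * inverse (h n)) = q"
    using h_pos by (auto simp: fun_eq_iff less_imp_neq[THEN not_sym])
  ultimately have qH: "qinf = inverse H"
    using LIMSEQ_unique[OF qinf[OF \<alpha>]] by simp
  have pos: "0 < qinf" using H qH by simp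
  have "filterlim (\<lambda>n. qinf * real n) at_top sequentially"
    by (rule filterlim_tendsto_pos_mult_at_top[OF tendsto_const pos filterlim_real_sequentially])
  from floor_ratio_tendsto_1[OF this]
  have "(\<lambda>n. real (nat \<lfloor>qinf * real n\<rfloor>) / (qinf * real n) * (qinf * h n)) \<longlonglongrightarrow> 1 * (qinf * H)"
    by (intro tendsto_intros H)
  moreover have "qinf * H = 1" using H qH by simp
  moreover have "(\<lambda>n. real (nat \<lfloor>qinf * real n\<rfloor>) / (qinf * real n) * (qinf * h n)) = (\<lambda>n. real (m n) * h n / real n)"
    using \<alpha> pos by (simp add: m fun_eq_iff)
  ultimately show ?thesis by simp
next
  assume \<alpha>: "\<alpha> = 1"
  have "(\<lambda>n. real (nat \<lfloor>real n / h n\<rfloor>) / (real n / h n)) \<longlonglongrightarrow> 1"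
    by (rule floor_ratio_tendsto_1[OF n_div_green])
  then show ?thesis using \<alpha> by (simp add: m)
qed

end

section \<open>Avoidance probabilities of a mixing scenery\<close>

lemma abs_mult_diff_le:
  fixes a b c d :: real
  assumes "0 \<le> a" "a \<le> 1" "0 \<le> d" "d \<le> 1"
  shows "\<bar>a * b - c * d\<bar> \<le> \<bar>a - c\<bar> + \<bar>b - d\<bar>"
proof -
  have "a * b - c * d = a * (b - d) + (a - c) * d" by (simp add: algebra_simps)
  also have "\<bar>\<dots>\<bar> \<le> \<bar>a\<bar> * \<bar>b - d\<bar> + \<bar>a - c\<bar> * \<bar>d\<bar>"
    using abs_triangle_ineq[of "a * (b - d)" "(a - c) * d"] by (simp add: abs_mult)
  also have "\<dots> \<le> 1 * \<bar>b - d\<bar> + \<bar>a - c\<bar> * 1"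
    using assms by (intro add_mono mult_right_mono mult_left_mono) auto
  finally show ?thesis by simp
qed

lemma abs_diff_chain4:
  fixes a :: real
  assumes "\<bar>a - b\<bar> \<le> e1" "\<bar>b - c\<bar> \<le> e2" "\<bar>c - d\<bar> \<le> e3" "\<bar>d - f\<bar> \<le> e4"
  shows "\<bar>a - f\<bar> \<le> e1 + e2 + e3 + e4"
proof -
  have "\<bar>a - c\<bar> \<le> e1 + e2" "\<bar>c - f\<bar> \<le> e3 + e4" using assms by linarith+
  then show ?thesis by linarith
qed

lemma exp_minus_lipschitz:
  fixes x y :: real
  assumes "0 \<le> x" "0 \<le> y"
  shows "\<bar>exp (- x) - exp (- y)\<bar> \<le> \<bar>x - y\<bar>"
proof -
  have *: "exp (- x) - exp (- y) \<le> y - x" if "0 \<le> x" "x \<le> y" for x y :: real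
  proof -
    have "exp (- x) - exp (- y) = exp (- x) * (1 - exp (- (y - x)))"
      by (simp add: algebra_simps flip: exp_add)
    also have "\<dots> \<le> 1 * (1 - exp (- (y - x)))"
      using that by (intro mult_right_mono) auto
    also have "\<dots> \<le> y - x"
    proof -
      define e where "e = exp (- (y - x))"
      have "1 + - (y - x) \<le> e" unfolding e_def by (rule exp_ge_add_one_self)
      then show ?thesis unfolding e_def[symmetric] by simp
    qed
    finally show ?thesis .
  qed
  show ?thesis
  proof (cases "x \<le> y")
    case True
    then have "exp (- y) \<le> exp (- x)" by simp
    with *[OF assms(1) True] True show ?thesis by simp
  next
    case False
    then have "exp (- x) \<le> exp (- y)" by simp
    with *[OF assms(2), of x] False show ?thesis by simp
  qed
qed

lemma exp_minus_quadratic: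
  fixes x :: real
  assumes "0 \<le> x"
  shows "\<bar>exp (- x) - (1 - x)\<bar> \<le> x\<^sup>2"
proof -
  have "exp (- x) \<le> 1 - x + x\<^sup>2"
  proof -
    have "exp (- x) = inverse (exp x)" by (rule exp_minus)
    also have "\<dots> \<le> inverse (1 + x)"
      using assms exp_ge_add_one_self[of x] by (intro le_imp_inverse_le) auto
    also have "\<dots> \<le> 1 - x + x\<^sup>2"
    proof -
      have "(1 - x + x\<^sup>2) * (1 + x) = 1 + x ^ 3" by (simp add: algebra_simps power2_eq_square power3_eq_cube)
      then have "1 \<le> (1 - x + x\<^sup>2) * (1 + x)" using assms by simp
      then show ?thesis using assms by (simp add: field_simps)
    qed
    finally show ?thesis .
  qed
  moreover have "1 - x \<le> exp (- x)" using exp_ge_add_one_self[of "- x"] by simp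
  ultimately show ?thesis by simp
qed

lemma smallest_elements:
  fixes A :: "int set"
  assumes "finite A" "k \<le> card A"
  obtains B where "B \<subseteq> A" "card B = k" "\<And>b c. b \<in> B \<Longrightarrow> c \<in> A - B \<Longrightarrow> b < c"
proof -
  have "\<exists>B\<subseteq>A. card B = k \<and> (\<forall>b\<in>B. \<forall>c\<in>A - B. b < c)"
    using assms(2)
  proof (induction k)
    case (Suc k)
    then obtain B where B: "B \<subseteq> A" "card B = k" "\<forall>b\<in>B. \<forall>c\<in>A - B. b < c" by auto
    have fin: "finite B" "finite (A - B)" using B assms finite_subset by auto
    have "card (A - B) = card A - k" using B fin by (simp add: card_Diff_subset)
    then have "0 < card (A - B)" using Suc.prems by simp
    then have ne: "A - B \<noteq> {}" by (metis card.empty less_irrefl)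
    let ?m = "Min (A - B)"
    have m: "?m \<in> A - B" by (rule Min_in[OF fin(2) ne])
    have "?m < c" if "c \<in> A - insert ?m B" for c
      using Min_le[OF fin(2), of c] that by (auto simp: le_less)
    then show ?case
      using B m fin by (intro exI[of _ "insert ?m B"]) auto
  qed auto
  then show ?thesis using that by blast
qed

locale scenery = prob_space M for M :: "'w measure" +
  fixes \<xi> :: "int \<Rightarrow> 'w \<Rightarrow> real"
  assumes stat: "stationary M \<xi>"
begin

lemma \<xi>_measurable [measurable]: "\<xi> k \<in> borel_measurable M"
  using stat by (simp add: stationary_def)

lemma stationary_prob:
  assumes B: "B \<in> sets (\<Pi>\<^sub>M k\<in>UNIV. borel)"
  shows "prob {\<omega> \<in> space M. (\<lambda>k. \<xi> (k + s) \<omega>) \<in> B} = prob {\<omega> \<in> space M. (\<lambda>k. \<xi> k \<omega>) \<in> B}"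
proof -
  have m: "(\<lambda>\<omega> k. \<xi> (k + s) \<omega>) \<in> measurable M (\<Pi>\<^sub>M k\<in>UNIV. borel)" for s
    by (rule measurable_PiM_single') auto
  have "measure (distr M (\<Pi>\<^sub>M k\<in>UNIV. borel) (\<lambda>\<omega> k. \<xi> (k + s) \<omega>)) B = measure (distr M (\<Pi>\<^sub>M k\<in>UNIV. borel) (\<lambda>\<omega> k. \<xi> k \<omega>)) B"
    using stat unfolding stationary_def by metis
  then show ?thesis
    using m[of s] m[of 0] B by (simp add: measure_distr vimage_def Int_def conj_commute)
qed

definition avoid :: "int set \<Rightarrow> real \<Rightarrow> 'w set" where
  "avoid A u = {\<omega> \<in> space M. \<forall>i\<in>A. \<xi> i \<omega> \<le> u}"

lemma avoid_sets [measurable]: "finite A \<Longrightarrow> avoid A u \<in> sets M"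
  unfolding avoid_def by measurable

lemma joint_cdf_eq: "joint_cdf M \<xi> A u = prob (avoid A u)"
  by (simp add: joint_cdf_def avoid_def)

lemma avoid_Un: "avoid (A \<union> B) u = avoid A u \<inter> avoid B u"
  by (auto simp: avoid_def)

lemma avoid_empty [simp]: "avoid {} u = space M"
  by (simp add: avoid_def)

lemma prob_avoid_translate:
  assumes "finite A"
  shows "prob (avoid ((+) s ` A) u) = prob (avoid A u)"
proof -
  have B: "{f. \<forall>i\<in>A. f i \<le> u} \<in> sets (\<Pi>\<^sub>M k\<in>(UNIV :: int set). (borel :: real measure))"
  proof -
    have "{f \<in> space (\<Pi>\<^sub>M k\<in>(UNIV :: int set). (borel :: real measure)). \<forall>i\<in>A. f i \<le> u} \<in> sets (\<Pi>\<^sub>M k\<in>UNIV. borel)"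
      using assms by measurable
    then show ?thesis by (simp add: space_PiM)
  qed
  have "avoid ((+) s ` A) u = {\<omega> \<in> space M. (\<lambda>k. \<xi> (k + s) \<omega>) \<in> {f. \<forall>i\<in>A. f i \<le> u}}"
    by (auto simp: avoid_def add.commute)
  moreover have "avoid A u = {\<omega> \<in> space M. (\<lambda>k. \<xi> k \<omega>) \<in> {f. \<forall>i\<in>A. f i \<le> u}}"
    by (auto simp: avoid_def)
  ultimately show ?thesis using stationary_prob[OF B] by simp
qed

definition exceed_prob :: "real \<Rightarrow> real" where
  "exceed_prob u = prob {\<omega> \<in> space M. u < \<xi> 0 \<omega>}"

definition joint_exceed_prob :: "real \<Rightarrow> int \<Rightarrow> real" where
  "joint_exceed_prob u d = prob {\<omega> \<in> space M. u < \<xi> 0 \<omega> \<and> u < \<xi> d \<omega>}"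

lemma exceed_prob_nonneg: "0 \<le> exceed_prob u" and exceed_prob_le_1: "exceed_prob u \<le> 1"
  by (simp_all add: exceed_prob_def)

lemma prob_exceed: "prob {\<omega> \<in> space M. u < \<xi> z \<omega>} = exceed_prob u"
proof -
  have "prob {\<omega> \<in> space M. u < \<xi> z \<omega>} = 1 - prob (avoid {z} u)" for z
  proof -
    have "{\<omega> \<in> space M. u < \<xi> z \<omega>} = space M - avoid {z} u" by (auto simp: avoid_def)
    then show ?thesis by (simp add: prob_compl)
  qed
  moreover have "prob (avoid {z} u) = prob (avoid {0} u)"
    using prob_avoid_translate[of "{0}" z u] by simp
  ultimately show ?thesis by (simp add: exceed_prob_def)
qed

lemma prob_exceed_both: "prob {\<omega> \<in> space M. u < \<xi> y \<omega> \<and> u < \<xi> z \<omega>} = joint_exceed_prob u (z - y)"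
proof -
  have B: "{f. u < f 0 \<and> u < f (z - y)} \<in> sets (\<Pi>\<^sub>M k\<in>(UNIV :: int set). (borel :: real measure))"
  proof -
    have "{f \<in> space (\<Pi>\<^sub>M k\<in>(UNIV :: int set). (borel :: real measure)). u < f 0 \<and> u < f (z - y)} \<in> sets (\<Pi>\<^sub>M k\<in>UNIV. borel)"
      by measurable
    then show ?thesis by (simp add: space_PiM)
  qed
  show ?thesis using stationary_prob[OF B, of y] by (simp add: joint_exceed_prob_def)
qed

lemma prob_avoid_insert_le:
  assumes "finite A" "finite C"
  shows "prob (avoid A u) - real (card C) * exceed_prob u \<le> prob (avoid (A \<union> C) u)"
proof -
  have "avoid A u \<subseteq> avoid (A \<union> C) u \<union> (\<Union>z\<in>C. {\<omega> \<in> space M. u < \<xi> z \<omega>})"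
    by (auto simp: avoid_def not_le)
  then have "prob (avoid A u) \<le> prob (avoid (A \<union> C) u \<union> (\<Union>z\<in>C. {\<omega> \<in> space M. u < \<xi> z \<omega>}))"
    using assms by (intro finite_measure_mono) measurable
  also have "\<dots> \<le> prob (avoid (A \<union> C) u) + prob (\<Union>z\<in>C. {\<omega> \<in> space M. u < \<xi> z \<omega>})"
    using assms by (intro measure_Un_le) measurable
  also have "prob (\<Union>z\<in>C. {\<omega> \<in> space M. u < \<xi> z \<omega>}) \<le> (\<Sum>z\<in>C. prob {\<omega> \<in> space M. u < \<xi> z \<omega>})"
    using assms by (intro finite_measure_subadditive_finite) auto
  finally show ?thesis by (simp add: prob_exceed)
qed

lemma prob_avoid_mono: "A \<subseteq> B \<Longrightarrow> finite B \<Longrightarrow> prob (avoid B u) \<le> prob (avoid A u)"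
  by (intro finite_measure_mono avoid_sets) (auto simp: avoid_def dest: finite_subset)

text \<open>
  Inclusion and exclusion, truncated after the first and after the second term.
\<close>

lemma bonferroni_avoid:
  assumes "finite A"
  shows "1 - real (card A) * exceed_prob u \<le> prob (avoid A u)"
    and "prob (avoid A u) \<le> 1 - real (card A) * exceed_prob u + (\<Sum>y\<in>A. \<Sum>z\<in>{z\<in>A. y < z}. joint_exceed_prob u (z - y))"
proof -
  show "1 - real (card A) * exceed_prob u \<le> prob (avoid A u)"
    using prob_avoid_insert_le[of "{}" A u] assms by (simp add: prob_space)
  show "prob (avoid A u) \<le> 1 - real (card A) * exceed_prob u + (\<Sum>y\<in>A. \<Sum>z\<in>{z\<in>A. y < z}. joint_exceed_prob u (z - y))"
    using assms
  proof (induction rule: finite_linorder_max_induct)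
    case empty
    then show ?case by (simp add: prob_space)
  next
    case (insert b A)
    let ?B = "\<lambda>z. {\<omega> \<in> space M. u < \<xi> z \<omega>}"
    have b: "b \<notin> A" using insert by auto
    have "avoid (insert b A) u = avoid A u - (avoid A u \<inter> ?B b)"
      by (auto simp: avoid_def)
    then have 1: "prob (avoid (insert b A) u) = prob (avoid A u) - prob (avoid A u \<inter> ?B b)"
      using insert by (simp add: finite_measure_Diff)
    have "exceed_prob u = prob (?B b)" by (rule prob_exceed[symmetric])
    also have "?B b \<subseteq> (avoid A u \<inter> ?B b) \<union> (\<Union>y\<in>A. {\<omega> \<in> space M. u < \<xi> y \<omega> \<and> u < \<xi> b \<omega>})"
      by (auto simp: avoid_def not_le)
    then have "prob (?B b) \<le> prob ((avoid A u \<inter> ?B b) \<union> (\<Union>y\<in>A. {\<omega> \<in> space M. u < \<xi> y \<omega> \<and> u < \<xi> b \<omega>}))"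
      using insert by (intro finite_measure_mono) measurable
    also have "\<dots> \<le> prob (avoid A u \<inter> ?B b) + prob (\<Union>y\<in>A. {\<omega> \<in> space M. u < \<xi> y \<omega> \<and> u < \<xi> b \<omega>})"
      using insert by (intro measure_Un_le) measurable
    also have "prob (\<Union>y\<in>A. {\<omega> \<in> space M. u < \<xi> y \<omega> \<and> u < \<xi> b \<omega>}) \<le> (\<Sum>y\<in>A. prob {\<omega> \<in> space M. u < \<xi> y \<omega> \<and> u < \<xi> b \<omega>})"
      using insert by (intro finite_measure_subadditive_finite) auto
    also have "\<dots> = (\<Sum>y\<in>A. joint_exceed_prob u (b - y))"
      by (simp add: prob_exceed_both)
    finally have 2: "exceed_prob u \<le> prob (avoid A u \<inter> ?B b) + (\<Sum>y\<in>A. joint_exceed_prob u (b - y))" by simp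
    have 3: "(\<Sum>y\<in>insert b A. \<Sum>z\<in>{z\<in>insert b A. y < z}. joint_exceed_prob u (z - y))
      = (\<Sum>y\<in>A. \<Sum>z\<in>{z\<in>A. y < z}. joint_exceed_prob u (z - y)) + (\<Sum>y\<in>A. joint_exceed_prob u (b - y))"
    proof -
      have "{z\<in>insert b A. b < z} = {}" using insert by force
      then have "(\<Sum>z\<in>{z\<in>insert b A. b < z}. joint_exceed_prob u (z - b)) = 0" by (simp only: sum.empty)
      moreover have "(\<Sum>z\<in>{z\<in>insert b A. y < z}. joint_exceed_prob u (z - y))
          = joint_exceed_prob u (b - y) + (\<Sum>z\<in>{z\<in>A. y < z}. joint_exceed_prob u (z - y))" if "y \<in> A" for y
      proof -
        have "{z\<in>insert b A. y < z} = insert b {z\<in>A. y < z}" using insert that by auto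
        then show ?thesis using insert b by simp
      qed
      ultimately show ?thesis using insert(1) b
        by (simp only: sum.insert[OF insert(1) b] sum.distrib add_0_left add.commute cong: sum.cong)
    qed
    show ?case
      using insert b 1 2 unfolding 3 by (simp add: algebra_simps)
  qed
qed

text \<open>
  The quantitative form of the classical blocking argument, for an arbitrary finite set of sites:
  the set is cut into successive blocks of \<open>s\<close> elements, and \<open>l\<close> elements are dropped after every
  block, so that consecutive blocks lie at distance more than \<open>l\<close>.
\<close>

context
  fixes u \<gamma> a :: real and s l :: nat
  assumes gap: "\<And>I J. finite I \<Longrightarrow> I \<noteq> {} \<Longrightarrow> finite J \<Longrightarrow> J \<noteq> {} \<Longrightarrow> Max I < Min J \<Longrightarrow> int l \<le> Min J - Max I
      \<Longrightarrow> \<bar>prob (avoid (I \<union> J) u) - prob (avoid I u) * prob (avoid J u)\<bar> \<le> a"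
    and \<gamma>: "\<gamma> = (\<Sum>j=1..s. joint_exceed_prob u (int j))"
    and ls: "l \<le> s" and l0: "0 < l"
begin

lemma a_nonneg: "0 \<le> a"
  using gap[of "{0}" "{int l}"] l0 by simp

lemma \<gamma>_nonneg: "0 \<le> \<gamma>"
  unfolding \<gamma> by (intro sum_nonneg) (simp add: joint_exceed_prob_def)

text \<open>
  Two sites at distance more than \<open>s \<ge> l\<close> are covered by the mixing bound.
\<close>

lemma joint_exceed_far:
  assumes "int s < d"
  shows "joint_exceed_prob u d \<le> (exceed_prob u)\<^sup>2 + a"
proof -
  let ?B = "\<lambda>z. {\<omega> \<in> space M. u < \<xi> z \<omega>}"
  have g: "\<bar>prob (avoid ({0} \<union> {d}) u) - prob (avoid {0} u) * prob (avoid {d} u)\<bar> \<le> a"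
    using assms ls l0 by (intro gap) auto
  have one: "prob (avoid {z} u) = 1 - exceed_prob u" for z
  proof -
    have "avoid {z} u = space M - ?B z" by (auto simp: avoid_def)
    then show ?thesis by (simp add: prob_compl prob_exceed)
  qed
  have "avoid ({0} \<union> {d}) u = space M - (?B 0 \<union> ?B d)" by (auto simp: avoid_def)
  then have "prob (avoid ({0} \<union> {d}) u) = 1 - prob (?B 0 \<union> ?B d)" by (simp add: prob_compl)
  also have "prob (?B 0 \<union> ?B d) = prob (?B 0) + prob (?B d) - prob (?B 0 \<inter> ?B d)"
    by (rule measure_Un3) (auto simp: fmeasurable_eq_sets)
  also have "?B 0 \<inter> ?B d = {\<omega> \<in> space M. u < \<xi> 0 \<omega> \<and> u < \<xi> d \<omega>}" by auto
  finally have "prob (avoid ({0} \<union> {d}) u) = 1 - 2 * exceed_prob u + joint_exceed_prob u d"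
    by (simp add: prob_exceed joint_exceed_prob_def)
  with g show ?thesis by (simp add: one power2_eq_square algebra_simps abs_le_iff)
qed

text \<open>
  In the second Bonferroni term, pairs at distance at most \<open>s\<close> are controlled by \<open>\<gamma>\<close>, all other pairs by mixing.
\<close>

lemma avoid_block:
  assumes A: "finite A" "card A \<le> s"
  shows "\<bar>prob (avoid A u) - exp (- real (card A) * exceed_prob u)\<bar>
    \<le> real s * \<gamma> + (real s)\<^sup>2 * ((exceed_prob u)\<^sup>2 + a) + (real s * exceed_prob u)\<^sup>2"
proof -
  let ?p = "exceed_prob u" and ?c = "real (card A)"
  have p0: "0 \<le> ?p" by (rule exceed_prob_nonneg)
  have cs: "?c \<le> real s" using A by simp
  have pairs: "(\<Sum>z\<in>{z\<in>A. y < z}. joint_exceed_prob u (z - y)) \<le> \<gamma> + real s * (?p\<^sup>2 + a)" for y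
  proof -
    have "(\<Sum>z\<in>{z\<in>A. y < z}. joint_exceed_prob u (z - y))
       \<le> (\<Sum>z\<in>{z\<in>A. y < z}. (if z - y \<le> int s then joint_exceed_prob u (z - y) else 0) + (?p\<^sup>2 + a))"
      using joint_exceed_far a_nonneg by (intro sum_mono) auto
    also have "\<dots> = (\<Sum>z\<in>{z\<in>A. y < z \<and> z - y \<le> int s}. joint_exceed_prob u (z - y)) + real (card {z\<in>A. y < z}) * (?p\<^sup>2 + a)"
      using A by (simp add: sum.distrib sum.If_cases Int_def conj_assoc)
    also have "(\<Sum>z\<in>{z\<in>A. y < z \<and> z - y \<le> int s}. joint_exceed_prob u (z - y))
       = (\<Sum>j\<in>(\<lambda>z. nat (z - y)) ` {z\<in>A. y < z \<and> z - y \<le> int s}. joint_exceed_prob u (int j))"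
      by (subst sum.reindex) (auto simp: inj_on_def)
    also have "\<dots> \<le> \<gamma>"
      unfolding \<gamma> by (intro sum_mono2) (auto simp: joint_exceed_prob_def)
    also have "real (card {z\<in>A. y < z}) * (?p\<^sup>2 + a) \<le> real s * (?p\<^sup>2 + a)"
    proof (intro mult_right_mono)
      have "card {z\<in>A. y < z} \<le> card A" using A by (intro card_mono) auto
      then show "real (card {z\<in>A. y < z}) \<le> real s" using A by simp
    qed (use a_nonneg in simp)
    finally show ?thesis by simp
  qed
  have "(\<Sum>y\<in>A. \<Sum>z\<in>{z\<in>A. y < z}. joint_exceed_prob u (z - y)) \<le> (\<Sum>y\<in>A. \<gamma> + real s * (?p\<^sup>2 + a))"
    by (intro sum_mono pairs)
  also have "\<dots> = ?c * (\<gamma> + real s * (?p\<^sup>2 + a))" by simp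
  also have "\<dots> \<le> real s * (\<gamma> + real s * (?p\<^sup>2 + a))"
    using cs \<gamma>_nonneg a_nonneg by (intro mult_right_mono) auto
  finally have "(\<Sum>y\<in>A. \<Sum>z\<in>{z\<in>A. y < z}. joint_exceed_prob u (z - y)) \<le> real s * \<gamma> + (real s)\<^sup>2 * (?p\<^sup>2 + a)"
    by (simp add: power2_eq_square algebra_simps)
  then have 1: "\<bar>prob (avoid A u) - (1 - ?c * ?p)\<bar> \<le> real s * \<gamma> + (real s)\<^sup>2 * (?p\<^sup>2 + a)"
    using bonferroni_avoid[OF A(1), of u] by (simp add: abs_le_iff)
  have 2: "\<bar>exp (- (?c * ?p)) - (1 - ?c * ?p)\<bar> \<le> (real s * ?p)\<^sup>2"
  proof -
    have 0: "0 \<le> ?c * ?p" using p0 by simp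
    show ?thesis by (rule order_trans[OF exp_minus_quadratic[OF 0] power_mono[OF mult_right_mono[OF cs p0] 0]])
  qed
  show ?thesis using 1 2 by (simp add: abs_le_iff)
qed

text \<open>
  By induction the smallest \<open>s\<close> elements are split off.  The \<open>l\<close> elements after them are dropped, at the
  cost of \<open>l\<close> exceedance probabilities in the avoidance probability and in the exponential; since the sites are
  integers, the gap has length at least \<open>l\<close>.
\<close>

lemma avoid_many_blocks:
  assumes "finite A" "card A \<le> j * (s + l)"
  shows "\<bar>prob (avoid A u) - exp (- real (card A) * exceed_prob u)\<bar>
    \<le> real j * (2 * real l * exceed_prob u + a + (real s * \<gamma> + (real s)\<^sup>2 * ((exceed_prob u)\<^sup>2 + a) + (real s * exceed_prob u)\<^sup>2))"
  using assms
proof (induction j arbitrary: A)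
  case 0
  then show ?case by (simp add: prob_space)
next
  case (Suc j)
  let ?p = "exceed_prob u"
  let ?b = "real s * \<gamma> + (real s)\<^sup>2 * (?p\<^sup>2 + a) + (real s * ?p)\<^sup>2"
  let ?e = "2 * real l * ?p + a + ?b"
  let ?F = "\<lambda>A. prob (avoid A u)" and ?X = "\<lambda>A. exp (- real (card A) * ?p)"
  have p0: "0 \<le> ?p" by (rule exceed_prob_nonneg)
  have b0: "0 \<le> ?b" using \<gamma>_nonneg a_nonneg by simp
  have e0: "0 \<le> real j * ?e" using \<gamma>_nonneg a_nonneg p0 by (intro mult_nonneg_nonneg add_nonneg_nonneg) auto
  have drop: "\<bar>?F (A \<union> C) - ?F A\<bar> \<le> real l * ?p" "\<bar>exp (- (real n + real (card C)) * ?p) - exp (- real n * ?p)\<bar> \<le> real l * ?p"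
    if "finite A" "finite C" "card C \<le> l" for A C n
  proof -
    have cl: "real (card C) * ?p \<le> real l * ?p" using that p0 by (intro mult_right_mono) auto
    show "\<bar>?F (A \<union> C) - ?F A\<bar> \<le> real l * ?p"
      using prob_avoid_insert_le[of A C u] prob_avoid_mono[of A "A \<union> C" u] that cl by (simp add: abs_le_iff)
    have "\<bar>exp (- ((real n + real (card C)) * ?p)) - exp (- (real n * ?p))\<bar> \<le> \<bar>(real n + real (card C)) * ?p - real n * ?p\<bar>"
      using p0 by (intro exp_minus_lipschitz) auto
    also have "\<dots> = real (card C) * ?p" using p0 by (simp add: algebra_simps)
    finally show "\<bar>exp (- (real n + real (card C)) * ?p) - exp (- real n * ?p)\<bar> \<le> real l * ?p"
      unfolding mult_minus_left using cl by linarith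
  qed
  have main: "\<bar>?F A - ?X A\<bar> \<le> real j * ?e + ?e"
  proof (cases "card A \<le> s")
    case True
    have lp: "0 \<le> 2 * real l * ?p" using p0 by simp
    show ?thesis using avoid_block[OF Suc.prems(1) True] e0 lp a_nonneg by linarith
  next
    case False
    then obtain B where B: "B \<subseteq> A" "card B = s" and Bless: "\<And>b c. b \<in> B \<Longrightarrow> c \<in> A - B \<Longrightarrow> b < c"
      using smallest_elements[OF Suc.prems(1), of s] by auto
    have finB: "finite B" "finite (A - B)" using B Suc.prems finite_subset by auto
    have cardAB: "card (A - B) = card A - s" using B finB by (simp add: card_Diff_subset)
    have blk: "\<bar>?F B - ?X B\<bar> \<le> ?b" using B finB by (intro avoid_block) auto
    show ?thesis
    proof (cases "card (A - B) \<le> l")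
      case True
      have AB: "A = B \<union> (A - B)" using B by auto
      have "\<bar>?F A - ?F B\<bar> \<le> real l * ?p"
        using drop(1)[OF finB True] AB by simp
      moreover have "real (card A) = real s + real (card (A - B))" using cardAB False by simp
      then have "\<bar>?X A - ?X B\<bar> \<le> real l * ?p"
        using drop(2)[OF finB True, of s] B by simp
      ultimately show ?thesis using blk e0 a_nonneg by linarith
    next
      case F2: False
      then obtain C where C: "C \<subseteq> A - B" "card C = l" and Cless: "\<And>b c. b \<in> C \<Longrightarrow> c \<in> A - B - C \<Longrightarrow> b < c"
        using smallest_elements[OF finB(2), of l] by auto
      define A' where "A' = A - B - C"
      have fin: "finite C" "finite A'" using C finB finite_subset by (auto simp: A'_def)
      have cardA': "card A' = card A - s - l"
        using C fin cardAB by (simp add: A'_def card_Diff_subset)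
      have cA: "real (card A) = real s + real (card A') + real l"
        using cardA' cardAB F2 False by simp
      have A'ne: "A' \<noteq> {}" using F2 cardAB cardA' fin by auto
      have Bne: "B \<noteq> {}" using B ls l0 by auto
      have AA: "A = (B \<union> A') \<union> C" using B C by (auto simp: A'_def)
      have sep: "Max B < Min A'" "int l \<le> Min A' - Max B"
      proof -
        have mb: "Max B \<in> B" "Min A' \<in> A'" using finB Bne fin A'ne by auto
        then show lt: "Max B < Min A'" using Bless by (auto simp: A'_def)
        have "C \<subseteq> {Max B<..<Min A'}"
          using mb Bless Cless C by (auto simp: A'_def)
        then have "card C \<le> card {Max B<..<Min A'}" by (intro card_mono) auto
        then show "int l \<le> Min A' - Max B" using C lt by simp
      qed
      have 1: "\<bar>?F A - ?F (B \<union> A')\<bar> \<le> real l * ?p"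
        using drop(1)[of "B \<union> A'" C] finB fin C AA by simp
      have 2: "\<bar>?F (B \<union> A') - ?F B * ?F A'\<bar> \<le> a"
        using finB fin Bne A'ne sep by (intro gap)
      have "\<bar>?F A' - ?X A'\<bar> \<le> real j * ?e"
        using Suc.prems cardA' fin by (intro Suc.IH) auto
      moreover have "\<bar>?F B * ?F A' - ?X B * ?X A'\<bar> \<le> \<bar>?F B - ?X B\<bar> + \<bar>?F A' - ?X A'\<bar>"
        using p0 by (intro abs_mult_diff_le) (auto simp: mult_nonneg_nonneg)
      ultimately have 3: "\<bar>?F B * ?F A' - ?X B * ?X A'\<bar> \<le> ?b + real j * ?e"
        using blk by (meson add_mono order_trans)
      have "?X B * ?X A' = exp (- real (s + card A') * ?p)"
        using B by (simp add: algebra_simps flip: exp_add)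
      moreover have "\<bar>?X A - exp (- real (s + card A') * ?p)\<bar> \<le> real l * ?p"
        using drop(2)[of "{}" C "s + card A'"] fin C cA by simp
      ultimately have 4: "\<bar>?X B * ?X A' - ?X A\<bar> \<le> real l * ?p"
        by (simp only: abs_minus_commute)
      show ?thesis
        using abs_diff_chain4[OF 1 2 3 4] by (rule order_trans) (simp add: algebra_simps)
    qed
  qed
  then show ?case by (simp add: algebra_simps)
qed

end

text \<open>
  The avoidance probability of a large deterministic set depends, in the limit, on its
  cardinality only.
\<close>

definition uniform_avoidance :: "(nat \<Rightarrow> real) \<Rightarrow> bool" where
  "uniform_avoidance u \<longleftrightarrow> (\<forall>\<Lambda>>0. \<exists>\<epsilon>. \<epsilon> \<longlonglongrightarrow> 0 \<and> (\<forall>\<^sub>F n in sequentially. \<forall>A. finite A \<and> real (card A) \<le> \<Lambda> * real n \<longrightarrow>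
      \<bar>prob (avoid A (u n)) - exp (- real (card A) * exceed_prob (u n))\<bar> \<le> \<epsilon> n))"

theorem uniform_avoidance_of_mixing:
  assumes D: "cond_D M \<xi> u \<A> l" and D': "cond_D' M \<xi> u \<A> l"
    and tail: "(\<lambda>n. real n * exceed_prob (u n)) \<longlonglongrightarrow> \<tau>"
  shows "uniform_avoidance u"
  unfolding uniform_avoidance_def
proof (intro allI impI)
  fix \<Lambda> :: real assume \<Lambda>: "0 < \<Lambda>"
  obtain k where k_inf: "filterlim k at_top sequentially"
    and k1: "(\<lambda>n. (real n)\<^sup>2 / real (k n) * \<A> n (l n)) \<longlonglongrightarrow> 0"
    and k2: "(\<lambda>n. real (k n * l n) / real n) \<longlonglongrightarrow> 0"
    and k3: "(\<lambda>n. real n * (\<Sum>j=1..n div k n. joint_exceed_prob (u n) (int j))) \<longlonglongrightarrow> 0"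
    using D' unfolding cond_D'_def joint_exceed_prob_def by blast
  have l0: "0 < l n" for n using D by (simp add: cond_D_def)
  have a_lim: "(\<lambda>n. \<A> n (l n)) \<longlonglongrightarrow> 0" using D by (simp add: cond_D_def)
  have gap: "\<bar>prob (avoid (I \<union> J) (u n)) - prob (avoid I (u n)) * prob (avoid J (u n))\<bar> \<le> \<A> n (l n)"
    if "finite I" "I \<noteq> {}" "finite J" "J \<noteq> {}" "Max I < Min J" "int (l n) \<le> Min J - Max I" for I J n
    using D that unfolding cond_D_def joint_cdf_eq by blast
  define p where "p n = exceed_prob (u n)" for n
  define a where "a n = \<A> n (l n)" for n
  define \<gamma> where "\<gamma> n = (\<Sum>j=1..n div k n. joint_exceed_prob (u n) (int j))" for n
  define err where "err n = 2 * (real (k n * l n) / real n) * (real n * p n) + (real (k n * l n) / real n)\<^sup>2 * ((real n)\<^sup>2 / real (k n) * a n)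
     + real n * \<gamma> n + 2 * (real n * p n)\<^sup>2 * inverse (real (k n)) + (real n)\<^sup>2 / real (k n) * a n" for n
  have k_real: "filterlim (\<lambda>n. real (k n)) at_top sequentially"
    using k_inf by (rule filterlim_compose[OF filterlim_real_sequentially])
  have "err \<longlonglongrightarrow> 2 * 0 * \<tau> + 0\<^sup>2 * 0 + 0 + 2 * \<tau>\<^sup>2 * 0 + 0"
    unfolding err_def[abs_def] p_def a_def \<gamma>_def
    by (intro tendsto_intros k1 k2 k3 tail tendsto_inverse_0_at_top k_real)
  then have err: "err \<longlonglongrightarrow> 0" by simp
  have ev: "\<forall>\<^sub>F n in sequentially. \<forall>A. finite A \<and> real (card A) \<le> \<Lambda> * real n \<longrightarrow>
      \<bar>prob (avoid A (u n)) - exp (- real (card A) * exceed_prob (u n))\<bar> \<le> (2 * \<Lambda> + 1) * err n"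
  proof -
    have "\<forall>\<^sub>F n in sequentially. real (k n * l n) / real n < 1 / 2"
      using k2 by (rule order_tendstoD) simp
    moreover have "\<forall>\<^sub>F n in sequentially. 1 \<le> k n"
      using k_inf by (simp add: filterlim_at_top)
    ultimately show ?thesis using eventually_gt_at_top[of 0]
    proof eventually_elim
      case (elim n)
      \<comment> \<open>blocks of \<open>n / k\<close> elements, so that a set of \<open>\<Lambda> n\<close> sites needs at most \<open>(2 \<Lambda> + 1) k\<close> blocks\<close>
      let ?s = "n div k n" and ?k = "real (k n)" and ?n = "real n"
      have kl: "2 * real (k n * l n) < ?n" using elim by (simp add: field_simps)
      then have "real (k n * l n) \<le> ?n" using of_nat_0_le_iff[of "k n * l n", where 'a=real] by linarith
      then have "k n * l n \<le> n" by (simp only: of_nat_le_iff)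
      then have "l n \<le> ?s" using elim by (simp add: less_eq_div_iff_mult_less_eq mult.commute)
      have k0: "0 < ?k" using elim by simp
      have kn: "2 * ?k < ?n"
      proof -
        have "?k * 1 \<le> ?k * real (l n)" using l0[of n] k0 by (intro mult_left_mono) auto
        then show ?thesis using kl by simp
      qed
      have sk: "?k * real ?s \<le> ?n"
      proof -
        have "real (k n * ?s) \<le> ?n" by (simp only: of_nat_le_iff) simp
        then show ?thesis by simp
      qed
      have ks: "?n \<le> 2 * ?k * real ?s"
      proof -
        have "n < k n + k n * ?s" using elim by (intro dividend_less_times_div) auto
        then have "?n < real (k n + k n * ?s)" by (simp only: of_nat_less_iff)
        then show ?thesis using kn by simp
      qed
      have s0: "0 < real ?s" using \<open>l n \<le> ?s\<close> l0[of n] by linarith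
      have p0: "0 \<le> p n" by (simp add: p_def exceed_prob_nonneg)
      have a0: "0 \<le> a n" unfolding a_def by (rule a_nonneg[OF gap \<gamma>_def \<open>l n \<le> ?s\<close> l0])
      have \<gamma>0: "0 \<le> \<gamma> n" unfolding \<gamma>_def by (intro sum_nonneg) (simp add: joint_exceed_prob_def)
      let ?e = "2 * real (l n) * p n + a n + (real ?s * \<gamma> n + (real ?s)\<^sup>2 * ((p n)\<^sup>2 + a n) + (real ?s * p n)\<^sup>2)"
      have ke: "?k * ?e \<le> err n"
      proof -
        have e1: "?k * (2 * real (l n) * p n) = 2 * (real (k n * l n) / ?n) * (?n * p n)" using elim by simp
        have e2: "?k * a n \<le> (real (k n * l n) / ?n)\<^sup>2 * (?n\<^sup>2 / ?k * a n)"
        proof -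
          have "?k * a n * 1 \<le> ?k * a n * (real (l n))\<^sup>2"
            using a0 k0 l0[of n] by (intro mult_left_mono) (auto simp: power2_eq_square intro: mult_ge1_I)
          also have "\<dots> = (real (k n * l n) / ?n)\<^sup>2 * (?n\<^sup>2 / ?k * a n)"
            using elim k0 by (simp add: power2_eq_square field_simps)
          finally show ?thesis by simp
        qed
        have e3: "?k * (real ?s * \<gamma> n) \<le> ?n * \<gamma> n"
          using mult_right_mono[OF sk \<gamma>0] by (simp add: mult.assoc)
        have ks2: "?k * ((real ?s)\<^sup>2 * x) \<le> ?n\<^sup>2 / ?k * x" if "0 \<le> x" for x
        proof -
          have "(?k * real ?s)\<^sup>2 \<le> ?n\<^sup>2" using sk k0 by (intro power_mono) auto
          then have "?k * (real ?s)\<^sup>2 \<le> ?n\<^sup>2 / ?k" using k0 by (simp add: field_simps power2_eq_square)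
          from mult_right_mono[OF this that] show ?thesis by (simp add: mult.assoc)
        qed
        have e6: "2 * (?n\<^sup>2 / ?k * (p n)\<^sup>2) = 2 * (?n * p n)\<^sup>2 * inverse ?k"
          by (simp add: power_mult_distrib divide_inverse mult_ac)
        have e7: "?k * ?e = ?k * (2 * real (l n) * p n) + ?k * a n + ?k * (real ?s * \<gamma> n)
           + 2 * (?k * ((real ?s)\<^sup>2 * (p n)\<^sup>2)) + ?k * ((real ?s)\<^sup>2 * a n)"
          by (simp add: power_mult_distrib algebra_simps)
        have "?k * ?e \<le> 2 * (real (k n * l n) / ?n) * (?n * p n) + (real (k n * l n) / ?n)\<^sup>2 * (?n\<^sup>2 / ?k * a n)
            + ?n * \<gamma> n + 2 * (?n\<^sup>2 / ?k * (p n)\<^sup>2) + ?n\<^sup>2 / ?k * a n"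
          unfolding e7 by (intro add_mono mult_left_mono eq_refl[OF e1] e2 e3 ks2 a0) auto
        then show ?thesis unfolding e6 err_def .
      qed
      have e0: "0 \<le> ?e" using p0 a0 \<gamma>0 by (intro add_nonneg_nonneg mult_nonneg_nonneg) auto
      show ?case
      proof (intro allI impI)
        fix A :: "int set" assume A: "finite A \<and> real (card A) \<le> \<Lambda> * ?n"
        define j where "j = card A div ?s + 1"
        have sn: "0 < ?s" using s0 by simp
        have "card A < ?s + ?s * (card A div ?s)" using sn by (intro dividend_less_times_div)
        then have "card A \<le> j * ?s" by (simp add: j_def algebra_simps)
        also have "\<dots> \<le> j * (?s + l n)" by simp
        finally have "\<bar>prob (avoid A (u n)) - exp (- real (card A) * exceed_prob (u n))\<bar> \<le> real j * ?e"
          using avoid_many_blocks[OF gap \<gamma>_def \<open>l n \<le> ?s\<close> l0, of A j] A unfolding p_def a_def by blast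
        also have "\<dots> \<le> ((2 * \<Lambda> + 1) * ?k) * ?e"
        proof (intro mult_right_mono e0)
          have "real (card A div ?s * ?s) \<le> real (card A)" by (simp only: of_nat_le_iff) simp
          then have "real (card A div ?s) * real ?s \<le> real (card A)" by (simp only: of_nat_mult)
          also have "\<dots> \<le> \<Lambda> * ?n" using A by simp
          also have "\<dots> \<le> \<Lambda> * (2 * ?k * real ?s)" using ks \<Lambda> by (intro mult_left_mono) auto
          finally have "real (card A div ?s) * real ?s \<le> \<Lambda> * (2 * ?k * real ?s)" .
          then have "real (card A div ?s) * real ?s \<le> (2 * \<Lambda> * ?k) * real ?s" by (simp add: mult_ac)
          then have "real (card A div ?s) \<le> 2 * \<Lambda> * ?k" using s0 by (simp only: mult_le_cancel_right_pos)
          moreover have "1 \<le> ?k" using elim by simp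
          ultimately show "real j \<le> (2 * \<Lambda> + 1) * ?k" by (simp add: j_def distrib_right)
        qed
        also have "\<dots> = (2 * \<Lambda> + 1) * (?k * ?e)" by simp
        also have "\<dots> \<le> (2 * \<Lambda> + 1) * err n" using ke \<Lambda> by (intro mult_left_mono) auto
        finally show "\<bar>prob (avoid A (u n)) - exp (- real (card A) * exceed_prob (u n))\<bar> \<le> (2 * \<Lambda> + 1) * err n" .
      qed
    qed
  qed
  have "(\<lambda>n. (2 * \<Lambda> + 1) * err n) \<longlonglongrightarrow> (2 * \<Lambda> + 1) * 0" by (intro tendsto_intros err)
  then show "\<exists>\<epsilon>. \<epsilon> \<longlonglongrightarrow> 0 \<and> (\<forall>\<^sub>F n in sequentially. \<forall>A. finite A \<and> real (card A) \<le> \<Lambda> * real n \<longrightarrow>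
      \<bar>prob (avoid A (u n)) - exp (- real (card A) * exceed_prob (u n))\<bar> \<le> \<epsilon> n)"
    using ev by (intro exI[of _ "\<lambda>n. (2 * \<Lambda> + 1) * err n"]) simp
qed

end

section \<open>Independence of the time blocks\<close>

lemma expectation_pair_pmf:
  fixes f :: "'a \<times> 'b \<Rightarrow> real"
  assumes "\<And>x y. x \<in> set_pmf p \<Longrightarrow> y \<in> set_pmf q \<Longrightarrow> \<bar>f (x, y)\<bar> \<le> B"
  shows "measure_pmf.expectation (pair_pmf p q) f = measure_pmf.expectation p (\<lambda>x. measure_pmf.expectation q (\<lambda>y. f (x, y)))"
proof -
  have "pair_pmf p q = bind_pmf p (\<lambda>x. map_pmf (Pair x) q)"
    by (simp add: pair_pmf_def map_pmf_def)
  then show ?thesis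
    using assms by (simp only:) (subst expectation_bind_pmf[where B=B], auto)
qed

text \<open>
  Fubini for a discrete law and an abstract probability space.
\<close>

lemma (in prob_space) expectation_pmf_swap:
  fixes f :: "'b::countable \<Rightarrow> 'a \<Rightarrow> real"
  assumes meas [measurable]: "\<And>w. f w \<in> borel_measurable M"
    and B: "\<And>w \<omega>. \<omega> \<in> space M \<Longrightarrow> \<bar>f w \<omega>\<bar> \<le> B"
  shows "(\<lambda>\<omega>. measure_pmf.expectation p (\<lambda>w. f w \<omega>)) \<in> borel_measurable M"
    and "expectation (\<lambda>\<omega>. measure_pmf.expectation p (\<lambda>w. f w \<omega>)) = measure_pmf.expectation p (\<lambda>w. expectation (f w))"
proof -
  interpret pair_prob_space M "measure_pmf p" ..
  have snd: "snd \<in> measurable (M \<Otimes>\<^sub>M measure_pmf p) (count_space UNIV)"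
    using measurable_snd[of M "measure_pmf p"] by simp
  have m: "(\<lambda>x. f (snd x) (fst x)) \<in> borel_measurable (M \<Otimes>\<^sub>M measure_pmf p)"
    by (rule measurable_compose_countable[OF _ snd]) measurable
  then have m': "(\<lambda>(\<omega>, w). f w \<omega>) \<in> borel_measurable (M \<Otimes>\<^sub>M measure_pmf p)"
    by (simp add: split_beta')
  then show "(\<lambda>\<omega>. measure_pmf.expectation p (\<lambda>w. f w \<omega>)) \<in> borel_measurable M"
    by (rule measure_pmf.borel_measurable_lebesgue_integral)
  have int: "integrable (M \<Otimes>\<^sub>M measure_pmf p) (\<lambda>(\<omega>, w). f w \<omega>)"
  proof (rule P.integrable_const_bound[where B=B])
    show "AE x in M \<Otimes>\<^sub>M measure_pmf p. norm (case x of (\<omega>, w) \<Rightarrow> f w \<omega>) \<le> B"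
      by (rule AE_I2) (auto simp: space_pair_measure intro!: B)
  qed (rule m')
  show "integral\<^sup>L M (\<lambda>\<omega>. measure_pmf.expectation p (\<lambda>w. f w \<omega>)) = measure_pmf.expectation p (\<lambda>w. integral\<^sup>L M (f w))"
    using Fubini_integral[OF int] by simp
qed

context scenery
begin

text \<open>
  Conditionally on the scenery, the avoidance probability of a random set is a random variable
  \<open>H\<close>.  Its second moment is the avoidance probability of the union of two independent copies of
  the random set; if this is close to the square of its mean, then \<open>H\<close> is nearly constant and the
  avoidance event is nearly independent of every event \<open>E\<close> of the scenery.
\<close>

lemma avoid_decoupling:
  fixes V :: "'b::countable \<Rightarrow> int set"
  assumes fin: "\<And>w. finite (V w)" and E [measurable]: "E \<in> sets M"
  shows "\<bar>measure_pmf.expectation p (\<lambda>w. prob (E \<inter> avoid (V w) u)) - c * prob E\<bar>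
    \<le> sqrt (measure_pmf.expectation (pair_pmf p p) (\<lambda>(w, w'). prob (avoid (V w \<union> V w') u))
         - 2 * c * measure_pmf.expectation p (\<lambda>w. prob (avoid (V w) u)) + c\<^sup>2)"
proof -
  define F where "F w = avoid (V w) u" for w
  have F [measurable]: "F w \<in> sets M" for w unfolding F_def by (rule avoid_sets[OF fin])
  define H where "H \<omega> = measure_pmf.expectation p (\<lambda>w. indicator (F w) \<omega> :: real)" for \<omega>
  have H [measurable]: "H \<in> borel_measurable M"
    unfolding H_def[abs_def] by (rule expectation_pmf_swap(1)[where B=1]) (auto simp: indicator_def)
  have H01: "0 \<le> H \<omega>" "H \<omega> \<le> 1" for \<omega>
    unfolding H_def by (auto intro!: integral_nonneg_AE expectation_pmf_le simp: indicator_def)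
  have int: "integrable M (\<lambda>\<omega>. indicator A \<omega> * H \<omega>)" if "A \<in> sets M" for A
    using H01 that by (intro integrable_const_bound[where B=1]) (auto simp: indicator_def)
  have EH: "expectation (\<lambda>\<omega>. indicator A \<omega> * H \<omega>) = measure_pmf.expectation p (\<lambda>w. prob (A \<inter> F w))"
    if [measurable]: "A \<in> sets M" for A
  proof -
    have "expectation (\<lambda>\<omega>. indicator A \<omega> * H \<omega>) = expectation (\<lambda>\<omega>. measure_pmf.expectation p (\<lambda>w. indicator (A \<inter> F w) \<omega>))"
      by (simp add: H_def indicator_inter_arith)
    also have "\<dots> = measure_pmf.expectation p (\<lambda>w. expectation (indicator (A \<inter> F w)))"
      by (rule expectation_pmf_swap(2)[where B=1]) (auto simp: indicator_def)
    finally show ?thesis by simp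
  qed
  have H1: "expectation H = measure_pmf.expectation p (\<lambda>w. prob (F w))"
  proof -
    have "expectation H = expectation (\<lambda>\<omega>. indicator (space M) \<omega> * H \<omega>)"
      by (intro Bochner_Integration.integral_cong) auto
    also have "\<dots> = measure_pmf.expectation p (\<lambda>w. prob (space M \<inter> F w))" by (rule EH) simp
    finally show ?thesis by (simp add: Int_absorb1 sets.sets_into_space[OF F])
  qed
  have H2: "expectation (\<lambda>\<omega>. (H \<omega>)\<^sup>2) = measure_pmf.expectation (pair_pmf p p) (\<lambda>(w, w'). prob (avoid (V w \<union> V w') u))"
  proof -
    have "expectation (\<lambda>\<omega>. (H \<omega>)\<^sup>2) = expectation (\<lambda>\<omega>. measure_pmf.expectation p (\<lambda>w. indicator (F w) \<omega> * H \<omega>))"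
      by (simp add: H_def power2_eq_square)
    also have "\<dots> = measure_pmf.expectation p (\<lambda>w. expectation (\<lambda>\<omega>. indicator (F w) \<omega> * H \<omega>))"
      using H01 by (intro expectation_pmf_swap(2)[where B=1]) (auto simp: indicator_def)
    also have "\<dots> = measure_pmf.expectation p (\<lambda>w. measure_pmf.expectation p (\<lambda>w'. prob (F w \<inter> F w')))"
      by (simp add: EH)
    also have "\<dots> = measure_pmf.expectation (pair_pmf p p) (\<lambda>(w, w'). prob (avoid (V w \<union> V w') u))"
      by (subst expectation_pair_pmf[where B=1]) (auto simp: F_def avoid_Un)
    finally show ?thesis .
  qed
  have intH: "integrable M H" "integrable M (\<lambda>\<omega>. (H \<omega>)\<^sup>2)"
    using H01 by (auto intro!: integrable_const_bound[where B=1] simp: power_le_one)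
  have intE: "integrable M (\<lambda>\<omega>. indicator E \<omega> * c)"
    by (intro integrable_const_bound[where B="\<bar>c\<bar>"]) (auto simp: indicator_def)
  define X where "X \<omega> = \<bar>H \<omega> - c\<bar>" for \<omega>
  have X2: "(X \<omega>)\<^sup>2 = (H \<omega>)\<^sup>2 - 2 * c * H \<omega> + c\<^sup>2" for \<omega>
    by (simp add: X_def power2_eq_square algebra_simps flip: abs_mult)
  have intX: "integrable M X" unfolding X_def[abs_def] using intH by simp
  have intX2: "integrable M (\<lambda>\<omega>. (X \<omega>)\<^sup>2)" unfolding X2 using intH by simp
  have "measure_pmf.expectation p (\<lambda>w. prob (E \<inter> F w)) - c * prob E = expectation (\<lambda>\<omega>. indicator E \<omega> * H \<omega>) - expectation (\<lambda>\<omega>. indicator E \<omega> * c)"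
    by (subst EH[OF E]) (simp add: mult.commute)
  also have "\<dots> = expectation (\<lambda>\<omega>. indicator E \<omega> * H \<omega> - indicator E \<omega> * c)"
    using int[OF E] intE by simp
  also have "\<bar>\<dots>\<bar> \<le> expectation (\<lambda>\<omega>. \<bar>indicator E \<omega> * H \<omega> - indicator E \<omega> * c\<bar>)"
    by (rule integral_abs_bound)
  also have "\<dots> \<le> expectation X"
    using int[OF E] intE intX by (intro integral_mono) (auto simp: X_def indicator_def)
  also have "expectation X \<le> sqrt (expectation (\<lambda>\<omega>. (X \<omega>)\<^sup>2))"
  proof (rule real_le_rsqrt)
    have "0 \<le> variance X" by (rule variance_positive)
    also have "\<dots> = expectation (\<lambda>\<omega>. (X \<omega>)\<^sup>2) - (expectation X)\<^sup>2"
      using intX intX2 by (rule variance_eq)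
    finally show "(expectation X)\<^sup>2 \<le> expectation (\<lambda>\<omega>. (X \<omega>)\<^sup>2)" by simp
  qed
  also have "expectation (\<lambda>\<omega>. (X \<omega>)\<^sup>2) = expectation (\<lambda>\<omega>. (H \<omega>)\<^sup>2) - 2 * c * expectation H + c\<^sup>2"
    unfolding X2 using intH by (simp add: prob_space)
  finally show ?thesis unfolding H1 H2 F_def .
qed

text \<open>
  The set has about \<open>\<kappa> m\<close> elements, and its avoidance probability is a Lipschitz function of that number.  Sets
  that are too large for \<open>uniform_avoidance\<close> are rare.
\<close>

lemma expectation_avoid_tendsto:
  fixes P :: "nat \<Rightarrow> 'b pmf" and V :: "'b \<Rightarrow> int set"
  assumes u: "uniform_avoidance u" and tail: "(\<lambda>n. real n * exceed_prob (u n)) \<longlonglongrightarrow> \<tau>"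
    and m: "filterlim m at_top sequentially" and fin: "\<And>w. finite (V w)"
    and bounded: "\<And>n w. w \<in> set_pmf (P n) \<Longrightarrow> card (V w) \<le> b n"
    and \<kappa>: "0 \<le> \<kappa>"
    and conc: "(\<lambda>n. measure_pmf.expectation (P n) (\<lambda>w. \<bar>real (card (V w)) / real (m n) - \<kappa>\<bar>)) \<longlonglongrightarrow> 0"
  shows "(\<lambda>n. measure_pmf.expectation (P n) (\<lambda>w. prob (avoid (V w) (u (m n))))) \<longlonglongrightarrow> exp (- (\<kappa> * \<tau>))"
proof -
  obtain \<epsilon> where \<epsilon>: "\<epsilon> \<longlonglongrightarrow> 0" and ev: "\<forall>\<^sub>F n in sequentially. \<forall>A. finite A \<and> real (card A) \<le> (\<kappa> + 1) * real n \<longrightarrow>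
      \<bar>prob (avoid A (u n)) - exp (- real (card A) * exceed_prob (u n))\<bar> \<le> \<epsilon> n"
    using u \<kappa> unfolding uniform_avoidance_def by (meson add_nonneg_pos zero_less_one)
  define D where "D n = measure_pmf.expectation (P n) (\<lambda>w. \<bar>real (card (V w)) / real (m n) - \<kappa>\<bar>)" for n
  define y where "y n = real (m n) * exceed_prob (u (m n))" for n
  have y: "y \<longlonglongrightarrow> \<tau>" unfolding y_def[abs_def] by (rule filterlim_compose[OF tail m])
  define e where "e n = \<epsilon> (m n) + (1 + y n) * D n + \<bar>exp (- (\<kappa> * y n)) - exp (- (\<kappa> * \<tau>))\<bar>" for n
  have "e \<longlonglongrightarrow> 0 + (1 + \<tau>) * 0 + \<bar>exp (- (\<kappa> * \<tau>)) - exp (- (\<kappa> * \<tau>))\<bar>"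
    unfolding e_def[abs_def] using conc by (intro tendsto_intros y filterlim_compose[OF \<epsilon> m]) (simp add: D_def[abs_def])
  then have e: "e \<longlonglongrightarrow> 0" by simp
  have "\<forall>\<^sub>F n in sequentially. 1 \<le> m n" using m by (simp add: filterlim_at_top)
  moreover have "\<forall>\<^sub>F n in sequentially. \<forall>A. finite A \<and> real (card A) \<le> (\<kappa> + 1) * real (m n) \<longrightarrow>
      \<bar>prob (avoid A (u (m n))) - exp (- real (card A) * exceed_prob (u (m n)))\<bar> \<le> \<epsilon> (m n)"
    using ev m by (rule eventually_compose_filterlim)
  ultimately have "\<forall>\<^sub>F n in sequentially. norm (measure_pmf.expectation (P n) (\<lambda>w. prob (avoid (V w) (u (m n)))) - exp (- (\<kappa> * \<tau>))) \<le> e n"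
  proof eventually_elim
    case (elim n)
    let ?p = "exceed_prob (u (m n))" and ?M = "real (m n)" and ?F = "\<lambda>w. prob (avoid (V w) (u (m n)))"
    have M: "0 < ?M" using elim(1) by simp
    have p0: "0 \<le> ?p" by (rule exceed_prob_nonneg)
    have y0: "0 \<le> y n" using p0 by (simp add: y_def)
    have \<epsilon>0: "0 \<le> \<epsilon> (m n)" using elim(2)[rule_format, of "{}"] \<kappa> M by (simp add: prob_space)
    have pt: "\<bar>?F w - exp (- (\<kappa> * \<tau>))\<bar> \<le> \<epsilon> (m n) + (1 + y n) * \<bar>real (card (V w)) / ?M - \<kappa>\<bar> + \<bar>exp (- (\<kappa> * y n)) - exp (- (\<kappa> * \<tau>))\<bar>" for w
    proof -
      let ?d = "\<bar>real (card (V w)) / ?M - \<kappa>\<bar>"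
      have "\<bar>?F w - exp (- (\<kappa> * y n))\<bar> \<le> \<epsilon> (m n) + (1 + y n) * ?d"
      proof (cases "real (card (V w)) \<le> (\<kappa> + 1) * ?M")
        case True
        have 1: "\<bar>?F w - exp (- (real (card (V w)) * ?p))\<bar> \<le> \<epsilon> (m n)"
          using elim(2)[rule_format, of "V w"] fin True by simp
        have "\<bar>exp (- (real (card (V w)) * ?p)) - exp (- (\<kappa> * y n))\<bar> \<le> \<bar>real (card (V w)) * ?p - \<kappa> * y n\<bar>"
          using p0 y0 \<kappa> by (intro exp_minus_lipschitz) auto
        also have "real (card (V w)) * ?p - \<kappa> * y n = y n * (real (card (V w)) / ?M - \<kappa>)"
          using M by (simp add: y_def field_simps)
        also have "\<bar>\<dots>\<bar> = y n * ?d" using y0 by (simp add: abs_mult)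
        finally have 2: "\<bar>exp (- (real (card (V w)) * ?p)) - exp (- (\<kappa> * y n))\<bar> \<le> y n * ?d" .
        have "y n * ?d \<le> (1 + y n) * ?d" by (intro mult_right_mono) auto
        with 1 2 show ?thesis by linarith
      next
        case False
        then have "\<kappa> + 1 < real (card (V w)) / ?M" using M by (simp add: field_simps)
        then have "1 \<le> ?d" by linarith
        moreover have "0 \<le> y n * ?d" using y0 by simp
        moreover have "exp (- (\<kappa> * y n)) \<le> 1" "0 \<le> exp (- (\<kappa> * y n))" using \<kappa> y0 by auto
        then have "\<bar>?F w - exp (- (\<kappa> * y n))\<bar> \<le> 1"
          using prob_le_1[of "avoid (V w) (u (m n))"] measure_nonneg[of M "avoid (V w) (u (m n))"] by linarith
        ultimately show ?thesis using \<epsilon>0 by (simp add: distrib_right)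
      qed
      then show ?thesis by linarith
    qed
    have intD: "integrable (measure_pmf (P n)) (\<lambda>w. \<bar>real (card (V w)) / ?M - \<kappa>\<bar>)"
    proof (rule integrable_bounded_pmf[where B="real (b n) / ?M + \<kappa>"])
      fix w assume "w \<in> set_pmf (P n)"
      then have "real (card (V w)) / ?M \<le> real (b n) / ?M"
        using bounded[of w n] by (intro divide_right_mono) auto
      moreover have "0 \<le> real (card (V w)) / ?M" by simp
      ultimately show "norm \<bar>real (card (V w)) / ?M - \<kappa>\<bar> \<le> real (b n) / ?M + \<kappa>"
        unfolding real_norm_def abs_abs using \<kappa> by linarith
    qed
    have intF: "integrable (measure_pmf (P n)) ?F" by (rule integrable_bounded_pmf[where B=1]) simp
    have "measure_pmf.expectation (P n) ?F - exp (- (\<kappa> * \<tau>)) = measure_pmf.expectation (P n) (\<lambda>w. ?F w - exp (- (\<kappa> * \<tau>)))"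
      using intF by simp
    also have "\<bar>\<dots>\<bar> \<le> measure_pmf.expectation (P n) (\<lambda>w. \<bar>?F w - exp (- (\<kappa> * \<tau>))\<bar>)"
      by (rule integral_abs_bound)
    also have "\<dots> \<le> measure_pmf.expectation (P n) (\<lambda>w. \<epsilon> (m n) + (1 + y n) * \<bar>real (card (V w)) / ?M - \<kappa>\<bar> + \<bar>exp (- (\<kappa> * y n)) - exp (- (\<kappa> * \<tau>))\<bar>)"
      using intF intD by (intro integral_mono pt) auto
    also have "\<dots> = e n" using intD by (simp add: e_def D_def)
    finally show ?case by simp
  qed
  from Lim_null_comparison[OF this e] show ?thesis by (simp add: LIM_zero_iff)
qed

end

text \<open>
  Walk and scenery are independent: the walk enters through its step law only, and expectations over
  paths are taken outside of the probabilities of the scenery.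
\<close>

locale walk_in_scenery = stable_walk \<rho> \<alpha> C\<^sub>1 C\<^sub>2 \<mu> + scenery M \<xi>
  for \<rho> :: "int pmf" and \<alpha> C\<^sub>1 C\<^sub>2 :: real and \<mu> :: "real measure"
    and M :: "'w measure" and \<xi> :: "int \<Rightarrow> 'w \<Rightarrow> real" +
  fixes m :: "nat \<Rightarrow> nat"
  assumes scale: "(\<lambda>n. real (m n) * green \<rho> n / real n) \<longlonglongrightarrow> 1"
begin

text \<open>
  The union is as large as the two ranges together, up to their negligible intersection.
\<close>

lemma union_concentration:
  assumes l: "(\<lambda>n. real (l n) / real n) \<longlonglongrightarrow> \<kappa>" "0 < \<kappa>"
  shows "(\<lambda>n. measure_pmf.expectation (pair_pmf (replicate_pmf (l n) \<rho>) (replicate_pmf (l n) \<rho>))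
      (\<lambda>w. \<bar>real (card (visited 0 (fst w) \<union> visited 0 (snd w))) / real (m n) - 2 * \<kappa>\<bar>)) \<longlonglongrightarrow> 0"
proof -
  let ?PP = "\<lambda>n. pair_pmf (replicate_pmf (l n) \<rho>) (replicate_pmf (l n) \<rho>)"
  let ?R = "\<lambda>w. real (card (visited 0 w))"
  let ?d = "\<lambda>n w. \<bar>?R w / real (m n) - \<kappa>\<bar>"
  let ?I = "\<lambda>w. real (card (visited 0 (fst w) \<inter> visited 0 (snd w)))"
  have "(\<lambda>n. 2 * steps_expectation \<rho> (l n) (?d n) + mean_intersection \<rho> (l n) / real (m n)) \<longlonglongrightarrow> 2 * 0 + 0"
    by (intro tendsto_intros range_concentration[OF scale l] intersection_negligible[OF scale l])
  then have lim: "(\<lambda>n. 2 * steps_expectation \<rho> (l n) (?d n) + mean_intersection \<rho> (l n) / real (m n)) \<longlonglongrightarrow> 0" by simp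
  have lo: "\<forall>\<^sub>F n in sequentially. 0 \<le> measure_pmf.expectation (?PP n) (\<lambda>w. \<bar>real (card (visited 0 (fst w) \<union> visited 0 (snd w))) / real (m n) - 2 * \<kappa>\<bar>)"
    by (intro always_eventually allI integral_nonneg_AE) auto
  have up: "\<forall>\<^sub>F n in sequentially. measure_pmf.expectation (?PP n) (\<lambda>w. \<bar>real (card (visited 0 (fst w) \<union> visited 0 (snd w))) / real (m n) - 2 * \<kappa>\<bar>)
      \<le> 2 * steps_expectation \<rho> (l n) (?d n) + mean_intersection \<rho> (l n) / real (m n)"
  proof (intro always_eventually allI)
    fix n
    have R: "?R w \<le> real (l n)" if "w \<in> set_pmf (replicate_pmf (l n) \<rho>)" for w
      using card_visited_le_of_length[OF length_replicate_pmf[OF that], of 0] by simp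
    have d: "?d n w \<le> real (l n) / real (m n) + \<kappa>" if "w \<in> set_pmf (replicate_pmf (l n) \<rho>)" for w
    proof -
      have "?R w / real (m n) \<le> real (l n) / real (m n)" using R[OF that] by (intro divide_right_mono) auto
      moreover have "0 \<le> ?R w / real (m n)" by simp
      ultimately show ?thesis using l(2) by linarith
    qed
    have I: "?I w \<le> real (l n)" if "w \<in> set_pmf (?PP n)" for w
    proof -
      have "card (visited 0 (fst w) \<inter> visited 0 (snd w)) \<le> card (visited 0 (fst w))" by (intro card_mono) auto
      then show ?thesis using R[of "fst w"] that by auto
    qed
    have int1: "integrable (measure_pmf (?PP n)) (\<lambda>w. ?d n (fst w))" "integrable (measure_pmf (?PP n)) (\<lambda>w. ?d n (snd w))"
      by (auto intro!: integrable_bounded_pmf[where B="real (l n) / real (m n) + \<kappa>"] d)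
    have int2: "integrable (measure_pmf (?PP n)) (\<lambda>w. ?I w / real (m n))"
      by (intro integrable_divide integrable_bounded_pmf[where B="real (l n)"]) (use I in auto)
    have pt: "\<bar>real (card (visited 0 (fst w) \<union> visited 0 (snd w))) / real (m n) - 2 * \<kappa>\<bar> \<le> ?d n (fst w) + ?d n (snd w) + ?I w / real (m n)" for w
    proof -
      have "real (card (visited 0 (fst w) \<union> visited 0 (snd w))) = ?R (fst w) + ?R (snd w) - ?I w"
        using card_Un_Int[of "visited 0 (fst w)" "visited 0 (snd w)"] by simp
      then have "real (card (visited 0 (fst w) \<union> visited 0 (snd w))) / real (m n) - 2 * \<kappa>
          = (?R (fst w) / real (m n) - \<kappa>) + (?R (snd w) / real (m n) - \<kappa>) - ?I w / real (m n)"
        by (simp add: diff_divide_distrib add_divide_distrib)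
      moreover have "0 \<le> ?I w / real (m n)" by simp
      ultimately show ?thesis by linarith
    qed
    have "measure_pmf.expectation (?PP n) (\<lambda>w. \<bar>real (card (visited 0 (fst w) \<union> visited 0 (snd w))) / real (m n) - 2 * \<kappa>\<bar>)
        \<le> measure_pmf.expectation (?PP n) (\<lambda>w. ?d n (fst w) + ?d n (snd w) + ?I w / real (m n))"
    proof (rule integral_mono_AE')
      show "integrable (measure_pmf (?PP n)) (\<lambda>w. ?d n (fst w) + ?d n (snd w) + ?I w / real (m n))"
        using int1 int2 by (intro Bochner_Integration.integrable_add)
    qed (use pt in \<open>auto intro!: AE_I2\<close>)
    also have "\<dots> = measure_pmf.expectation (?PP n) (\<lambda>w. ?d n (fst w)) + measure_pmf.expectation (?PP n) (\<lambda>w. ?d n (snd w))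
        + measure_pmf.expectation (?PP n) (\<lambda>w. ?I w / real (m n))"
      by (simp only: Bochner_Integration.integral_add Bochner_Integration.integrable_add int1 int2)
    also have "measure_pmf.expectation (?PP n) (\<lambda>w. ?d n (fst w)) = steps_expectation \<rho> (l n) (?d n)"
      by (subst expectation_pair_pmf[where B="real (l n) / real (m n) + \<kappa>"]) (use d in auto)
    also have "measure_pmf.expectation (?PP n) (\<lambda>w. ?d n (snd w)) = steps_expectation \<rho> (l n) (?d n)"
      by (subst expectation_pair_pmf[where B="real (l n) / real (m n) + \<kappa>"]) (use d in auto)
    also have "measure_pmf.expectation (?PP n) (\<lambda>w. ?I w / real (m n)) = measure_pmf.expectation (?PP n) ?I / real (m n)"
      by simp
    also have "measure_pmf.expectation (?PP n) ?I = mean_intersection \<rho> (l n)"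
    proof -
      have "\<bar>?I (x, y)\<bar> \<le> real (l n)" if "x \<in> set_pmf (replicate_pmf (l n) \<rho>)" "y \<in> set_pmf (replicate_pmf (l n) \<rho>)" for x y
        using I[of "(x, y)"] that by simp
      from expectation_pair_pmf[where f="?I", OF this] show ?thesis by (simp add: mean_intersection_def)
    qed
    finally show "measure_pmf.expectation (?PP n) (\<lambda>w. \<bar>real (card (visited 0 (fst w) \<union> visited 0 (snd w))) / real (m n) - 2 * \<kappa>\<bar>)
        \<le> 2 * steps_expectation \<rho> (l n) (?d n) + mean_intersection \<rho> (l n) / real (m n)" by simp
  qed
  show ?thesis by (rule tendsto_sandwich[OF lo up tendsto_const lim])
qed

text \<open>
  The sites visited at the times in \<open>(t i, t (i + 1)]\<close>; sites that were visited before are included.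
\<close>

definition block :: "(nat \<Rightarrow> nat) \<Rightarrow> int list \<Rightarrow> nat \<Rightarrow> int set" where
  "block t w i = visited (sum_list (take (t i) w)) (drop (t i) (take (t (Suc i)) w))"

definition blocks_avoid :: "(nat \<Rightarrow> nat) \<Rightarrow> int list \<Rightarrow> nat set \<Rightarrow> (nat \<Rightarrow> real) \<Rightarrow> 'w set" where
  "blocks_avoid t w I u = {\<omega> \<in> space M. \<forall>i\<in>I. \<omega> \<in> avoid (block t w i) (u i)}"

lemma finite_block [simp]: "finite (block t w i)"
  by (simp add: block_def)

lemma blocks_avoid_sets [measurable]: "finite I \<Longrightarrow> blocks_avoid t w I u \<in> sets M"
  unfolding blocks_avoid_def avoid_def by measurable

text \<open>
  \<open>avoid_decoupling\<close> with \<open>c = exp (- \<kappa> \<tau>)\<close>: a single range avoids the level with probability tending to \<open>c\<close>, the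
  union of two independent ranges with probability tending to \<open>exp (- 2 \<kappa> \<tau>) = c\<^sup>2\<close>.  By stationarity the bound does not
  depend on the starting point \<open>s\<close> of the piece.
\<close>

lemma avoid_fresh_piece_decoupled:
  assumes u: "uniform_avoidance u" and tail: "(\<lambda>n. real n * exceed_prob (u n)) \<longlonglongrightarrow> \<tau>"
    and l: "(\<lambda>n. real (l n) / real n) \<longlonglongrightarrow> \<kappa>" "0 < \<kappa>"
  obtains \<delta> where "\<delta> \<longlonglongrightarrow> 0"
    "\<And>n s E. E \<in> sets M \<Longrightarrow> \<bar>steps_expectation \<rho> (l n) (\<lambda>v. prob (E \<inter> avoid (visited s v) (u (m n)))) - exp (- (\<kappa> * \<tau>)) * prob E\<bar> \<le> \<delta> n"
proof -
  have m_inf: "filterlim m at_top sequentially" by (rule scale_at_top[OF scale])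
  let ?P = "\<lambda>n. replicate_pmf (l n) \<rho>" and ?c = "exp (- (\<kappa> * \<tau>))"
  let ?E1 = "\<lambda>n. steps_expectation \<rho> (l n) (\<lambda>w. prob (avoid (visited 0 w) (u (m n))))"
  let ?E2 = "\<lambda>n. measure_pmf.expectation (pair_pmf (?P n) (?P n)) (\<lambda>w. prob (avoid (visited 0 (fst w) \<union> visited 0 (snd w)) (u (m n))))"
  have E1: "?E1 \<longlonglongrightarrow> ?c"
  proof (rule expectation_avoid_tendsto[OF u tail m_inf])
    show "card (visited 0 w) \<le> l n" if "w \<in> set_pmf (?P n)" for w n
      by (rule card_visited_le_of_length[OF length_replicate_pmf[OF that]])
    show "(\<lambda>n. measure_pmf.expectation (?P n) (\<lambda>w. \<bar>real (card (visited 0 w)) / real (m n) - \<kappa>\<bar>)) \<longlonglongrightarrow> 0"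
      by (rule range_concentration[OF scale l])
  qed (use l in auto)
  have E2: "?E2 \<longlonglongrightarrow> exp (- (2 * \<kappa> * \<tau>))"
  proof (rule expectation_avoid_tendsto[OF u tail m_inf, where V="\<lambda>w. visited 0 (fst w) \<union> visited 0 (snd w)"])
    show "card (visited 0 (fst w) \<union> visited 0 (snd w)) \<le> l n + l n" if "w \<in> set_pmf (pair_pmf (?P n) (?P n))" for w n
      using card_Un_le[of "visited 0 (fst w)" "visited 0 (snd w)"] that
        card_visited_le_of_length[OF length_replicate_pmf[of "fst w" "l n" \<rho>], of 0]
        card_visited_le_of_length[OF length_replicate_pmf[of "snd w" "l n" \<rho>], of 0]
      by (auto simp: mem_Times_iff)
    show "(\<lambda>n. measure_pmf.expectation (pair_pmf (?P n) (?P n))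
        (\<lambda>w. \<bar>real (card (visited 0 (fst w) \<union> visited 0 (snd w))) / real (m n) - 2 * \<kappa>\<bar>)) \<longlonglongrightarrow> 0"
      by (rule union_concentration[OF l])
  qed (use l in auto)
  define \<delta> where "\<delta> n = sqrt (?E2 n - 2 * ?c * ?E1 n + ?c\<^sup>2)" for n
  have "\<delta> \<longlonglongrightarrow> sqrt (exp (- (2 * \<kappa> * \<tau>)) - 2 * ?c * ?c + ?c\<^sup>2)"
    unfolding \<delta>_def[abs_def] by (intro tendsto_intros E1 E2)
  also have "exp (- (2 * \<kappa> * \<tau>)) = ?c\<^sup>2"
    by (simp add: power2_eq_square flip: exp_add)
  finally have \<delta>: "\<delta> \<longlonglongrightarrow> 0" by (simp add: power2_eq_square)
  show ?thesis
  proof (rule that[OF \<delta>])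
    fix n s E assume E: "E \<in> sets M"
    have tr: "prob (avoid (visited s v) (u (m n))) = prob (avoid (visited 0 v) (u (m n)))" for v
      by (subst visited_translate) (simp add: prob_avoid_translate)
    have tr2: "prob (avoid (visited s v \<union> visited s w) (u (m n))) = prob (avoid (visited 0 v \<union> visited 0 w) (u (m n)))" for v w
      unfolding visited_translate[of s] image_Un[symmetric] by (rule prob_avoid_translate) simp
    show "\<bar>steps_expectation \<rho> (l n) (\<lambda>v. prob (E \<inter> avoid (visited s v) (u (m n)))) - ?c * prob E\<bar> \<le> \<delta> n"
      using avoid_decoupling[of "visited s" E "?P n" "u (m n)" ?c] E
      by (simp add: tr tr2 \<delta>_def case_prod_unfold)
  qed
qed

text \<open>
  Given the path up to \<open>t n K\<close>, that the earlier blocks avoid their levels is an event of the scenery, whatever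
  these levels are, and the next block is a fresh piece of the walk.
\<close>

theorem blocks_avoid_tendsto:
  fixes t :: "nat \<Rightarrow> nat \<Rightarrow> nat" and u :: "nat \<Rightarrow> nat \<Rightarrow> real"
  assumes t0: "\<And>n. t n 0 = 0" and t_mono: "\<And>n i. t n i \<le> t n (Suc i)"
    and t_lim: "\<And>i. (\<lambda>n. real (t n (Suc i) - t n i) / real n) \<longlonglongrightarrow> \<kappa>" and \<kappa>: "0 < \<kappa>"
    and u: "\<And>i. i \<in> I \<Longrightarrow> uniform_avoidance (u i)"
    and tail: "\<And>i. i \<in> I \<Longrightarrow> (\<lambda>n. real n * exceed_prob (u i n)) \<longlonglongrightarrow> \<tau> i"
  shows "(\<lambda>n. steps_expectation \<rho> (t n K) (\<lambda>w. prob (blocks_avoid (t n) w (I \<inter> {..<K}) (\<lambda>i. u i (m n)))))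
    \<longlonglongrightarrow> (\<Prod>i\<in>I \<inter> {..<K}. exp (- (\<kappa> * \<tau> i)))"
proof (induction K)
  case 0
  then show ?case by (simp add: t0 blocks_avoid_def prob_space)
next
  case (Suc K)
  let ?u = "\<lambda>n i. u i (m n)"
  let ?G = "\<lambda>K n w. blocks_avoid (t n) w (I \<inter> {..<K}) (?u n)"
  have tK: "t n i \<le> t n K" if "i \<le> K" for n i K
    using that by (rule lift_Suc_mono_le[of "t n", OF t_mono])
  have past: "?G K n (take (t n K) w) = ?G K n w" for n w
  proof -
    have "block (t n) (take (t n K) w) i = block (t n) w i" if "i < K" for i
      using tK[of i K n] tK[of "Suc i" K n] that by (simp add: block_def min_def)
    then show ?thesis by (auto simp: blocks_avoid_def)
  qed
  have G_sets: "?G K n w \<in> sets M" for n w by measurable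
  have step: "steps_expectation \<rho> (t n (Suc K)) (\<lambda>w. prob (?G K n w)) = steps_expectation \<rho> (t n K) (\<lambda>w. prob (?G K n w))" for n
  proof -
    have "steps_expectation \<rho> (t n (Suc K)) (\<lambda>w. prob (?G K n (take (t n K) w))) = steps_expectation \<rho> (t n K) (\<lambda>w. prob (?G K n w))"
      by (rule expectation_steps_take[where B=1]) (auto intro: t_mono)
    then show ?thesis by (simp only: past)
  qed
  show ?case
  proof (cases "K \<in> I")
    case False
    then have eq: "I \<inter> {..<Suc K} = I \<inter> {..<K}" by (auto simp: less_Suc_eq)
    show ?thesis unfolding eq step by (rule Suc)
  next
    case True
    have eq: "I \<inter> {..<Suc K} = insert K (I \<inter> {..<K})" using True by (auto simp: less_Suc_eq)
    let ?c = "exp (- (\<kappa> * \<tau> K))" and ?l = "\<lambda>n. t n (Suc K) - t n K"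
    obtain \<delta> where \<delta>: "\<delta> \<longlonglongrightarrow> 0"
      and dec: "\<And>n s E. E \<in> sets M \<Longrightarrow> \<bar>steps_expectation \<rho> (?l n) (\<lambda>v. prob (E \<inter> avoid (visited s v) (u K (m n)))) - ?c * prob E\<bar> \<le> \<delta> n"
      using avoid_fresh_piece_decoupled[OF u[OF True] tail[OF True] t_lim \<kappa>] by blast
    let ?A = "\<lambda>n. steps_expectation \<rho> (t n (Suc K)) (\<lambda>w. prob (?G (Suc K) n w))"
    let ?B = "\<lambda>n. steps_expectation \<rho> (t n K) (\<lambda>w. prob (?G K n w))"
    have split: "?A n = steps_expectation \<rho> (t n K) (\<lambda>w. steps_expectation \<rho> (?l n) (\<lambda>v. prob (?G K n w \<inter> avoid (visited (sum_list w) v) (u K (m n)))))" for n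
    proof -
      have "?G (Suc K) n w = ?G K n (take (t n K) w) \<inter> avoid (visited (sum_list (take (t n K) w)) (drop (t n K) w)) (u K (m n))"
        if "length w = t n (Suc K)" for w
        unfolding past eq using that by (auto simp: blocks_avoid_def block_def)
      then have "?A n = steps_expectation \<rho> (t n (Suc K))
          (\<lambda>w. prob (?G K n (take (t n K) w) \<inter> avoid (visited (sum_list (take (t n K) w)) (drop (t n K) w)) (u K (m n))))"
        by (intro integral_pmf_cong) (auto dest!: length_replicate_pmf)
      also have "\<dots> = steps_expectation \<rho> (t n K) (\<lambda>w. steps_expectation \<rho> (?l n) (\<lambda>v. prob (?G K n w \<inter> avoid (visited (sum_list w) v) (u K (m n)))))"
        by (rule expectation_steps_split[where B=1]) (auto intro: t_mono)
      finally show ?thesis .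
    qed
    have close: "\<bar>?A n - ?c * ?B n\<bar> \<le> \<delta> n" for n
    proof -
      let ?f = "\<lambda>w. steps_expectation \<rho> (?l n) (\<lambda>v. prob (?G K n w \<inter> avoid (visited (sum_list w) v) (u K (m n))))"
      have f: "\<bar>?f w\<bar> \<le> 1" for w
      proof -
        have "0 \<le> ?f w" by (intro integral_nonneg_AE) auto
        moreover have "?f w \<le> 1" by (intro expectation_pmf_le) auto
        ultimately show ?thesis by simp
      qed
      have d: "\<bar>?f w - ?c * prob (?G K n w)\<bar> \<le> \<delta> n" for w
        by (rule dec[of "?G K n w" n "sum_list w", OF G_sets])
      define g where "g w = \<bar>?f w - ?c * prob (?G K n w)\<bar>" for w
      have g: "\<bar>g w\<bar> \<le> \<delta> n" for w
        unfolding g_def abs_abs by (rule d)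
      have int: "integrable (measure_pmf (replicate_pmf (t n K) \<rho>)) ?f" "integrable (measure_pmf (replicate_pmf (t n K) \<rho>)) (\<lambda>w. prob (?G K n w))"
        by (rule integrable_bounded_pmf[where B=1], use f in simp)+
      have 1: "?A n - ?c * ?B n = steps_expectation \<rho> (t n K) (\<lambda>w. ?f w - ?c * prob (?G K n w))"
        unfolding split using int by simp
      have 2: "\<bar>steps_expectation \<rho> (t n K) (\<lambda>w. ?f w - ?c * prob (?G K n w))\<bar> \<le> steps_expectation \<rho> (t n K) g"
        unfolding g_def by (rule integral_abs_bound)
      have 3: "steps_expectation \<rho> (t n K) g \<le> \<delta> n"
        by (rule expectation_pmf_le) (simp only: g)
      show ?thesis unfolding 1 by (rule order_trans[OF 2 3])
    qed
    have "(\<lambda>n. ?A n - ?c * ?B n) \<longlonglongrightarrow> 0"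
      by (rule Lim_null_comparison[OF _ \<delta>]) (use close in simp)
    from tendsto_add[OF this tendsto_mult[OF tendsto_const[of ?c] Suc]]
    have "?A \<longlonglongrightarrow> ?c * (\<Prod>i\<in>I \<inter> {..<K}. exp (- (\<kappa> * \<tau> i)))" by simp
    then show ?thesis unfolding eq by simp
  qed
qed

end

section \<open>Weak convergence of point processes through counts on a grid\<close>

subsection \<open>Integrals and counts of point sums\<close>

lemma sets_point_sum_cong [measurable_cong]: "sets (point_sum E I x) = sets (restrict_space borel E)"
  by (rule sets_point_sum)

lemma integral_point_sum:
  fixes f :: "'a::topological_space \<Rightarrow> real"
  assumes f: "f \<in> borel_measurable (restrict_space borel E)" and S: "finite S" "S \<subseteq> {i \<in> I. x i \<in> E}"
    and zero: "\<And>i. i \<in> I \<Longrightarrow> x i \<in> E \<Longrightarrow> i \<notin> S \<Longrightarrow> f (x i) = 0"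
  shows "integral\<^sup>L (point_sum E I x) f = (\<Sum>i\<in>S. f (x i))"
proof -
  let ?J = "{i \<in> I. x i \<in> E}"
  have sub: "{i \<in> ?J. f (x i) \<noteq> 0} \<subseteq> S" using zero by auto
  have "integral\<^sup>L (point_sum E I x) f = (\<integral>i. f (x i) \<partial>count_space ?J)"
    unfolding point_sum_def by (rule integral_distr[OF _ f]) (auto simp: space_restrict_space)
  also have "\<dots> = (\<Sum>i | i \<in> ?J \<and> f (x i) \<noteq> 0. f (x i))"
    by (rule lebesgue_integral_count_space_finite_support) (rule finite_subset[OF sub S(1)])
  also have "\<dots> = (\<Sum>i\<in>S. f (x i))"
    using S sub by (intro sum.mono_neutral_left) auto
  finally show ?thesis .
qed

lemma emeasure_point_sum_finite:
  assumes "A \<in> sets (restrict_space borel E)" "finite {i \<in> I. x i \<in> A}"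
  shows "emeasure (point_sum E I x) A = of_nat (card {i \<in> I. x i \<in> A})"
  using assms by (simp add: emeasure_point_sum emeasure_count_space_finite)

lemma measure_point_sum_finite:
  assumes "A \<in> sets (restrict_space borel E)" "finite {i \<in> I. x i \<in> A}"
  shows "measure (point_sum E I x) A = real (card {i \<in> I. x i \<in> A})"
  using emeasure_point_sum_finite[OF assms] by (simp add: measure_def)

subsection \<open>The grid\<close>

text \<open>
  The state space is \<open>[0, \<infinity>) \<times> (lo, hi]\<close>.  The grid of resolution \<open>r\<close> is made of dyadic time
  intervals of length \<open>2\<^sup>-\<^sup>r\<close> and of finitely many rational levels; a level cell is the set of
  all points that exceed the same levels.
\<close>

locale half_open_space =
  fixes lo hi :: ereal
  assumes lo_hi: "lo < hi"
begin

definition "space_E = {0::real..} \<times> {lo<..hi}"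

definition levels :: "nat \<Rightarrow> real set" where
  "levels r = {x \<in> (\<lambda>k. real_of_rat (from_nat k)) ` {..<r}. ereal x \<in> {lo<..hi}}"

definition level_index :: "nat \<Rightarrow> ereal \<Rightarrow> nat" where
  "level_index r y = card {x \<in> levels r. ereal x < y}"

definition time_index :: "nat \<Rightarrow> real \<Rightarrow> nat" where
  "time_index r t = nat \<lfloor>2 ^ r * t\<rfloor>"

definition cell_index :: "nat \<Rightarrow> real \<times> ereal \<Rightarrow> nat \<times> nat" where
  "cell_index r p = (time_index r (fst p), level_index r (snd p))"

definition window :: "nat \<Rightarrow> (real \<times> ereal) set" where
  "window r = {p \<in> space_E. fst p < real r \<and> (\<exists>x\<in>levels r. ereal x < snd p)}"

definition cell :: "nat \<Rightarrow> nat \<times> nat \<Rightarrow> (real \<times> ereal) set" where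
  "cell r c = {p \<in> space_E. cell_index r p = c}"

definition cells :: "nat \<Rightarrow> (nat \<times> nat) list" where
  "cells r = List.product [0..<r * 2 ^ r] [1..<Suc (card (levels r))]"

definition counts :: "nat \<Rightarrow> (real \<times> ereal) measure \<Rightarrow> nat list" where
  "counts r \<mu> = map (\<lambda>c. nat \<lfloor>measure \<mu> (cell r c)\<rfloor>) (cells r)"

lemma finite_levels [simp]: "finite (levels r)"
  by (simp add: levels_def)

lemma levels_mono: "r \<le> r' \<Longrightarrow> levels r \<subseteq> levels r'"
  by (auto simp: levels_def)

lemma levels_in_space: "x \<in> levels r \<Longrightarrow> ereal x \<in> {lo<..hi}"
  by (simp add: levels_def)

lemma ex_level_between:
  assumes "lo \<le> c" "c < y" "y \<le> hi"
  obtains x r where "x \<in> levels r" "c < ereal x" "ereal x < y"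
proof -
  obtain z :: rat where z: "c < real_of_rat z" "real_of_rat z < y"
    using ereal_dense3[OF assms(2)] by blast
  have "ereal (real_of_rat z) \<in> {lo<..hi}" using z assms by auto
  moreover have "z = from_nat (to_nat z)" by simp
  ultimately have "real_of_rat z \<in> levels (Suc (to_nat z))"
    unfolding levels_def by (auto intro!: image_eqI[where x="to_nat z"])
  then show ?thesis using that z by blast
qed

lemma level_index_eq_iff:
  "level_index r y = level_index r y' \<longleftrightarrow> {x \<in> levels r. ereal x < y} = {x \<in> levels r. ereal x < y'}"
proof
  assume eq: "level_index r y = level_index r y'"
  have "{x \<in> levels r. ereal x < y} \<subseteq> {x \<in> levels r. ereal x < y'} \<or> {x \<in> levels r. ereal x < y'} \<subseteq> {x \<in> levels r. ereal x < y}"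
    by (cases "y \<le> y'") (auto simp: not_le intro: less_le_trans less_trans)
  then show "{x \<in> levels r. ereal x < y} = {x \<in> levels r. ereal x < y'}"
  proof
    assume "{x \<in> levels r. ereal x < y} \<subseteq> {x \<in> levels r. ereal x < y'}"
    then show ?thesis by (rule card_subset_eq[rotated]) (use eq in \<open>simp_all add: level_index_def\<close>)
  next
    assume "{x \<in> levels r. ereal x < y'} \<subseteq> {x \<in> levels r. ereal x < y}"
    then have "{x \<in> levels r. ereal x < y'} = {x \<in> levels r. ereal x < y}"
      by (rule card_subset_eq[rotated]) (use eq in \<open>simp_all add: level_index_def\<close>)
    then show ?thesis ..
  qed
qed (simp add: level_index_def)

lemma level_index_pos_iff: "1 \<le> level_index r y \<longleftrightarrow> (\<exists>x\<in>levels r. ereal x < y)"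
proof -
  have "1 \<le> level_index r y \<longleftrightarrow> {x \<in> levels r. ereal x < y} \<noteq> {}"
    unfolding level_index_def by (simp add: Suc_le_eq card_gt_0_iff)
  then show ?thesis by auto
qed

lemma level_index_le: "level_index r y \<le> card (levels r)"
  unfolding level_index_def by (intro card_mono) auto

lemma level_index_eq_mono:
  assumes "level_index r y = level_index r y'" "r0 \<le> r"
  shows "(\<exists>x\<in>levels r0. ereal x < y) \<longleftrightarrow> (\<exists>x\<in>levels r0. ereal x < y')"
  using assms levels_mono[OF assms(2)] unfolding level_index_eq_iff by blast

lemma time_index_less_iff: "0 \<le> t \<Longrightarrow> time_index r t < k \<longleftrightarrow> t < real k / 2 ^ r"
proof -
  assume "0 \<le> t"
  then have "time_index r t < k \<longleftrightarrow> \<lfloor>2 ^ r * t\<rfloor> < int k"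
    unfolding time_index_def by (simp add: nat_less_iff)
  also have "\<dots> \<longleftrightarrow> 2 ^ r * t < real k" by (simp add: floor_less_iff)
  also have "\<dots> \<longleftrightarrow> t < real k / 2 ^ r" by (simp add: field_simps)
  finally show ?thesis .
qed

lemma time_index_eq_iff: "0 \<le> t \<Longrightarrow> time_index r t = i \<longleftrightarrow> real i / 2 ^ r \<le> t \<and> t < real (Suc i) / 2 ^ r"
  using time_index_less_iff[of t r i] time_index_less_iff[of t r "Suc i"] by auto

lemma window_iff: "p \<in> space_E \<Longrightarrow> p \<in> window r \<longleftrightarrow> cell_index r p \<in> set (cells r)"
proof -
  assume p: "p \<in> space_E"
  then have t: "0 \<le> fst p" by (auto simp: space_E_def)
  have "cell_index r p \<in> set (cells r) \<longleftrightarrow> time_index r (fst p) < r * 2 ^ r \<and> 1 \<le> level_index r (snd p)"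
    using level_index_le[of r "snd p"] by (auto simp: cell_index_def cells_def)
  also have "\<dots> \<longleftrightarrow> p \<in> window r"
    using p by (simp add: window_def time_index_less_iff[OF t] level_index_pos_iff[unfolded One_nat_def])
  finally show ?thesis ..
qed

lemma window_mono: "r \<le> r' \<Longrightarrow> window r \<subseteq> window r'"
  using levels_mono[of r r'] by (auto simp: window_def)

lemma window_cell_index:
  assumes "r0 \<le> r" "p \<in> space_E" "p' \<in> space_E" "cell_index r p = cell_index r p'"
  shows "p \<in> window r0 \<longleftrightarrow> p' \<in> window r0"
proof -
  have t: "0 \<le> fst p" "0 \<le> fst p'" using assms by (auto simp: space_E_def)
  have eq: "time_index r (fst p) = time_index r (fst p')" "level_index r (snd p) = level_index r (snd p')"
    using assms(4) by (auto simp: cell_index_def)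
  have "fst p < real r0 \<longleftrightarrow> fst p' < real r0"
    using eq(1) time_index_less_iff[OF t(1), of r "r0 * 2 ^ r"] time_index_less_iff[OF t(2), of r "r0 * 2 ^ r"] by simp
  then show ?thesis
    using assms level_index_eq_mono[OF eq(2) assms(1)] by (simp add: window_def)
qed

lemma compact_subset_window:
  assumes K: "compact K" "K \<subseteq> space_E"
  shows "\<exists>r. K \<subseteq> window r"
proof -
  define W where "W r = (\<Union>x\<in>levels r. {..<real r} \<times> {ereal x<..})" for r
  have W_mono: "W r \<subseteq> W r'" if "r \<le> r'" for r r'
    using levels_mono[OF that] that by (fastforce simp: W_def)
  have "K \<subseteq> (\<Union>r. W r)"
  proof
    fix p assume "p \<in> K"
    then have p: "0 \<le> fst p" "lo < snd p" "snd p \<le> hi" using K by (auto simp: space_E_def)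
    obtain x r where x: "x \<in> levels r" "ereal x < snd p"
      using ex_level_between[OF order_refl p(2,3)] by blast
    obtain k where k: "fst p < real k" using reals_Archimedean2 by blast
    have "x \<in> levels (max r k)" using x(1) levels_mono[of r "max r k"] by auto
    then have "p \<in> W (max r k)" using x k by (auto simp: W_def mem_Times_iff)
    then show "p \<in> (\<Union>r. W r)" by blast
  qed
  moreover have "open (W r)" for r unfolding W_def by (intro open_UN ballI open_Times) auto
  ultimately obtain C where C: "finite C" "K \<subseteq> (\<Union>r\<in>C. W r)"
    using compactE_image[OF K(1), of UNIV W] by auto
  have "K \<subseteq> W (Max (insert 0 C))"
    using C W_mono[of _ "Max (insert 0 C)"] by (auto dest!: subsetD intro: Max_ge)
  moreover have "W r \<inter> space_E \<subseteq> window r" for r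
    by (auto simp: W_def window_def)
  ultimately have "K \<subseteq> window (Max (insert 0 C))"
    using K by blast
  then show ?thesis ..
qed

lemma window_in_compact: "\<exists>K. compact K \<and> K \<subseteq> space_E \<and> window r \<subseteq> K"
proof -
  define K where "K = (\<Union>x\<in>levels r. {0..real r} \<times> {ereal x..hi})"
  have "compact {ereal x..hi}" for x
    using compact_Int_closed[OF compact_UNIV closed_atLeastAtMost[of "ereal x" hi]] by simp
  then have "compact K" unfolding K_def by (intro compact_UN compact_Times) auto
  moreover have "K \<subseteq> space_E"
    using levels_in_space by (fastforce simp: K_def space_E_def)
  moreover have "window r \<subseteq> K"
    by (auto simp: window_def space_E_def K_def)
  ultimately show ?thesis by blast
qed

text \<open>
  The cells of a point shrink to it: from below because a level is eventually squeezed in between, and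
  from above as well unless the mark is the right end point.
\<close>

lemma cell_index_shrinks:
  assumes p: "p \<in> space_E" and V: "open V" "p \<in> V"
  shows "\<forall>\<^sub>F r in sequentially. \<forall>p'\<in>space_E. cell_index r p' = cell_index r p \<longrightarrow> p' \<in> V"
proof -
  obtain A B where AB: "open A" "open B" "fst p \<in> A" "snd p \<in> B" "A \<times> B \<subseteq> V"
    using V by (auto elim!: open_prod_elim)
  have pE: "0 \<le> fst p" "lo < snd p" "snd p \<le> hi" using p by (auto simp: space_E_def)
  obtain e where e: "0 < e" "\<And>t. \<bar>t - fst p\<bar> < e \<Longrightarrow> t \<in> A"
    using AB by (auto simp: open_dist dist_real_def)
  have "(\<lambda>r. (1 / 2) ^ r :: real) \<longlonglongrightarrow> 0" by (rule LIMSEQ_realpow_zero) auto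
  then have ev1: "\<forall>\<^sub>F r in sequentially. (1 / 2) ^ r < e" using e(1) by (rule order_tendstoD)
  obtain c where c: "c < snd p" "{c<..snd p} \<subseteq> B"
    using open_left[OF AB(2) AB(4) pE(2)] by blast
  obtain x1 r1 where x1: "x1 \<in> levels r1" "max lo c < ereal x1" "ereal x1 < snd p"
    using ex_level_between[of "max lo c" "snd p"] c pE by auto
  have up: "\<exists>r2. \<forall>r\<ge>r2. \<forall>y\<in>{lo<..hi}. level_index r y = level_index r (snd p) \<longrightarrow> (snd p < y \<longrightarrow> y \<in> B)"
  proof (cases "snd p = hi")
    case True
    then have "\<not> snd p < y" if "y \<in> {lo<..hi}" for y using that by (auto simp: not_less)
    then show ?thesis by blast
  next
    case False
    then have "snd p < hi" using pE by simp
    then obtain d where d: "snd p < d" "{snd p..<d} \<subseteq> B"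
      using open_right[OF AB(2) AB(4)] by blast
    obtain x2 r2 where x2: "x2 \<in> levels r2" "snd p < ereal x2" "ereal x2 < min d hi"
      using ex_level_between[of "snd p" "min d hi"] d pE \<open>snd p < hi\<close> less_imp_le[OF pE(2)] by auto
    have "y \<in> B" if "r2 \<le> r" "level_index r y = level_index r (snd p)" "snd p < y" for r y
    proof -
      have "x2 \<in> levels r" using x2 levels_mono[OF that(1)] by auto
      moreover have "\<not> ereal x2 < snd p" using x2 by auto
      ultimately have "\<not> ereal x2 < y" using that(2) unfolding level_index_eq_iff by blast
      then have "y < d" using x2 by (auto simp: not_less min_def split: if_splits intro: le_less_trans less_trans)
      then show ?thesis using d that(3) by auto
    qed
    then show ?thesis by blast
  qed
  then obtain r2 where r2: "\<And>r y. r2 \<le> r \<Longrightarrow> y \<in> {lo<..hi} \<Longrightarrow> level_index r y = level_index r (snd p) \<Longrightarrow> snd p < y \<Longrightarrow> y \<in> B"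
    by blast
  show ?thesis
    using ev1 eventually_ge_at_top[of r1] eventually_ge_at_top[of r2]
  proof eventually_elim
    case (elim r)
    show ?case
    proof (intro ballI impI)
      fix p' assume p': "p' \<in> space_E" and eq: "cell_index r p' = cell_index r p"
      have p'E: "0 \<le> fst p'" "snd p' \<in> {lo<..hi}" using p' by (auto simp: space_E_def)
      have teq: "time_index r (fst p') = time_index r (fst p)" and leq: "level_index r (snd p') = level_index r (snd p)"
        using eq by (auto simp: cell_index_def)
      let ?i = "time_index r (fst p)"
      have "real ?i / 2 ^ r \<le> fst p" "fst p < real (Suc ?i) / 2 ^ r"
        using time_index_eq_iff[OF pE(1), of r ?i] by auto
      moreover have "real ?i / 2 ^ r \<le> fst p'" "fst p' < real (Suc ?i) / 2 ^ r"
        using time_index_eq_iff[OF p'E(1), of r ?i] teq by auto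
      moreover have "real (Suc ?i) / 2 ^ r = real ?i / 2 ^ r + (1 / 2) ^ r"
        by (simp add: add_divide_distrib power_one_over)
      ultimately have "\<bar>fst p' - fst p\<bar> < (1 / 2) ^ r" by linarith
      then have "fst p' \<in> A" using elim e by auto
      moreover have "snd p' \<in> B"
      proof (cases "snd p < snd p'")
        case True
        then show ?thesis using r2[OF elim(3) p'E(2) leq] by simp
      next
        case False
        have "x1 \<in> levels r" using x1 levels_mono[OF elim(2)] by auto
        then have "ereal x1 < snd p'" using leq x1(3) unfolding level_index_eq_iff by blast
        then have "c < snd p'" using x1(2) by (auto intro: less_trans)
        then show ?thesis using c False by auto
      qed
      ultimately show "p' \<in> V" using AB(5) by (metis mem_Times_iff prod.collapse subsetD)
    qed
  qed
qed

lemma fst_borel [measurable]: "fst \<in> measurable (borel :: (real \<times> ereal) measure) borel"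
  by (rule borel_measurable_continuous_onI) (intro continuous_intros)

lemma snd_borel [measurable]: "snd \<in> measurable (borel :: (real \<times> ereal) measure) borel"
  by (rule borel_measurable_continuous_onI) (intro continuous_intros)

lemma space_E_borel [measurable]: "space_E \<in> sets borel"
proof -
  have "space_E = {p \<in> space borel. 0 \<le> fst p \<and> lo < snd p \<and> snd p \<le> hi}"
    by (auto simp: space_E_def)
  also have "\<dots> \<in> sets borel" by measurable
  finally show ?thesis .
qed

lemma cell_index_measurable [measurable]: "cell_index r \<in> measurable borel (count_space UNIV)"
proof -
  have "level_index r y = (\<Sum>x\<in>levels r. of_bool (ereal x < y))" for y
    by (simp add: level_index_def Int_def conj_commute)
  then have "level_index r = (\<lambda>y. \<Sum>x\<in>levels r. of_bool (ereal x < y))" by (rule ext)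
  moreover have "(\<lambda>y. \<Sum>x\<in>levels r. of_bool (ereal x < y) :: nat) \<in> measurable borel (count_space UNIV)"
    by measurable
  ultimately have l [measurable]: "level_index r \<in> measurable borel (count_space UNIV)" by simp
  have t [measurable]: "time_index r \<in> measurable borel (count_space UNIV)"
    unfolding time_index_def[abs_def] by measurable
  have "cell_index r -` {c} \<inter> space borel = {p \<in> space borel. time_index r (fst p) = fst c \<and> level_index r (snd p) = snd c}" for c
    by (auto simp: cell_index_def)
  moreover have "{p \<in> space borel. time_index r (fst p) = fst c \<and> level_index r (snd p) = snd c} \<in> sets borel" for c
    by measurable
  ultimately show ?thesis by (simp add: measurable_count_space_eq2_countable)
qed

lemma cell_sets [measurable]: "cell r c \<in> sets (restrict_space borel space_E)"
proof -
  have "cell r c = space_E \<inter> {p \<in> space borel. cell_index r p = c}" by (auto simp: cell_def)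
  moreover have "{p \<in> space borel. cell_index r p = c} \<in> sets borel" by measurable
  ultimately show ?thesis by (auto simp: sets_restrict_space)
qed

lemma finite_in_window:
  assumes fin: "\<And>K. compact K \<Longrightarrow> K \<subseteq> space_E \<Longrightarrow> finite {i \<in> I. x i \<in> K}"
  shows "finite {i \<in> I. x i \<in> window r}"
proof -
  obtain K where "compact K" "K \<subseteq> space_E" "window r \<subseteq> K" using window_in_compact[of r] by blast
  then show ?thesis by (auto intro: finite_subset[OF _ fin[of K]])
qed

lemma counts_point_sum:
  assumes fin: "\<And>r. finite {i \<in> I. x i \<in> window r}"
  shows "counts r (point_sum space_E I x) = map (\<lambda>c. card {i \<in> I. x i \<in> cell r c}) (cells r)"
  unfolding counts_def
proof (rule map_cong)
  fix c assume c: "c \<in> set (cells r)"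
  have "{i \<in> I. x i \<in> cell r c} \<subseteq> {i \<in> I. x i \<in> window r}"
    using c by (auto simp: cell_def window_iff)
  then have "finite {i \<in> I. x i \<in> cell r c}" using fin finite_subset by blast
  then show "nat \<lfloor>measure (point_sum space_E I x) (cell r c)\<rfloor> = card {i \<in> I. x i \<in> cell r c}"
    by (simp add: measure_point_sum_finite)
qed simp

subsection \<open>Counts on the grid determine the vague topology\<close>

text \<open>
  Let \<open>\<mu>\<close> have finitely many points in a window that contains the support of \<open>f\<close>.  For a fine grid
  every cell with such a point lies where \<open>f\<close> is nearly constant, so any point measure with the
  same counts integrates \<open>f\<close> to nearly the same value.
\<close>

lemma counts_control_integral:
  assumes \<mu>: "\<mu> \<in> point_measures space_E" and f: "f \<in> cc_fun space_E" and \<epsilon>: "0 < \<epsilon>"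
  shows "\<forall>\<^sub>F r in sequentially. \<forall>\<mu>'\<in>point_measures space_E. counts r \<mu>' = counts r \<mu> \<longrightarrow> \<bar>integral\<^sup>L \<mu>' f - integral\<^sup>L \<mu> f\<bar> < \<epsilon>"
proof -
  obtain I :: "nat set" and x where \<mu>_eq: "\<mu> = point_sum space_E I x"
    and fin: "\<And>K. compact K \<Longrightarrow> K \<subseteq> space_E \<Longrightarrow> finite {i \<in> I. x i \<in> K}"
    using \<mu> by (auto simp: point_measures_def)
  obtain K where fc: "continuous_on space_E f" and K: "compact K" "K \<subseteq> space_E" "\<And>p. p \<in> space_E - K \<Longrightarrow> f p = 0"
    using f by (auto simp: cc_fun_def)
  have fm: "f \<in> borel_measurable (restrict_space borel space_E)"
    using fc by (rule borel_measurable_continuous_on_restrict)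
  obtain r0 where r0: "K \<subseteq> window r0" using compact_subset_window[OF K(1,2)] by blast
  have f0: "f p = 0" if "p \<in> space_E" "p \<notin> window r0" for p using K(3)[of p] r0 that by auto
  have winE: "window r \<subseteq> space_E" for r by (auto simp: window_def)
  define P where "P = {i \<in> I. x i \<in> window r0}"
  have finP: "finite P" unfolding P_def by (rule finite_in_window[OF fin])
  \<comment> \<open>each of the \<open>card P\<close> points contributes an error of at most \<open>2 \<delta>\<close>\<close>
  define \<delta> where "\<delta> = \<epsilon> / (2 * (real (card P) + 1))"
  have \<delta>: "0 < \<delta>" using \<epsilon> by (simp add: \<delta>_def)
  have "\<forall>\<^sub>F r in sequentially. \<forall>i\<in>P. \<forall>p\<in>space_E. cell_index r p = cell_index r (x i) \<longrightarrow> \<bar>f p - f (x i)\<bar> < \<delta>"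
  proof (rule eventually_ball_finite[OF finP], rule ballI)
    fix i assume "i \<in> P"
    then have xi: "x i \<in> space_E" using winE by (auto simp: P_def)
    have op: "open {f (x i) - \<delta><..<f (x i) + \<delta>}" "f (x i) \<in> {f (x i) - \<delta><..<f (x i) + \<delta>}" using \<delta> by auto
    then obtain V where V: "open V" "x i \<in> V" "\<And>p. p \<in> space_E \<Longrightarrow> p \<in> V \<Longrightarrow> f p \<in> {f (x i) - \<delta><..<f (x i) + \<delta>}"
      using fc xi unfolding continuous_on_topological by metis
    have "\<bar>f p - f (x i)\<bar> < \<delta>" if "p \<in> space_E" "p \<in> V" for p
      using V(3)[OF that] by (auto simp: abs_less_iff)
    with cell_index_shrinks[OF xi V(1,2)]
    show "\<forall>\<^sub>F r in sequentially. \<forall>p\<in>space_E. cell_index r p = cell_index r (x i) \<longrightarrow> \<bar>f p - f (x i)\<bar> < \<delta>"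
      by (auto elim!: eventually_mono)
  qed
  then show ?thesis
    using eventually_ge_at_top[of r0]
  proof eventually_elim
    case (elim r)
    show ?case
    proof (intro ballI impI)
      fix \<mu>' assume \<mu>': "\<mu>' \<in> point_measures space_E" and ceq: "counts r \<mu>' = counts r \<mu>"
      obtain I' :: "nat set" and x' where \<mu>'_eq: "\<mu>' = point_sum space_E I' x'"
        and fin': "\<And>K. compact K \<Longrightarrow> K \<subseteq> space_E \<Longrightarrow> finite {i \<in> I'. x' i \<in> K}"
        using \<mu>' by (auto simp: point_measures_def)
      define P' where "P' = {i \<in> I'. x' i \<in> window r0}"
      have finP': "finite P'" unfolding P'_def by (rule finite_in_window[OF fin'])
      have int: "integral\<^sup>L \<mu> f = (\<Sum>i\<in>P. f (x i))"
        unfolding \<mu>_eq by (rule integral_point_sum[OF fm finP]) (use f0 winE in \<open>auto simp: P_def\<close>)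
      have int': "integral\<^sup>L \<mu>' f = (\<Sum>i\<in>P'. f (x' i))"
        unfolding \<mu>'_eq by (rule integral_point_sum[OF fm finP']) (use f0 winE in \<open>auto simp: P'_def\<close>)
      let ?C = "set (cells r)"
      let ?g = "\<lambda>i. cell_index r (x i)" and ?g' = "\<lambda>i. cell_index r (x' i)"
      have card_eq: "card {i \<in> I'. x' i \<in> cell r c} = card {i \<in> I. x i \<in> cell r c}" if "c \<in> ?C" for c
      proof -
        have c1: "counts r (point_sum space_E I x) = map (\<lambda>c. card {i \<in> I. x i \<in> cell r c}) (cells r)"
          by (rule counts_point_sum) (rule finite_in_window[OF fin])
        have c2: "counts r (point_sum space_E I' x') = map (\<lambda>c. card {i \<in> I'. x' i \<in> cell r c}) (cells r)"
          by (rule counts_point_sum) (rule finite_in_window[OF fin'])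
        have "map (\<lambda>c. card {i \<in> I'. x' i \<in> cell r c}) (cells r) = map (\<lambda>c. card {i \<in> I. x i \<in> cell r c}) (cells r)"
          using ceq unfolding \<mu>_eq \<mu>'_eq c1 c2 .
        then show ?thesis using that by simp
      qed
      have cells_P: "?g i \<in> ?C" if "i \<in> P" for i
        using that window_mono[OF elim(2)] window_iff[of "x i" r] winE[of r0] by (auto simp: P_def)
      have cells_P': "?g' i \<in> ?C" if "i \<in> P'" for i
        using that window_mono[OF elim(2)] window_iff[of "x' i" r] winE[of r0] by (auto simp: P'_def)
      have class_card: "card {i \<in> P'. ?g' i = c} = card {i \<in> P. ?g i = c}" if c: "c \<in> ?C" for c
      proof (cases "\<exists>p\<in>window r0. cell_index r p = c")
        case True
        then obtain p where p: "p \<in> window r0" "cell_index r p = c" by blast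
        have pw: "q \<in> window r0 \<longleftrightarrow> q \<in> space_E" if "cell_index r q = c" for q
          using window_cell_index[OF elim(2), of p q] p winE[of r0] that by (metis subsetD)
        have e: "x i \<in> window r0 \<longleftrightarrow> x i \<in> space_E" if "?g i = c" for i
          using pw[of "x i"] that by simp
        have e': "x' i \<in> window r0 \<longleftrightarrow> x' i \<in> space_E" if "?g' i = c" for i
          using pw[of "x' i"] that by simp
        have "{i \<in> P. ?g i = c} = {i \<in> I. x i \<in> cell r c}"
          using e by (auto simp: P_def cell_def)
        moreover have "{i \<in> P'. ?g' i = c} = {i \<in> I'. x' i \<in> cell r c}"
          using e' by (auto simp: P'_def cell_def)
        ultimately show ?thesis using card_eq[OF c] by simp
      next
        case False
        then have "{i \<in> P. ?g i = c} = {}" "{i \<in> P'. ?g' i = c} = {}" by (auto simp: P_def P'_def)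
        then show ?thesis by (simp only: card.empty)
      qed
      have class_sum: "\<bar>(\<Sum>i\<in>{i \<in> P'. ?g' i = c}. f (x' i)) - (\<Sum>i\<in>{i \<in> P. ?g i = c}. f (x i))\<bar> \<le> 2 * \<delta> * real (card {i \<in> P. ?g i = c})"
        if c: "c \<in> ?C" for c
      proof (cases "{i \<in> P. ?g i = c} = {}")
        case True
        then have "card {i \<in> P'. ?g' i = c} = 0" using class_card[OF c] by (simp only: card.empty)
        then have "{i \<in> P'. ?g' i = c} = {}" using finP' by simp
        then show ?thesis using True by (simp only: sum.empty card.empty)
      next
        case False
        then obtain i0 where i0: "i0 \<in> P" "?g i0 = c" by auto
        let ?n = "real (card {i \<in> P. ?g i = c})"
        have near: "\<bar>f p - f (x i0)\<bar> \<le> \<delta>" if "p \<in> space_E" "cell_index r p = c" for p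
          using bspec[OF bspec[OF elim(1) i0(1)] that(1)] that(2) i0(2) by (simp add: less_imp_le)
        have "\<bar>(\<Sum>i\<in>{i \<in> P. ?g i = c}. f (x i)) - ?n * f (x i0)\<bar> = \<bar>\<Sum>i\<in>{i \<in> P. ?g i = c}. f (x i) - f (x i0)\<bar>"
          by (simp add: sum_subtractf)
        also have "\<dots> \<le> (\<Sum>i\<in>{i \<in> P. ?g i = c}. \<delta>)"
          by (intro order_trans[OF sum_abs] sum_mono near) (use winE[of r0] in \<open>auto simp: P_def\<close>)
        finally have 1: "\<bar>(\<Sum>i\<in>{i \<in> P. ?g i = c}. f (x i)) - ?n * f (x i0)\<bar> \<le> ?n * \<delta>" by simp
        have "\<bar>(\<Sum>i\<in>{i \<in> P'. ?g' i = c}. f (x' i)) - ?n * f (x i0)\<bar> = \<bar>\<Sum>i\<in>{i \<in> P'. ?g' i = c}. f (x' i) - f (x i0)\<bar>"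
          by (simp add: sum_subtractf class_card[OF c])
        also have "\<dots> \<le> (\<Sum>i\<in>{i \<in> P'. ?g' i = c}. \<delta>)"
          by (intro order_trans[OF sum_abs] sum_mono near) (use winE[of r0] in \<open>auto simp: P'_def\<close>)
        finally have 2: "\<bar>(\<Sum>i\<in>{i \<in> P'. ?g' i = c}. f (x' i)) - ?n * f (x i0)\<bar> \<le> ?n * \<delta>"
          by (simp add: class_card[OF c])
        from 1 2 show ?thesis by (simp add: abs_le_iff algebra_simps)
      qed
      have "integral\<^sup>L \<mu>' f - integral\<^sup>L \<mu> f = (\<Sum>c\<in>?C. \<Sum>i\<in>{i \<in> P'. ?g' i = c}. f (x' i)) - (\<Sum>c\<in>?C. \<Sum>i\<in>{i \<in> P. ?g i = c}. f (x i))"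
        unfolding int int' using finP finP' cells_P cells_P' by (subst (1 2) sum.group) auto
      also have "\<bar>\<dots>\<bar> \<le> (\<Sum>c\<in>?C. 2 * \<delta> * real (card {i \<in> P. ?g i = c}))"
        unfolding sum_subtractf[symmetric] by (intro order_trans[OF sum_abs] sum_mono class_sum)
      also have "\<dots> = 2 * \<delta> * (\<Sum>c\<in>?C. \<Sum>i\<in>{i \<in> P. ?g i = c}. 1)"
        by (simp add: sum_distrib_left)
      also have "(\<Sum>c\<in>?C. \<Sum>i\<in>{i \<in> P. ?g i = c}. 1) = real (card P)"
        using finP cells_P by (subst sum.group) auto
      also have "2 * \<delta> * real (card P) < \<epsilon>"
        using \<epsilon> by (simp add: \<delta>_def field_simps)
      finally show "\<bar>integral\<^sup>L \<mu>' f - integral\<^sup>L \<mu> f\<bar> < \<epsilon>" .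
    qed
  qed
qed

lemma counts_determine_open:
  assumes U: "openin (vague_topology space_E) U" and \<mu>: "\<mu> \<in> U"
  shows "\<forall>\<^sub>F r in sequentially. \<forall>\<mu>'\<in>point_measures space_E. counts r \<mu>' = counts r \<mu> \<longrightarrow> \<mu>' \<in> U"
proof -
  let ?S = "{{\<mu> \<in> point_measures space_E. integral\<^sup>L \<mu> f \<in> U} | f U. f \<in> cc_fun space_E \<and> open U}"
  have "generate_topology_on ?S U"
    using U unfolding vague_topology_def openin_topology_generated_by_iff .
  then have "\<forall>\<mu>\<in>U. \<forall>\<^sub>F r in sequentially. \<forall>\<mu>'\<in>point_measures space_E. counts r \<mu>' = counts r \<mu> \<longrightarrow> \<mu>' \<in> U"
  proof (induction rule: generate_topology_on.induct)
    case Empty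
    then show ?case by simp
  next
    case (Int a b)
    show ?case
    proof
      fix \<mu> assume "\<mu> \<in> a \<inter> b"
      then have "\<forall>\<^sub>F r in sequentially. \<forall>\<mu>'\<in>point_measures space_E. counts r \<mu>' = counts r \<mu> \<longrightarrow> \<mu>' \<in> a"
        "\<forall>\<^sub>F r in sequentially. \<forall>\<mu>'\<in>point_measures space_E. counts r \<mu>' = counts r \<mu> \<longrightarrow> \<mu>' \<in> b"
        using Int.IH by auto
      then show "\<forall>\<^sub>F r in sequentially. \<forall>\<mu>'\<in>point_measures space_E. counts r \<mu>' = counts r \<mu> \<longrightarrow> \<mu>' \<in> a \<inter> b"
        by eventually_elim blast
    qed
  next
    case (UN K)
    show ?case
    proof
      fix \<mu> assume "\<mu> \<in> \<Union>K"
      then obtain k where k: "k \<in> K" "\<mu> \<in> k" by auto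
      from UN.IH[OF k(1)] k(2) have "\<forall>\<^sub>F r in sequentially. \<forall>\<mu>'\<in>point_measures space_E. counts r \<mu>' = counts r \<mu> \<longrightarrow> \<mu>' \<in> k" by blast
      then show "\<forall>\<^sub>F r in sequentially. \<forall>\<mu>'\<in>point_measures space_E. counts r \<mu>' = counts r \<mu> \<longrightarrow> \<mu>' \<in> \<Union>K"
        by eventually_elim (use k in blast)
    qed
  next
    case (Basis s)
    then obtain f B where s: "s = {\<mu> \<in> point_measures space_E. integral\<^sup>L \<mu> f \<in> B}" and f: "f \<in> cc_fun space_E" and B: "open B"
      by blast
    show ?case
    proof
      fix \<mu> assume "\<mu> \<in> s"
      then have \<mu>: "\<mu> \<in> point_measures space_E" "integral\<^sup>L \<mu> f \<in> B" by (auto simp: s)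
      obtain e where e: "0 < e" "\<And>y. \<bar>y - integral\<^sup>L \<mu> f\<bar> < e \<Longrightarrow> y \<in> B"
        using B \<mu>(2) by (auto simp: open_dist dist_real_def)
      from counts_control_integral[OF \<mu>(1) f e(1)]
      show "\<forall>\<^sub>F r in sequentially. \<forall>\<mu>'\<in>point_measures space_E. counts r \<mu>' = counts r \<mu> \<longrightarrow> \<mu>' \<in> s"
        by eventually_elim (use e(2) in \<open>auto simp: s\<close>)
    qed
  qed
  with \<mu> show ?thesis by blast
qed

text \<open>
  The count vectors that force membership in \<open>U\<close>.
\<close>

definition inner_counts :: "(real \<times> ereal) measure set \<Rightarrow> nat \<Rightarrow> nat list set" where
  "inner_counts U r = {s. \<forall>\<mu>\<in>point_measures space_E. counts r \<mu> = s \<longrightarrow> \<mu> \<in> U}"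

lemma counts_determine_open':
  assumes U: "openin (vague_topology space_E) U" and \<mu>: "\<mu> \<in> point_measures space_E"
  shows "\<mu> \<in> U \<longleftrightarrow> (\<forall>\<^sub>F r in sequentially. counts r \<mu> \<in> inner_counts U r)"
proof
  assume "\<mu> \<in> U"
  from counts_determine_open[OF U this] show "\<forall>\<^sub>F r in sequentially. counts r \<mu> \<in> inner_counts U r"
    by eventually_elim (auto simp: inner_counts_def)
next
  assume "\<forall>\<^sub>F r in sequentially. counts r \<mu> \<in> inner_counts U r"
  then obtain r where "counts r \<mu> \<in> inner_counts U r" by (auto simp: eventually_sequentially)
  then show "\<mu> \<in> U" using \<mu> by (auto simp: inner_counts_def)
qed

lemma sets_borel_of_pow: "{U. openin T U} \<subseteq> Pow (topspace T)"
  by (auto dest: openin_subset)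

lemma space_borel_of: "space (borel_of T) = topspace T"
  unfolding borel_of_def by (rule space_measure_of[OF sets_borel_of_pow])

lemma openin_borel_of: "openin T U \<Longrightarrow> U \<in> sets (borel_of T)"
  unfolding borel_of_def by (simp add: sets_measure_of[OF sets_borel_of_pow])

lemma measurable_borel_of_vagueI:
  assumes Y: "\<And>\<omega>. \<omega> \<in> space M \<Longrightarrow> Y \<omega> \<in> point_measures space_E"
    and meas: "\<And>r s. {\<omega> \<in> space M. counts r (Y \<omega>) = s} \<in> sets M"
  shows "Y \<in> measurable M (borel_of (vague_topology space_E))"
  unfolding borel_of_def
proof (rule measurable_measure_of[OF sets_borel_of_pow])
  show "Y \<in> space M \<rightarrow> topspace (vague_topology space_E)"
    using Y by (auto simp: topspace_vague_topology)
  fix U assume "U \<in> {U. openin (vague_topology space_E) U}"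
  then have U: "openin (vague_topology space_E) U" by simp
  have "Y -` U \<inter> space M = {\<omega> \<in> space M. \<exists>N. \<forall>r\<ge>N. counts r (Y \<omega>) \<in> inner_counts U r}"
    using counts_determine_open'[OF U Y] by (auto simp: eventually_sequentially)
  also have "\<dots> \<in> sets M"
  proof -
    have "{\<omega> \<in> space M. counts r (Y \<omega>) \<in> inner_counts U r} = (\<Union>s\<in>inner_counts U r. {\<omega> \<in> space M. counts r (Y \<omega>) = s})" for r
      by auto
    moreover have "(\<Union>s\<in>inner_counts U r. {\<omega> \<in> space M. counts r (Y \<omega>) = s}) \<in> sets M" for r
      by (rule sets.countable_UN') (use meas in auto)
    ultimately have "{\<omega> \<in> space M. counts r (Y \<omega>) \<in> inner_counts U r} \<in> sets M" for r by simp
    then show ?thesis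
      by (intro sets.sets_Collect_countable_Ex sets.sets_Collect_countable_All sets.sets_Collect_imp sets.sets_Collect_const)
  qed
  finally show "Y -` U \<inter> space M \<in> sets M" .
qed

subsection \<open>The convergence criterion\<close>

lemma continuous_map_measurable_borel_of:
  assumes f: "continuous_map T euclideanreal f"
  shows "f \<in> borel_measurable (borel_of T)"
proof (rule borel_measurableI)
  fix S :: "real set" assume "open S"
  then have "openin T {x \<in> topspace T. f x \<in> S}"
    using f by (simp add: continuous_map_def)
  moreover have "f -` S \<inter> space (borel_of T) = {x \<in> topspace T. f x \<in> S}"
    by (auto simp: space_borel_of)
  ultimately show "f -` S \<inter> space (borel_of T) \<in> sets (borel_of T)"
    by (simp add: openin_borel_of)
qed

text \<open>Lower bounds for open half-lines give convergence of the distribution functions.\<close>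

lemma weak_conv_of_open_halflines:
  fixes X :: "nat \<Rightarrow> 'a \<Rightarrow> real" and X0 :: "'b \<Rightarrow> real"
  assumes M: "prob_space M" and M': "prob_space M'"
    and X: "\<And>n. X n \<in> borel_measurable M" and X0: "X0 \<in> borel_measurable M'"
    and gt: "\<And>a c. c < measure M' {\<omega> \<in> space M'. a < X0 \<omega>} \<Longrightarrow> \<forall>\<^sub>F n in sequentially. c < measure M {\<omega> \<in> space M. a < X n \<omega>}"
    and lt: "\<And>a c. c < measure M' {\<omega> \<in> space M'. X0 \<omega> < a} \<Longrightarrow> \<forall>\<^sub>F n in sequentially. c < measure M {\<omega> \<in> space M. X n \<omega> < a}"
  shows "weak_conv_m (\<lambda>n. distr M borel (X n)) (distr M' borel X0)"
proof -
  interpret M: prob_space M by fact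
  interpret M': prob_space M' by fact
  note [measurable] = X X0
  have F: "cdf (distr M borel (X n)) a = 1 - measure M {\<omega> \<in> space M. a < X n \<omega>}"
      "cdf (distr M borel (X n)) a = measure M {\<omega> \<in> space M. X n \<omega> \<le> a}" for n a
  proof -
    show 1: "cdf (distr M borel (X n)) a = measure M {\<omega> \<in> space M. X n \<omega> \<le> a}"
      by (simp add: cdf_def measure_distr vimage_def Int_def conj_commute)
    have "{\<omega> \<in> space M. X n \<omega> \<le> a} = space M - {\<omega> \<in> space M. a < X n \<omega>}" by auto
    then show "cdf (distr M borel (X n)) a = 1 - measure M {\<omega> \<in> space M. a < X n \<omega>}"
      unfolding 1 by (simp add: M.prob_compl)
  qed
  have F0: "cdf (distr M' borel X0) a = 1 - measure M' {\<omega> \<in> space M'. a < X0 \<omega>}"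
      "cdf (distr M' borel X0) a = measure M' {\<omega> \<in> space M'. X0 \<omega> \<le> a}" for a
  proof -
    show 1: "cdf (distr M' borel X0) a = measure M' {\<omega> \<in> space M'. X0 \<omega> \<le> a}"
      by (simp add: cdf_def measure_distr vimage_def Int_def conj_commute)
    have "{\<omega> \<in> space M'. X0 \<omega> \<le> a} = space M' - {\<omega> \<in> space M'. a < X0 \<omega>}" by auto
    then show "cdf (distr M' borel X0) a = 1 - measure M' {\<omega> \<in> space M'. a < X0 \<omega>}"
      unfolding 1 by (simp add: M'.prob_compl)
  qed
  interpret D0: real_distribution "distr M' borel X0" by simp
  show ?thesis
    unfolding weak_conv_m_def weak_conv_def
  proof (intro allI impI)
    fix a assume "isCont (cdf (distr M' borel X0)) a"
    then have "measure (distr M' borel X0) {a} = 0" by (simp add: D0.isCont_cdf)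
    then have z: "measure M' {\<omega> \<in> space M'. X0 \<omega> = a} = 0"
      by (simp add: measure_distr vimage_def Int_def conj_commute)
    have "measure M' {\<omega> \<in> space M'. X0 \<omega> \<le> a} = measure M' ({\<omega> \<in> space M'. X0 \<omega> < a} \<union> {\<omega> \<in> space M'. X0 \<omega> = a})"
      by (rule arg_cong[where f="measure M'"]) auto
    also have "\<dots> \<le> measure M' {\<omega> \<in> space M'. X0 \<omega> < a} + measure M' {\<omega> \<in> space M'. X0 \<omega> = a}"
      by (rule measure_Un_le) measurable
    finally have le: "cdf (distr M' borel X0) a \<le> measure M' {\<omega> \<in> space M'. X0 \<omega> < a}" using z F0(2) by simp
    show "(\<lambda>n. cdf (distr M borel (X n)) a) \<longlonglongrightarrow> cdf (distr M' borel X0) a"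
    proof (rule order_tendstoI)
      fix c assume "c < cdf (distr M' borel X0) a"
      then have "c < measure M' {\<omega> \<in> space M'. X0 \<omega> < a}" using le by simp
      from lt[OF this] show "\<forall>\<^sub>F n in sequentially. c < cdf (distr M borel (X n)) a"
      proof eventually_elim
        case (elim n)
        have "measure M {\<omega> \<in> space M. X n \<omega> < a} \<le> measure M {\<omega> \<in> space M. X n \<omega> \<le> a}"
          by (intro M.finite_measure_mono) auto
        then show ?case using elim F(2)[of n a] by simp
      qed
    next
      fix c assume "cdf (distr M' borel X0) a < c"
      then have "1 - c < measure M' {\<omega> \<in> space M'. a < X0 \<omega>}" using F0(1)[of a] by simp
      from gt[OF this] show "\<forall>\<^sub>F n in sequentially. cdf (distr M borel (X n)) a < c"
        by eventually_elim (use F(1) in simp)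
    qed
  qed
qed

text \<open>
  By \<open>counts_determine_open'\<close> an open set \<open>U\<close> is, up to a small probability under the limit law, described by
  finitely many count vectors that force membership in \<open>U\<close>.  This gives \<open>liminf P(Y\<^sub>n \<in> U) \<ge> P(Z \<in> U)\<close>, the
  portmanteau criterion, which is applied to the preimages of half-lines under a bounded continuous function.
\<close>

theorem converges_weakly_of_counts:
  assumes M: "prob_space M" and M': "prob_space M'"
    and Y: "\<And>n. Y n \<in> measurable M (borel_of (vague_topology space_E))"
    and Z: "Z \<in> measurable M' (borel_of (vague_topology space_E))"
    and Ym: "\<And>n r s. {\<omega> \<in> space M. counts r (Y n \<omega>) = s} \<in> sets M"
    and Zm: "\<And>r s. {\<omega> \<in> space M'. counts r (Z \<omega>) = s} \<in> sets M'"
    and conv: "\<And>r s. (\<lambda>n. measure M {\<omega> \<in> space M. counts r (Y n \<omega>) = s}) \<longlonglongrightarrow> measure M' {\<omega> \<in> space M'. counts r (Z \<omega>) = s}"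
  shows "converges_weakly (vague_topology space_E) M Y M' Z"
proof -
  interpret M: prob_space M by fact
  interpret M': prob_space M' by fact
  have Ypm: "Y n \<omega> \<in> point_measures space_E" if "\<omega> \<in> space M" for n \<omega>
    using measurable_space[OF Y that] by (simp add: space_borel_of topspace_vague_topology)
  have Zpm: "Z \<omega> \<in> point_measures space_E" if "\<omega> \<in> space M'" for \<omega>
    using measurable_space[OF Z that] by (simp add: space_borel_of topspace_vague_topology)
  have portmanteau: "\<forall>\<^sub>F n in sequentially. c < measure M {\<omega> \<in> space M. Y n \<omega> \<in> U}"
    if U: "openin (vague_topology space_E) U" and c: "c < measure M' {\<omega> \<in> space M'. Z \<omega> \<in> U}" for U c
  proof -
    define A where "A r = {\<omega> \<in> space M'. counts r (Z \<omega>) \<in> inner_counts U r}" for r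
    have A_un: "A r = (\<Union>s\<in>inner_counts U r. {\<omega> \<in> space M'. counts r (Z \<omega>) = s})" for r
      by (auto simp: A_def)
    have A [measurable]: "A r \<in> sets M'" for r
      unfolding A_un by (rule sets.countable_UN') (use Zm in auto)
    have ZU [measurable]: "{\<omega> \<in> space M'. Z \<omega> \<in> U} \<in> sets M'"
      using measurable_sets[OF Z openin_borel_of[OF U]] by (simp add: vimage_def Int_def conj_commute)
    have "(\<lambda>r. integral\<^sup>L M' (indicator (A r) :: _ \<Rightarrow> real)) \<longlonglongrightarrow> integral\<^sup>L M' (indicator {\<omega> \<in> space M'. Z \<omega> \<in> U})"
    proof (rule integral_dominated_convergence[where w="\<lambda>_. 1"])
      show "AE \<omega> in M'. (\<lambda>r. indicator (A r) \<omega> :: real) \<longlonglongrightarrow> indicator {\<omega> \<in> space M'. Z \<omega> \<in> U} \<omega>"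
      proof (rule AE_I2)
        fix \<omega> assume \<omega>: "\<omega> \<in> space M'"
        show "(\<lambda>r. indicator (A r) \<omega> :: real) \<longlonglongrightarrow> indicator {\<omega> \<in> space M'. Z \<omega> \<in> U} \<omega>"
        proof (cases "Z \<omega> \<in> U")
          case True
          then have "\<forall>\<^sub>F r in sequentially. counts r (Z \<omega>) \<in> inner_counts U r"
            using counts_determine_open'[OF U Zpm[OF \<omega>]] by simp
          then have "\<forall>\<^sub>F r in sequentially. indicator (A r) \<omega> = (1 :: real)"
            by eventually_elim (use \<omega> in \<open>simp add: A_def\<close>)
          then show ?thesis using True \<omega> by (simp add: tendsto_eventually)
        next
          case False
          then have "indicator (A r) \<omega> = (0 :: real)" for r
            using Zpm[OF \<omega>] by (auto simp: A_def inner_counts_def indicator_def)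
          then show ?thesis using False by simp
        qed
      qed
    qed (auto simp: indicator_def)
    then have "(\<lambda>r. measure M' (A r)) \<longlonglongrightarrow> measure M' {\<omega> \<in> space M'. Z \<omega> \<in> U}" by simp
    then have "\<forall>\<^sub>F r in sequentially. c < measure M' (A r)" using c by (rule order_tendstoD)
    then obtain r where r: "c < measure M' (A r)" by (auto simp: eventually_sequentially)
    define S where "S = inner_counts U r"
    define B where "B k = {s \<in> S. to_nat s < k}" for k
    have finB: "finite (B k)" for k
      by (rule finite_imageD[where f=to_nat]) (auto simp: B_def intro: finite_subset[of _ "{..<k}"])
    have "(\<lambda>k. measure M' (\<Union>s\<in>B k. {\<omega> \<in> space M'. counts r (Z \<omega>) = s})) \<longlonglongrightarrow> measure M' (\<Union>k. \<Union>s\<in>B k. {\<omega> \<in> space M'. counts r (Z \<omega>) = s})"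
      by (rule M'.finite_Lim_measure_incseq) (use finB Zm in \<open>auto simp: incseq_def B_def intro!: sets.countable_UN'\<close>)
    also have "(\<Union>k. \<Union>s\<in>B k. {\<omega> \<in> space M'. counts r (Z \<omega>) = s}) = A r"
      unfolding A_un by (auto simp: B_def S_def)
    finally have "\<forall>\<^sub>F k in sequentially. c < measure M' (\<Union>s\<in>B k. {\<omega> \<in> space M'. counts r (Z \<omega>) = s})"
      using r by (rule order_tendstoD)
    then obtain k where k: "c < measure M' (\<Union>s\<in>B k. {\<omega> \<in> space M'. counts r (Z \<omega>) = s})"
      by (auto simp: eventually_sequentially)
    also have "measure M' (\<Union>s\<in>B k. {\<omega> \<in> space M'. counts r (Z \<omega>) = s}) = (\<Sum>s\<in>B k. measure M' {\<omega> \<in> space M'. counts r (Z \<omega>) = s})"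
      by (rule M'.finite_measure_finite_Union) (use finB Zm in \<open>auto simp: disjoint_family_on_def\<close>)
    finally have c_sum: "c < (\<Sum>s\<in>B k. measure M' {\<omega> \<in> space M'. counts r (Z \<omega>) = s})" .
    have "(\<lambda>n. \<Sum>s\<in>B k. measure M {\<omega> \<in> space M. counts r (Y n \<omega>) = s}) \<longlonglongrightarrow> (\<Sum>s\<in>B k. measure M' {\<omega> \<in> space M'. counts r (Z \<omega>) = s})"
      by (intro tendsto_sum conv)
    then have "\<forall>\<^sub>F n in sequentially. c < (\<Sum>s\<in>B k. measure M {\<omega> \<in> space M. counts r (Y n \<omega>) = s})"
      using c_sum by (rule order_tendstoD)
    then show ?thesis
    proof eventually_elim
      case (elim n)
      have YU: "{\<omega> \<in> space M. Y n \<omega> \<in> U} \<in> sets M"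
        using measurable_sets[OF Y openin_borel_of[OF U]] by (simp add: vimage_def Int_def conj_commute)
      have "(\<Sum>s\<in>B k. measure M {\<omega> \<in> space M. counts r (Y n \<omega>) = s}) = measure M (\<Union>s\<in>B k. {\<omega> \<in> space M. counts r (Y n \<omega>) = s})"
        by (rule M.finite_measure_finite_Union[symmetric]) (use finB Ym in \<open>auto simp: disjoint_family_on_def\<close>)
      also have "\<dots> \<le> measure M {\<omega> \<in> space M. Y n \<omega> \<in> U}"
        by (rule M.finite_measure_mono[OF _ YU]) (use Ypm in \<open>auto simp: B_def S_def inner_counts_def\<close>)
      finally show ?case using elim by simp
    qed
  qed
  show ?thesis
    unfolding converges_weakly_def
  proof (intro conjI allI impI Y Z)
    fix f assume f: "continuous_map (vague_topology space_E) euclideanreal f \<and> bounded (f ` topspace (vague_topology space_E))"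
    then obtain B where B: "\<And>\<mu>. \<mu> \<in> point_measures space_E \<Longrightarrow> \<bar>f \<mu>\<bar> \<le> B"
      unfolding bounded_iff topspace_vague_topology by auto
    have fm: "f \<in> borel_measurable (borel_of (vague_topology space_E))"
      using f by (intro continuous_map_measurable_borel_of) auto
    have pre: "openin (vague_topology space_E) {\<mu> \<in> point_measures space_E. f \<mu> \<in> S}" if "open S" for S
      using f that by (simp add: continuous_map_def topspace_vague_topology)
    have Xm: "(\<lambda>\<omega>. f (Y n \<omega>)) \<in> borel_measurable M" for n by (rule measurable_compose[OF Y fm])
    have X0m: "(\<lambda>\<omega>. f (Z \<omega>)) \<in> borel_measurable M'" by (rule measurable_compose[OF Z fm])
    have half: "\<forall>\<^sub>F n in sequentially. c < measure M {\<omega> \<in> space M. f (Y n \<omega>) \<in> S}"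
      if "open S" "c < measure M' {\<omega> \<in> space M'. f (Z \<omega>) \<in> S}" for S c
    proof -
      have "{\<omega> \<in> space M'. f (Z \<omega>) \<in> S} = {\<omega> \<in> space M'. Z \<omega> \<in> {\<mu> \<in> point_measures space_E. f \<mu> \<in> S}}" using Zpm by auto
      moreover have "{\<omega> \<in> space M. f (Y n \<omega>) \<in> S} = {\<omega> \<in> space M. Y n \<omega> \<in> {\<mu> \<in> point_measures space_E. f \<mu> \<in> S}}" for n using Ypm by auto
      ultimately show ?thesis using portmanteau[OF pre[OF that(1)], of c] that(2) by simp
    qed
    have wc: "weak_conv_m (\<lambda>n. distr M borel (\<lambda>\<omega>. f (Y n \<omega>))) (distr M' borel (\<lambda>\<omega>. f (Z \<omega>)))"
      using half[of "{_<..}"] half[of "{..<_}"]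
      by (intro weak_conv_of_open_halflines[OF M M' Xm X0m]) auto
    let ?g = "\<lambda>y::real. max (- B) (min B y)"
    have "(\<lambda>n. integral\<^sup>L (distr M borel (\<lambda>\<omega>. f (Y n \<omega>))) ?g) \<longlonglongrightarrow> integral\<^sup>L (distr M' borel (\<lambda>\<omega>. f (Z \<omega>))) ?g"
    proof (rule weak_conv_imp_integral_bdd_continuous_conv[OF _ _ wc, where B="\<bar>B\<bar>"])
      show "real_distribution (distr M borel (\<lambda>\<omega>. f (Y n \<omega>)))" for n using Xm by simp
      show "real_distribution (distr M' borel (\<lambda>\<omega>. f (Z \<omega>)))" using X0m by simp
      show "isCont ?g y" for y by (intro continuous_intros)
    qed auto
    moreover have clamp: "max (- B) (min B y) = y" if "\<bar>y\<bar> \<le> B" for y :: real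
      using that by (auto simp: abs_le_iff max_def min_def)
    moreover have "integral\<^sup>L (distr M borel (\<lambda>\<omega>. f (Y n \<omega>))) ?g = integral\<^sup>L M (\<lambda>\<omega>. f (Y n \<omega>))" for n
      by (subst integral_distr[OF Xm]) (auto intro!: Bochner_Integration.integral_cong clamp B Ypm)
    moreover have "integral\<^sup>L (distr M' borel (\<lambda>\<omega>. f (Z \<omega>))) ?g = integral\<^sup>L M' (\<lambda>\<omega>. f (Z \<omega>))"
      by (subst integral_distr[OF X0m]) (auto intro!: Bochner_Integration.integral_cong clamp B Zpm)
    ultimately show "(\<lambda>n. integral\<^sup>L M (\<lambda>\<omega>. f (Y n \<omega>))) \<longlonglongrightarrow> integral\<^sup>L M' (\<lambda>\<omega>. f (Z \<omega>))" by simp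
  qed
qed

end

section \<open>First visits and the law of the path\<close>

lemma point_sum_reindex:
  assumes "bij_betw g I J"
  shows "point_sum E I (\<lambda>i. x (g i)) = point_sum E J x"
proof (rule measure_eqI)
  fix A assume "A \<in> sets (point_sum E I (\<lambda>i. x (g i)))"
  then have A: "A \<in> sets (restrict_space borel E)" by (simp add: sets_point_sum)
  have b: "bij_betw g {i \<in> I. x (g i) \<in> A} {j \<in> J. x j \<in> A}"
    using assms by (auto simp: bij_betw_def inj_on_def)
  then show "emeasure (point_sum E I (\<lambda>i. x (g i))) A = emeasure (point_sum E J x) A"
    using bij_betw_finite[OF b] bij_betw_same_card[OF b]
    by (simp add: emeasure_point_sum[OF A] emeasure_count_space)
qed (simp add: sets_point_sum)

definition first_visit :: "(nat \<Rightarrow> int) \<Rightarrow> nat \<Rightarrow> bool" where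
  "first_visit s j \<longleftrightarrow> 1 \<le> j \<and> s j \<notin> s ` {1..<j}"

lemma card_sites_Suc: "card (s ` {1..Suc j}) = card (s ` {1..j}) + of_bool (first_visit s (Suc j))"
proof -
  have "{1..Suc j} = insert (Suc j) {1..j}" by auto
  moreover have "{1..<Suc j} = {1..j}" by auto
  ultimately show ?thesis by (simp add: first_visit_def card_insert_if)
qed

lemma card_sites_mono:
  fixes i j :: nat
  shows "i \<le> j \<Longrightarrow> card (s ` {1..i}) \<le> card (s ` {1..j})"
  by (intro card_mono image_mono) auto

text \<open>
  The number of visited sites grows by one exactly at first visits, so it reaches \<open>k\<close> at one of them.
\<close>

lemma visit_time_eq_iff:
  assumes k: "1 \<le> k"
  shows "visit_time s k = enat j \<longleftrightarrow> first_visit s j \<and> card (s ` {1..j}) = k"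
proof -
  let ?c = "\<lambda>j. card (s ` {1..j})"
  let ?A = "{enat m | m. 1 \<le> m \<and> k \<le> ?c m}"
  have pred: "1 \<le> j \<Longrightarrow> ?c j = ?c (j - 1) + of_bool (first_visit s j)" for j
    using card_sites_Suc[of s "j - 1"] by simp
  show ?thesis
  proof
    assume j: "visit_time s k = enat j"
    have ne: "?A \<noteq> {}"
    proof
      assume "?A = {}"
      then have "visit_time s k = \<infinity>" unfolding visit_time_def by (simp only: Inf_enat_def) simp
      with j show False by simp
    qed
    then have "Inf ?A = (LEAST e. e \<in> ?A)" by (simp only: Inf_enat_def if_False)
    moreover have "(LEAST e. e \<in> ?A) \<in> ?A" by (rule LeastI_ex) (use ne in blast)
    ultimately have "Inf ?A \<in> ?A" by simp
    then have jA: "1 \<le> j" "k \<le> ?c j" using j by (auto simp: visit_time_def)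
    have "\<not> k \<le> ?c (j - 1)"
    proof
      assume le: "k \<le> ?c (j - 1)"
      then have "1 \<le> j - 1" using k by (cases "j - 1") auto
      then have "enat (j - 1) \<in> ?A" using le by auto
      then have "visit_time s k \<le> enat (j - 1)" unfolding visit_time_def by (rule Inf_lower)
      then show False using j jA by simp
    qed
    then show "first_visit s j \<and> ?c j = k" using pred[OF jA(1)] jA(2) by (cases "first_visit s j") auto
  next
    assume a: "first_visit s j \<and> ?c j = k"
    then have j1: "1 \<le> j" by (simp add: first_visit_def)
    have "enat j \<le> e" if "e \<in> ?A" for e
    proof -
      from that obtain m where m: "e = enat m" "1 \<le> m" "k \<le> ?c m" by blast
      have "\<not> m < j"
      proof
        assume "m < j"
        then have "?c m \<le> ?c (j - 1)" by (intro card_sites_mono) simp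
        then show False using m pred[OF j1] a by simp
      qed
      then show ?thesis using m by simp
    qed
    moreover have "enat j \<in> ?A" using a j1 by auto
    ultimately show "visit_time s k = enat j"
      unfolding visit_time_def by (intro antisym Inf_lower Inf_greatest) auto
  qed
qed

lemma bij_betw_visit_time:
  "bij_betw (\<lambda>k. the_enat (visit_time s k)) {k. 1 \<le> k \<and> visit_time s k \<noteq> \<infinity>} {j. first_visit s j}"
proof (rule bij_betw_byWitness[where f'="\<lambda>j. card (s ` {1..j})"])
  have fin: "\<exists>j. visit_time s k = enat j" if "visit_time s k \<noteq> \<infinity>" for k
    using that by (cases "visit_time s k") auto
  have *: "1 \<le> card (s ` {1..j})" if "first_visit s j" for j
  proof -
    have "s j \<in> s ` {1..j}" using that by (auto simp: first_visit_def)
    then have "0 < card (s ` {1..j})" by (auto simp: card_gt_0_iff)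
    then show ?thesis by simp
  qed
  have inv: "visit_time s (card (s ` {1..j})) = enat j" if "first_visit s j" for j
    by (rule iffD2[OF visit_time_eq_iff[OF *[OF that]]]) (simp add: that)
  show "\<forall>k\<in>{k. 1 \<le> k \<and> visit_time s k \<noteq> \<infinity>}. card (s ` {1..the_enat (visit_time s k)}) = k"
  proof
    fix k assume "k \<in> {k. 1 \<le> k \<and> visit_time s k \<noteq> \<infinity>}"
    then obtain j where "1 \<le> k" "visit_time s k = enat j" using fin by auto
    then show "card (s ` {1..the_enat (visit_time s k)}) = k" using visit_time_eq_iff[of k s j] by simp
  qed
  show "\<forall>j\<in>{j. first_visit s j}. the_enat (visit_time s (card (s ` {1..j}))) = j"
    using inv by simp
  show "(\<lambda>k. the_enat (visit_time s k)) ` {k. 1 \<le> k \<and> visit_time s k \<noteq> \<infinity>} \<subseteq> {j. first_visit s j}"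
  proof
    fix j' assume "j' \<in> (\<lambda>k. the_enat (visit_time s k)) ` {k. 1 \<le> k \<and> visit_time s k \<noteq> \<infinity>}"
    then obtain k j where "1 \<le> k" "visit_time s k = enat j" "j' = the_enat (visit_time s k)" using fin by auto
    then show "j' \<in> {j. first_visit s j}" using visit_time_eq_iff[of k s j] by simp
  qed
  show "(\<lambda>j. card (s ` {1..j})) ` {j. first_visit s j} \<subseteq> {k. 1 \<le> k \<and> visit_time s k \<noteq> \<infinity>}"
  proof
    fix k assume "k \<in> (\<lambda>j. card (s ` {1..j})) ` {j. first_visit s j}"
    then obtain j where "first_visit s j" "k = card (s ` {1..j})" by blast
    then show "k \<in> {k. 1 \<le> k \<and> visit_time s k \<noteq> \<infinity>}" using *[of j] inv[of j] by simp
  qed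
qed

text \<open>The finite visit times enumerate the times of first visits without repetition.\<close>

lemma first_visit_process_eq:
  "first_visit_process E X \<xi> a b n \<omega> = point_sum ({0..} \<times> E) {j. first_visit (\<lambda>j. walk X j \<omega>) j}
     (\<lambda>j. (real j / real n, ereal ((\<xi> (walk X j \<omega>) \<omega> - b) / a)))"
  unfolding first_visit_process_def Let_def
  by (rule point_sum_reindex[OF bij_betw_visit_time, where E="{0..} \<times> E" and x="\<lambda>j. (real j / real n, ereal ((\<xi> (walk X j \<omega>) \<omega> - b) / a))"])

lemma visited_eq_image: "visited z w = (\<lambda>j. z + sum_list (take j w)) ` {1..length w}"
proof (induction w arbitrary: z)
  case (Cons x w)
  have "{1..length (x # w)} = insert 1 (Suc ` {1..length w})"
    by (auto simp: image_iff)
  then have "(\<lambda>j. z + sum_list (take j (x # w))) ` {1..length (x # w)}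
      = insert (z + x) ((\<lambda>j. z + x + sum_list (take j w)) ` {1..length w})"
    by (simp only: image_insert image_image) (simp add: add.assoc)
  then show ?case using Cons[of "z + x"] by simp
qed simp

lemma pmf_replicate_pmf: "length w = n \<Longrightarrow> pmf (replicate_pmf n \<rho>) w = (\<Prod>i<n. pmf \<rho> (w ! i))"
proof (induction n arbitrary: w)
  case (Suc n)
  then obtain x v where w: "w = x # v" "length v = n" by (cases w) auto
  have "pmf (replicate_pmf (Suc n) \<rho>) w = measure_pmf.expectation \<rho> (\<lambda>y. pmf (map_pmf ((#) y) (replicate_pmf n \<rho>)) (x # v))"
    by (simp add: w(1) pmf_bind map_pmf_def)
  also have "\<dots> = measure_pmf.expectation \<rho> (\<lambda>y. indicator {x} y * pmf (replicate_pmf n \<rho>) v)"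
  proof (intro integral_pmf_cong)
    fix y
    show "pmf (map_pmf ((#) y) (replicate_pmf n \<rho>)) (x # v) = indicator {x} y * pmf (replicate_pmf n \<rho>) v"
    proof (cases "y = x")
      case True
      then show ?thesis by (simp add: pmf_map_inj' inj_def)
    next
      case False
      then have "pmf (map_pmf ((#) y) (replicate_pmf n \<rho>)) (x # v) = 0"
        unfolding pmf_eq_0_set_pmf by auto
      then show ?thesis using False by simp
    qed
  qed
  also have "\<dots> = pmf \<rho> x * pmf (replicate_pmf n \<rho>) v" by (simp add: measure_pmf_single)
  finally show ?case
    unfolding w(1) prod.lessThan_Suc_shift o_def using Suc.IH[OF w(2)] by (simp del: replicate_pmf.simps)
qed simp

locale walk_scenery_space = prob_space M for M :: "'w measure" +
  fixes X :: "nat \<Rightarrow> 'w \<Rightarrow> int" and \<xi> :: "int \<Rightarrow> 'w \<Rightarrow> real"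
  assumes X_indep: "indep_vars (\<lambda>_. count_space UNIV) X {1..}"
    and X_distr: "\<And>k. 1 \<le> k \<Longrightarrow> distr M (count_space UNIV) (X k) = distr M (count_space UNIV) (X 1)"
    and \<xi>_stationary: "stationary M \<xi>"
    and X_\<xi>_indep: "indep_set
      (sets (vimage_algebra (space M) (\<lambda>\<omega>. \<lambda>k\<in>{1..}. X k \<omega>) (\<Pi>\<^sub>M k\<in>{1..}. count_space UNIV)))
      (sets (vimage_algebra (space M) (\<lambda>\<omega> k. \<xi> k \<omega>) (\<Pi>\<^sub>M k\<in>UNIV. borel)))"
begin

sublocale scenery M \<xi>
  by unfold_locales (rule \<xi>_stationary)

lemma X_measurable: "1 \<le> k \<Longrightarrow> X k \<in> measurable M (count_space UNIV)"
  using X_indep by (auto simp: indep_vars_def)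

lemma walk_measurable [measurable]: "walk X j \<in> measurable M (count_space UNIV)"
proof (induction j)
  case 0
  then show ?case by (simp add: walk_def)
next
  case (Suc j)
  have "walk X (Suc j) = (\<lambda>\<omega>. walk X j \<omega> + X (Suc j) \<omega>)"
    by (simp add: walk_def fun_eq_iff)
  moreover have "(\<lambda>\<omega>. walk X j \<omega> + X (Suc j) \<omega>) \<in> measurable M (count_space UNIV)"
    using Suc X_measurable[of "Suc j"] by measurable
  ultimately show ?case by simp
qed

definition step_pmf :: "int pmf" where
  "step_pmf = embed_pmf (\<lambda>x. prob {\<omega> \<in> space M. X 1 \<omega> = x})"

lemma pmf_step_pmf: "pmf step_pmf x = prob {\<omega> \<in> space M. X 1 \<omega> = x}"
  unfolding step_pmf_def
proof (rule pmf_embed_pmf)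
  have X1 [measurable]: "X 1 \<in> measurable M (count_space UNIV)" by (rule X_measurable) simp
  have [measurable]: "X (Suc 0) \<in> measurable M (count_space UNIV)" by (rule X_measurable) simp
  let ?D = "distr M (count_space UNIV) (X 1)"
  interpret D: prob_space ?D by (rule prob_space_distr[OF X1])
  have "emeasure ?D {x} = ennreal (prob {\<omega> \<in> space M. X 1 \<omega> = x})" for x
    by (simp add: emeasure_distr vimage_def Int_def conj_commute emeasure_eq_measure)
  then have "(\<integral>\<^sup>+x. ennreal (prob {\<omega> \<in> space M. X 1 \<omega> = x}) \<partial>count_space UNIV) = emeasure ?D UNIV"
    by (subst emeasure_countable_singleton) auto
  also have "\<dots> = 1" using D.emeasure_space_1 by simp
  finally show "(\<integral>\<^sup>+x. ennreal (prob {\<omega> \<in> space M. X 1 \<omega> = x}) \<partial>count_space UNIV) = 1" .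
qed simp

lemma prob_step: "1 \<le> k \<Longrightarrow> prob {\<omega> \<in> space M. X k \<omega> = x} = pmf step_pmf x"
proof -
  assume k: "1 \<le> k"
  have m: "prob {\<omega> \<in> space M. X k \<omega> = x} = measure (distr M (count_space UNIV) (X k)) {x}" if "1 \<le> k" for k
    using X_measurable[OF that] by (simp add: measure_distr vimage_def Int_def conj_commute)
  show ?thesis
    using m[OF k] m[of 1] X_distr[OF k] by (simp add: pmf_step_pmf)
qed

definition path :: "nat \<Rightarrow> 'w \<Rightarrow> int list" where
  "path L \<omega> = map (\<lambda>i. X (Suc i) \<omega>) [0..<L]"

lemma length_path [simp]: "length (path L \<omega>) = L"
  by (simp add: path_def)

lemma sum_list_path: "sum_list (path L \<omega>) = walk X L \<omega>"
proof -
  have "sum_list (path L \<omega>) = (\<Sum>i<L. X (Suc i) \<omega>)"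
    by (simp add: path_def sum_list_sum_nth atLeast0LessThan)
  also have "\<dots> = walk X L \<omega>"
    unfolding walk_def by (intro sum.reindex_bij_witness[of _ "\<lambda>k. k - 1" Suc]) auto
  finally show ?thesis .
qed

lemma take_path: "j \<le> L \<Longrightarrow> take j (path L \<omega>) = path j \<omega>"
  by (simp add: path_def take_map)

lemma path_event:
  "{\<omega> \<in> space M. path L \<omega> = w} \<in> sets (vimage_algebra (space M) (\<lambda>\<omega>. \<lambda>k\<in>{1..}. X k \<omega>) (\<Pi>\<^sub>M k\<in>{1..}. count_space UNIV))"
proof (cases "length w = L")
  case True
  let ?N = "\<Pi>\<^sub>M k\<in>{1..}. count_space (UNIV :: int set)"
  let ?B = "{f \<in> space ?N. \<forall>i<L. f (Suc i) = w ! i}"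
  have "?B \<in> sets ?N"
  proof -
    have [measurable]: "(\<lambda>f. f (Suc i)) \<in> measurable ?N (count_space UNIV)" for i
      by (rule measurable_component_singleton) simp
    show ?thesis by measurable
  qed
  from in_vimage_algebra[OF this, of "\<lambda>\<omega>. \<lambda>k\<in>{1..}. X k \<omega>" "space M"]
  have "(\<lambda>\<omega>. \<lambda>k\<in>{1..}. X k \<omega>) -` ?B \<inter> space M \<in> sets (vimage_algebra (space M) (\<lambda>\<omega>. \<lambda>k\<in>{1..}. X k \<omega>) ?N)" .
  also have "(\<lambda>\<omega>. \<lambda>k\<in>{1..}. X k \<omega>) -` ?B \<inter> space M = {\<omega> \<in> space M. path L \<omega> = w}"
    using True by (auto simp: path_def space_PiM list_eq_iff_nth_eq)
  finally show ?thesis .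
next
  case False
  then have "{\<omega> \<in> space M. path L \<omega> = w} = {}" by auto
  then show ?thesis by (simp only: sets.empty_sets)
qed

lemma path_event_sets [measurable]: "{\<omega> \<in> space M. path L \<omega> = w} \<in> sets M"
  using path_event[of L w] X_\<xi>_indep unfolding indep_set_def indep_sets_def by (auto split: bool.splits)

lemma prob_path: "length w = L \<Longrightarrow> prob {\<omega> \<in> space M. path L \<omega> = w} = pmf (replicate_pmf L step_pmf) w"
proof -
  assume len: "length w = L"
  show ?thesis
  proof (cases "L = 0")
    case True
    then show ?thesis using len by (simp add: path_def prob_space)
  next
    case False
    have "{\<omega> \<in> space M. path L \<omega> = w} = (\<Inter>k\<in>{1..L}. X k -` {w ! (k - 1)} \<inter> space M)"
    proof -
      have "path L \<omega> = w \<longleftrightarrow> (\<forall>k\<in>{1..L}. X k \<omega> = w ! (k - 1))" for \<omega>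
      proof
        assume "path L \<omega> = w"
        then show "\<forall>k\<in>{1..L}. X k \<omega> = w ! (k - 1)"
          by (auto simp: path_def)
      next
        assume a: "\<forall>k\<in>{1..L}. X k \<omega> = w ! (k - 1)"
        show "path L \<omega> = w"
        proof (rule nth_equalityI)
          fix i assume "i < length (path L \<omega>)"
          then show "path L \<omega> ! i = w ! i" using a[rule_format, of "Suc i"] by (simp add: path_def)
        qed (simp add: len)
      qed
      then show ?thesis using False by auto
    qed
    then have "prob {\<omega> \<in> space M. path L \<omega> = w} = (\<Prod>k\<in>{1..L}. prob (X k -` {w ! (k - 1)} \<inter> space M))"
      using indep_varsD[OF X_indep, of "{1..L}" "\<lambda>k. {w ! (k - 1)}"] False by auto
    also have "\<dots> = (\<Prod>k\<in>{1..L}. pmf step_pmf (w ! (k - 1)))"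
      using prob_step by (intro prod.cong refl) (simp add: vimage_def Int_def conj_commute)
    also have "\<dots> = (\<Prod>i<L. pmf step_pmf (w ! i))"
      by (intro prod.reindex_bij_witness[of _ Suc "\<lambda>k. k - 1"]) auto
    finally show ?thesis by (simp add: pmf_replicate_pmf[OF len])
  qed
qed

text \<open>There are only countably many paths, and the event of following a given one is independent of the scenery.\<close>

lemma prob_path_scenery:
  assumes B: "\<And>w. B w \<in> sets (\<Pi>\<^sub>M k\<in>UNIV. borel)"
  shows "prob {\<omega> \<in> space M. (\<lambda>k. \<xi> k \<omega>) \<in> B (path L \<omega>)} = steps_expectation step_pmf L (\<lambda>w. prob {\<omega> \<in> space M. (\<lambda>k. \<xi> k \<omega>) \<in> B w})"
proof -
  let ?Q = "\<lambda>w. {\<omega> \<in> space M. (\<lambda>k. \<xi> k \<omega>) \<in> B w}"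
  have Q_alg: "?Q w \<in> sets (vimage_algebra (space M) (\<lambda>\<omega> k. \<xi> k \<omega>) (\<Pi>\<^sub>M k\<in>UNIV. borel))" for w
    using in_vimage_algebra[OF B[of w], of "\<lambda>\<omega> k. \<xi> k \<omega>" "space M"] by (simp add: vimage_def Int_def conj_commute)
  have Q [measurable]: "?Q w \<in> sets M" for w
    using Q_alg[of w] X_\<xi>_indep unfolding indep_set_def indep_sets_def by (auto split: bool.splits)
  let ?A = "\<lambda>w. {\<omega> \<in> space M. path L \<omega> = w} \<inter> ?Q w"
  have prod: "emeasure M (?A w) = ennreal (pmf (replicate_pmf L step_pmf) w) * emeasure M (?Q w)" for w
  proof (cases "length w = L")
    case True
    have "prob (?A w) = prob {\<omega> \<in> space M. path L \<omega> = w} * prob (?Q w)"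
      using X_\<xi>_indep path_event Q_alg by (rule indep_setD)
    then show ?thesis using prob_path[OF True] by (simp add: emeasure_eq_measure ennreal_mult)
  next
    case False
    then have "w \<notin> set_pmf (replicate_pmf L step_pmf)" using length_replicate_pmf by blast
    moreover have "?A w = {}" using False by auto
    ultimately show ?thesis by (simp add: set_pmf_iff)
  qed
  have "{\<omega> \<in> space M. (\<lambda>k. \<xi> k \<omega>) \<in> B (path L \<omega>)} = (\<Union>w. ?A w)" by auto
  then have "emeasure M {\<omega> \<in> space M. (\<lambda>k. \<xi> k \<omega>) \<in> B (path L \<omega>)} = (\<integral>\<^sup>+w. emeasure M (?A w) \<partial>count_space UNIV)"
    by (simp only:) (rule emeasure_UN_countable, auto simp: disjoint_family_on_def)
  also have "\<dots> = (\<integral>\<^sup>+w. emeasure M (?Q w) \<partial>measure_pmf (replicate_pmf L step_pmf))"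
    by (simp only: prod nn_integral_measure_pmf)
  also have "\<dots> = ennreal (steps_expectation step_pmf L (\<lambda>w. prob (?Q w)))"
    by (simp add: emeasure_eq_measure) (rule ennreal_expectation_pmf[where B=1, symmetric], auto)
  finally show ?thesis
    by (simp add: emeasure_eq_measure integral_nonneg_AE)
qed

lemma prob_path_event: "prob {\<omega> \<in> space M. P (path L \<omega>)} = steps_expectation step_pmf L (\<lambda>w. of_bool (P w))"
proof -
  have "prob {\<omega> \<in> space M. (\<lambda>k. \<xi> k \<omega>) \<in> (if P (path L \<omega>) then UNIV else {})}
      = steps_expectation step_pmf L (\<lambda>w. prob {\<omega> \<in> space M. (\<lambda>k. \<xi> k \<omega>) \<in> (if P w then UNIV else {})})"
    by (rule prob_path_scenery) (use sets.top[of "\<Pi>\<^sub>M k\<in>(UNIV :: int set). (borel :: real measure)"] in \<open>auto simp: space_PiM\<close>)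
  moreover have "{\<omega> \<in> space M. (\<lambda>k. \<xi> k \<omega>) \<in> (if P (path L \<omega>) then UNIV else {})} = {\<omega> \<in> space M. P (path L \<omega>)}"
    by auto
  moreover have "prob {\<omega> \<in> space M. (\<lambda>k. \<xi> k \<omega>) \<in> (if P w then UNIV else {})} = of_bool (P w)" for w
    by (auto simp: prob_space)
  ultimately show ?thesis by simp
qed

lemma prob_walk: "prob {\<omega> \<in> space M. walk X n \<omega> \<in> A} = measure (position_pmf step_pmf n) A"
proof -
  have "prob {\<omega> \<in> space M. walk X n \<omega> \<in> A} = steps_expectation step_pmf n (\<lambda>w. of_bool (sum_list w \<in> A))"
    using prob_path_event[of "\<lambda>w. sum_list w \<in> A" n] by (simp add: sum_list_path)
  also have "(\<lambda>w. of_bool (sum_list w \<in> A) :: real) = indicator (sum_list -` A)"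
    by (auto simp: indicator_def fun_eq_iff)
  finally show ?thesis by (simp add: position_pmf_def)
qed

lemma truncated_green_eq: "truncated_green M X n = green step_pmf n"
proof -
  have "{..n} = insert 0 {1..n}" by auto
  moreover have "measure M {\<omega> \<in> space M. walk X k \<omega> = 0} = pmf (position_pmf step_pmf k) 0" for k
    using prob_walk[of k "{0}"] by (simp add: measure_pmf_single)
  ultimately show ?thesis
    by (simp add: truncated_green_def green_def position_pmf_0)
qed

lemma visited_path: "visited 0 (path n \<omega>) = (\<lambda>j. walk X j \<omega>) ` {1..n}"
  unfolding visited_eq_image by (auto simp: take_path sum_list_path intro!: image_cong)

text \<open>
  The events of no return up to time \<open>n\<close> decrease to the event of no return.
\<close>

lemma no_return_tendsto_escape: "no_return_prob step_pmf \<longlonglongrightarrow> escape_prob M X"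
proof -
  let ?A = "\<lambda>n. {\<omega> \<in> space M. \<forall>k\<in>{1..n}. walk X k \<omega> \<noteq> 0}"
  have A: "prob (?A n) = no_return_prob step_pmf n" for n
  proof -
    have "?A n = {\<omega> \<in> space M. 0 \<notin> visited 0 (path n \<omega>)}"
      by (auto simp: visited_path)
    then show ?thesis
      using prob_path_event[of "\<lambda>w. 0 \<notin> visited 0 w" n] by (simp only: no_return_prob_def)
  qed
  have "(\<lambda>n. prob (?A n)) \<longlonglongrightarrow> prob (\<Inter>n. ?A n)"
    by (rule finite_Lim_measure_decseq) (auto simp: decseq_def)
  moreover have "(\<Inter>n. ?A n) = {\<omega> \<in> space M. \<forall>k\<ge>1. walk X k \<omega> \<noteq> 0}"
    by (auto, metis atLeastAtMost_iff order_refl)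
  ultimately have "(\<lambda>n. prob (?A n)) \<longlonglongrightarrow> prob {\<omega> \<in> space M. \<forall>k\<ge>1. walk X k \<omega> \<noteq> 0}"
    by (simp only:)
  then show ?thesis unfolding A escape_prob_def .
qed

lemma weak_conv_scaled_law:
  assumes "\<And>x. (\<lambda>n. measure M {\<omega> \<in> space M. real_of_int (walk X n \<omega>) / real n powr (1 / \<alpha>) \<le> x}) \<longlonglongrightarrow> cdf \<mu> x"
  shows "weak_conv_m (scaled_law step_pmf \<alpha>) \<mu>"
proof -
  have "cdf (scaled_law step_pmf \<alpha> n) x = measure M {\<omega> \<in> space M. real_of_int (walk X n \<omega>) / real n powr (1 / \<alpha>) \<le> x}" for n x
    using prob_walk[of n "{z. real_of_int z / real n powr (1 / \<alpha>) \<le> x}"]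
    by (simp add: cdf_def scaled_law_def measure_distr vimage_def)
  then show ?thesis using assms by (simp add: weak_conv_m_def weak_conv_def)
qed

end

context walk_in_scenery
begin

lemma mean_card_block:
  assumes "t i \<le> t (Suc i)" "t (Suc i) \<le> L"
  shows "steps_expectation \<rho> L (\<lambda>w. real (card (block t w i))) = mean_range \<rho> (t (Suc i) - t i)"
proof -
  let ?R = "\<lambda>w. real (card (visited 0 w))"
  have "steps_expectation \<rho> L (\<lambda>w. real (card (block t w i))) = steps_expectation \<rho> L (\<lambda>w. ?R (drop (t i) (take (t (Suc i)) w)))"
    by (simp add: block_def card_visited_translate[of "sum_list (take (t i) _)"])
  also have "\<dots> = steps_expectation \<rho> (t (Suc i)) (\<lambda>w. ?R (drop (t i) w))"
    by (rule expectation_steps_take[OF assms(2), where B="real (t (Suc i))"])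
      (auto intro!: order_trans[OF card_visited_le])
  also have "\<dots> = steps_expectation \<rho> (t (Suc i) - t i) ?R"
    by (rule expectation_steps_drop[OF assms(1), where B="real (t (Suc i))"])
      (auto intro!: order_trans[OF card_visited_le])
  finally show ?thesis by (simp add: expectation_card_visited)
qed

text \<open>
  The range grows by the number of sites in the block minus the number of those seen before.
\<close>

lemma mean_revisited:
  assumes "t i \<le> t (Suc i)" "t (Suc i) \<le> L"
  shows "steps_expectation \<rho> L (\<lambda>w. real (card (block t w i \<inter> visited 0 (take (t i) w))))
    = mean_range \<rho> (t (Suc i) - t i) - (mean_range \<rho> (t (Suc i)) - mean_range \<rho> (t i))"
proof -
  let ?R = "\<lambda>w. real (card (visited 0 w))"
  have R: "?R (take (t (Suc i)) w) = ?R (take (t i) w) + real (card (block t w i)) - real (card (block t w i \<inter> visited 0 (take (t i) w)))" for w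
  proof -
    have "take (t (Suc i)) w = take (t i) w @ drop (t i) (take (t (Suc i)) w)"
      using append_take_drop_id[of "t i" "take (t (Suc i)) w"] assms(1) by (simp add: min_def)
    then have "visited 0 (take (t (Suc i)) w) = visited 0 (take (t i) w) \<union> block t w i"
      using visited_append[of 0 "take (t i) w" "drop (t i) (take (t (Suc i)) w)"] by (simp add: block_def)
    then show ?thesis
      using card_Un_Int[of "visited 0 (take (t i) w)" "block t w i"] by (simp add: Int_commute)
  qed
  have b: "?R (take k w) \<le> real L" "real (card (block t w i)) \<le> real L" if "length w = L" for k w
    using card_visited_le[of 0 "take k w"] card_visited_le[of "sum_list (take (t i) w)" "drop (t i) (take (t (Suc i)) w)"] that
    by (auto simp: block_def)
  have E: "steps_expectation \<rho> L (\<lambda>w. ?R (take k w)) = mean_range \<rho> k" if "k \<le> L" for k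
    unfolding expectation_card_visited[symmetric]
    by (rule expectation_steps_take[OF that, where B="real k"]) (auto intro!: order_trans[OF card_visited_le])
  have int: "integrable (measure_pmf (replicate_pmf L \<rho>)) (\<lambda>w. ?R (take k w))"
    "integrable (measure_pmf (replicate_pmf L \<rho>)) (\<lambda>w. real (card (block t w i)))" for k
    by (rule integrable_bounded_pmf[where B="real L"]; use b in \<open>auto dest!: length_replicate_pmf\<close>)+
  have "steps_expectation \<rho> L (\<lambda>w. real (card (block t w i \<inter> visited 0 (take (t i) w))))
     = steps_expectation \<rho> L (\<lambda>w. ?R (take (t i) w) + real (card (block t w i)) - ?R (take (t (Suc i)) w))"
    by (simp add: R)
  also have "\<dots> = mean_range \<rho> (t i) + mean_range \<rho> (t (Suc i) - t i) - mean_range \<rho> (t (Suc i))"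
    using int assms by (simp add: E mean_card_block)
  finally show ?thesis by simp
qed

end

section \<open>Counts on the grid of asymptotically Poisson processes\<close>

lemma (in prob_space) abs_prob_diff_le:
  assumes [measurable]: "A \<in> events" "B \<in> events" "C \<in> events" and "A \<subseteq> B \<union> C" "B \<subseteq> A \<union> C"
  shows "\<bar>prob A - prob B\<bar> \<le> prob C"
proof -
  have "prob A \<le> prob (B \<union> C)" "prob B \<le> prob (A \<union> C)"
    by (rule finite_measure_mono; use assms in simp)+
  moreover have "prob (B \<union> C) \<le> prob B + prob C" "prob (A \<union> C) \<le> prob A + prob C"
    by (rule measure_Un_le; simp)+
  ultimately show ?thesis by linarith
qed

text \<open>
  Inclusion and exclusion: the joint law of finitely many events is determined, in the limit too,
  by the probabilities of their intersections.
\<close>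

lemma prob_atoms_tendsto:
  fixes p :: "nat \<Rightarrow> 'u \<Rightarrow> 'b \<Rightarrow> bool" and p' :: "nat \<Rightarrow> 'u \<Rightarrow> 'c \<Rightarrow> bool"
  assumes M: "prob_space M" and M': "prob_space M'" and U: "finite U"
    and p: "\<And>n u. {\<omega> \<in> space M. p n u \<omega>} \<in> sets M" and p': "\<And>n u. {\<omega> \<in> space M'. p' n u \<omega>} \<in> sets M'"
    and conv: "\<And>P. P \<subseteq> U \<Longrightarrow> (\<lambda>n. measure M {\<omega> \<in> space M. \<forall>u\<in>P. p n u \<omega>} - measure M' {\<omega> \<in> space M'. \<forall>u\<in>P. p' n u \<omega>}) \<longlonglongrightarrow> 0"
    and P: "P \<subseteq> U" and Q: "finite Q" "Q \<subseteq> U"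
  shows "(\<lambda>n. measure M {\<omega> \<in> space M. (\<forall>u\<in>P. p n u \<omega>) \<and> (\<forall>u\<in>Q. \<not> p n u \<omega>)}
    - measure M' {\<omega> \<in> space M'. (\<forall>u\<in>P. p' n u \<omega>) \<and> (\<forall>u\<in>Q. \<not> p' n u \<omega>)}) \<longlonglongrightarrow> 0"
  using Q P
proof (induction Q arbitrary: P rule: finite_induct)
  case empty
  then show ?case using conv[of P] by simp
next
  case (insert u Q)
  have diff: "measure N {\<omega> \<in> space N. (\<forall>v\<in>P. r v \<omega>) \<and> (\<forall>v\<in>insert u Q. \<not> r v \<omega>)}
      = measure N {\<omega> \<in> space N. (\<forall>v\<in>P. r v \<omega>) \<and> (\<forall>v\<in>Q. \<not> r v \<omega>)}
        - measure N {\<omega> \<in> space N. (\<forall>v\<in>insert u P. r v \<omega>) \<and> (\<forall>v\<in>Q. \<not> r v \<omega>)}"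
    if N: "prob_space N" and r: "\<And>v. {\<omega> \<in> space N. r v \<omega>} \<in> sets N" for N :: "'d measure" and r
  proof -
    interpret N: prob_space N by (rule N)
    have fin: "finite P" "finite Q" using insert U by (auto dest: finite_subset)
    have s: "{\<omega> \<in> space N. (\<forall>v\<in>A. r v \<omega>) \<and> (\<forall>v\<in>Q. \<not> r v \<omega>)} \<in> sets N" if "finite A" for A
      using that fin r
      by (intro sets.sets_Collect_conj sets.sets_Collect_finite_All sets.sets_Collect_neg) auto
    have "{\<omega> \<in> space N. (\<forall>v\<in>P. r v \<omega>) \<and> (\<forall>v\<in>insert u Q. \<not> r v \<omega>)}
      = {\<omega> \<in> space N. (\<forall>v\<in>P. r v \<omega>) \<and> (\<forall>v\<in>Q. \<not> r v \<omega>)} - {\<omega> \<in> space N. (\<forall>v\<in>insert u P. r v \<omega>) \<and> (\<forall>v\<in>Q. \<not> r v \<omega>)}"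
      by auto
    then show ?thesis
      using N.finite_measure_Diff[OF s[of P] s[of "insert u P"]] fin by auto
  qed
  have "(\<lambda>n. (measure M {\<omega> \<in> space M. (\<forall>v\<in>P. p n v \<omega>) \<and> (\<forall>v\<in>Q. \<not> p n v \<omega>)}
        - measure M' {\<omega> \<in> space M'. (\<forall>v\<in>P. p' n v \<omega>) \<and> (\<forall>v\<in>Q. \<not> p' n v \<omega>)})
      - (measure M {\<omega> \<in> space M. (\<forall>v\<in>insert u P. p n v \<omega>) \<and> (\<forall>v\<in>Q. \<not> p n v \<omega>)}
        - measure M' {\<omega> \<in> space M'. (\<forall>v\<in>insert u P. p' n v \<omega>) \<and> (\<forall>v\<in>Q. \<not> p' n v \<omega>)})) \<longlonglongrightarrow> 0 - 0"
    using insert.prems by (intro tendsto_diff insert.IH) auto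
  moreover have "measure M {\<omega> \<in> space M. (\<forall>v\<in>P. p n v \<omega>) \<and> (\<forall>v\<in>insert u Q. \<not> p n v \<omega>)}
      = measure M {\<omega> \<in> space M. (\<forall>v\<in>P. p n v \<omega>) \<and> (\<forall>v\<in>Q. \<not> p n v \<omega>)}
        - measure M {\<omega> \<in> space M. (\<forall>v\<in>insert u P. p n v \<omega>) \<and> (\<forall>v\<in>Q. \<not> p n v \<omega>)}" for n
    by (rule diff[OF M]) (rule p)
  moreover have "measure M' {\<omega> \<in> space M'. (\<forall>v\<in>P. p' n v \<omega>) \<and> (\<forall>v\<in>insert u Q. \<not> p' n v \<omega>)}
      = measure M' {\<omega> \<in> space M'. (\<forall>v\<in>P. p' n v \<omega>) \<and> (\<forall>v\<in>Q. \<not> p' n v \<omega>)}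
        - measure M' {\<omega> \<in> space M'. (\<forall>v\<in>insert u P. p' n v \<omega>) \<and> (\<forall>v\<in>Q. \<not> p' n v \<omega>)}" for n
    by (rule diff[OF M']) (rule p')
  ultimately show ?case by (simp only: diff_diff_eq2 diff_add_eq diff_diff_eq add.commute minus_zero diff_0_right) (simp add: algebra_simps)
qed

context half_open_space
begin

definition exceed_cell :: "nat \<Rightarrow> nat \<Rightarrow> real \<Rightarrow> (real \<times> ereal) set" where
  "exceed_cell R i x = {p \<in> space_E. time_index R (fst p) = i \<and> ereal x < snd p}"

lemma exceed_cell_sets [measurable]: "exceed_cell R i x \<in> sets (restrict_space borel space_E)"
proof -
  have "(cell_index R -` ({i} \<times> UNIV) \<inter> space borel) \<inter> {p \<in> space borel. ereal x < snd p} \<in> sets borel"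
    by (intro sets.Int measurable_sets[OF cell_index_measurable]) measurable
  moreover have "exceed_cell R i x = space_E \<inter> ((cell_index R -` ({i} \<times> UNIV) \<inter> space borel) \<inter> {p \<in> space borel. ereal x < snd p})"
    by (auto simp: exceed_cell_def cell_index_def)
  ultimately show ?thesis by (auto simp: sets_restrict_space)
qed

lemma exceed_cell_eq:
  assumes "ereal x \<in> {lo<..hi}"
  shows "exceed_cell R i x = {real i / 2 ^ R..<real (Suc i) / 2 ^ R} \<times> {y \<in> {lo<..hi}. ereal x < y}"
proof -
  have "0 \<le> t" if "real i / 2 ^ R \<le> t" for t :: real
    using that by (rule order_trans[rotated]) simp
  then show ?thesis
    using time_index_eq_iff[of _ R i] by (fastforce simp: exceed_cell_def space_E_def)
qed

lemma finite_in_exceed_cell: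
  assumes fin: "\<And>K. compact K \<Longrightarrow> K \<subseteq> space_E \<Longrightarrow> finite {k \<in> I. y k \<in> K}" and x: "ereal x \<in> {lo<..hi}"
  shows "finite {k \<in> I. y k \<in> exceed_cell R i x}"
proof -
  let ?K = "{0..real (Suc i) / 2 ^ R} \<times> {ereal x..hi}"
  have "compact {ereal x..hi}"
    using compact_Int_closed[OF compact_UNIV closed_atLeastAtMost[of "ereal x" hi]] by simp
  then have "compact ?K" by (intro compact_Times) auto
  moreover have "?K \<subseteq> space_E" using x by (auto simp: space_E_def)
  ultimately have finK: "finite {k \<in> I. y k \<in> ?K}" by (rule fin)
  have sub: "exceed_cell R i x \<subseteq> ?K"
    using time_index_eq_iff[of _ R i] by (fastforce simp: exceed_cell_def space_E_def)
  show ?thesis by (rule finite_subset[OF _ finK]) (use sub in blast)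
qed

lemma exceed_cell_count:
  assumes "\<mu> \<in> point_measures space_E" "ereal x \<in> {lo<..hi}"
  obtains k :: nat where "emeasure \<mu> (exceed_cell R i x) = of_nat k" "measure \<mu> (exceed_cell R i x) = real k"
proof -
  obtain I :: "nat set" and y where \<mu>: "\<mu> = point_sum space_E I y"
    and fin: "\<And>K. compact K \<Longrightarrow> K \<subseteq> space_E \<Longrightarrow> finite {i \<in> I. y i \<in> K}"
    using assms(1) unfolding point_measures_def by blast
  show ?thesis
    using that emeasure_point_sum_finite[OF exceed_cell_sets finite_in_exceed_cell[OF fin assms(2)]]
      measure_point_sum_finite[OF exceed_cell_sets finite_in_exceed_cell[OF fin assms(2)]] unfolding \<mu> by blast
qed

lemma measure_exceed_cell_0_iff:
  assumes "\<mu> \<in> point_measures space_E" "ereal x \<in> {lo<..hi}"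
  shows "measure \<mu> (exceed_cell R i x) = 0 \<longleftrightarrow> emeasure \<mu> (exceed_cell R i x) = 0"
  by (rule exceed_cell_count[OF assms, of R i]) auto

lemma exceed_cell_mono: "x \<le> x' \<Longrightarrow> exceed_cell R i x' \<subseteq> exceed_cell R i x"
  by (auto simp: exceed_cell_def intro: le_less_trans[of "ereal x" "ereal x'"])

lemma measure_exceed_cell_0_mono:
  assumes \<mu>: "\<mu> \<in> point_measures space_E" and x: "ereal x \<in> {lo<..hi}" "ereal x' \<in> {lo<..hi}" "x \<le> x'"
    and 0: "measure \<mu> (exceed_cell R i x) = 0"
  shows "measure \<mu> (exceed_cell R i x') = 0"
proof -
  have "exceed_cell R i x \<in> sets \<mu>"
    using \<mu> exceed_cell_sets by (auto simp: point_measures_def sets_point_sum)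
  then have "emeasure \<mu> (exceed_cell R i x') \<le> emeasure \<mu> (exceed_cell R i x)"
    by (intro emeasure_mono exceed_cell_mono x)
  then show ?thesis
    using 0 x \<mu> by (simp add: measure_exceed_cell_0_iff)
qed

subsection \<open>Counts from occupied cells of a finer grid\<close>

definition occupied :: "nat \<Rightarrow> nat \<Rightarrow> (real \<times> ereal) measure \<Rightarrow> (nat \<times> real) set" where
  "occupied r R \<mu> = {u \<in> {..<r * 2 ^ R} \<times> levels r. measure \<mu> (exceed_cell R (fst u) (snd u)) \<noteq> 0}"

text \<open>
  The counts as a function of the set \<open>V\<close> of occupied cells, provided that no interval of the finer grid carries
  two points: an interval \<open>i\<close> of the finer grid lies in the interval \<open>i div 2\<^sup>R\<^sup>-\<^sup>r\<close> of the coarser one, and the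
  number of occupied levels is the level index of its point.
\<close>

definition reconstruct :: "nat \<Rightarrow> nat \<Rightarrow> (nat \<times> real) set \<Rightarrow> nat list" where
  "reconstruct r R V = map (\<lambda>c. card {i. i < r * 2 ^ R \<and> i div 2 ^ (R - r) = fst c
     \<and> card {x \<in> levels r. (i, x) \<in> V} = snd c}) (cells r)"

lemma time_index_coarsen: "r \<le> R \<Longrightarrow> 0 \<le> t \<Longrightarrow> time_index r t = time_index R t div 2 ^ (R - r)"
proof -
  assume r: "r \<le> R" and t: "0 \<le> t"
  have less: "time_index r t < k \<longleftrightarrow> time_index R t div 2 ^ (R - r) < k" for k
  proof -
    have "real k / 2 ^ r = real (k * 2 ^ (R - r)) / 2 ^ R"
    proof -
      have "(2 :: real) ^ R = 2 ^ r * 2 ^ (R - r)" using r by (simp add: power_add[symmetric])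
      then show ?thesis by simp
    qed
    then show ?thesis
      by (simp only: time_index_less_iff[OF t] div_less_iff_less_mult zero_less_power zero_less_numeral)
  qed
  show ?thesis
    using less[of "time_index r t"] less[of "time_index R t div 2 ^ (R - r)"] by linarith
qed

text \<open>
  If no interval of the finer time grid carries two points above the lowest level, then the level
  cell of its only point can be read off from the levels that are exceeded in that interval.
\<close>

lemma counts_eq_reconstruct:
  assumes \<mu>: "\<mu> \<in> point_measures space_E" and ne: "levels r \<noteq> {}" and r: "r \<le> R"
    and simple: "\<And>i. i < r * 2 ^ R \<Longrightarrow> measure \<mu> (exceed_cell R i (Min (levels r))) \<le> 1"
  shows "counts r \<mu> = reconstruct r R (occupied r R \<mu>)"
proof -
  let ?x0 = "Min (levels r)"
  obtain I :: "nat set" and y where \<mu>_eq: "\<mu> = point_sum space_E I y"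
    and fin: "\<And>K. compact K \<Longrightarrow> K \<subseteq> space_E \<Longrightarrow> finite {i \<in> I. y i \<in> K}"
    using \<mu> unfolding point_measures_def by blast
  have x0: "?x0 \<in> levels r" using ne by simp
  have finC: "finite {k \<in> I. y k \<in> exceed_cell R i x}" if "x \<in> levels r" for i x
    using finite_in_exceed_cell[OF fin levels_in_space[OF that]] .
  have count: "measure \<mu> (exceed_cell R i x) = real (card {k \<in> I. y k \<in> exceed_cell R i x})" if "x \<in> levels r" for i x
    unfolding \<mu>_eq by (rule measure_point_sum_finite[OF exceed_cell_sets finC[OF that]])
  have unique: "k = k'" if "i < r * 2 ^ R" "k \<in> I" "k' \<in> I" "y k \<in> exceed_cell R i ?x0" "y k' \<in> exceed_cell R i ?x0" for i k k'
  proof -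
    have "card {k \<in> I. y k \<in> exceed_cell R i ?x0} \<le> 1"
      using simple[OF that(1)] by (simp add: count[OF x0])
    then show ?thesis
      using that(2-) card_le_Suc0_iff_eq[OF finC[OF x0, of i]] by auto
  qed
  have occ: "{x \<in> levels r. (i, x) \<in> occupied r R \<mu>} = {x \<in> levels r. ereal x < snd (y k)}"
    if i: "i < r * 2 ^ R" and k: "k \<in> I" "y k \<in> exceed_cell R i ?x0" for i k
  proof -
    have "(i, x) \<in> occupied r R \<mu> \<longleftrightarrow> ereal x < snd (y k)" if x: "x \<in> levels r" for x
    proof -
      have "(i, x) \<in> occupied r R \<mu> \<longleftrightarrow> {k \<in> I. y k \<in> exceed_cell R i x} \<noteq> {}"
        using i x finC[OF x, of i] by (simp add: occupied_def count[OF x])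
      also have "\<dots> \<longleftrightarrow> y k \<in> exceed_cell R i x"
      proof
        assume "{k \<in> I. y k \<in> exceed_cell R i x} \<noteq> {}"
        then obtain k' where k': "k' \<in> I" "y k' \<in> exceed_cell R i x" by blast
        have "?x0 \<le> x" using x by simp
        then have "y k' \<in> exceed_cell R i ?x0" using exceed_cell_mono k'(2) by blast
        then have "k' = k" by (rule unique[OF i k'(1) k(1) _ k(2)])
        then show "y k \<in> exceed_cell R i x" using k' by simp
      next
        assume "y k \<in> exceed_cell R i x"
        then show "{k \<in> I. y k \<in> exceed_cell R i x} \<noteq> {}" using k(1) by blast
      qed
      also have "\<dots> \<longleftrightarrow> ereal x < snd (y k)" using k by (auto simp: exceed_cell_def)
      finally show ?thesis .
    qed
    then show ?thesis by blast
  qed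
  have card_eq: "card {k \<in> I. y k \<in> cell r c} = card {i. i < r * 2 ^ R \<and> i div 2 ^ (R - r) = fst c
     \<and> card {x \<in> levels r. (i, x) \<in> occupied r R \<mu>} = snd c}" (is "card ?A = card ?B")
    if c: "c \<in> set (cells r)" for c
  proof (rule bij_betw_same_card[of "\<lambda>k. time_index R (fst (y k))"])
    have c': "fst c < r * 2 ^ r" "1 \<le> snd c" using c by (auto simp: cells_def)
    have in_A: "k \<in> I" "y k \<in> exceed_cell R (time_index R (fst (y k))) ?x0"
      "time_index R (fst (y k)) < r * 2 ^ R" "time_index R (fst (y k)) div 2 ^ (R - r) = fst c"
      "level_index r (snd (y k)) = snd c" if "k \<in> ?A" for k
    proof -
      show "k \<in> I" using that by simp
      have yk: "y k \<in> space_E" "time_index r (fst (y k)) = fst c" "level_index r (snd (y k)) = snd c"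
        using that by (auto simp: cell_def cell_index_def)
      then show "level_index r (snd (y k)) = snd c" by simp
      have t: "0 \<le> fst (y k)" using yk by (auto simp: space_E_def)
      show div: "time_index R (fst (y k)) div 2 ^ (R - r) = fst c"
        using time_index_coarsen[OF r t] yk by simp
      have "time_index R (fst (y k)) div 2 ^ (R - r) < r * 2 ^ r" using c'(1) div by simp
      then have "time_index R (fst (y k)) < (r * 2 ^ r) * 2 ^ (R - r)"
        by (simp only: div_less_iff_less_mult zero_less_power zero_less_numeral)
      also have "(r * 2 ^ r) * 2 ^ (R - r) = r * 2 ^ R"
        using r by (simp add: power_add[symmetric])
      finally show "time_index R (fst (y k)) < r * 2 ^ R" .
      obtain x where x: "x \<in> levels r" "ereal x < snd (y k)"
        using c'(2) yk(3) level_index_pos_iff[of r "snd (y k)"] by auto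
      then have "ereal ?x0 \<le> ereal x" by simp
      then have "ereal ?x0 < snd (y k)" using x(2) by (rule le_less_trans)
      then show "y k \<in> exceed_cell R (time_index R (fst (y k))) ?x0"
        using yk by (simp add: exceed_cell_def)
    qed
    show "bij_betw (\<lambda>k. time_index R (fst (y k))) ?A ?B"
      unfolding bij_betw_def
    proof
      show "inj_on (\<lambda>k. time_index R (fst (y k))) ?A"
      proof (rule inj_onI)
        fix k k' assume k: "k \<in> ?A" and k': "k' \<in> ?A" and eq: "time_index R (fst (y k)) = time_index R (fst (y k'))"
        show "k = k'"
          by (rule unique[OF in_A(3)[OF k] in_A(1)[OF k] in_A(1)[OF k'] in_A(2)[OF k]])
            (use in_A(2)[OF k'] eq in simp)
      qed
      show "(\<lambda>k. time_index R (fst (y k))) ` ?A = ?B"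
      proof (intro equalityI subsetI)
        fix i assume "i \<in> (\<lambda>k. time_index R (fst (y k))) ` ?A"
        then obtain k where k: "k \<in> ?A" "i = time_index R (fst (y k))" by blast
        have "card {x \<in> levels r. (i, x) \<in> occupied r R \<mu>} = level_index r (snd (y k))"
          unfolding level_index_def using occ[of i k] in_A[OF k(1)] k(2) by simp
        then show "i \<in> ?B" using in_A[OF k(1)] k(2) by simp
      next
        fix i assume "i \<in> ?B"
        then have i: "i < r * 2 ^ R" "i div 2 ^ (R - r) = fst c" "card {x \<in> levels r. (i, x) \<in> occupied r R \<mu>} = snd c"
          by auto
        have "{x \<in> levels r. (i, x) \<in> occupied r R \<mu>} \<noteq> {}"
          using i(3) c'(2) by (metis card.empty not_one_le_zero)
        then obtain x where x: "x \<in> levels r" "(i, x) \<in> occupied r R \<mu>" by blast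
        then have "{k \<in> I. y k \<in> exceed_cell R i x} \<noteq> {}"
          using finC[OF x(1), of i] by (simp add: occupied_def count[OF x(1)])
        then obtain k where k: "k \<in> I" "y k \<in> exceed_cell R i x" by blast
        then have k0: "y k \<in> exceed_cell R i ?x0" using exceed_cell_mono[of ?x0 x R i] x(1) by auto
        have yk: "y k \<in> space_E" "time_index R (fst (y k)) = i" using k by (auto simp: exceed_cell_def)
        then have "0 \<le> fst (y k)" by (auto simp: space_E_def)
        then have "time_index r (fst (y k)) = fst c" using time_index_coarsen[OF r] yk i by simp
        moreover have "level_index r (snd (y k)) = snd c"
          unfolding level_index_def using occ[OF i(1) k(1) k0] i(3) by simp
        ultimately have "k \<in> ?A" using k yk by (simp add: cell_def cell_index_def)
        then show "i \<in> (\<lambda>k. time_index R (fst (y k))) ` ?A" using yk by blast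
      qed
    qed
  qed
  have "counts r \<mu> = map (\<lambda>c. card {k \<in> I. y k \<in> cell r c}) (cells r)"
    unfolding \<mu>_eq by (rule counts_point_sum[OF finite_in_window[OF fin]])
  then show ?thesis unfolding reconstruct_def by (simp only:) (intro map_cong refl card_eq)
qed

subsection \<open>Comparison of asymptotically Poisson processes\<close>

text \<open>
  The properties that identify a Poisson limit with intensity \<open>T x\<close> above level \<open>x\<close> per unit of time: the
  probabilities of empty cells in finitely many time intervals, each with a level of its own, and a bound of
  second order for the probability of two points in one cell.
\<close>

definition asymptotically_poisson :: "(real \<Rightarrow> real) \<Rightarrow> 'b measure \<Rightarrow> (nat \<Rightarrow> 'b \<Rightarrow> (real \<times> ereal) measure) \<Rightarrow> bool" where
  "asymptotically_poisson T M Y \<longleftrightarrow> prob_space M \<and>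
    (\<forall>n. \<forall>\<omega>\<in>space M. Y n \<omega> \<in> point_measures space_E) \<and>
    (\<forall>n. \<forall>A\<in>sets (restrict_space borel space_E). (\<lambda>\<omega>. emeasure (Y n \<omega>) A) \<in> borel_measurable M) \<and>
    (\<forall>R I x. finite I \<and> (\<forall>i\<in>I. ereal (x i) \<in> {lo<..hi}) \<longrightarrow>
      (\<lambda>n. measure M {\<omega> \<in> space M. \<forall>i\<in>I. measure (Y n \<omega>) (exceed_cell R i (x i)) = 0}) \<longlonglongrightarrow> (\<Prod>i\<in>I. exp (- (T (x i) / 2 ^ R)))) \<and>
    (\<forall>R i x. ereal x \<in> {lo<..hi} \<longrightarrow> (\<exists>e L. e \<longlonglongrightarrow> L \<and> L \<le> (T x / 2 ^ R)\<^sup>2 \<and>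
      (\<forall>n. measure M {\<omega> \<in> space M. 1 < measure (Y n \<omega>) (exceed_cell R i x)} \<le> e n)))"

context
  fixes T :: "real \<Rightarrow> real" and M :: "'b measure" and Y :: "nat \<Rightarrow> 'b \<Rightarrow> (real \<times> ereal) measure"
  assumes Y: "asymptotically_poisson T M Y"
begin

lemma asym_prob_space: "prob_space M"
  using Y by (simp add: asymptotically_poisson_def)

lemma asym_point_measures: "\<omega> \<in> space M \<Longrightarrow> Y n \<omega> \<in> point_measures space_E"
  using Y by (simp add: asymptotically_poisson_def)

lemma asym_double:
  assumes "ereal x \<in> {lo<..hi}"
  shows "\<exists>e L. e \<longlonglongrightarrow> L \<and> L \<le> (T x / 2 ^ R)\<^sup>2 \<and>
    (\<forall>n. measure M {\<omega> \<in> space M. 1 < measure (Y n \<omega>) (exceed_cell R i x)} \<le> e n)"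
  using Y[unfolded asymptotically_poisson_def, THEN conjunct2, THEN conjunct2, THEN conjunct2, THEN conjunct2,
    THEN spec, THEN spec, THEN spec, THEN mp, OF assms] .

lemma asym_measurable [measurable]:
  "A \<in> sets (restrict_space borel space_E) \<Longrightarrow> (\<lambda>\<omega>. measure (Y n \<omega>) A) \<in> borel_measurable M"
  using Y unfolding measure_def by (intro borel_measurable_enn2real) (simp add: asymptotically_poisson_def)

lemma asym_counts_sets [measurable]: "{\<omega> \<in> space M. counts r (Y n \<omega>) = s} \<in> sets M"
proof -
  have [measurable]: "(\<lambda>\<omega>. measure (Y n \<omega>) (cell r c)) \<in> borel_measurable M" for c
    by (rule asym_measurable) (rule cell_sets)
  have "{\<omega> \<in> space M. counts r (Y n \<omega>) = s} = {\<omega> \<in> space M. length (cells r) = length s \<and>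
      (\<forall>k<length (cells r). nat \<lfloor>measure (Y n \<omega>) (cell r (cells r ! k))\<rfloor> = s ! k)}"
    by (auto simp: counts_def list_eq_iff_nth_eq)
  also have "\<dots> \<in> sets M" by measurable
  finally show ?thesis .
qed

lemma asym_cell_sets [measurable]:
  "{\<omega> \<in> space M. measure (Y n \<omega>) (exceed_cell R i x) = 0} \<in> sets M"
  "{\<omega> \<in> space M. 1 < measure (Y n \<omega>) (exceed_cell R i x)} \<in> sets M"
proof -
  have [measurable]: "(\<lambda>\<omega>. measure (Y n \<omega>) (exceed_cell R i x)) \<in> borel_measurable M"
    by (rule asym_measurable) (rule exceed_cell_sets)
  show "{\<omega> \<in> space M. measure (Y n \<omega>) (exceed_cell R i x) = 0} \<in> sets M"
    "{\<omega> \<in> space M. 1 < measure (Y n \<omega>) (exceed_cell R i x)} \<in> sets M" by measurable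
qed

lemma asym_occupied_eq:
  assumes "V \<subseteq> {..<r * 2 ^ R} \<times> levels r"
  shows "{\<omega> \<in> space M. occupied r R (Y n \<omega>) = V} = {\<omega> \<in> space M.
      (\<forall>u\<in>{..<r * 2 ^ R} \<times> levels r - V. measure (Y n \<omega>) (exceed_cell R (fst u) (snd u)) = 0) \<and>
      (\<forall>u\<in>V. \<not> measure (Y n \<omega>) (exceed_cell R (fst u) (snd u)) = 0)}"
  using assms unfolding occupied_def by blast

lemma asym_occupied_sets [measurable]:
  assumes V: "V \<subseteq> {..<r * 2 ^ R} \<times> levels r"
  shows "{\<omega> \<in> space M. occupied r R (Y n \<omega>) = V} \<in> sets M"
proof -
  have fin: "finite V" by (rule finite_subset[OF V]) simp
  show ?thesis
    unfolding asym_occupied_eq[OF V] using fin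
    by (intro sets.sets_Collect_conj sets.sets_Collect_finite_All sets.sets_Collect_neg asym_cell_sets) auto
qed

text \<open>
  In every time interval only the lowest of the given levels matters.
\<close>

lemma asym_void_tendsto:
  assumes Q: "Q \<subseteq> {..<r * 2 ^ R} \<times> levels r"
  shows "(\<lambda>n. measure M {\<omega> \<in> space M. \<forall>u\<in>Q. measure (Y n \<omega>) (exceed_cell R (fst u) (snd u)) = 0})
    \<longlonglongrightarrow> (\<Prod>i\<in>fst ` Q. exp (- (T (Min {x. (i, x) \<in> Q}) / 2 ^ R)))"
proof -
  let ?x = "\<lambda>i. Min {x. (i, x) \<in> Q}"
  have fin: "finite Q" by (rule finite_subset[OF Q]) simp
  have finx: "finite {x. (i, x) \<in> Q}" for i
    by (rule finite_subset[of _ "snd ` Q"]) (use fin in force)+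
  have xQ: "(i, ?x i) \<in> Q" if "i \<in> fst ` Q" for i
    using Min_in[OF finx[of i]] that by force
  then have x: "ereal (?x i) \<in> {lo<..hi}" if "i \<in> fst ` Q" for i
    using Q that by (intro levels_in_space) blast
  have eq: "(\<forall>u\<in>Q. measure (Y n \<omega>) (exceed_cell R (fst u) (snd u)) = 0) \<longleftrightarrow> (\<forall>i\<in>fst ` Q. measure (Y n \<omega>) (exceed_cell R i (?x i)) = 0)"
    if \<omega>: "\<omega> \<in> space M" for n \<omega>
  proof
    assume "\<forall>u\<in>Q. measure (Y n \<omega>) (exceed_cell R (fst u) (snd u)) = 0"
    then show "\<forall>i\<in>fst ` Q. measure (Y n \<omega>) (exceed_cell R i (?x i)) = 0"
      using xQ by (metis fst_conv snd_conv)
  next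
    assume a: "\<forall>i\<in>fst ` Q. measure (Y n \<omega>) (exceed_cell R i (?x i)) = 0"
    show "\<forall>u\<in>Q. measure (Y n \<omega>) (exceed_cell R (fst u) (snd u)) = 0"
    proof
      fix u assume u: "u \<in> Q"
      have s: "ereal (snd u) \<in> {lo<..hi}" using u Q by (intro levels_in_space) auto
      have le: "?x (fst u) \<le> snd u" using finx u by (intro Min_le) auto
      have f: "fst u \<in> fst ` Q" using u by (rule imageI)
      show "measure (Y n \<omega>) (exceed_cell R (fst u) (snd u)) = 0"
        by (rule measure_exceed_cell_0_mono[OF asym_point_measures[OF \<omega>] x[OF f] s le]) (rule bspec[OF a f])
    qed
  qed
  have "(\<lambda>n. measure M {\<omega> \<in> space M. \<forall>i\<in>fst ` Q. measure (Y n \<omega>) (exceed_cell R i (?x i)) = 0})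
    \<longlonglongrightarrow> (\<Prod>i\<in>fst ` Q. exp (- (T (?x i) / 2 ^ R)))"
    using x fin by (intro Y[unfolded asymptotically_poisson_def, THEN conjunct2, THEN conjunct2, THEN conjunct2, THEN conjunct1,
      THEN spec, THEN spec, THEN spec, THEN mp]) simp
  then show ?thesis using eq by (simp cong: conj_cong)
qed

lemma asym_double_bound:
  assumes "levels r \<noteq> {}"
  obtains e L where "e \<longlonglongrightarrow> L" "L \<le> real (r * 2 ^ R) * (T (Min (levels r)) / 2 ^ R)\<^sup>2"
    "\<And>n. measure M {\<omega> \<in> space M. \<exists>i<r * 2 ^ R. 1 < measure (Y n \<omega>) (exceed_cell R i (Min (levels r)))} \<le> e n"
proof -
  let ?x0 = "Min (levels r)"
  interpret prob_space M by (rule asym_prob_space)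
  have "?x0 \<in> levels r" using assms by simp
  then have "\<forall>i. \<exists>e L. e \<longlonglongrightarrow> L \<and> L \<le> (T ?x0 / 2 ^ R)\<^sup>2 \<and> (\<forall>n. prob {\<omega> \<in> space M. 1 < measure (Y n \<omega>) (exceed_cell R i ?x0)} \<le> e n)"
    by (intro allI asym_double levels_in_space)
  from choice[OF this] obtain e where "\<forall>i. \<exists>L. e i \<longlonglongrightarrow> L \<and> L \<le> (T ?x0 / 2 ^ R)\<^sup>2 \<and> (\<forall>n. prob {\<omega> \<in> space M. 1 < measure (Y n \<omega>) (exceed_cell R i ?x0)} \<le> e i n)" ..
  from choice[OF this] obtain L where L: "\<forall>i. e i \<longlonglongrightarrow> L i \<and> L i \<le> (T ?x0 / 2 ^ R)\<^sup>2 \<and> (\<forall>n. prob {\<omega> \<in> space M. 1 < measure (Y n \<omega>) (exceed_cell R i ?x0)} \<le> e i n)" ..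
  have eL: "e i \<longlonglongrightarrow> L i" "L i \<le> (T ?x0 / 2 ^ R)\<^sup>2" "prob {\<omega> \<in> space M. 1 < measure (Y n \<omega>) (exceed_cell R i ?x0)} \<le> e i n" for i n
    using L[rule_format, of i] by simp_all
  show ?thesis
  proof (rule that[of "\<lambda>n. \<Sum>i<r * 2 ^ R. e i n" "\<Sum>i<r * 2 ^ R. L i"])
    show "(\<lambda>n. \<Sum>i<r * 2 ^ R. e i n) \<longlonglongrightarrow> (\<Sum>i<r * 2 ^ R. L i)" by (intro tendsto_sum eL)
    show "(\<Sum>i<r * 2 ^ R. L i) \<le> real (r * 2 ^ R) * (T ?x0 / 2 ^ R)\<^sup>2"
      using sum_bounded_above[of "{..<r * 2 ^ R}" L, OF eL(2)] by simp
    fix n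
    have "{\<omega> \<in> space M. \<exists>i<r * 2 ^ R. 1 < measure (Y n \<omega>) (exceed_cell R i ?x0)}
      = (\<Union>i<r * 2 ^ R. {\<omega> \<in> space M. 1 < measure (Y n \<omega>) (exceed_cell R i ?x0)})" by auto
    also have "prob \<dots> \<le> (\<Sum>i<r * 2 ^ R. prob {\<omega> \<in> space M. 1 < measure (Y n \<omega>) (exceed_cell R i ?x0)})"
      by (rule finite_measure_subadditive_finite) (auto intro: asym_cell_sets)
    also have "\<dots> \<le> (\<Sum>i<r * 2 ^ R. e i n)" by (intro sum_mono eL)
    finally show "prob {\<omega> \<in> space M. \<exists>i<r * 2 ^ R. 1 < measure (Y n \<omega>) (exceed_cell R i ?x0)} \<le> (\<Sum>i<r * 2 ^ R. e i n)" .
  qed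
qed

lemma asym_counts_approx:
  assumes ne: "levels r \<noteq> {}" and r: "r \<le> R"
  shows "\<bar>measure M {\<omega> \<in> space M. counts r (Y n \<omega>) = s}
      - (\<Sum>V | V \<subseteq> {..<r * 2 ^ R} \<times> levels r \<and> reconstruct r R V = s. measure M {\<omega> \<in> space M. occupied r R (Y n \<omega>) = V})\<bar>
    \<le> measure M {\<omega> \<in> space M. \<exists>i<r * 2 ^ R. 1 < measure (Y n \<omega>) (exceed_cell R i (Min (levels r)))}"
proof -
  interpret prob_space M by (rule asym_prob_space)
  let ?S = "{V. V \<subseteq> {..<r * 2 ^ R} \<times> levels r \<and> reconstruct r R V = s}"
  let ?D = "{\<omega> \<in> space M. \<exists>i<r * 2 ^ R. 1 < measure (Y n \<omega>) (exceed_cell R i (Min (levels r)))}"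
  have fin: "finite ?S" by (rule finite_subset[of _ "Pow ({..<r * 2 ^ R} \<times> levels r)"]) auto
  have sub: "occupied r R \<mu> \<subseteq> {..<r * 2 ^ R} \<times> levels r" for \<mu> by (auto simp: occupied_def)
  have sum: "(\<Sum>V\<in>?S. prob {\<omega> \<in> space M. occupied r R (Y n \<omega>) = V}) = prob (\<Union>V\<in>?S. {\<omega> \<in> space M. occupied r R (Y n \<omega>) = V})"
    by (rule finite_measure_finite_Union[symmetric]) (use fin in \<open>auto simp: disjoint_family_on_def intro: asym_occupied_sets\<close>)
  have un: "(\<Union>V\<in>?S. {\<omega> \<in> space M. occupied r R (Y n \<omega>) = V}) = {\<omega> \<in> space M. reconstruct r R (occupied r R (Y n \<omega>)) = s}"
    using sub by auto
  have D: "?D \<in> events"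
  proof -
    have "?D = (\<Union>i<r * 2 ^ R. {\<omega> \<in> space M. 1 < measure (Y n \<omega>) (exceed_cell R i (Min (levels r)))})" by auto
    then show ?thesis by (auto intro: asym_cell_sets)
  qed
  have eq: "counts r (Y n \<omega>) = reconstruct r R (occupied r R (Y n \<omega>))" if "\<omega> \<in> space M" "\<omega> \<notin> ?D" for \<omega>
  proof (rule counts_eq_reconstruct[OF asym_point_measures[OF that(1)] ne r])
    fix i assume "i < r * 2 ^ R"
    then have "\<not> 1 < measure (Y n \<omega>) (exceed_cell R i (Min (levels r)))" using that by blast
    then show "measure (Y n \<omega>) (exceed_cell R i (Min (levels r))) \<le> 1" by (simp only: not_less)
  qed
  have B: "(\<Union>V\<in>?S. {\<omega> \<in> space M. occupied r R (Y n \<omega>) = V}) \<in> events"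
    by (rule sets.finite_UN[OF fin]) (auto intro: asym_occupied_sets)
  show ?thesis
    unfolding sum
    by (rule abs_prob_diff_le[OF asym_counts_sets B D]) (use eq in \<open>auto simp: un\<close>)
qed

end

text \<open>
  The counts can be reconstructed from the occupied cells unless one of the \<open>r 2\<^sup>R\<close> intervals carries two points; by
  the second-order bound the latter has probability of order \<open>2\<^sup>-\<^sup>R\<close>, and \<open>R\<close> is arbitrary.
\<close>

theorem asymptotically_poisson_counts:
  assumes Y: "asymptotically_poisson T M Y" and Z: "asymptotically_poisson T M' Z"
  shows "(\<lambda>n. measure M {\<omega> \<in> space M. counts r (Y n \<omega>) = s} - measure M' {\<omega> \<in> space M'. counts r (Z n \<omega>) = s}) \<longlonglongrightarrow> 0"
proof (cases "levels r = {}")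
  case True
  then have "set (cells r) = {}" by (auto simp: cells_def)
  then have "cells r = []" by simp
  then have "counts r \<mu> = []" for \<mu> by (simp add: counts_def)
  then show ?thesis
    using prob_space.prob_space[OF asym_prob_space[OF Y]] prob_space.prob_space[OF asym_prob_space[OF Z]]
    by (cases "s = []") auto
next
  case False
  let ?x0 = "Min (levels r)"
  let ?d = "\<lambda>n. measure M {\<omega> \<in> space M. counts r (Y n \<omega>) = s} - measure M' {\<omega> \<in> space M'. counts r (Z n \<omega>) = s}"
  have atoms: "(\<lambda>n. measure M {\<omega> \<in> space M. occupied r R (Y n \<omega>) = V} - measure M' {\<omega> \<in> space M'. occupied r R (Z n \<omega>) = V}) \<longlonglongrightarrow> 0"
    if V: "V \<subseteq> {..<r * 2 ^ R} \<times> levels r" for R V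
    unfolding asym_occupied_eq[OF Y V] asym_occupied_eq[OF Z V]
  proof (rule prob_atoms_tendsto[OF asym_prob_space[OF Y] asym_prob_space[OF Z]])
    show "(\<lambda>n. measure M {\<omega> \<in> space M. \<forall>u\<in>P. measure (Y n \<omega>) (exceed_cell R (fst u) (snd u)) = 0}
      - measure M' {\<omega> \<in> space M'. \<forall>u\<in>P. measure (Z n \<omega>) (exceed_cell R (fst u) (snd u)) = 0}) \<longlonglongrightarrow> 0"
      if P: "P \<subseteq> {..<r * 2 ^ R} \<times> levels r" for P
      using tendsto_diff[OF asym_void_tendsto[OF Y P] asym_void_tendsto[OF Z P]] by simp
  qed (use V finite_subset[OF V] in \<open>auto intro: asym_cell_sets[OF Y] asym_cell_sets[OF Z]\<close>)
  show ?thesis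
  proof (rule LIMSEQ_I)
    fix \<epsilon> :: real assume \<epsilon>: "0 < \<epsilon>"
    have "(\<lambda>R. (2 * real r * (T ?x0)\<^sup>2) * (1 / 2) ^ R) \<longlonglongrightarrow> (2 * real r * (T ?x0)\<^sup>2) * 0"
      by (intro tendsto_intros LIMSEQ_realpow_zero) auto
    then have "\<forall>\<^sub>F R in sequentially. (2 * real r * (T ?x0)\<^sup>2) * (1 / 2) ^ R < \<epsilon>"
      by (rule order_tendstoD) (use \<epsilon> in simp)
    then obtain R where R: "r \<le> R" "(2 * real r * (T ?x0)\<^sup>2) * (1 / 2) ^ R < \<epsilon>"
      using eventually_conj[OF _ eventually_ge_at_top[of r]] by (metis (mono_tags, lifting) eventually_sequentially order_refl)
    let ?b = "real (r * 2 ^ R) * (T ?x0 / 2 ^ R)\<^sup>2"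
    have b: "2 * ?b < \<epsilon>"
    proof -
      have "2 * ?b = (2 * real r * (T ?x0)\<^sup>2) * (1 / 2) ^ R"
        by (simp add: power_divide power2_eq_square field_simps)
      then show ?thesis using R(2) by (simp only:)
    qed
    obtain e L where e: "e \<longlonglongrightarrow> L" "L \<le> ?b" and
      eY: "\<And>n. measure M {\<omega> \<in> space M. \<exists>i<r * 2 ^ R. 1 < measure (Y n \<omega>) (exceed_cell R i ?x0)} \<le> e n"
      using asym_double_bound[OF Y False, of R] by blast
    obtain e' L' where e': "e' \<longlonglongrightarrow> L'" "L' \<le> ?b" and
      eZ: "\<And>n. measure M' {\<omega> \<in> space M'. \<exists>i<r * 2 ^ R. 1 < measure (Z n \<omega>) (exceed_cell R i ?x0)} \<le> e' n"
      using asym_double_bound[OF Z False, of R] by blast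
    let ?S = "{V. V \<subseteq> {..<r * 2 ^ R} \<times> levels r \<and> reconstruct r R V = s}"
    define g where "g n = (\<Sum>V\<in>?S. measure M {\<omega> \<in> space M. occupied r R (Y n \<omega>) = V} - measure M' {\<omega> \<in> space M'. occupied r R (Z n \<omega>) = V})" for n
    have "g \<longlonglongrightarrow> (\<Sum>V\<in>?S. 0)" unfolding g_def by (intro tendsto_sum atoms) auto
    then have "(\<lambda>n. \<bar>g n\<bar> + e n + e' n) \<longlonglongrightarrow> \<bar>0\<bar> + L + L'" using e(1) e'(1) by (intro tendsto_intros) simp_all
    then have "\<forall>\<^sub>F n in sequentially. \<bar>g n\<bar> + e n + e' n < \<epsilon>"
      by (rule order_tendstoD) (use e(2) e'(2) b in simp)
    moreover have "\<bar>?d n\<bar> \<le> \<bar>g n\<bar> + e n + e' n" for n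
      using order_trans[OF asym_counts_approx[OF Y False R(1), of n s] eY[of n]]
        order_trans[OF asym_counts_approx[OF Z False R(1), of n s] eZ[of n]]
      unfolding g_def sum_subtractf by linarith
    ultimately have "\<forall>\<^sub>F n in sequentially. \<bar>?d n\<bar> < \<epsilon>"
      by (auto elim!: eventually_mono intro: le_less_trans)
    then show "\<exists>n0. \<forall>n\<ge>n0. norm (?d n - 0) < \<epsilon>" by (simp add: eventually_sequentially)
  qed
qed

end

context half_open_space
begin

text \<open>
  The union of cells in different time intervals has mass \<open>\<Sum>i. T (x i) / 2\<^sup>R\<close>, and a Poisson variable with mean
  \<open>\<lambda>\<close> exceeds \<open>1\<close> with probability at most \<open>\<lambda>\<^sup>2\<close>.
\<close>

lemma poisson_point_process_asymptotically_poisson: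
  assumes poisson: "poisson_point_process space_E (restrict_space lborel {0..} \<Otimes>\<^sub>M \<nu>) M N"
    and sets_\<nu>: "sets \<nu> = sets (restrict_space borel {lo<..hi})"
    and tail_\<nu>: "\<And>x. ereal x \<in> {lo<..hi} \<Longrightarrow> emeasure \<nu> {y \<in> {lo<..hi}. ereal x < y} = ennreal (T x)"
    and T: "\<And>x. ereal x \<in> {lo<..hi} \<Longrightarrow> 0 \<le> T x"
  shows "asymptotically_poisson T M (\<lambda>_. N)"
proof -
  let ?\<mu> = "restrict_space lborel {0::real..} \<Otimes>\<^sub>M \<nu>"
  interpret prob_space M using poisson by (simp add: poisson_point_process_def)
  have N: "N \<in> measurable M (borel_of (vague_topology space_E))"
    using poisson by (simp add: poisson_point_process_def)
  have law: "prob {\<omega> \<in> space M. emeasure (N \<omega>) B = of_nat k} = exp (- measure ?\<mu> B) * measure ?\<mu> B ^ k / fact k"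
    if "B \<in> sets (restrict_space borel space_E)" "emeasure ?\<mu> B < \<infinity>" for B k
    using poisson that unfolding poisson_point_process_def by blast
  have pm: "N \<omega> \<in> point_measures space_E" if "\<omega> \<in> space M" for \<omega>
    using measurable_space[OF N that] by (simp add: space_borel_of topspace_vague_topology)
  have meas: "(\<lambda>\<omega>. emeasure (N \<omega>) A) \<in> borel_measurable M" if "A \<in> sets (restrict_space borel space_E)" for A
  proof -
    have "\<forall>\<B>. finite \<B> \<and> \<B> \<subseteq> sets (restrict_space borel space_E) \<and> disjoint \<B> \<longrightarrow>
        indep_vars (\<lambda>_. borel) (\<lambda>B \<omega>. emeasure (N \<omega>) B) \<B>"
      using poisson unfolding poisson_point_process_def by blast
    from this[rule_format, of "{A}"] have "indep_vars (\<lambda>_. borel) (\<lambda>B \<omega>. emeasure (N \<omega>) B) {A}"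
      using that by (simp add: disjoint_def)
    then show ?thesis by (simp add: indep_vars_def)
  qed
  have space_\<nu>: "space \<nu> = {lo<..hi}"
    using sets_eq_imp_space_eq[OF sets_\<nu>] by (simp add: space_restrict_space)
  have above: "{y \<in> {lo<..hi}. ereal x < y} \<in> sets \<nu>" for x
  proof -
    have "{y \<in> {lo<..hi}. ereal x < y} = {lo<..hi} \<inter> {ereal x<..}" by auto
    moreover have "{lo<..hi} \<inter> {ereal x<..} \<in> sets (restrict_space borel {lo<..hi})"
      unfolding sets_restrict_space by (rule imageI) simp
    ultimately show ?thesis by (simp only: sets_\<nu>)
  qed
  interpret \<nu>: sigma_finite_measure \<nu>
  proof
    let ?A = "(\<lambda>x. {y \<in> {lo<..hi}. ereal x < y}) ` (\<Union>r. levels r)"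
    have "countable ?A" by (intro countable_image countable_UN) (auto intro: countable_finite)
    moreover have "?A \<subseteq> sets \<nu>" using above by blast
    moreover have "\<Union>?A = space \<nu>"
    proof
      show "space \<nu> \<subseteq> \<Union>?A"
      proof
        fix y assume "y \<in> space \<nu>"
        then have y: "lo < y" "y \<le> hi" by (auto simp: space_\<nu>)
        obtain x r where "x \<in> levels r" "lo < ereal x" "ereal x < y"
          using ex_level_between[OF order_refl y] by blast
        then show "y \<in> \<Union>?A" using y by auto
      qed
    qed (auto simp: space_\<nu>)
    moreover have "\<forall>B\<in>?A. emeasure \<nu> B \<noteq> \<infinity>"
      using tail_\<nu> levels_in_space by fastforce
    ultimately show "\<exists>A. countable A \<and> A \<subseteq> sets \<nu> \<and> \<Union>A = space \<nu> \<and> (\<forall>a\<in>A. emeasure \<nu> a \<noteq> \<infinity>)" by blast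
  qed
  have Ico: "{real i / 2 ^ R..<real (Suc i) / 2 ^ R} \<subseteq> {0..}" for i R
    by (auto intro: order_trans[rotated])
  have cell_sets: "exceed_cell R i x \<in> sets ?\<mu>" if x: "ereal x \<in> {lo<..hi}" for R i x
    unfolding exceed_cell_eq[OF x] using Ico[of i R]
    by (intro pair_measureI above) (auto simp: sets_restrict_space_iff)
  have cell: "emeasure ?\<mu> (exceed_cell R i x) = ennreal (T x / 2 ^ R)" if x: "ereal x \<in> {lo<..hi}" for R i x
  proof -
    have "emeasure ?\<mu> (exceed_cell R i x) = emeasure (restrict_space lborel {0..}) {real i / 2 ^ R..<real (Suc i) / 2 ^ R} * ennreal (T x)"
      unfolding exceed_cell_eq[OF x] tail_\<nu>[OF x, symmetric] using Ico[of i R]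
      by (intro \<nu>.emeasure_pair_measure_Times above) (auto simp: sets_restrict_space_iff)
    also have "emeasure (restrict_space lborel {0..}) {real i / 2 ^ R..<real (Suc i) / 2 ^ R} = ennreal (1 / 2 ^ R)"
      using Ico[of i R] by (simp add: emeasure_restrict_space divide_right_mono diff_divide_distrib[symmetric])
    also have "ennreal (1 / 2 ^ R) * ennreal (T x) = ennreal (T x / 2 ^ R)"
      using T[OF x] by (simp add: ennreal_mult[symmetric])
    finally show ?thesis .
  qed
  have void: "prob {\<omega> \<in> space M. \<forall>i\<in>I. measure (N \<omega>) (exceed_cell R i (x i)) = 0} = (\<Prod>i\<in>I. exp (- (T (x i) / 2 ^ R)))"
    if I: "finite I" and x: "\<And>i. i \<in> I \<Longrightarrow> ereal (x i) \<in> {lo<..hi}" for R I x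
  proof -
    let ?B = "\<Union>i\<in>I. exceed_cell R i (x i)"
    have B: "?B \<in> sets (restrict_space borel space_E)" using I by (intro sets.finite_UN exceed_cell_sets)
    have "emeasure ?\<mu> ?B = (\<Sum>i\<in>I. emeasure ?\<mu> (exceed_cell R i (x i)))"
      by (rule sum_emeasure[symmetric]) (use I x cell_sets in \<open>auto simp: disjoint_family_on_def exceed_cell_def\<close>)
    also have "\<dots> = (\<Sum>i\<in>I. ennreal (T (x i) / 2 ^ R))" using x cell by (intro sum.cong) auto
    also have "\<dots> = ennreal (\<Sum>i\<in>I. T (x i) / 2 ^ R)" using x T by (intro sum_ennreal) auto
    finally have em: "emeasure ?\<mu> ?B = ennreal (\<Sum>i\<in>I. T (x i) / 2 ^ R)" .
    then have m: "measure ?\<mu> ?B = (\<Sum>i\<in>I. T (x i) / 2 ^ R)"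
      using x T by (simp add: measure_def sum_nonneg)
    have "(\<forall>i\<in>I. measure (N \<omega>) (exceed_cell R i (x i)) = 0) \<longleftrightarrow> emeasure (N \<omega>) ?B = of_nat 0" if \<omega>: "\<omega> \<in> space M" for \<omega>
    proof -
      have s: "sets (N \<omega>) = sets (restrict_space borel space_E)"
        using pm[OF \<omega>] by (auto simp: point_measures_def sets_point_sum)
      have sub: "(\<lambda>i. exceed_cell R i (x i)) ` I \<subseteq> sets (N \<omega>)"
        unfolding s by (rule image_subsetI) (rule exceed_cell_sets)
      have "emeasure (N \<omega>) ?B = 0" if "\<forall>i\<in>I. emeasure (N \<omega>) (exceed_cell R i (x i)) = 0"
        using emeasure_subadditive_finite[OF I sub] that by simp
      moreover have "emeasure (N \<omega>) (exceed_cell R i (x i)) = 0" if "emeasure (N \<omega>) ?B = 0" "i \<in> I" for i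
        using emeasure_mono[of "exceed_cell R i (x i)" ?B "N \<omega>"] that B s by auto
      ultimately show ?thesis
        using measure_exceed_cell_0_iff[OF pm[OF \<omega>] x] by auto
    qed
    then have "prob {\<omega> \<in> space M. \<forall>i\<in>I. measure (N \<omega>) (exceed_cell R i (x i)) = 0} = prob {\<omega> \<in> space M. emeasure (N \<omega>) ?B = of_nat 0}"
      by (simp cong: conj_cong)
    also have "\<dots> = exp (- (\<Sum>i\<in>I. T (x i) / 2 ^ R))"
      using law[OF B, of 0] em m by simp
    also have "\<dots> = (\<Prod>i\<in>I. exp (- (T (x i) / 2 ^ R)))"
      using exp_sum[OF I, of "\<lambda>i. - (T (x i) / 2 ^ R)"] by (simp add: sum_negf)
    finally show ?thesis .
  qed
  have double: "prob {\<omega> \<in> space M. 1 < measure (N \<omega>) (exceed_cell R i x)} \<le> (T x / 2 ^ R)\<^sup>2"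
    if x: "ereal x \<in> {lo<..hi}" for R i x
  proof -
    let ?C = "exceed_cell R i x" and ?l = "T x / 2 ^ R"
    have l: "0 \<le> ?l" using T[OF x] by simp
    have m: "measure ?\<mu> ?C = ?l" using cell[OF x, of R i] l by (simp add: measure_def)
    have [measurable]: "(\<lambda>\<omega>. emeasure (N \<omega>) ?C) \<in> borel_measurable M" by (rule meas[OF exceed_cell_sets])
    have p: "prob {\<omega> \<in> space M. emeasure (N \<omega>) ?C = of_nat k} = exp (- ?l) * ?l ^ k / fact k" for k
      using law[OF exceed_cell_sets, of R i x k] cell[OF x, of R i] m by simp
    have s: "{\<omega> \<in> space M. emeasure (N \<omega>) ?C = of_nat k} \<in> events" for k by measurable
    have "{\<omega> \<in> space M. 1 < measure (N \<omega>) ?C} = space M - ({\<omega> \<in> space M. emeasure (N \<omega>) ?C = of_nat 0} \<union> {\<omega> \<in> space M. emeasure (N \<omega>) ?C = of_nat 1})"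
    proof -
      have "1 < measure (N \<omega>) ?C \<longleftrightarrow> emeasure (N \<omega>) ?C \<noteq> of_nat 0 \<and> emeasure (N \<omega>) ?C \<noteq> of_nat 1" if "\<omega> \<in> space M" for \<omega>
      proof (rule exceed_cell_count[OF pm[OF that] x, of R i])
        fix k assume k: "emeasure (N \<omega>) ?C = of_nat k" "measure (N \<omega>) ?C = real k"
        show ?thesis unfolding k of_nat_eq_iff by auto
      qed
      then show ?thesis by blast
    qed
    also have "prob \<dots> = 1 - prob ({\<omega> \<in> space M. emeasure (N \<omega>) ?C = of_nat 0} \<union> {\<omega> \<in> space M. emeasure (N \<omega>) ?C = of_nat 1})"
      by (rule prob_compl) (intro sets.Un s)
    also have "prob ({\<omega> \<in> space M. emeasure (N \<omega>) ?C = of_nat 0} \<union> {\<omega> \<in> space M. emeasure (N \<omega>) ?C = of_nat 1})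
        = prob {\<omega> \<in> space M. emeasure (N \<omega>) ?C = of_nat 0} + prob {\<omega> \<in> space M. emeasure (N \<omega>) ?C = of_nat 1}"
      by (rule finite_measure_Union[OF s s]) auto
    also have "\<dots> = exp (- ?l) * (1 + ?l)" unfolding p by (simp add: algebra_simps)
    finally have "prob {\<omega> \<in> space M. 1 < measure (N \<omega>) ?C} = 1 - exp (- ?l) * (1 + ?l)" .
    moreover have "(1 - ?l) * (1 + ?l) \<le> exp (- ?l) * (1 + ?l)"
      using exp_ge_add_one_self[of "- ?l"] l by (intro mult_right_mono) simp_all
    ultimately show ?thesis by (simp add: algebra_simps power2_eq_square)
  qed
  show ?thesis
    unfolding asymptotically_poisson_def
  proof (intro conjI allI ballI impI)
    fix R i x assume "ereal x \<in> {lo<..hi}"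
    then show "\<exists>e L. e \<longlonglongrightarrow> L \<and> L \<le> (T x / 2 ^ R)\<^sup>2 \<and> (\<forall>n. prob {\<omega> \<in> space M. 1 < measure (N \<omega>) (exceed_cell R i x)} \<le> e n)"
      using double by (intro exI[of _ "\<lambda>_. (T x / 2 ^ R)\<^sup>2"] exI[of _ "(T x / 2 ^ R)\<^sup>2"]) auto
  qed (use pm meas void prob_space_axioms in auto)
qed

end

section \<open>The process of first visits is asymptotically Poisson\<close>

context walk_scenery_space
begin

lemma path_scenery_event_sets:
  assumes B: "\<And>w. B w \<in> sets (\<Pi>\<^sub>M k\<in>UNIV. borel)"
  shows "{\<omega> \<in> space M. (\<lambda>k. \<xi> k \<omega>) \<in> B (path L \<omega>)} \<in> events"
proof -
  have m: "(\<lambda>\<omega> k. \<xi> k \<omega>) \<in> measurable M (\<Pi>\<^sub>M k\<in>UNIV. borel)"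
    by (rule measurable_PiM_single') auto
  have "{\<omega> \<in> space M. (\<lambda>k. \<xi> k \<omega>) \<in> B w} \<in> events" for w
    using measurable_sets[OF m B[of w]] by (simp add: vimage_def Int_def conj_commute)
  then have "(\<Union>w. {\<omega> \<in> space M. path L \<omega> = w} \<inter> {\<omega> \<in> space M. (\<lambda>k. \<xi> k \<omega>) \<in> B w}) \<in> events"
    by (intro sets.countable_UN' sets.Int path_event_sets) auto
  also have "(\<Union>w. {\<omega> \<in> space M. path L \<omega> = w} \<inter> {\<omega> \<in> space M. (\<lambda>k. \<xi> k \<omega>) \<in> B w}) = {\<omega> \<in> space M. (\<lambda>k. \<xi> k \<omega>) \<in> B (path L \<omega>)}"
    by auto
  finally show ?thesis .
qed

lemma coordinate_event:
  assumes "S \<in> sets borel"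
  shows "{f. f z \<in> S} \<in> sets (\<Pi>\<^sub>M k\<in>(UNIV :: int set). (borel :: real measure))"
proof -
  have m: "(\<lambda>f. f z) \<in> measurable (\<Pi>\<^sub>M k\<in>(UNIV :: int set). (borel :: real measure)) borel"
    by (rule measurable_component_singleton) simp
  have "(\<lambda>f. f z) -` S \<inter> space (\<Pi>\<^sub>M k\<in>(UNIV :: int set). (borel :: real measure)) \<in> sets (\<Pi>\<^sub>M k\<in>UNIV. borel)"
    by (rule measurable_sets[OF m assms])
  then show ?thesis by (simp add: space_PiM vimage_def)
qed

lemma prob_scenery_at: "S \<in> sets borel \<Longrightarrow> prob {\<omega> \<in> space M. \<xi> z \<omega> \<in> S} = prob {\<omega> \<in> space M. \<xi> 0 \<omega> \<in> S}"
  using stationary_prob[OF coordinate_event[of S 0], of z] by simp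

text \<open>A union bound over the sites of a random set that depends on the path only.\<close>

lemma prob_site_event:
  assumes S: "S \<in> sets borel" and F: "\<And>w. finite (F w)" "\<And>w. length w = L \<Longrightarrow> card (F w) \<le> L"
  shows "{\<omega> \<in> space M. \<exists>z\<in>F (path L \<omega>). \<xi> z \<omega> \<in> S} \<in> events"
    and "prob {\<omega> \<in> space M. \<exists>z\<in>F (path L \<omega>). \<xi> z \<omega> \<in> S}
      \<le> steps_expectation step_pmf L (\<lambda>w. real (card (F w))) * prob {\<omega> \<in> space M. \<xi> 0 \<omega> \<in> S}"
proof -
  let ?B = "\<lambda>w. {f. \<exists>z\<in>F w. f z \<in> S}" and ?p = "prob {\<omega> \<in> space M. \<xi> 0 \<omega> \<in> S}"
  have B: "?B w \<in> sets (\<Pi>\<^sub>M k\<in>(UNIV :: int set). (borel :: real measure))" for w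
  proof -
    have "?B w = (\<Union>z\<in>F w. {f. f z \<in> S})" by auto
    then show ?thesis using F(1) coordinate_event[OF S] by auto
  qed
  show "{\<omega> \<in> space M. \<exists>z\<in>F (path L \<omega>). \<xi> z \<omega> \<in> S} \<in> events"
    using path_scenery_event_sets[of ?B L] B by simp
  have le: "prob {\<omega> \<in> space M. (\<lambda>k. \<xi> k \<omega>) \<in> ?B w} \<le> real (card (F w)) * ?p" for w
  proof -
    have ev: "{\<omega> \<in> space M. \<xi> z \<omega> \<in> S} \<in> events" for z
      using measurable_sets[OF \<xi>_measurable S, of z] by (simp add: vimage_def Int_def conj_commute)
    have "{\<omega> \<in> space M. (\<lambda>k. \<xi> k \<omega>) \<in> ?B w} = (\<Union>z\<in>F w. {\<omega> \<in> space M. \<xi> z \<omega> \<in> S})" by auto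
    also have "prob \<dots> \<le> (\<Sum>z\<in>F w. prob {\<omega> \<in> space M. \<xi> z \<omega> \<in> S})"
      using ev by (intro finite_measure_subadditive_finite F) auto
    also have "\<dots> = (\<Sum>z\<in>F w. ?p)" by (intro sum.cong refl prob_scenery_at S)
    also have "\<dots> = real (card (F w)) * ?p" by simp
    finally show ?thesis .
  qed
  have "prob {\<omega> \<in> space M. (\<lambda>k. \<xi> k \<omega>) \<in> ?B (path L \<omega>)} = steps_expectation step_pmf L (\<lambda>w. prob {\<omega> \<in> space M. (\<lambda>k. \<xi> k \<omega>) \<in> ?B w})"
    by (rule prob_path_scenery[OF B])
  also have "\<dots> \<le> steps_expectation step_pmf L (\<lambda>w. real (card (F w)) * ?p)"
  proof (rule integral_pmf_mono[where B=1 and C="real L"])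
    fix w assume "w \<in> set_pmf (replicate_pmf L step_pmf)"
    then have "real (card (F w)) \<le> real L" using F(2)[OF length_replicate_pmf] by simp
    then have "real (card (F w)) * ?p \<le> real L * 1" by (intro mult_mono) auto
    then show "\<bar>real (card (F w)) * ?p\<bar> \<le> real L" by simp
  qed (use le in auto)
  finally show "prob {\<omega> \<in> space M. \<exists>z\<in>F (path L \<omega>). \<xi> z \<omega> \<in> S} \<le> steps_expectation step_pmf L (\<lambda>w. real (card (F w))) * ?p"
    by simp
qed

text \<open>
  Whether a time is a first visit, and at which site, depends on the path only; the scenery value found there is
  therefore distributed like \<open>\<xi> 0\<close>.
\<close>

lemma prob_first_visit_exceed:
  "{\<omega> \<in> space M. first_visit (\<lambda>j. walk X j \<omega>) (Suc j) \<and> u < \<xi> (walk X (Suc j) \<omega>) \<omega>} \<in> events" (is ?ev)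
  "prob {\<omega> \<in> space M. first_visit (\<lambda>j. walk X j \<omega>) (Suc j) \<and> u < \<xi> (walk X (Suc j) \<omega>) \<omega>}
    = (mean_range step_pmf (Suc j) - mean_range step_pmf j) * exceed_prob u" (is ?pr)
proof -
  let ?fv = "\<lambda>w. first_visit (\<lambda>k. sum_list (take k w)) (Suc j)"
  let ?B = "\<lambda>w. if ?fv w then {f. f (sum_list w) \<in> {u<..}} else {}"
  let ?A = "{\<omega> \<in> space M. first_visit (\<lambda>j. walk X j \<omega>) (Suc j) \<and> u < \<xi> (walk X (Suc j) \<omega>) \<omega>}"
  have B: "?B w \<in> sets (\<Pi>\<^sub>M k\<in>(UNIV :: int set). (borel :: real measure))" for w
    using coordinate_event[of "{u<..}" "sum_list w"] by simp
  have fv: "?fv (path (Suc j) \<omega>) \<longleftrightarrow> first_visit (\<lambda>j. walk X j \<omega>) (Suc j)" for \<omega>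
  proof -
    have eq: "sum_list (take k (path (Suc j) \<omega>)) = walk X k \<omega>" if "k \<le> Suc j" for k
      using that by (simp add: take_path sum_list_path)
    have "(\<lambda>k. sum_list (take k (path (Suc j) \<omega>))) ` {1..<Suc j} = (\<lambda>k. walk X k \<omega>) ` {1..<Suc j}"
      by (intro image_cong refl eq) simp
    then show ?thesis by (simp only: first_visit_def eq[OF order_refl])
  qed
  have A: "?A = {\<omega> \<in> space M. (\<lambda>k. \<xi> k \<omega>) \<in> ?B (path (Suc j) \<omega>)}"
    by (auto simp: fv sum_list_path)
  show ?ev unfolding A by (rule path_scenery_event_sets[OF B])
  have card_fv: "of_bool (?fv w) = real (card (visited 0 w)) - real (card (visited 0 (take j w)))" if "length w = Suc j" for w
  proof -
    have "visited 0 w = (\<lambda>k. sum_list (take k w)) ` {1..Suc j}" using visited_eq_image[of 0 w] that by simp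
    moreover have "visited 0 (take j w) = (\<lambda>k. sum_list (take k w)) ` {1..j}"
      using that unfolding visited_eq_image by (auto simp: min_def intro!: image_cong)
    ultimately show ?thesis using card_sites_Suc[of "\<lambda>k. sum_list (take k w)" j] by simp
  qed
  have "prob ?A = steps_expectation step_pmf (Suc j) (\<lambda>w. prob {\<omega> \<in> space M. (\<lambda>k. \<xi> k \<omega>) \<in> ?B w})"
    unfolding A by (rule prob_path_scenery[OF B])
  also have "\<dots> = steps_expectation step_pmf (Suc j) (\<lambda>w. (real (card (visited 0 w)) - real (card (visited 0 (take j w)))) * exceed_prob u)"
  proof (rule integral_pmf_cong)
    fix w assume "w \<in> set_pmf (replicate_pmf (Suc j) step_pmf)"
    then have "length w = Suc j" by (rule length_replicate_pmf)
    from card_fv[OF this, symmetric]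
    show "prob {\<omega> \<in> space M. (\<lambda>k. \<xi> k \<omega>) \<in> ?B w} = (real (card (visited 0 w)) - real (card (visited 0 (take j w)))) * exceed_prob u"
      using prob_exceed[of u "sum_list w"] by simp
  qed
  also have "\<dots> = steps_expectation step_pmf (Suc j) (\<lambda>w. real (card (visited 0 w)) - real (card (visited 0 (take j w)))) * exceed_prob u"
    by (rule integral_mult_left_zero)
  also have "steps_expectation step_pmf (Suc j) (\<lambda>w. real (card (visited 0 w)) - real (card (visited 0 (take j w))))
      = steps_expectation step_pmf (Suc j) (\<lambda>w. real (card (visited 0 w))) - steps_expectation step_pmf (Suc j) (\<lambda>w. real (card (visited 0 (take j w))))"
  proof (rule Bochner_Integration.integral_diff; rule integrable_bounded_pmf[where B="real (Suc j)"])
    fix w assume "w \<in> set_pmf (replicate_pmf (Suc j) step_pmf)"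
    then have "length w = Suc j" by (rule length_replicate_pmf)
    then show "norm (real (card (visited 0 w))) \<le> real (Suc j)" "norm (real (card (visited 0 (take j w)))) \<le> real (Suc j)"
      using card_visited_le[of 0 w] card_visited_le[of 0 "take j w"] by auto
  qed
  also have "steps_expectation step_pmf (Suc j) (\<lambda>w. real (card (visited 0 w))) = mean_range step_pmf (Suc j)"
    by (rule expectation_card_visited)
  also have "steps_expectation step_pmf (Suc j) (\<lambda>w. real (card (visited 0 (take j w)))) = steps_expectation step_pmf j (\<lambda>w. real (card (visited 0 w)))"
    by (rule expectation_steps_take[where B="real j"]) (auto intro!: order_trans[OF card_visited_le])
  also have "\<dots> = mean_range step_pmf j" by (rule expectation_card_visited)
  finally show ?pr .
qed

end

lemma (in walk_in_scenery) block_eq_image: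
  assumes "t i \<le> t (Suc i)" "t (Suc i) \<le> length w"
  shows "block t w i = (\<lambda>j. sum_list (take j w)) ` {t i<..t (Suc i)}"
proof -
  have "block t w i = (\<lambda>j. sum_list (take (t i + j) w)) ` {1..t (Suc i) - t i}"
    unfolding block_def visited_eq_image using assms
    by (auto simp: min_def take_add take_drop[symmetric] drop_take intro!: image_cong)
  also have "{1..t (Suc i) - t i} = {j. t i + j \<in> {t i<..t (Suc i)}}" using assms(1) by auto
  also have "(\<lambda>j. sum_list (take (t i + j) w)) ` {j. t i + j \<in> {t i<..t (Suc i)}} = (\<lambda>j. sum_list (take j w)) ` ((+) (t i) ` {j. t i + j \<in> {t i<..t (Suc i)}})"
    by (simp add: image_image)
  also have "(+) (t i) ` {j. t i + j \<in> {t i<..t (Suc i)}} = {t i<..t (Suc i)}"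
    by (auto simp: image_iff intro!: exI[of _ "_ - t i"])
  finally show ?thesis .
qed

subsection \<open>The time grid\<close>

text \<open>
  The largest time \<open>j\<close> with \<open>j / n < i / 2\<^sup>R\<close>: the dyadic intervals are open on the right, hence the ceiling minus one.
  For \<open>i = 0\<close> the truncation at \<open>0\<close> gives the right value.
\<close>

definition grid :: "nat \<Rightarrow> nat \<Rightarrow> nat \<Rightarrow> nat" where
  "grid R n i = nat (\<lceil>real i * real n / 2 ^ R\<rceil> - 1)"

lemma le_grid_iff: "1 \<le> j \<Longrightarrow> j \<le> grid R n i \<longleftrightarrow> real j < real i * real n / 2 ^ R"
proof -
  assume "1 \<le> j"
  then have "j \<le> grid R n i \<longleftrightarrow> int j < \<lceil>real i * real n / 2 ^ R\<rceil>"
    unfolding grid_def by linarith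
  then show ?thesis by (simp add: less_ceiling_iff)
qed

lemma grid_0 [simp]: "grid R n 0 = 0"
  by (simp add: grid_def)

lemma grid_mono: "grid R n i \<le> grid R n (Suc i)"
  unfolding grid_def by (intro nat_mono diff_mono ceiling_mono divide_right_mono mult_right_mono) auto

lemma grid_close: "\<bar>real (grid R n i) - real i * real n / 2 ^ R\<bar> \<le> 1"
proof -
  let ?y = "real i * real n / 2 ^ R"
  have y: "0 \<le> ?y" by simp
  have c: "?y \<le> of_int \<lceil>?y\<rceil>" "of_int \<lceil>?y\<rceil> < ?y + 1" by linarith+
  show ?thesis
  proof (cases "1 \<le> \<lceil>?y\<rceil>")
    case True
    then have "real (grid R n i) = of_int \<lceil>?y\<rceil> - 1" by (simp add: grid_def)
    then show ?thesis using c by linarith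
  next
    case False
    then have le: "\<lceil>?y\<rceil> \<le> 0" by linarith
    have "of_int \<lceil>?y\<rceil> \<le> (0 :: real)" using le by (simp only: of_int_le_0_iff)
    moreover have "grid R n i = 0" unfolding grid_def using le by linarith
    ultimately show ?thesis using c y by linarith
  qed
qed

lemma grid_asymptotic: "(\<lambda>n. real (grid R n i) / real n) \<longlonglongrightarrow> real i / 2 ^ R"
proof -
  have "(\<lambda>n. real (grid R n i) / real n - real i / 2 ^ R) \<longlonglongrightarrow> 0"
  proof (rule Lim_null_comparison[OF _ lim_1_over_n])
    show "\<forall>\<^sub>F n in sequentially. norm (real (grid R n i) / real n - real i / 2 ^ R) \<le> 1 / real n"
      using eventually_gt_at_top[of 0]
    proof eventually_elim
      case (elim n)
      have "real (grid R n i) / real n - real i / 2 ^ R = (real (grid R n i) - real i * real n / 2 ^ R) / real n"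
        using elim by (simp add: field_simps)
      then show ?case
        using divide_right_mono[OF grid_close[of R n i], of "real n"] by (simp add: abs_divide)
    qed
  qed
  then show ?thesis by (simp add: LIM_zero_iff)
qed

lemma grid_increment: "(\<lambda>n. real (grid R n (Suc i) - grid R n i) / real n) \<longlonglongrightarrow> 1 / 2 ^ R"
proof -
  have "(\<lambda>n. real (grid R n (Suc i)) / real n - real (grid R n i) / real n) \<longlonglongrightarrow> real (Suc i) / 2 ^ R - real i / 2 ^ R"
    by (intro tendsto_diff grid_asymptotic)
  then show ?thesis
    using grid_mono[of R _ i] by (simp add: of_nat_diff diff_divide_distrib add_divide_distrib)
qed

lemma (in half_open_space) time_index_grid:
  assumes n: "1 \<le> n" and j: "1 \<le> j"
  shows "time_index R (real j / real n) = i \<longleftrightarrow> grid R n i < j \<and> j \<le> grid R n (Suc i)"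
proof -
  have "time_index R (real j / real n) < k \<longleftrightarrow> j \<le> grid R n k" for k
    unfolding le_grid_iff[OF j] using n by (subst time_index_less_iff) (auto simp: field_simps)
  from this[of i] this[of "Suc i"] show ?thesis by auto
qed

subsection \<open>Empty and doubly occupied cells\<close>

text \<open>
  Marks above \<open>hi\<close> fall outside of the state space; the last assumption says that they are too rare to
  be met.
\<close>

locale first_visits = walk_scenery_space M X \<xi> + half_open_space lo hi
    + walk: walk_in_scenery "walk_scenery_space.step_pmf M X" \<alpha> C\<^sub>1 C\<^sub>2 \<mu> M \<xi> m
  for M :: "'w measure" and X :: "nat \<Rightarrow> 'w \<Rightarrow> int" and \<xi> :: "int \<Rightarrow> 'w \<Rightarrow> real" and lo hi :: ereal
    and \<alpha> C\<^sub>1 C\<^sub>2 :: real and \<mu> :: "real measure" and m :: "nat \<Rightarrow> nat" +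
  fixes a b :: "nat \<Rightarrow> real" and T :: "real \<Rightarrow> real"
  assumes a_pos: "\<And>n. 0 < a n"
    and T_nonneg: "\<And>x. ereal x \<in> {lo<..hi} \<Longrightarrow> 0 \<le> T x"
    and avoidance: "\<And>x. ereal x \<in> {lo<..hi} \<Longrightarrow> uniform_avoidance (\<lambda>n. a n * x + b n)"
    and tail: "\<And>x. ereal x \<in> {lo<..hi} \<Longrightarrow> (\<lambda>n. real n * exceed_prob (a n * x + b n)) \<longlonglongrightarrow> T x"
    and no_excess: "(\<lambda>n. real n * prob {\<omega> \<in> space M. hi < ereal ((\<xi> 0 \<omega> - b n) / a n)}) \<longlonglongrightarrow> 0"
begin

definition mark :: "nat \<Rightarrow> nat \<Rightarrow> 'w \<Rightarrow> ereal" where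
  "mark n j \<omega> = ereal ((\<xi> (walk X j \<omega>) \<omega> - b (m n)) / a (m n))"

definition process :: "nat \<Rightarrow> 'w \<Rightarrow> (real \<times> ereal) measure" where
  "process n = first_visit_process {lo<..hi} X \<xi> (a (m n)) (b (m n)) n"

definition threshold :: "real \<Rightarrow> nat \<Rightarrow> real" where
  "threshold x n = a n * x + b n"

abbreviation "new_site \<omega> \<equiv> first_visit (\<lambda>j. walk X j \<omega>)"

lemma less_normalized_iff: "ereal x < ereal ((y - b n) / a n) \<longleftrightarrow> threshold x n < y"
  using a_pos[of n] by (simp add: threshold_def pos_less_divide_eq mult.commute less_diff_eq)

lemma less_mark_iff: "ereal x < mark n j \<omega> \<longleftrightarrow> threshold x (m n) < \<xi> (walk X j \<omega>) \<omega>"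
  unfolding mark_def by (rule less_normalized_iff)

lemma process_eq: "process n \<omega> = point_sum space_E {j. new_site \<omega> j} (\<lambda>j. (real j / real n, mark n j \<omega>))"
  unfolding process_def first_visit_process_eq space_E_def mark_def ..

lemma finite_points:
  assumes n: "1 \<le> n" and K: "compact K"
  shows "finite {j \<in> J. (real j / real n, mark n j \<omega>) \<in> K}"
proof -
  have "bounded (fst ` K)" using K by (intro compact_imp_bounded compact_continuous_image continuous_intros)
  then obtain B where B: "\<And>p. p \<in> K \<Longrightarrow> \<bar>fst p\<bar> \<le> B" by (auto simp: bounded_iff)
  have "j \<le> nat \<lfloor>B * real n\<rfloor>" if "(real j / real n, mark n j \<omega>) \<in> K" for j
  proof -
    have "real j \<le> B * real n" using B[OF that] n by (simp add: field_simps)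
    then show ?thesis by (simp add: le_nat_floor)
  qed
  then have "{j \<in> J. (real j / real n, mark n j \<omega>) \<in> K} \<subseteq> {..nat \<lfloor>B * real n\<rfloor>}" by blast
  then show ?thesis by (rule finite_subset) simp
qed

lemma process_point_measures:
  assumes n: "1 \<le> n"
  shows "process n \<omega> \<in> point_measures space_E"
  unfolding process_eq point_measures_def using finite_points[OF n, of _ "{j. new_site \<omega> j}" \<omega>] by blast

lemma mark_measurable [measurable]: "mark n j \<in> borel_measurable M"
proof -
  have "(\<lambda>\<omega>. \<xi> (walk X j \<omega>) \<omega>) \<in> borel_measurable M"
    by (rule measurable_compose_countable[OF \<xi>_measurable walk_measurable])
  then show ?thesis unfolding mark_def[abs_def] by measurable
qed

lemma new_site_sets [measurable]: "{\<omega> \<in> space M. new_site \<omega> j} \<in> events"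
proof -
  have "{\<omega> \<in> space M. new_site \<omega> j} = {\<omega> \<in> space M. 1 \<le> j \<and> (\<forall>k\<in>{1..<j}. walk X j \<omega> \<noteq> walk X k \<omega>)}"
    by (auto simp: first_visit_def)
  also have "\<dots> \<in> events" by measurable
  finally show ?thesis .
qed

lemma process_measurable:
  assumes A: "A \<in> sets (restrict_space borel space_E)"
  shows "(\<lambda>\<omega>. emeasure (process n \<omega>) A) \<in> borel_measurable M"
proof -
  have A': "A \<in> sets borel"
    using A by (auto simp: sets_restrict_space)
  have [measurable]: "{\<omega> \<in> space M. (real j / real n, mark n j \<omega>) \<in> A} \<in> events" for j
  proof -
    have "(\<lambda>\<omega>. (real j / real n, mark n j \<omega>)) \<in> borel_measurable M"
      by (intro borel_measurable_Pair) auto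
    from measurable_sets[OF this A'] show ?thesis by (simp add: vimage_def Int_def conj_commute)
  qed
  have "emeasure (process n \<omega>) A = (\<Sum>j. indicator {\<omega> \<in> space M. new_site \<omega> j \<and> (real j / real n, mark n j \<omega>) \<in> A} \<omega>)"
    if "\<omega> \<in> space M" for \<omega>
  proof -
    have "emeasure (process n \<omega>) A = (\<integral>\<^sup>+j. indicator {j. new_site \<omega> j \<and> (real j / real n, mark n j \<omega>) \<in> A} j \<partial>count_space UNIV)"
      unfolding process_eq by (simp add: emeasure_point_sum[OF A])
    also have "\<dots> = (\<Sum>j. indicator {j. new_site \<omega> j \<and> (real j / real n, mark n j \<omega>) \<in> A} j)"
      by (rule nn_integral_count_space_nat)
    also have "\<dots> = (\<Sum>j. indicator {\<omega> \<in> space M. new_site \<omega> j \<and> (real j / real n, mark n j \<omega>) \<in> A} \<omega>)"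
      using that by (intro suminf_cong) (simp add: indicator_def)
    finally show ?thesis .
  qed
  then show ?thesis
    by (subst measurable_cong) (assumption, measurable)
qed

lemma measure_process_cell:
  assumes n: "1 \<le> n" and x: "ereal x \<in> {lo<..hi}"
  shows "measure (process n \<omega>) (exceed_cell R i x)
    = real (card {j \<in> {grid R n i<..grid R n (Suc i)}. new_site \<omega> j \<and> ereal x < mark n j \<omega> \<and> mark n j \<omega> \<le> hi})"
proof -
  have fin: "finite {j \<in> {j. new_site \<omega> j}. (real j / real n, mark n j \<omega>) \<in> exceed_cell R i x}"
    by (rule finite_in_exceed_cell[OF finite_points[OF n] x])
  have "(real j / real n, mark n j \<omega>) \<in> exceed_cell R i x \<longleftrightarrow>
      j \<in> {grid R n i<..grid R n (Suc i)} \<and> ereal x < mark n j \<omega> \<and> mark n j \<omega> \<le> hi" if "new_site \<omega> j" for j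
  proof -
    have "1 \<le> j" using that by (simp add: first_visit_def)
    then have "time_index R (real j / real n) = i \<longleftrightarrow> j \<in> {grid R n i<..grid R n (Suc i)}"
      using time_index_grid[OF n, of j R i] by simp
    then show ?thesis using x by (auto simp: exceed_cell_def space_E_def intro: less_trans)
  qed
  then have "{j \<in> {j. new_site \<omega> j}. (real j / real n, mark n j \<omega>) \<in> exceed_cell R i x}
      = {j \<in> {grid R n i<..grid R n (Suc i)}. new_site \<omega> j \<and> ereal x < mark n j \<omega> \<and> mark n j \<omega> \<le> hi}" by blast
  then show ?thesis
    unfolding process_eq measure_point_sum_finite[OF exceed_cell_sets fin] by simp
qed

lemma measure_process_cell_0_iff:
  assumes n: "1 \<le> n" and x: "ereal x \<in> {lo<..hi}"
  shows "measure (process n \<omega>) (exceed_cell R i x) = 0 \<longleftrightarrow>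
    (\<forall>j\<in>{grid R n i<..grid R n (Suc i)}. new_site \<omega> j \<longrightarrow> ereal x < mark n j \<omega> \<longrightarrow> hi < mark n j \<omega>)"
  unfolding measure_process_cell[OF n x] by (auto simp: not_le)

lemma cell_events:
  assumes n: "1 \<le> n" and x: "ereal x \<in> {lo<..hi}"
  shows "{\<omega> \<in> space M. measure (process n \<omega>) (exceed_cell R i x) = 0} \<in> events"
    and "{\<omega> \<in> space M. 1 < measure (process n \<omega>) (exceed_cell R i x)} \<in> events"
proof -
  have [measurable]: "(\<lambda>\<omega>. measure (process n \<omega>) (exceed_cell R i x)) \<in> borel_measurable M"
    unfolding measure_def by (intro borel_measurable_enn2real process_measurable exceed_cell_sets)
  show "{\<omega> \<in> space M. measure (process n \<omega>) (exceed_cell R i x) = 0} \<in> events"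
    "{\<omega> \<in> space M. 1 < measure (process n \<omega>) (exceed_cell R i x)} \<in> events" by measurable
qed

lemma m_at_top: "filterlim m at_top sequentially"
  by (rule walk.scale_at_top[OF walk.scale])

lemma mean_range_grid: "(\<lambda>n. mean_range step_pmf (grid R n i) / real (m n)) \<longlonglongrightarrow> real i / 2 ^ R"
proof (cases "i = 0")
  case False
  then show ?thesis by (intro walk.mean_range_scale[OF walk.scale grid_asymptotic]) simp
qed simp

lemma mean_range_grid_increment:
  "(\<lambda>n. mean_range step_pmf (grid R n (Suc i) - grid R n i) / real (m n)) \<longlonglongrightarrow> 1 / 2 ^ R"
  by (rule walk.mean_range_scale[OF walk.scale grid_increment]) simp

text \<open>An expected number of sites of order \<open>m n\<close> against a probability of order \<open>1 / m n\<close> at each of them.\<close>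

lemma rare_site_limit:
  assumes c: "(\<lambda>n. c n / real (m n)) \<longlonglongrightarrow> \<kappa>" and p: "(\<lambda>n. real n * p n) \<longlonglongrightarrow> \<tau>"
  shows "(\<lambda>n. c n * p (m n)) \<longlonglongrightarrow> \<kappa> * \<tau>"
proof -
  have "(\<lambda>n. (c n / real (m n)) * (real (m n) * p (m n))) \<longlonglongrightarrow> \<kappa> * \<tau>"
    by (intro tendsto_mult c filterlim_compose[OF p m_at_top])
  moreover have "\<forall>\<^sub>F n in sequentially. (c n / real (m n)) * (real (m n) * p (m n)) = c n * p (m n)"
    using m_at_top[unfolded filterlim_at_top, rule_format, of 1] by eventually_elim simp
  ultimately show ?thesis by (rule Lim_transform_eventually)
qed

lemma tail': "ereal x \<in> {lo<..hi} \<Longrightarrow> (\<lambda>n. real n * exceed_prob (threshold x n)) \<longlonglongrightarrow> T x"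
  using tail by (simp add: threshold_def)

text \<open>
  A cell of the process is empty if and only if no newly visited site of its time interval has a mark
  above the level and in the state space.  Avoidance by whole blocks, as in \<open>blocks_avoid_tendsto\<close>, is a smaller
  event.  The difference requires a mark above \<open>hi\<close>, or an exceedance at a site of the block that was visited
  before; such sites are too few to matter by \<open>mean_revisited\<close>.
\<close>

lemma void_asymptotic:
  fixes x :: "nat \<Rightarrow> real"
  assumes I: "finite I" and x: "\<And>i. i \<in> I \<Longrightarrow> ereal (x i) \<in> {lo<..hi}"
  shows "(\<lambda>n. prob {\<omega> \<in> space M. \<forall>i\<in>I. measure (process n \<omega>) (exceed_cell R i (x i)) = 0})
    \<longlonglongrightarrow> (\<Prod>i\<in>I. exp (- (T (x i) / 2 ^ R)))"
proof -
  obtain K where K: "I \<subseteq> {..<K}" using finite_nat_bounded[OF I] by blast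
  then have IK: "I \<inter> {..<K} = I" by blast
  let ?t = "grid R" and ?u = "\<lambda>n i. threshold (x i) (m n)"
  let ?L = "\<lambda>n. ?t n K"
  let ?blk = "\<lambda>n i w. walk.block (?t n) w i" and ?old = "\<lambda>n i w. walk.block (?t n) w i \<inter> visited 0 (take (?t n i) w)"
  let ?A = "\<lambda>n. {\<omega> \<in> space M. \<forall>i\<in>I. measure (process n \<omega>) (exceed_cell R i (x i)) = 0}"
  let ?B = "\<lambda>n. {\<omega> \<in> space M. \<forall>i\<in>I. \<forall>z\<in>?blk n i (path (?L n) \<omega>). \<xi> z \<omega> \<le> ?u n i}"
  let ?Sx = "\<lambda>n. {y. hi < ereal ((y - b (m n)) / a (m n))}"
  let ?C = "\<lambda>n i. {\<omega> \<in> space M. \<exists>z\<in>?blk n i (path (?L n) \<omega>). \<xi> z \<omega> \<in> ?Sx n}"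
  let ?D = "\<lambda>n i. {\<omega> \<in> space M. \<exists>z\<in>?old n i (path (?L n) \<omega>). \<xi> z \<omega> \<in> {?u n i<..}}"
  have t_le: "?t n i \<le> ?t n k" if "i \<le> k" for n i k
    using that by (rule lift_Suc_mono_le[of "?t n", OF grid_mono])
  have tL: "?t n (Suc i) \<le> ?L n" if "i \<in> I" for n i
    using K that by (intro t_le) auto
  have card_blk: "card (?blk n i w) \<le> ?L n" if "length w = ?L n" for n i w
    using card_visited_le[of "sum_list (take (?t n i) w)" "drop (?t n i) (take (?t n (Suc i)) w)"] that
    by (simp add: walk.block_def)
  have card_old: "card (?old n i w) \<le> ?L n" if "length w = ?L n" for n i w
    using card_blk[OF that, of i] by (meson Int_lower1 card_mono le_trans walk.finite_block)
  have Sx: "?Sx n \<in> sets borel" for n by measurable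
  have B_prob: "prob (?B n) = steps_expectation step_pmf (?L n) (\<lambda>w. prob (walk.blocks_avoid (?t n) w (I \<inter> {..<K}) (\<lambda>i. ?u n i)))"
    and B_ev: "?B n \<in> events" for n
  proof -
    let ?F = "\<lambda>w. {f. \<forall>i\<in>I. \<forall>z\<in>?blk n i w. f z \<in> {..?u n i}}"
    have F: "?F w \<in> sets (\<Pi>\<^sub>M k\<in>(UNIV :: int set). (borel :: real measure))" for w
    proof -
      let ?N = "\<Pi>\<^sub>M k\<in>(UNIV :: int set). (borel :: real measure)"
      have "{f \<in> space ?N. f z \<in> {..?u n i}} \<in> sets ?N" for z i
        using coordinate_event[of "{..?u n i}" z] by (simp add: space_PiM)
      then have "{f \<in> space ?N. \<forall>i\<in>I. \<forall>z\<in>?blk n i w. f z \<in> {..?u n i}} \<in> sets ?N"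
        using I by (intro sets.sets_Collect_finite_All) auto
      then show ?thesis by (simp add: space_PiM)
    qed
    have B_eq: "?B n = {\<omega> \<in> space M. (\<lambda>k. \<xi> k \<omega>) \<in> ?F (path (?L n) \<omega>)}" by auto
    show "?B n \<in> events" unfolding B_eq by (rule path_scenery_event_sets[OF F])
    have avoid: "{\<omega> \<in> space M. (\<lambda>k. \<xi> k \<omega>) \<in> ?F w} = walk.blocks_avoid (?t n) w (I \<inter> {..<K}) (\<lambda>i. ?u n i)" for w
      unfolding IK walk.blocks_avoid_def avoid_def by auto
    have "prob (?B n) = steps_expectation step_pmf (?L n) (\<lambda>w. prob {\<omega> \<in> space M. (\<lambda>k. \<xi> k \<omega>) \<in> ?F w})"
      unfolding B_eq by (rule prob_path_scenery[OF F])
    then show "prob (?B n) = steps_expectation step_pmf (?L n) (\<lambda>w. prob (walk.blocks_avoid (?t n) w (I \<inter> {..<K}) (\<lambda>i. ?u n i)))"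
      unfolding avoid .
  qed
  have C_ev: "?C n i \<in> events" for n i
    by (rule prob_site_event(1)[OF Sx]) (use card_blk in auto)
  have D_ev: "?D n i \<in> events" for n i
    by (rule prob_site_event(1)) (use card_old in auto)
  have C_le: "prob (?C n i) \<le> mean_range step_pmf (?t n (Suc i) - ?t n i) * prob {\<omega> \<in> space M. \<xi> 0 \<omega> \<in> ?Sx n}" if i: "i \<in> I" for n i
  proof -
    have "prob (?C n i) \<le> steps_expectation step_pmf (?L n) (\<lambda>w. real (card (?blk n i w))) * prob {\<omega> \<in> space M. \<xi> 0 \<omega> \<in> ?Sx n}"
      by (rule prob_site_event(2)[OF Sx]) (use card_blk in auto)
    then show ?thesis unfolding walk.mean_card_block[where t="?t n", OF grid_mono tL[OF i]] .
  qed
  have D_le: "prob (?D n i) \<le> (mean_range step_pmf (?t n (Suc i) - ?t n i) - (mean_range step_pmf (?t n (Suc i)) - mean_range step_pmf (?t n i)))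
      * exceed_prob (?u n i)" if i: "i \<in> I" for n i
  proof -
    have "prob (?D n i) \<le> steps_expectation step_pmf (?L n) (\<lambda>w. real (card (?old n i w))) * prob {\<omega> \<in> space M. \<xi> 0 \<omega> \<in> {?u n i<..}}"
      by (rule prob_site_event(2)) (use card_old in auto)
    then show ?thesis
      unfolding walk.mean_revisited[where t="?t n", OF grid_mono tL[OF i]] greaterThan_iff prob_exceed .
  qed
  have block_sites: "?blk n i (path (?L n) \<omega>) = (\<lambda>j. walk X j \<omega>) ` {?t n i<..?t n (Suc i)}" if i: "i \<in> I" for n i \<omega>
  proof -
    have "sum_list (take j (path (?L n) \<omega>)) = walk X j \<omega>" if "j \<in> {?t n i<..?t n (Suc i)}" for j
      using that tL[OF i, of n] by (simp add: take_path sum_list_path)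
    then show ?thesis
      using tL[OF i, of n] by (subst walk.block_eq_image) (auto simp: grid_mono intro!: image_cong)
  qed
  have past_sites: "visited 0 (take (?t n i) (path (?L n) \<omega>)) = (\<lambda>j. walk X j \<omega>) ` {1..?t n i}" if i: "i \<in> I" for n i \<omega>
    using tL[OF i, of n] grid_mono[of R n i] by (simp only: take_path[OF order_trans[OF grid_mono tL[OF i]]] visited_path)
  have BA: "?B n \<subseteq> ?A n" if n: "1 \<le> n" for n
  proof
    fix \<omega> assume \<omega>: "\<omega> \<in> ?B n"
    have "\<not> ereal (x i) < mark n j \<omega>" if "i \<in> I" "j \<in> {?t n i<..?t n (Suc i)}" for i j
      using \<omega> that unfolding less_mark_iff by (auto simp: block_sites not_less)
    then show "\<omega> \<in> ?A n"
      using \<omega> by (auto simp: measure_process_cell_0_iff[OF n x])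
  qed
  have AB: "?A n \<subseteq> ?B n \<union> (\<Union>i\<in>I. ?C n i \<union> ?D n i)" if n: "1 \<le> n" for n
  proof
    fix \<omega> assume \<omega>: "\<omega> \<in> ?A n"
    show "\<omega> \<in> ?B n \<union> (\<Union>i\<in>I. ?C n i \<union> ?D n i)"
    proof (rule ccontr)
      assume not: "\<omega> \<notin> ?B n \<union> (\<Union>i\<in>I. ?C n i \<union> ?D n i)"
      then obtain i z where i: "i \<in> I" and z: "z \<in> ?blk n i (path (?L n) \<omega>)" "?u n i < \<xi> z \<omega>"
        using \<omega> by (auto simp: not_le)
      have notC: "\<not> hi < ereal ((\<xi> z \<omega> - b (m n)) / a (m n))" and notold: "z \<notin> visited 0 (take (?t n i) (path (?L n) \<omega>))"
        using not i z \<omega> by auto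
      obtain k where k: "k \<in> {?t n i<..?t n (Suc i)}" "walk X k \<omega> = z"
        using z(1) unfolding block_sites[OF i] by blast
      \<comment> \<open>the first visit to \<open>z\<close>; it falls into the block because \<open>z\<close> was not visited before\<close>
      define j where "j = (LEAST j. 1 \<le> j \<and> walk X j \<omega> = z)"
      have j: "1 \<le> j \<and> walk X j \<omega> = z" unfolding j_def by (rule LeastI[of _ k]) (use k in auto)
      have jk: "j \<le> k" unfolding j_def by (rule Least_le) (use k in auto)
      have least: "\<not> (1 \<le> k \<and> walk X k \<omega> = z)" if "k < j" for k
        using that unfolding j_def by (rule not_less_Least)
      have "walk X j \<omega> \<notin> (\<lambda>j. walk X j \<omega>) ` {1..<j}"
      proof
        assume "walk X j \<omega> \<in> (\<lambda>j. walk X j \<omega>) ` {1..<j}"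
        then obtain k where "k \<in> {1..<j}" "walk X j \<omega> = walk X k \<omega>" by blast
        then show False using least[of k] j by simp
      qed
      then have "new_site \<omega> j" unfolding first_visit_def by (intro conjI) (rule conjunct1[OF j])
      moreover have "?t n i < j"
        using notold j unfolding past_sites[OF i] by (metis atLeastAtMost_iff image_eqI not_less)
      moreover have "ereal (x i) < mark n j \<omega>" unfolding less_mark_iff using j z by simp
      moreover have "\<not> hi < mark n j \<omega>" unfolding mark_def using j notC by simp
      moreover have "j \<le> ?t n (Suc i)" using jk k by simp
      ultimately show False
        using \<omega> i by (auto simp: measure_process_cell_0_iff[OF n x])
    qed
  qed
  let ?e = "\<lambda>n. \<Sum>i\<in>I. mean_range step_pmf (?t n (Suc i) - ?t n i) * prob {\<omega> \<in> space M. \<xi> 0 \<omega> \<in> ?Sx n}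
    + (mean_range step_pmf (?t n (Suc i) - ?t n i) - (mean_range step_pmf (?t n (Suc i)) - mean_range step_pmf (?t n i))) * exceed_prob (?u n i)"
  have close: "\<bar>prob (?A n) - prob (?B n)\<bar> \<le> ?e n" if n: "1 \<le> n" for n
  proof -
    have A_ev: "?A n \<in> events" using I cell_events(1)[OF n x] by (intro sets.sets_Collect_finite_All) auto
    have U_ev: "(\<Union>i\<in>I. ?C n i \<union> ?D n i) \<in> events" using I C_ev D_ev by (intro sets.finite_UN sets.Un) auto
    have "\<bar>prob (?A n) - prob (?B n)\<bar> \<le> prob (\<Union>i\<in>I. ?C n i \<union> ?D n i)"
      by (rule abs_prob_diff_le[OF A_ev B_ev U_ev AB[OF n]]) (use BA[OF n] in blast)
    also have "\<dots> \<le> (\<Sum>i\<in>I. prob (?C n i \<union> ?D n i))"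
      using I C_ev D_ev by (intro finite_measure_subadditive_finite) auto
    also have "\<dots> \<le> ?e n"
      by (intro sum_mono order_trans[OF measure_Un_le[OF C_ev D_ev]] add_mono C_le D_le)
    finally show ?thesis .
  qed
  have e: "?e \<longlonglongrightarrow> (\<Sum>i\<in>I. 1 / 2 ^ R * 0 + 0 * T (x i))"
  proof (intro tendsto_sum tendsto_add)
    fix i assume i: "i \<in> I"
    show "(\<lambda>n. mean_range step_pmf (?t n (Suc i) - ?t n i) * prob {\<omega> \<in> space M. \<xi> 0 \<omega> \<in> ?Sx n}) \<longlonglongrightarrow> 1 / 2 ^ R * 0"
      using rare_site_limit[OF mean_range_grid_increment no_excess] by simp
    have "(\<lambda>n. (mean_range step_pmf (?t n (Suc i) - ?t n i) - (mean_range step_pmf (?t n (Suc i)) - mean_range step_pmf (?t n i))) / real (m n))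
        \<longlonglongrightarrow> 1 / 2 ^ R - (real (Suc i) / 2 ^ R - real i / 2 ^ R)"
      unfolding diff_divide_distrib by (intro tendsto_diff mean_range_grid mean_range_grid_increment)
    also have "1 / 2 ^ R - (real (Suc i) / 2 ^ R - real i / 2 ^ R) = 0"
      by (simp add: add_divide_distrib)
    finally show "(\<lambda>n. (mean_range step_pmf (?t n (Suc i) - ?t n i) - (mean_range step_pmf (?t n (Suc i)) - mean_range step_pmf (?t n i))) * exceed_prob (?u n i)) \<longlonglongrightarrow> 0 * T (x i)"
      by (rule rare_site_limit[OF _ tail'[OF x[OF i]]])
  qed
  then have e0: "?e \<longlonglongrightarrow> 0" by simp
  have "(\<lambda>n. prob (?A n) - prob (?B n)) \<longlonglongrightarrow> 0"
    by (rule Lim_null_comparison[OF _ e0]) (use close in \<open>auto intro: eventually_mono[OF eventually_ge_at_top[of 1]]\<close>)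
  moreover have "(\<lambda>n. prob (?B n)) \<longlonglongrightarrow> (\<Prod>i\<in>I. exp (- (T (x i) / 2 ^ R)))"
  proof -
    have "(\<lambda>n. steps_expectation step_pmf (?L n) (\<lambda>w. prob (walk.blocks_avoid (?t n) w (I \<inter> {..<K}) (\<lambda>i. threshold (x i) (m n)))))
      \<longlonglongrightarrow> (\<Prod>i\<in>I \<inter> {..<K}. exp (- (1 / 2 ^ R * T (x i))))"
    proof (rule walk.blocks_avoid_tendsto)
      show "uniform_avoidance (threshold (x i))" if "i \<in> I" for i
        using avoidance[OF x[OF that]] by (simp add: threshold_def[abs_def])
      show "(\<lambda>n. real n * exceed_prob (threshold (x i) n)) \<longlonglongrightarrow> T (x i)" if "i \<in> I" for i
        by (rule tail'[OF x[OF that]])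
    qed (rule grid_0 grid_mono grid_increment | simp)+
    then show ?thesis unfolding B_prob IK by simp
  qed
  ultimately have "(\<lambda>n. (prob (?A n) - prob (?B n)) + prob (?B n)) \<longlonglongrightarrow> 0 + (\<Prod>i\<in>I. exp (- (T (x i) / 2 ^ R)))"
    by (rule tendsto_add)
  then show ?thesis by simp
qed

text \<open>
  A random variable \<open>c\<close> with values in the natural numbers satisfies \<open>P (c > 1) \<le> E c - 1 + P (c = 0)\<close>; the right-hand side
  is of second order in the length of the time interval.
\<close>

lemma double_asymptotic:
  assumes x: "ereal x \<in> {lo<..hi}"
  shows "\<exists>e L. e \<longlonglongrightarrow> L \<and> L \<le> (T x / 2 ^ R)\<^sup>2 \<and>
    (\<forall>n\<ge>1. prob {\<omega> \<in> space M. 1 < measure (process n \<omega>) (exceed_cell R i x)} \<le> e n)"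
proof (intro exI conjI allI impI)
  let ?t = "grid R" and ?u = "\<lambda>n. threshold x (m n)"
  let ?l = "T x / 2 ^ R"
  let ?e = "\<lambda>n. (mean_range step_pmf (?t n (Suc i)) - mean_range step_pmf (?t n i)) * exceed_prob (?u n) - 1
    + prob {\<omega> \<in> space M. \<forall>i\<in>{i}. measure (process n \<omega>) (exceed_cell R i x) = 0}"
  have "(\<lambda>n. (mean_range step_pmf (?t n (Suc i)) - mean_range step_pmf (?t n i)) / real (m n)) \<longlonglongrightarrow> real (Suc i) / 2 ^ R - real i / 2 ^ R"
    unfolding diff_divide_distrib by (intro tendsto_diff mean_range_grid)
  then have "(\<lambda>n. (mean_range step_pmf (?t n (Suc i)) - mean_range step_pmf (?t n i)) * exceed_prob (?u n)) \<longlonglongrightarrow> (real (Suc i) / 2 ^ R - real i / 2 ^ R) * T x"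
    by (rule rare_site_limit[OF _ tail'[OF x]])
  moreover have "(real (Suc i) / 2 ^ R - real i / 2 ^ R) * T x = ?l"
    by (simp add: add_divide_distrib)
  ultimately have "(\<lambda>n. (mean_range step_pmf (?t n (Suc i)) - mean_range step_pmf (?t n i)) * exceed_prob (?u n)) \<longlonglongrightarrow> ?l"
    by (simp only:)
  then show "?e \<longlonglongrightarrow> ?l - 1 + (\<Prod>i\<in>{i}. exp (- ?l))"
    using x by (intro tendsto_add tendsto_diff tendsto_const void_asymptotic[of "{i}" "\<lambda>_. x"]) simp_all
  show "?l - 1 + (\<Prod>i\<in>{i}. exp (- ?l)) \<le> ?l\<^sup>2"
    using exp_minus_quadratic[of ?l] T_nonneg[OF x] by simp
  fix n :: nat assume n: "1 \<le> n"
  let ?c = "\<lambda>\<omega>. measure (process n \<omega>) (exceed_cell R i x)"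
  let ?J = "{?t n i..<?t n (Suc i)}"
  let ?S = "\<lambda>j. {\<omega> \<in> space M. new_site \<omega> (Suc j) \<and> ?u n < \<xi> (walk X (Suc j) \<omega>) \<omega>}"
  have c_le: "?c \<omega> \<le> (\<Sum>j\<in>?J. indicator (?S j) \<omega>)" if \<omega>: "\<omega> \<in> space M" for \<omega>
  proof -
    have "?c \<omega> = real (card {j \<in> {?t n i<..?t n (Suc i)}. new_site \<omega> j \<and> ereal x < mark n j \<omega> \<and> mark n j \<omega> \<le> hi})"
      by (rule measure_process_cell[OF n x])
    also have "\<dots> \<le> real (card (Suc ` {j \<in> ?J. \<omega> \<in> ?S j}))"
    proof (intro of_nat_mono card_mono subsetI)
      fix j assume j: "j \<in> {j \<in> {?t n i<..?t n (Suc i)}. new_site \<omega> j \<and> ereal x < mark n j \<omega> \<and> mark n j \<omega> \<le> hi}"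
      then have "j - 1 \<in> {j \<in> ?J. \<omega> \<in> ?S j}" "j = Suc (j - 1)"
        using \<omega> by (auto simp: less_mark_iff)
      then show "j \<in> Suc ` {j \<in> ?J. \<omega> \<in> ?S j}" by (rule image_eqI[rotated])
    qed simp
    also have "\<dots> = real (card {j \<in> ?J. \<omega> \<in> ?S j})" by (simp add: card_image)
    also have "\<dots> = (\<Sum>j\<in>?J. indicator (?S j) \<omega>)"
      by (simp add: indicator_def Int_def sum.If_cases)
    finally show ?thesis .
  qed
  have int: "integrable M (indicator (?S j) :: 'w \<Rightarrow> real)" for j
    using prob_first_visit_exceed(1)[of j "?u n"] by (simp add: emeasure_eq_measure)
  have A: "{\<omega> \<in> space M. 1 < ?c \<omega>} \<in> events" "{\<omega> \<in> space M. ?c \<omega> = 0} \<in> events"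
    using cell_events[OF n x] by auto
  have "prob {\<omega> \<in> space M. 1 < ?c \<omega>} = expectation (indicator {\<omega> \<in> space M. 1 < ?c \<omega>})"
    using A by simp
  also have "\<dots> \<le> expectation (\<lambda>\<omega>. (\<Sum>j\<in>?J. indicator (?S j) \<omega>) - 1 + indicator {\<omega> \<in> space M. ?c \<omega> = 0} \<omega>)"
  proof (rule integral_mono)
    fix \<omega> assume \<omega>: "\<omega> \<in> space M"
    obtain k :: nat where k: "?c \<omega> = real k"
      by (rule exceed_cell_count[OF process_point_measures[OF n] x])
    show "(indicator {\<omega> \<in> space M. 1 < ?c \<omega>} \<omega> :: real) \<le> (\<Sum>j\<in>?J. indicator (?S j) \<omega>) - 1 + indicator {\<omega> \<in> space M. ?c \<omega> = 0} \<omega>"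
    proof -
      define s :: real where "s = (\<Sum>j\<in>?J. indicator (?S j) \<omega>)"
      have "real k \<le> s" using c_le[OF \<omega>] unfolding k s_def .
      moreover have "indicator {\<omega> \<in> space M. 1 < ?c \<omega>} \<omega> = (of_bool (1 < k) :: real)"
        "indicator {\<omega> \<in> space M. ?c \<omega> = 0} \<omega> = (of_bool (k = 0) :: real)"
        using \<omega> by (simp_all add: k indicator_def)
      ultimately show ?thesis
        unfolding s_def[symmetric] by (cases "k = 0"; cases "k = 1") auto
    qed
  qed (use A int in \<open>auto simp: emeasure_eq_measure\<close>)
  also have "\<dots> = (\<Sum>j\<in>?J. prob (?S j)) - 1 + prob {\<omega> \<in> space M. ?c \<omega> = 0}"
    using A int prob_first_visit_exceed(1) by (simp add: emeasure_eq_measure prob_space)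
  also have "(\<Sum>j\<in>?J. prob (?S j)) = (\<Sum>j\<in>?J. mean_range step_pmf (Suc j) - mean_range step_pmf j) * exceed_prob (?u n)"
    unfolding prob_first_visit_exceed(2) by (rule sum_distrib_right[symmetric])
  also have "(\<Sum>j\<in>?J. mean_range step_pmf (Suc j) - mean_range step_pmf j) = mean_range step_pmf (?t n (Suc i)) - mean_range step_pmf (?t n i)"
    by (rule sum_Suc_diff'[OF grid_mono])
  finally show "prob {\<omega> \<in> space M. 1 < ?c \<omega>} \<le> ?e n" by simp
qed

text \<open>
  The index is shifted because the time of every point is \<open>0\<close> for \<open>n = 0\<close>.
\<close>

theorem process_asymptotically_poisson: "asymptotically_poisson T M (\<lambda>n. process (Suc n))"
  unfolding asymptotically_poisson_def
proof (intro conjI allI ballI impI)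
  show "prob_space M" by (rule prob_space_axioms)
  show "process (Suc n) \<omega> \<in> point_measures space_E" for n \<omega> by (rule process_point_measures) simp
  show "(\<lambda>\<omega>. emeasure (process (Suc n) \<omega>) A) \<in> borel_measurable M" if "A \<in> sets (restrict_space borel space_E)" for n A
    by (rule process_measurable[OF that])
  fix R
  show "(\<lambda>n. prob {\<omega> \<in> space M. \<forall>i\<in>I. measure (process (Suc n) \<omega>) (exceed_cell R i (x i)) = 0}) \<longlonglongrightarrow> (\<Prod>i\<in>I. exp (- (T (x i) / 2 ^ R)))"
    if "finite I \<and> (\<forall>i\<in>I. ereal (x i) \<in> {lo<..hi})" for I x
    by (rule LIMSEQ_Suc[OF void_asymptotic]) (use that in auto)
  fix i x assume x: "ereal x \<in> {lo<..hi}"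
  from double_asymptotic[OF x, of R i] obtain e L where e: "e \<longlonglongrightarrow> L" "L \<le> (T x / 2 ^ R)\<^sup>2"
    "\<forall>n\<ge>1. prob {\<omega> \<in> space M. 1 < measure (process n \<omega>) (exceed_cell R i x)} \<le> e n" by blast
  show "\<exists>e L. e \<longlonglongrightarrow> L \<and> L \<le> (T x / 2 ^ R)\<^sup>2 \<and>
      (\<forall>n. prob {\<omega> \<in> space M. 1 < measure (process (Suc n) \<omega>) (exceed_cell R i x)} \<le> e n)"
    using LIMSEQ_Suc[OF e(1)] e(2,3) by (intro exI[of _ "\<lambda>n. e (Suc n)"] exI[of _ L]) auto
qed

end

theorem theorem2:
  fixes M :: "'w measure" and X :: "nat \<Rightarrow> 'w \<Rightarrow> int" and \<xi> :: "int \<Rightarrow> 'w \<Rightarrow> real"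
    and \<alpha> C\<^sub>1 C\<^sub>2 :: real and \<mu> :: "real measure"
    and G :: extreme_value and \<nu> :: "ereal measure" and a b :: "nat \<Rightarrow> real"
    and M' :: "'v measure" and N :: "'v \<Rightarrow> (real \<times> ereal) measure"
  assumes "prob_space M"
    and iid: "prob_space.indep_vars M (\<lambda>_. count_space UNIV) X {1..}"
      "\<And>k. 1 \<le> k \<Longrightarrow> distr M (count_space UNIV) (X k) = distr M (count_space UNIV) (X 1)"
    and centered: "integrable M (\<lambda>\<omega>. real_of_int (X 1 \<omega>)) \<Longrightarrow>
      integral\<^sup>L M (\<lambda>\<omega>. real_of_int (X 1 \<omega>)) = 0"
    and index: "0 < \<alpha>" "\<alpha> \<le> 2"
    and stable_law: "real_distribution \<mu>" "0 < C\<^sub>1"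
      "\<And>\<theta>. char \<mu> \<theta> =
        exp (- complex_of_real (\<bar>\<theta>\<bar> powr \<alpha>) * (complex_of_real C\<^sub>1 + \<i> * complex_of_real (C\<^sub>2 * sgn \<theta>)))"
    and attraction: "\<And>x. (\<lambda>n. measure M {\<omega> \<in> space M.
        real_of_int (walk X n \<omega>) / real n powr (1 / \<alpha>) \<le> x}) \<longlonglongrightarrow> cdf \<mu> x"
    and stat: "stationary M \<xi>"
    and indep: "prob_space.indep_set M
      (sets (vimage_algebra (space M) (\<lambda>\<omega>. \<lambda>k\<in>{1..}. X k \<omega>) (\<Pi>\<^sub>M k\<in>{1..}. count_space UNIV)))
      (sets (vimage_algebra (space M) (\<lambda>\<omega> k. \<xi> k \<omega>) (\<Pi>\<^sub>M k\<in>UNIV. borel)))"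
    and extreme: "ev_valid G" "in_domain_of_attraction M (\<xi> 0) G" "ev_measure G \<nu>"
    and a_pos: "\<And>n. 0 < a n"
    and "\<alpha> \<le> 1"
    and tail: "\<And>x. ereal x \<in> ev_space G \<Longrightarrow>
      (\<lambda>n. real n * measure M {\<omega> \<in> space M. \<xi> 0 \<omega> > a n * x + b n}) \<longlonglongrightarrow> ev_tail G x"
    and mixing: "\<And>x. ereal x \<in> ev_space G \<Longrightarrow>
      \<exists>A l. cond_D M \<xi> (\<lambda>n. a n * x + b n) A l \<and> cond_D' M \<xi> (\<lambda>n. a n * x + b n) A l"
    and poisson: "poisson_point_process ({0..} \<times> ev_space G)
      (restrict_space lborel {0..} \<Otimes>\<^sub>M \<nu>) M' N"
  shows "converges_weakly (vague_topology ({0..} \<times> ev_space G))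
    M (\<lambda>n. let m = range_scale M X \<alpha> (Suc n)
           in first_visit_process (ev_space G) X \<xi> (a m) (b m) (Suc n))
    M' N"
proof -
  interpret prob_space M by fact
  interpret walk_scenery_space M X \<xi>
    by (intro walk_scenery_space.intro walk_scenery_space_axioms.intro) (rule prob_space_axioms iid stat indep | assumption)+
  define m where "m = range_scale M X \<alpha>"
  interpret stable_walk step_pmf \<alpha> C\<^sub>1 C\<^sub>2 \<mu>
    by (intro stable_walk.intro) (rule index(1) \<open>\<alpha> \<le> 1\<close> stable_law weak_conv_scaled_law[OF attraction])+
  have scale: "(\<lambda>n. real (m n) * green step_pmf n / real n) \<longlonglongrightarrow> 1"
    by (rule scale_asymptotic[where qinf="escape_prob M X"])
      (simp_all add: m_def range_scale_def truncated_green_eq no_return_tendsto_escape)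
  interpret walk: walk_in_scenery step_pmf \<alpha> C\<^sub>1 C\<^sub>2 \<mu> M \<xi> m
    by unfold_locales (rule scale)
  have upper_set: "{c<..} = {c<..\<infinity> :: ereal}" for c by auto
  obtain lo hi :: ereal where lo_hi: "lo < hi" and E: "ev_space G = {lo<..hi}"
    and hi: "hi = \<infinity> \<or> (hi = 0 \<and> ereal 0 \<in> ev_space G \<and> ev_tail G 0 = 0)"
  proof (cases G)
    case (Frechet \<beta>)
    then show ?thesis using that[of 0 \<infinity>] by (simp add: upper_set)
  next
    case (Weibull \<delta>)
    then show ?thesis using that[of "-\<infinity>" 0] by (auto simp: zero_ereal_def)
  next
    case Gumbel
    then show ?thesis using that[of "-\<infinity>" \<infinity>] by (simp add: upper_set)
  qed
  have tail_E: "(\<lambda>n. real n * exceed_prob (a n * x + b n)) \<longlonglongrightarrow> ev_tail G x" if "ereal x \<in> ev_space G" for x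
    using tail[OF that] by (simp add: exceed_prob_def)
  have "uniform_avoidance (\<lambda>n. a n * x + b n)" if x: "ereal x \<in> ev_space G" for x
    using mixing[OF x] uniform_avoidance_of_mixing[OF _ _ tail_E[OF x]] by blast
  moreover have "0 \<le> ev_tail G x" for x by (cases G) auto
  moreover have "(\<lambda>n. real n * prob {\<omega> \<in> space M. hi < ereal ((\<xi> 0 \<omega> - b n) / a n)}) \<longlonglongrightarrow> 0"
    using hi
  proof
    \<comment> \<open>the Weibull case: the tail assumption at \<open>x = 0\<close> says that values above \<open>0\<close> are negligible\<close>
    assume h: "hi = 0 \<and> ereal 0 \<in> ev_space G \<and> ev_tail G 0 = 0"
    have "0 < ereal ((\<xi> 0 \<omega> - b n) / a n) \<longleftrightarrow> a n * 0 + b n < \<xi> 0 \<omega>" for n \<omega>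
      using a_pos[of n] by (simp add: zero_less_divide_iff)
    then have "{\<omega> \<in> space M. hi < ereal ((\<xi> 0 \<omega> - b n) / a n)} = {\<omega> \<in> space M. a n * 0 + b n < \<xi> 0 \<omega>}" for n
      using h by simp
    then show ?thesis using tail[of 0] h by simp
  qed simp
  ultimately interpret fv: first_visits M X \<xi> lo hi \<alpha> C\<^sub>1 C\<^sub>2 \<mu> m a b "ev_tail G"
    using lo_hi a_pos tail_E unfolding E by unfold_locales
  have space: "{0..} \<times> ev_space G = fv.space_E" by (simp add: fv.space_E_def E)
  have Y: "fv.asymptotically_poisson (ev_tail G) M (\<lambda>n. fv.process (Suc n))"
    by (rule fv.process_asymptotically_poisson)
  have Z: "fv.asymptotically_poisson (ev_tail G) M' (\<lambda>_. N)"
  proof (rule fv.poisson_point_process_asymptotically_poisson)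
    show "poisson_point_process fv.space_E (restrict_space lborel {0..} \<Otimes>\<^sub>M \<nu>) M' N"
      using poisson unfolding space .
    show "sets \<nu> = sets (restrict_space borel {lo<..hi})"
      using extreme(3) unfolding ev_measure_def E by (rule conjunct1)
    show "emeasure \<nu> {y \<in> {lo<..hi}. ereal x < y} = ennreal (ev_tail G x)" if "ereal x \<in> {lo<..hi}" for x
      using extreme(3) that unfolding ev_measure_def E by blast
  qed (rule fv.T_nonneg)
  have "converges_weakly (vague_topology fv.space_E) M (\<lambda>n. fv.process (Suc n)) M' N"
  proof (rule fv.converges_weakly_of_counts)
    show "prob_space M" by fact
    show "prob_space M'" by (rule fv.asym_prob_space[OF Z])
    show "fv.process (Suc n) \<in> measurable M (borel_of (vague_topology fv.space_E))" for n
      by (rule fv.measurable_borel_of_vagueI[OF fv.asym_point_measures[OF Y] fv.asym_counts_sets[OF Y]])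
    show "N \<in> measurable M' (borel_of (vague_topology fv.space_E))"
      using poisson by (simp add: poisson_point_process_def space)
    show "{\<omega> \<in> space M. fv.counts r (fv.process (Suc n) \<omega>) = s} \<in> sets M" for n r s
      by (rule fv.asym_counts_sets[OF Y])
    show "{\<omega> \<in> space M'. fv.counts r (N \<omega>) = s} \<in> sets M'" for r s
      by (rule fv.asym_counts_sets[OF Z])
    show "(\<lambda>n. prob {\<omega> \<in> space M. fv.counts r (fv.process (Suc n) \<omega>) = s})
        \<longlonglongrightarrow> measure M' {\<omega> \<in> space M'. fv.counts r (N \<omega>) = s}" for r s
      using fv.asymptotically_poisson_counts[OF Y Z, of r s] by (simp add: LIM_zero_iff)
  qed
  then show ?thesis
    unfolding space unfolding fv.process_def Let_def E unfolding m_def .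
qed

end
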